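(* Let $S$ be a compact Hausdorff space, let $X$ be a Banach–Kantorovich space over a Dedekind complete vector lattice $E$, let $W$ be a vector subspace of $C_{uo}(S,X)$, and put $$A:=\{\varphi\in C_{uo}(S,\Lambda): \varphi g\in W \text{ for all } g\in W\}.$$ Assume that $A$ separates the points of $\Sigma$ and that for every $\sigma\in\Sigma$ the set $W(\sigma):=\{g(\sigma): g\in W\}\subset X$ approximates every member of $X$, i.e. $\inf\{\|x-y\|:y\in W(\sigma)\}=0$ for all $x\in X$. Then the following hold: (1) $\mathrm{mix}_{\mathrm{fin}}(W)$ is norm $o$-dense in $C_{uo}(S,X)$; (2) if, moreover, $E$ has an order unit $\mathbb 1$, then $\mathrm{mix}(W)$ is norm $r$-dense in $C_{uo}(S,X)$ with the same regulator $\mathbb 1$, i.e. every member of $C_{uo}(S,X)$ is the norm $r$-limit with regulator $\mathbb 1$ of some net in $\mathrm{mix}(W)$.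
   Context: **Lattices.** Vector lattices are real and Archimedean. $E$ is a Dedekind complete vector lattice, $\mathbb B=\mathbb P(E)$ is the complete Boolean algebra of its band projections, $\Lambda=\mathrm{Orth}(E)$ is the Dedekind complete $f$-algebra (under composition) of orthomorphisms of $E$, with unit $I=I_E$. Elements of $\mathbb B$ act on $\Lambda$ by multiplication. A partition of unity in $\mathbb B$ is a family of pairwise disjoint elements with supremum $I$. An order unit of $E$ is an element $\mathbb 1\in E_+$ such that each $e\in E$ satisfies $|e|\le\lambda\mathbb 1$ for some real $\lambda>0$. **Lattice normed spaces.** A lattice normed space (LNS) over $E$ is a real or complex vector space $X$ with a map $\|\cdot\|:X\to E_+$ such that $\|x\|=0$ implies $x=0$, $\|\lambda x\|=|\lambda|\|x\|$ for scalars $\lambda$, and $\|x+y\|\le\|x\|+\|y\|$. It is always assumed that $\{\|x\|:x\in X\}^{\perp\perp}=E$. A net $(x_\alpha)$ norm $o$-converges to $x$ if $\|x-x_\alpha\|$ order converges to $0$ in $E$, and norm $r$-converges to $x$ with regulator $e\in E_+$ if for every real $\varepsilon>0$ one has $\|x-x_\alpha\|\le\varepsilon e$ for all sufficiently large $\alpha$. A subset is norm $o$-dense if every member of the space is the norm $o$-limit of some net in the subset. $X$ is norm $o$-complete if every net $(x_\alpha)$ for which $(x_\alpha-x_\beta)_{(\alpha,\beta)}$ norm $o$-converges to $0$ is norm $o$-convergent in $X$. $X$ is decomposable if $\|x\|=e_1+e_2$ with $e_1,e_2\in E_+$ implies $x=x_1+x_2$ with $\|x_k\|=e_k$ for some $x_1,x_2\in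 X$. A Banach–Kantorovich space over $E$ is a decomposable norm $o$-complete LNS. Each $\pi\in\mathbb B$ acts on such $X$ as a linear projection with $\|\pi x+\pi^\perp y\|=\pi\|x\|+\pi^\perp\|y\|$, and this action extends to a faithful $\Lambda$-module structure on $X$ with $\|\lambda x\|=|\lambda|\,\|x\|$. **Mixings.** For a partition of unity $(\pi_\xi)$ in $\mathbb B$ and a family $(x_\xi)$, an element $x$ with $\pi_\xi x=\pi_\xi x_\xi$ for all $\xi$ is the mixing of $(x_\xi)$ by $(\pi_\xi)$. For a set $U$, $\mathrm{mix}(U)$ (resp. $\mathrm{mix}_{\mathrm{fin}}(U)$) is the set of all mixings existing in the space of arbitrary (resp. finite) families in $U$. In $C_{uo}(S,X)$, projections act by $(\pi f)(s)=\pi f(s)$. **The space $C_{uo}$.** $S$ carries its unique compatible uniformity $\mathcal U$. $C_{uo}(S,X)$ is the vector space of uniformly order continuous $f:S\to X$, i.e. norm bounded $f$ (there is $e\in E$ with $\|f(s)\|\le e$ for all $s$) with $\inf_{U\in\mathcal U}\sup\{\|f(s)-f(t)\|:(s,t)\in U\}=0$. It has the $E$-valued norm $\|f\|=\sup_{s\in S}\|f(s)\|$. $C_{uo}(S,\Lambda)$ is defined in the same way, with $\Lambda$ viewed as an LNS over itself with norm $|\cdot|$; it has pointwise multiplication and order. For $\varphi\in C_{uo}(S,\Lambda)$ and $f\in C_{uo}(S,X)$, $(\varphi f)(s)=\varphi(s)f(s)$. **The set $\Sigma$.** Let $\varepsilon^c:C_{uo}(S,\Lambda)\to\Lambda$,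 $\varepsilon^c(\varphi)=\sup_{s\in S}\varphi(s)$, and let $\partial\varepsilon^c$ be the convex set of linear operators $T:C_{uo}(S,\Lambda)\to\Lambda$ with $T\varphi\le\varepsilon^c(\varphi)$ for all $\varphi$. $\Sigma$ is the set of extreme points of $\partial\varepsilon^c$; equivalently, the set of all lattice homomorphisms $\sigma:C_{uo}(S,\Lambda)\to\Lambda$ with $\sigma(\bar\lambda)=\lambda$ for every $\lambda\in\Lambda$, where $\bar\lambda$ is the constant function $s\mapsto\lambda$. A pure state is an operator $\sum_{s\in S}\pi_s\delta_s:\varphi\mapsto o\text{-}\sum_s\pi_s\varphi(s)$ with $(\pi_s)_{s\in S}$ a partition of unity in $\mathbb B$. Every $\sigma\in\Sigma$ is a pointwise $r$-limit (relatively uniform limit) of a net of pure states. **Values $f(\sigma)$.** Each $f\in C_{uo}(S,X)$ extends canonically to a map $\Sigma\to X$, $\sigma\mapsto f(\sigma)$: for a pure state $\sigma=\sum_s\pi_s\delta_s$, $f(\sigma)=\sum_s\pi_sf(s)$, i.e. the unique element of $X$ with $\pi_sf(\sigma)=\pi_sf(s)$ for all $s$; for general $\sigma$, $f(\sigma)=\lim_\alpha f(\sigma_\alpha)$ (norm $o$-limit in $X$) for any net $(\sigma_\alpha)$ of pure states that $r$-converges pointwise to $\sigma$. **Separation.** A set $\mathcal F\subset C_{uo}(S,\Lambda)$ separates the points of $\Sigma$ if for all $\sigma,\tau\in\Sigma$ and $b\in\mathbb B$: whenever $b\sigma(\varphi)=b\tau(\varphi)$ for all $\varphi\in\mathcal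 F$, then $b\sigma=b\tau$. *)

theory Defs
  imports Complex_Main "HOL-Library.Lattice_Algebras" "HOL-Library.Function_Algebras"
    "HOL-Library.FuncSet"
begin

section \<open>Dedekind complete vector lattices\<close>

text \<open>
  Every nonempty subset that is bounded above has a supremum; this implies the Archimedean
  property.  The suprema and infima \<^term>\<open>Sup A\<close>, \<^term>\<open>Inf A\<close> are meaningful only
  for nonempty order bounded \<^term>\<open>A\<close>.
\<close>

class dedekind_vector_lattice =
  ordered_real_vector + lattice_ab_group_add_abs + conditionally_complete_lattice

instance real :: dedekind_vector_lattice ..

definition lat_disjoint :: "'e::dedekind_vector_lattice \<Rightarrow> 'e \<Rightarrow> bool"
  where "lat_disjoint x y \<longleftrightarrow> inf \<bar>x\<bar> \<bar>y\<bar> = 0"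

definition disjoint_compl :: "'e::dedekind_vector_lattice set \<Rightarrow> 'e set"
  where "disjoint_compl A = {x. \<forall>a\<in>A. lat_disjoint x a}"

definition is_band :: "'e::dedekind_vector_lattice set \<Rightarrow> bool"
  where "is_band K \<longleftrightarrow> disjoint_compl (disjoint_compl K) = K"

definition order_unit :: "'e::dedekind_vector_lattice \<Rightarrow> bool"
  where "order_unit u \<longleftrightarrow> 0 \<le> u \<and> (\<forall>e. \<exists>r>0. \<bar>e\<bar> \<le> r *\<^sub>R u)"

section \<open>Orthomorphisms\<close>

definition order_bounded_map :: "('e::dedekind_vector_lattice \<Rightarrow> 'e) \<Rightarrow> bool"
  where "order_bounded_map T \<longleftrightarrow> (\<forall>a b. \<exists>c d. T ` {a..b} \<subseteq> {c..d})"

definition band_preserving :: "('e::dedekind_vector_lattice \<Rightarrow> 'e) \<Rightarrow> bool"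
  where "band_preserving T \<longleftrightarrow> (\<forall>x y. lat_disjoint x y \<longrightarrow> lat_disjoint (T x) y)"

definition orthomorphism :: "('e::dedekind_vector_lattice \<Rightarrow> 'e) \<Rightarrow> bool"
  where "orthomorphism T \<longleftrightarrow> linear T \<and> order_bounded_map T \<and> band_preserving T"

lemma lat_disjoint_abs_mono:
  assumes "lat_disjoint x z" "\<bar>y\<bar> \<le> \<bar>x\<bar>"
  shows "lat_disjoint y (z::'e::dedekind_vector_lattice)"
proof -
  have "(inf \<bar>y\<bar> \<bar>z\<bar>) \<le> (inf \<bar>x\<bar> \<bar>z\<bar>)"
    using assms(2) by (meson inf_mono order_refl)
  moreover have "0 \<le> inf \<bar>y\<bar> \<bar>z\<bar>" by simp
  ultimately show ?thesis using assms(1) unfolding lat_disjoint_def by (metis order_antisym)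
qed

lemma lat_disjoint_add:
  assumes "lat_disjoint x z" "lat_disjoint y z"
  shows "lat_disjoint (x + y) (z::'e::dedekind_vector_lattice)"
proof -
  define w where "w = inf \<bar>x + y\<bar> \<bar>z\<bar>"
  have w1: "w \<le> \<bar>x\<bar> + \<bar>y\<bar>" unfolding w_def by (meson abs_triangle_ineq inf_le1 order_trans)
  have w2: "w \<le> \<bar>z\<bar>" unfolding w_def by simp
  have "w - \<bar>y\<bar> \<le> \<bar>x\<bar>" using w1 by (simp add: diff_le_eq)
  moreover have "w - \<bar>y\<bar> \<le> \<bar>z\<bar>" using w2 by (metis abs_ge_zero add.right_neutral add_mono diff_le_eq)
  ultimately have "w - \<bar>y\<bar> \<le> inf \<bar>x\<bar> \<bar>z\<bar>" by simp
  hence "w \<le> \<bar>y\<bar>" using assms(1) unfolding lat_disjoint_def by simp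
  hence "w \<le> inf \<bar>y\<bar> \<bar>z\<bar>" using w2 by simp
  hence "w \<le> 0" using assms(2) unfolding lat_disjoint_def by simp
  moreover have "0 \<le> w" unfolding w_def by simp
  ultimately show ?thesis unfolding lat_disjoint_def w_def by (rule order_antisym)
qed

lemma lat_disjoint_minus: "lat_disjoint x z \<Longrightarrow> lat_disjoint (- x) (z::'e::dedekind_vector_lattice)"
  by (simp add: lat_disjoint_def)

lemma lat_disjoint_diff:
  "lat_disjoint x z \<Longrightarrow> lat_disjoint y z \<Longrightarrow> lat_disjoint (x - y) (z::'e::dedekind_vector_lattice)"
  using lat_disjoint_add[of x z "- y"] lat_disjoint_minus[of y z] by simp

lemma lat_disjoint_zero: "lat_disjoint 0 (z::'e::dedekind_vector_lattice)"
  by (simp add: lat_disjoint_def inf.absorb1)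

lemma lat_disjoint_scaleR:
  assumes "lat_disjoint x z"
  shows "lat_disjoint (r *\<^sub>R x) (z::'e::dedekind_vector_lattice)"
proof -
  define m where "m = max 1 \<bar>r\<bar>"
  have m: "m \<ge> 1" "m \<ge> \<bar>r\<bar>" unfolding m_def by auto
  have le: "\<bar>s *\<^sub>R y\<bar> \<le> \<bar>s\<bar> *\<^sub>R \<bar>y\<bar>" for s and y :: 'e
  proof (cases "s \<ge> 0")
    case True
    then show ?thesis
      by (smt (verit, best) abs_ge_minus_self abs_ge_self abs_leI abs_of_nonneg
          real_vector.scale_minus_right scaleR_left_mono)
  next
    case False
    then have s: "\<bar>s\<bar> = - s" "0 \<le> - s" by auto
    have "s *\<^sub>R y = (- s) *\<^sub>R (- y)" by simp
    moreover have "(- s) *\<^sub>R (- y) \<le> (- s) *\<^sub>R \<bar>y\<bar>"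
      using s(2) by (intro scaleR_left_mono) (auto simp: abs_ge_minus_self)
    moreover have "- (s *\<^sub>R y) \<le> (- s) *\<^sub>R \<bar>y\<bar>"
      using scaleR_left_mono[of y "\<bar>y\<bar>" "- s"] s(2) by (simp add: abs_ge_self)
    ultimately show ?thesis using s(1) by (intro abs_leI) auto
  qed
  define w where "w = inf \<bar>r *\<^sub>R x\<bar> \<bar>z\<bar>"
  have "w \<le> m *\<^sub>R \<bar>x\<bar>"
    unfolding w_def using le[of r x] m(2) by (meson abs_ge_zero inf_le1 order_trans scaleR_right_mono)
  moreover have "w \<le> m *\<^sub>R \<bar>z\<bar>"
    unfolding w_def using scaleR_right_mono[OF m(1), of "\<bar>z\<bar>"] by (metis abs_ge_zero inf_le2 order_trans scaleR_one)
  ultimately have "(1/m) *\<^sub>R w \<le> (1/m) *\<^sub>R (m *\<^sub>R \<bar>x\<bar>)" "(1/m) *\<^sub>R w \<le> (1/m) *\<^sub>R (m *\<^sub>R \<bar>z\<bar>)"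
    using m(1) by (auto simp del: scaleR_scaleR intro!: scaleR_left_mono)
  hence "(1/m) *\<^sub>R w \<le> inf \<bar>x\<bar> \<bar>z\<bar>" using m(1) by simp
  hence "m *\<^sub>R ((1/m) *\<^sub>R w) \<le> m *\<^sub>R 0"
    using assms m(1) unfolding lat_disjoint_def by (intro scaleR_left_mono) auto
  hence "w \<le> 0" using m(1) by simp
  moreover have "0 \<le> w" unfolding w_def by simp
  ultimately show ?thesis unfolding lat_disjoint_def w_def by (rule order_antisym)
qed

lemma lat_disjoint_Sup_nonneg:
  fixes A :: "'e::dedekind_vector_lattice set"
  assumes "A \<noteq> {}" "bdd_above A" "\<And>a. a \<in> A \<Longrightarrow> 0 \<le> a" "\<And>a. a \<in> A \<Longrightarrow> lat_disjoint a z"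
  shows "lat_disjoint (Sup A) z"
proof -
  define s where "s = Sup A"
  have up: "a \<le> s" if "a \<in> A" for a unfolding s_def by (rule cSup_upper[OF that assms(2)])
  have s0: "0 \<le> s" using assms(1,3) up by (metis ex_in_conv order_trans)
  define w where "w = inf \<bar>s\<bar> \<bar>z\<bar>"
  have w: "w \<le> s" "w \<le> \<bar>z\<bar>" "0 \<le> w" unfolding w_def using s0 by auto
  have "a \<le> s - w" if a: "a \<in> A" for a
  proof -
    have "inf a w \<le> inf \<bar>a\<bar> \<bar>z\<bar>" using w(2) by (meson abs_ge_self inf_mono)
    hence "inf a w \<le> 0" using assms(4)[OF a] unfolding lat_disjoint_def by simp
    moreover have "0 \<le> inf a w" using assms(3)[OF a] w(3) by simp
    ultimately have "inf a w = 0" by (rule order_antisym)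
    moreover have "a + w = sup a w + inf a w" by (rule add_eq_inf_sup[THEN trans]) (simp add: add.commute)
    ultimately have "a + w = sup a w" by simp
    hence "a + w \<le> s" using up[OF a] w(1) by simp
    thus ?thesis by (simp add: le_diff_eq)
  qed
  hence "s \<le> s - w" unfolding s_def by (intro cSup_least[OF assms(1)])
  hence "w \<le> 0" by simp
  hence "w = 0" using w(3) by (rule order_antisym)
  thus ?thesis unfolding lat_disjoint_def w_def s_def .
qed

lemma lat_disjoint_Sup:
  fixes A :: "'e::dedekind_vector_lattice set"
  assumes "A \<noteq> {}" "bdd_above A" "\<And>a. a \<in> A \<Longrightarrow> lat_disjoint a z"
  shows "lat_disjoint (Sup A) z"
proof -
  obtain b where b: "b \<in> A" using assms(1) by blast
  define B where "B = (\<lambda>a. sup (a - b) 0) ` A"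
  have bA: "b \<le> Sup A" by (rule cSup_upper[OF b assms(2)])
  have up: "x \<le> Sup A - b" if "x \<in> B" for x
    using that bA cSup_upper[OF _ assms(2)] unfolding B_def by (auto simp: diff_right_mono)
  have "Sup B = Sup A - b"
  proof (rule order_antisym)
    show "Sup B \<le> Sup A - b" using b up by (intro cSup_least) (auto simp: B_def)
    have "a \<le> Sup B + b" if "a \<in> A" for a
    proof -
      have "sup (a - b) 0 \<le> Sup B"
        using that up by (intro cSup_upper bdd_aboveI[of B "Sup A - b"]) (auto simp: B_def)
      thus ?thesis by (simp add: diff_le_eq)
    qed
    hence "Sup A \<le> Sup B + b" by (rule cSup_least[OF assms(1)])
    thus "Sup A - b \<le> Sup B" by (simp add: diff_le_eq)
  qed
  moreover have "lat_disjoint (Sup B) z"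
  proof (rule lat_disjoint_Sup_nonneg)
    show "B \<noteq> {}" using b by (auto simp: B_def)
    show "bdd_above B" using up by (rule bdd_aboveI)
    show "0 \<le> a" if "a \<in> B" for a using that by (auto simp: B_def)
    show "lat_disjoint a z" if a: "a \<in> B" for a
    proof -
      obtain c where c: "c \<in> A" "a = sup (c - b) 0" using a unfolding B_def by blast
      have "lat_disjoint (c - b) z" using assms(3) b c(1) by (intro lat_disjoint_diff) auto
      moreover have "\<bar>a\<bar> \<le> \<bar>c - b\<bar>" unfolding c(2) by (simp add: abs_ge_self)
      ultimately show ?thesis by (rule lat_disjoint_abs_mono)
    qed
  qed
  ultimately have "lat_disjoint (Sup A - b + b) z"
    using assms(3)[OF b] by (intro lat_disjoint_add) auto
  thus ?thesis by simp
qed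

lemma pos_part_decomp: "x = sup x 0 - sup (- x) (0::'e::dedekind_vector_lattice)"
proof -
  have "inf x 0 = - sup (- x) 0" by (rule inf_eq_neg_sup[of x 0, unfolded minus_zero])
  hence "sup x 0 - sup (- x) 0 = pprt x + nprt x" by (simp only: pprt_def nprt_def diff_conv_add_uminus)
  also have "\<dots> = x" by (rule prts[symmetric])
  finally show ?thesis by (rule sym)
qed

lemma pos_part_obtain:
  obtains a b :: "'e::dedekind_vector_lattice"
  where "a = sup x 0" "b = sup (- x) 0" "x = a - b" "0 \<le> a" "0 \<le> b"
  by (rule that[OF refl refl pos_part_decomp sup_ge2 sup_ge2])

lemma lat_disjoint_pos_part:
  assumes "lat_disjoint x z"
  shows "lat_disjoint (sup x 0) (z::'e::dedekind_vector_lattice)" "lat_disjoint (sup (- x) 0) z"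
proof -
  have "\<bar>sup y 0\<bar> \<le> \<bar>x\<bar>" if "y \<le> \<bar>x\<bar>" for y
  proof -
    have "\<bar>sup y 0\<bar> = sup y 0" by (intro abs_of_nonneg sup_ge2)
    also have "\<dots> \<le> \<bar>x\<bar>" by (intro sup_least that abs_ge_zero)
    finally show ?thesis .
  qed
  note * = this
  show "lat_disjoint (sup x 0) z"
    by (rule lat_disjoint_abs_mono[OF assms *[OF abs_ge_self]])
  show "lat_disjoint (sup (- x) 0) z"
    by (rule lat_disjoint_abs_mono[OF assms *[OF abs_ge_minus_self]])
qed

subsection \<open>Extension from the positive cone\<close>

definition cone_ext :: "('e::dedekind_vector_lattice \<Rightarrow> 'e) \<Rightarrow> 'e \<Rightarrow> 'e"
  where "cone_ext p x = p (sup x 0) - p (sup (- x) 0)"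

locale cone_map =
  fixes p :: "'e::dedekind_vector_lattice \<Rightarrow> 'e"
  assumes add: "0 \<le> x \<Longrightarrow> 0 \<le> y \<Longrightarrow> p (x + y) = p x + p y"
    and hom: "0 < r \<Longrightarrow> 0 \<le> x \<Longrightarrow> p (r *\<^sub>R x) = r *\<^sub>R p x"
begin

lemma zero: "p 0 = 0"
  using add[of 0 0] by simp

lemma ext_diff:
  assumes "0 \<le> a" "0 \<le> b" shows "cone_ext p (a - b) = p a - p b"
proof -
  obtain u v where uv: "u = sup (a - b) 0" "v = sup (- (a - b)) 0" "a - b = u - v" "0 \<le> u" "0 \<le> v"
    by (rule pos_part_obtain)
  have "u + b = (u - v) + (v + b)" by simp
  also have "\<dots> = a + v" unfolding uv(3)[symmetric] by (simp add: add.commute)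
  finally have "u + b = a + v" .
  hence "p u + p b = p a + p v"
    using add[of u b] add[of a v] assms uv(4,5) by simp
  hence "p u = (p a + p v) - p b" by (metis add_diff_cancel)
  hence "p u - p v = p a - p b" by simp
  thus ?thesis unfolding cone_ext_def using uv(1,2) by simp
qed

lemma ext_nonneg: "0 \<le> x \<Longrightarrow> cone_ext p x = p x"
  using ext_diff[of x 0] zero by simp

lemma ext_linear: "linear (cone_ext p)"
proof (rule linearI)
  fix x y :: 'e
  obtain a b where x: "x = a - b" "0 \<le> a" "0 \<le> b" by (rule pos_part_obtain)
  obtain c d where y: "y = c - d" "0 \<le> c" "0 \<le> d" by (rule pos_part_obtain)
  have "x + y = (a + c) - (b + d)" using x y by (simp add: algebra_simps)
  hence "cone_ext p (x + y) = cone_ext p ((a + c) - (b + d))" by (rule arg_cong)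
  also have "\<dots> = (p a + p c) - (p b + p d)"
    using ext_diff[of "a + c" "b + d"] x y by (simp add: add)
  finally show "cone_ext p (x + y) = cone_ext p x + cone_ext p y"
    unfolding x(1) y(1) using x y by (simp add: ext_diff)
next
  fix r :: real and x :: 'e
  obtain a b where x: "x = a - b" "0 \<le> a" "0 \<le> b" by (rule pos_part_obtain)
  consider "r = 0" | "r > 0" | "- r > 0" by linarith
  then show "cone_ext p (r *\<^sub>R x) = r *\<^sub>R cone_ext p x"
  proof cases
    case 1
    then show ?thesis using ext_diff[of 0 0] by simp
  next
    case 2
    have "r *\<^sub>R x = r *\<^sub>R a - r *\<^sub>R b" using x(1) by (simp add: scaleR_diff_right)
    hence "cone_ext p (r *\<^sub>R x) = r *\<^sub>R p a - r *\<^sub>R p b"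
      using 2 x ext_diff[of "r *\<^sub>R a" "r *\<^sub>R b"] by (simp add: scaleR_nonneg_nonneg hom)
    thus ?thesis using x by (simp add: ext_diff scaleR_diff_right)
  next
    case 3
    define s where "s = - r"
    have s: "0 < s" "r = - s" using 3 by (simp_all add: s_def)
    have "r *\<^sub>R x = s *\<^sub>R b - s *\<^sub>R a" using x(1) s(2) by (simp add: scaleR_diff_right)
    hence "cone_ext p (r *\<^sub>R x) = s *\<^sub>R p b - s *\<^sub>R p a"
      using s x ext_diff[of "s *\<^sub>R b" "s *\<^sub>R a"] by (simp add: scaleR_nonneg_nonneg hom)
    thus ?thesis using x s(2) by (simp add: ext_diff scaleR_diff_right)
  qed
qed

lemma ext_band_preserving:
  assumes "\<And>x z. 0 \<le> x \<Longrightarrow> lat_disjoint x z \<Longrightarrow> lat_disjoint (p x) z"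
  shows "band_preserving (cone_ext p)"
  unfolding band_preserving_def cone_ext_def
  by (intro allI impI lat_disjoint_diff assms lat_disjoint_pos_part sup_ge2)

end

lemma order_bounded_mono:
  assumes "linear T" "\<And>x. 0 \<le> x \<Longrightarrow> 0 \<le> T x"
  shows "order_bounded_map (T :: 'e::dedekind_vector_lattice \<Rightarrow> 'e)"
proof -
  have "T x \<le> T y" if "x \<le> y" for x y
    using assms(2)[of "y - x"] that by (simp add: linear_diff[OF assms(1)])
  thus ?thesis unfolding order_bounded_map_def by (force simp: image_subset_iff)
qed

lemma order_bounded_map_add:
  assumes "order_bounded_map S" "order_bounded_map T"
  shows "order_bounded_map (\<lambda>x. S x + T x)"
  unfolding order_bounded_map_def
proof (intro allI)
  fix a b
  obtain c d c' d' where "S ` {a..b} \<subseteq> {c..d}" "T ` {a..b} \<subseteq> {c'..d'}"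
    using assms unfolding order_bounded_map_def by metis
  hence "(\<lambda>x. S x + T x) ` {a..b} \<subseteq> {c + c'..d + d'}"
    by (fastforce intro: add_mono simp: image_subset_iff)
  thus "\<exists>c d. (\<lambda>x. S x + T x) ` {a..b} \<subseteq> {c..d}" by blast
qed

lemma order_bounded_map_minus:
  assumes "order_bounded_map T" shows "order_bounded_map (\<lambda>x. - T x)"
  unfolding order_bounded_map_def
proof (intro allI)
  fix a b
  obtain c d where "T ` {a..b} \<subseteq> {c..d}" using assms unfolding order_bounded_map_def by metis
  hence "(\<lambda>x. - T x) ` {a..b} \<subseteq> {-d..-c}" by auto
  thus "\<exists>c d. (\<lambda>x. - T x) ` {a..b} \<subseteq> {c..d}" by blast
qed

lemma order_bounded_map_scaleR:
  assumes "order_bounded_map T" shows "order_bounded_map (\<lambda>x. r *\<^sub>R T x)"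
proof -
  have *: "order_bounded_map (\<lambda>x. s *\<^sub>R T x)" if s: "s \<ge> 0" for s
    unfolding order_bounded_map_def
  proof (intro allI)
    fix a b
    obtain c d where "T ` {a..b} \<subseteq> {c..d}" using assms unfolding order_bounded_map_def by metis
    hence "(\<lambda>x. s *\<^sub>R T x) ` {a..b} \<subseteq> {s *\<^sub>R c..s *\<^sub>R d}"
      using s by (auto intro!: scaleR_left_mono)
    thus "\<exists>c d. (\<lambda>x. s *\<^sub>R T x) ` {a..b} \<subseteq> {c..d}" by blast
  qed
  show ?thesis
  proof (cases "r \<ge> 0")
    case False
    then show ?thesis using order_bounded_map_minus[OF *[of "- r"]] by simp
  qed (rule *)
qed

lemma orthomorphism_zero: "orthomorphism (\<lambda>x. 0)"
  by (auto simp: orthomorphism_def band_preserving_def lat_disjoint_zero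
      intro!: linear_zero order_bounded_mono)

lemma orthomorphism_add:
  "orthomorphism S \<Longrightarrow> orthomorphism T \<Longrightarrow> orthomorphism (\<lambda>x. S x + T x)"
  by (auto simp: orthomorphism_def band_preserving_def
      intro!: linear_compose_add order_bounded_map_add lat_disjoint_add)

lemma orthomorphism_minus: "orthomorphism T \<Longrightarrow> orthomorphism (\<lambda>x. - T x)"
  by (auto simp: orthomorphism_def band_preserving_def
      intro!: linear_compose_neg order_bounded_map_minus lat_disjoint_minus)

lemma orthomorphism_diff:
  "orthomorphism S \<Longrightarrow> orthomorphism T \<Longrightarrow> orthomorphism (\<lambda>x. S x - T x)"
  using orthomorphism_add[of S "\<lambda>x. - T x"] orthomorphism_minus[of T] by simp

lemma orthomorphism_scaleR: "orthomorphism T \<Longrightarrow> orthomorphism (\<lambda>x. r *\<^sub>R T x)"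
  by (auto simp: orthomorphism_def band_preserving_def
      intro!: linear_compose_scale_right order_bounded_map_scaleR lat_disjoint_scaleR)

lemma orthomorphism_id: "orthomorphism (\<lambda>x. x)"
  by (auto simp: orthomorphism_def order_bounded_map_def band_preserving_def linear_iff)

lemma orthomorphism_compose:
  assumes "orthomorphism S" "orthomorphism T" shows "orthomorphism (\<lambda>x. S (T x))"
proof -
  have "linear (\<lambda>x. S (T x))"
    using assms linear_compose[of T S] by (simp add: orthomorphism_def o_def)
  moreover have "order_bounded_map (\<lambda>x. S (T x))"
    unfolding order_bounded_map_def
  proof (intro allI)
    fix a b
    obtain c d where 1: "T ` {a..b} \<subseteq> {c..d}"
      using assms unfolding orthomorphism_def order_bounded_map_def by metis
    obtain c' d' where 2: "S ` {c..d} \<subseteq> {c'..d'}"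
      using assms unfolding orthomorphism_def order_bounded_map_def by metis
    have "(\<lambda>x. S (T x)) ` {a..b} \<subseteq> {c'..d'}" using 1 2 by blast
    thus "\<exists>c d. (\<lambda>x. S (T x)) ` {a..b} \<subseteq> {c..d}" by blast
  qed
  ultimately show ?thesis using assms by (auto simp: orthomorphism_def band_preserving_def)
qed

subsection \<open>Positive parts and suprema\<close>

lemma orthomorphism_pos_part:
  assumes T: "orthomorphism T"
  shows "\<exists>P. orthomorphism P \<and> (\<forall>x\<ge>0. 0 \<le> P x \<and> T x \<le> P x)
    \<and> (\<forall>U. orthomorphism U \<longrightarrow> (\<forall>x\<ge>0. 0 \<le> U x \<and> T x \<le> U x) \<longrightarrow> (\<forall>x\<ge>0. P x \<le> U x))"
proof -
  have lin: "linear T" and obd: "order_bounded_map T" and bp: "band_preserving T"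
    using T by (auto simp: orthomorphism_def)
  define p where "p x = Sup (T ` {0..x})" for x
  have bdd: "bdd_above (T ` {0..x})" for x
  proof -
    obtain c d where "T ` {0..x} \<subseteq> {c..d}" using obd unfolding order_bounded_map_def by blast
    thus ?thesis by (meson bdd_above_Icc bdd_above_mono)
  qed
  have up: "T y \<le> p x" if "0 \<le> y" "y \<le> x" for x y
    unfolding p_def using that by (intro cSup_upper bdd) auto
  have least: "p x \<le> u" if "0 \<le> x" "\<And>y. 0 \<le> y \<Longrightarrow> y \<le> x \<Longrightarrow> T y \<le> u" for x u
    unfolding p_def using that by (intro cSup_least) auto
  have hom1: "p (r *\<^sub>R x) \<le> r *\<^sub>R p x" if r: "0 < r" and x: "0 \<le> x" for r x
  proof (rule least)
    show "0 \<le> r *\<^sub>R x" using r x by (simp add: scaleR_nonneg_nonneg)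
    fix y assume y: "0 \<le> y" "y \<le> r *\<^sub>R x"
    have "(1/r) *\<^sub>R y \<le> (1/r) *\<^sub>R (r *\<^sub>R x)" using y r by (intro scaleR_left_mono) auto
    hence "T ((1/r) *\<^sub>R y) \<le> p x" using y r by (intro up) (auto simp: scaleR_nonneg_nonneg)
    hence "r *\<^sub>R T ((1/r) *\<^sub>R y) \<le> r *\<^sub>R p x" using r by (intro scaleR_left_mono) auto
    thus "T y \<le> r *\<^sub>R p x" using r by (simp add: linear_cmul[OF lin])
  qed
  interpret cone_map p
  proof
    fix x y :: 'a assume xy: "0 \<le> x" "0 \<le> y"
    show "p (x + y) = p x + p y"
    proof (rule order_antisym)
      show "p (x + y) \<le> p x + p y"
      proof (rule least)
        show "0 \<le> x + y" using xy by simp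
        fix z assume z: "0 \<le> z" "z \<le> x + y"
        have 1: "T (inf z x) \<le> p x" using z xy by (intro up) auto
        have "z - y \<le> inf z x" using z xy by (intro inf_greatest) (simp_all add: diff_le_eq)
        hence "z - inf z x \<le> y" by (simp only: diff_le_eq add.commute[of y])
        hence 2: "T (z - inf z x) \<le> p y" by (rule up[OF iffD2[OF diff_ge_0_iff_ge inf_le1]])
        have "T z = T (inf z x) + T (z - inf z x)" by (simp only: linear_diff[OF lin] add_diff_eq add_diff_cancel_left')
        thus "T z \<le> p x + p y" using add_mono[OF 1 2] by simp
      qed
      have "p x \<le> p (x + y) - p y"
      proof (rule least[OF xy(1)])
        fix a assume a: "0 \<le> a" "a \<le> x"
        have "p y \<le> p (x + y) - T a"
        proof (rule least[OF xy(2)])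
          fix b assume b: "0 \<le> b" "b \<le> y"
          have "T (a + b) \<le> p (x + y)" using a b by (intro up) (auto intro: add_mono)
          thus "T b \<le> p (x + y) - T a" by (simp add: linear_add[OF lin] algebra_simps)
        qed
        thus "T a \<le> p (x + y) - p y" by (simp add: algebra_simps)
      qed
      thus "p x + p y \<le> p (x + y)" by (simp add: algebra_simps)
    qed
  next
    fix r :: real and x :: 'a assume r: "0 < r" and x: "0 \<le> x"
    have "p ((1/r) *\<^sub>R (r *\<^sub>R x)) \<le> (1/r) *\<^sub>R p (r *\<^sub>R x)"
      using r x by (intro hom1) (auto simp: scaleR_nonneg_nonneg)
    hence "r *\<^sub>R p x \<le> r *\<^sub>R ((1/r) *\<^sub>R p (r *\<^sub>R x))" using r by (intro scaleR_left_mono) auto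
    hence "r *\<^sub>R p x \<le> p (r *\<^sub>R x)" using r by simp
    with hom1[OF r x] show "p (r *\<^sub>R x) = r *\<^sub>R p x" by (rule order_antisym)
  qed
  define P where "P = cone_ext p"
  have Pp: "P x = p x" if "0 \<le> x" for x unfolding P_def using that by (rule ext_nonneg)
  have P0: "0 \<le> P x" if "0 \<le> x" for x
    using up[of 0 x] that Pp linear_0[OF lin] by simp
  have PT: "T x \<le> P x" if "0 \<le> x" for x
    using up[of x x] that Pp by simp
  have "band_preserving P" unfolding P_def
  proof (rule ext_band_preserving)
    fix x z :: 'a assume x: "0 \<le> x" and d: "lat_disjoint x z"
    show "lat_disjoint (p x) z" unfolding p_def
    proof (rule lat_disjoint_Sup[OF _ bdd])
      show "T ` {0..x} \<noteq> {}" using x by auto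
      fix a assume "a \<in> T ` {0..x}"
      then obtain y where y: "0 \<le> y" "y \<le> x" "a = T y" by auto
      have "lat_disjoint y z" using d y x by (auto intro: lat_disjoint_abs_mono)
      thus "lat_disjoint a z" using bp y(3) unfolding band_preserving_def by blast
    qed
  qed
  moreover have "linear P" unfolding P_def by (rule ext_linear)
  ultimately have "orthomorphism P" unfolding orthomorphism_def using order_bounded_mono P0 by blast
  moreover have "P x \<le> U x"
    if U: "orthomorphism U" "\<forall>x\<ge>0. 0 \<le> U x \<and> T x \<le> U x" and x: "0 \<le> x" for U x
  proof -
    have "p x \<le> U x"
    proof (rule least[OF x])
      fix y assume y: "0 \<le> y" "y \<le> x"
      have "0 \<le> U (x - y)" using U(2) y by simp
      hence "U y \<le> U x" using U(1) by (simp add: orthomorphism_def linear_diff)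
      thus "T y \<le> U x" using U(2) y(1) order_trans by blast
    qed
    thus ?thesis using Pp[OF x] by simp
  qed
  ultimately show ?thesis using P0 PT by blast
qed

subsection \<open>The type of orthomorphisms\<close>

typedef (overloaded) 'e orth = "{T :: 'e::dedekind_vector_lattice \<Rightarrow> 'e. orthomorphism T}"
  morphisms orth_apply Abs_orth
  using orthomorphism_zero by blast

setup_lifting type_definition_orth

lemma orth_apply_orthomorphism: "orthomorphism (orth_apply T)"
  using orth_apply by blast

lemma linear_orth_apply: "linear (orth_apply T)"
  using orth_apply_orthomorphism by (auto simp: orthomorphism_def)

instantiation orth :: (dedekind_vector_lattice) real_vector
begin

lift_definition zero_orth :: "'a orth" is "\<lambda>x. 0" by (rule orthomorphism_zero)
lift_definition plus_orth :: "'a orth \<Rightarrow> 'a orth \<Rightarrow> 'a orth" is "\<lambda>S T x. S x + T x"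
  by (rule orthomorphism_add)
lift_definition minus_orth :: "'a orth \<Rightarrow> 'a orth \<Rightarrow> 'a orth" is "\<lambda>S T x. S x - T x"
  by (rule orthomorphism_diff)
lift_definition uminus_orth :: "'a orth \<Rightarrow> 'a orth" is "\<lambda>T x. - T x"
  by (rule orthomorphism_minus)
lift_definition scaleR_orth :: "real \<Rightarrow> 'a orth \<Rightarrow> 'a orth" is "\<lambda>r T x. r *\<^sub>R T x"
  by (rule orthomorphism_scaleR)

instance
  by standard (transfer; auto simp: algebra_simps scaleR_add_left)+

end

instantiation orth :: (dedekind_vector_lattice) "{ring, monoid_mult}"
begin

lift_definition one_orth :: "'a orth" is "\<lambda>x. x" by (rule orthomorphism_id)
lift_definition times_orth :: "'a orth \<Rightarrow> 'a orth \<Rightarrow> 'a orth" is "\<lambda>S T x. S (T x)"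
  by (rule orthomorphism_compose)

instance
  by standard (transfer; auto simp: orthomorphism_def linear_add)+

end

instantiation orth :: (dedekind_vector_lattice) ordered_real_vector
begin

lift_definition less_eq_orth :: "'a orth \<Rightarrow> 'a orth \<Rightarrow> bool" is "\<lambda>S T. \<forall>x\<ge>0. S x \<le> T x" .
definition less_orth :: "'a orth \<Rightarrow> 'a orth \<Rightarrow> bool" where "less_orth S T \<longleftrightarrow> S \<le> T \<and> \<not> T \<le> S"

instance
proof
  fix S T U :: "'a orth" and a b :: real
  show "S < T \<longleftrightarrow> S \<le> T \<and> \<not> T \<le> S" by (rule less_orth_def)
  show "S \<le> S" by transfer simp
  show "S \<le> T \<Longrightarrow> T \<le> U \<Longrightarrow> S \<le> U" by transfer (blast intro: order_trans)
  show "S \<le> T \<Longrightarrow> T \<le> S \<Longrightarrow> S = T"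
  proof transfer
    fix S T :: "'a \<Rightarrow> 'a"
    assume o: "orthomorphism S" "orthomorphism T" and le: "\<forall>x\<ge>0. S x \<le> T x" "\<forall>x\<ge>0. T x \<le> S x"
    show "S = T"
    proof
      fix x
      have eq: "S y = T y" if "0 \<le> y" for y using le that by (meson order_antisym)
      show "S x = T x"
        using o pos_part_obtain[of x] by (metis orthomorphism_def linear_diff eq)
    qed
  qed
  show "S \<le> T \<Longrightarrow> U + S \<le> U + T" by transfer simp
  show "S \<le> T \<Longrightarrow> 0 \<le> a \<Longrightarrow> a *\<^sub>R S \<le> a *\<^sub>R T" by transfer (simp add: scaleR_left_mono)
  show "a \<le> b \<Longrightarrow> 0 \<le> S \<Longrightarrow> a *\<^sub>R S \<le> b *\<^sub>R S" by transfer (simp add: scaleR_right_mono)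
qed

end

lemma orth_pos_part_ex:
  "\<exists>P. 0 \<le> P \<and> T \<le> P \<and> (\<forall>U. 0 \<le> U \<longrightarrow> T \<le> U \<longrightarrow> P \<le> (U::'e::dedekind_vector_lattice orth))"
proof transfer
  fix T :: "'e \<Rightarrow> 'e" assume "orthomorphism T"
  from orthomorphism_pos_part[OF this]
  show "\<exists>P\<in>Collect orthomorphism. (\<forall>x\<ge>0. 0 \<le> P x) \<and> (\<forall>x\<ge>0. T x \<le> P x)
      \<and> (\<forall>U\<in>Collect orthomorphism. (\<forall>x\<ge>0. 0 \<le> U x) \<longrightarrow> (\<forall>x\<ge>0. T x \<le> U x) \<longrightarrow> (\<forall>x\<ge>0. P x \<le> U x))"
    by (metis mem_Collect_eq)
qed

lemma orth_sup_ex: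
  "\<exists>P. S \<le> P \<and> T \<le> P \<and> (\<forall>U. S \<le> U \<longrightarrow> T \<le> U \<longrightarrow> P \<le> (U::'e::dedekind_vector_lattice orth))"
proof -
  obtain P where P: "0 \<le> P" "T - S \<le> P" "\<And>U. 0 \<le> U \<Longrightarrow> T - S \<le> U \<Longrightarrow> P \<le> U"
    using orth_pos_part_ex[of "T - S"] by blast
  have "S \<le> S + P" using P(1) by simp
  moreover have "T \<le> S + P" using P(2) by (simp add: diff_le_eq add.commute)
  moreover have "S + P \<le> U" if "S \<le> U" "T \<le> U" for U
    using P(3)[of "U - S"] that by (simp add: diff_right_mono le_diff_eq add.commute)
  ultimately show ?thesis by blast
qed

instantiation orth :: (dedekind_vector_lattice) lattice_ab_group_add_abs
begin

definition sup_orth :: "'a orth \<Rightarrow> 'a orth \<Rightarrow> 'a orth"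
  where "sup_orth S T = (THE P. S \<le> P \<and> T \<le> P \<and> (\<forall>U. S \<le> U \<longrightarrow> T \<le> U \<longrightarrow> P \<le> U))"
definition inf_orth :: "'a orth \<Rightarrow> 'a orth \<Rightarrow> 'a orth"
  where "inf_orth S T = - sup (- S) (- T)"
definition abs_orth :: "'a orth \<Rightarrow> 'a orth"
  where "abs_orth T = sup T (- T)"

instance
proof
  fix S T U :: "'a orth"
  have sup: "S \<le> sup S T \<and> T \<le> sup S T \<and> (\<forall>U. S \<le> U \<longrightarrow> T \<le> U \<longrightarrow> sup S T \<le> U)"
    for S T :: "'a orth"
    unfolding sup_orth_def
    by (rule theI', rule ex_ex1I[OF orth_sup_ex]) (meson order_antisym)
  show "S \<le> sup S T" "T \<le> sup S T" using sup by blast+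
  show "T \<le> S \<Longrightarrow> U \<le> S \<Longrightarrow> sup T U \<le> S" using sup by blast
  show "inf S T \<le> S" "inf S T \<le> T"
    unfolding inf_orth_def using sup[of "- S" "- T"] by (simp_all add: minus_le_iff)
  show "S \<le> inf T U" if "S \<le> T" "S \<le> U"
    unfolding inf_orth_def using sup[of "- T" "- U"] that
    by (subst le_minus_iff) (simp del: neg_le_iff_le add: neg_le_iff_le[THEN iffD2])
  show "\<bar>S\<bar> = sup S (- S)" by (rule abs_orth_def)
qed

end

lemma orth_le_iff: "S \<le> T \<longleftrightarrow> (\<forall>x\<ge>0. orth_apply S x \<le> orth_apply T x)"
  by (rule less_eq_orth.rep_eq)

lemma orth_Sup_ex_directed:
  fixes D :: "'e::dedekind_vector_lattice orth set"
  assumes ne: "D \<noteq> {}" and bd: "bdd_above D"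
    and dir: "\<And>S T. S \<in> D \<Longrightarrow> T \<in> D \<Longrightarrow> \<exists>U\<in>D. S \<le> U \<and> T \<le> U"
  shows "\<exists>P. (\<forall>T\<in>D. T \<le> P) \<and> (\<forall>U. (\<forall>T\<in>D. T \<le> U) \<longrightarrow> P \<le> U)"
proof -
  define p where "p x = (SUP T\<in>D. orth_apply T x)" for x
  obtain B where B: "\<And>T. T \<in> D \<Longrightarrow> T \<le> B" using bd unfolding bdd_above_def by blast
  have bdd: "bdd_above ((\<lambda>T. orth_apply T x) ` D)" if "0 \<le> x" for x
    using B that by (auto simp: orth_le_iff intro!: bdd_aboveI[of _ "orth_apply B x"])
  have up: "orth_apply T x \<le> p x" if "0 \<le> x" "T \<in> D" for x T
    unfolding p_def using that by (intro cSup_upper bdd) auto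
  have least: "p x \<le> u" if "\<And>T. T \<in> D \<Longrightarrow> orth_apply T x \<le> u" for x u
    unfolding p_def using that ne by (intro cSup_least) auto
  have hom1: "p (r *\<^sub>R x) \<le> r *\<^sub>R p x" if r: "0 < r" and x: "0 \<le> x" for r x
    using up[OF x] r
    by (intro least) (simp add: linear_cmul[OF linear_orth_apply] scaleR_left_mono)
  interpret cone_map p
  proof
    fix x y :: 'e assume xy: "0 \<le> x" "0 \<le> y"
    show "p (x + y) = p x + p y"
    proof (rule order_antisym)
      show "p (x + y) \<le> p x + p y"
        by (rule least) (simp add: linear_add[OF linear_orth_apply] add_mono up xy)
      have "p x \<le> p (x + y) - p y"
      proof (rule least)
        fix S assume S: "S \<in> D"
        have "p y \<le> p (x + y) - orth_apply S x"
        proof (rule least)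
          fix T assume "T \<in> D"
          then obtain U where U: "U \<in> D" "S \<le> U" "T \<le> U" using dir S by blast
          have "orth_apply S x + orth_apply T y \<le> orth_apply U x + orth_apply U y"
            using U xy by (intro add_mono) (auto simp: orth_le_iff)
          also have "\<dots> = orth_apply U (x + y)" by (simp add: linear_add[OF linear_orth_apply])
          also have "\<dots> \<le> p (x + y)" using xy U(1) by (intro up) auto
          finally show "orth_apply T y \<le> p (x + y) - orth_apply S x" by (simp add: algebra_simps)
        qed
        thus "orth_apply S x \<le> p (x + y) - p y" by (simp add: algebra_simps)
      qed
      thus "p x + p y \<le> p (x + y)" by (simp add: algebra_simps)
    qed
  next
    fix r :: real and x :: 'e assume r: "0 < r" and x: "0 \<le> x"
    have "p ((1/r) *\<^sub>R (r *\<^sub>R x)) \<le> (1/r) *\<^sub>R p (r *\<^sub>R x)"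
      using r x by (intro hom1) (auto simp: scaleR_nonneg_nonneg)
    hence "r *\<^sub>R p x \<le> r *\<^sub>R ((1/r) *\<^sub>R p (r *\<^sub>R x))" using r by (intro scaleR_left_mono) auto
    hence "r *\<^sub>R p x \<le> p (r *\<^sub>R x)" using r by simp
    with hom1[OF r x] show "p (r *\<^sub>R x) = r *\<^sub>R p x" by (rule order_antisym)
  qed
  obtain T0 where T0: "T0 \<in> D" using ne by blast
  let ?P = "cone_ext p"
  have lin: "linear ?P" by (rule ext_linear)
  have bp: "band_preserving ?P"
  proof (rule ext_band_preserving)
    fix x z :: 'e assume x: "0 \<le> x" and d: "lat_disjoint x z"
    show "lat_disjoint (p x) z" unfolding p_def
      using ne bdd[OF x] d orth_apply_orthomorphism
      by (intro lat_disjoint_Sup) (auto simp: orthomorphism_def band_preserving_def)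
  qed
  have "order_bounded_map (\<lambda>x. ?P x - orth_apply T0 x)"
    using up[OF _ T0] by (intro order_bounded_mono linear_compose_sub lin linear_orth_apply) (simp add: ext_nonneg)
  from order_bounded_map_add[OF this, of "orth_apply T0"]
  have "order_bounded_map ?P" using orth_apply_orthomorphism[of T0] by (simp add: orthomorphism_def)
  hence P: "orthomorphism ?P" using lin bp by (simp add: orthomorphism_def)
  have ap: "orth_apply (Abs_orth ?P) x = p x" if "0 \<le> x" for x
    using P that by (simp add: Abs_orth_inverse ext_nonneg)
  have "\<forall>T\<in>D. T \<le> Abs_orth ?P" by (simp add: orth_le_iff ap up)
  moreover have "Abs_orth ?P \<le> U" if "\<forall>T\<in>D. T \<le> U" for U
    using that by (simp add: orth_le_iff ap least)
  ultimately show ?thesis by blast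
qed

lemma orth_Sup_ex:
  fixes A :: "'e::dedekind_vector_lattice orth set"
  assumes ne: "A \<noteq> {}" and bd: "bdd_above A"
  shows "\<exists>P. (\<forall>T\<in>A. T \<le> P) \<and> (\<forall>U. (\<forall>T\<in>A. T \<le> U) \<longrightarrow> P \<le> U)"
proof -
  define D where "D = {Sup_fin F | F. finite F \<and> F \<noteq> {} \<and> F \<subseteq> A}"
  have AD: "T \<in> D" if "T \<in> A" for T
    unfolding D_def using that by (intro CollectI exI[of _ "{T}"]) auto
  have ub: "T \<le> U" if "\<forall>T\<in>A. T \<le> U" "T \<in> D" for T U
    using that unfolding D_def by (auto intro!: Sup_fin.boundedI)
  obtain B where B: "\<forall>T\<in>A. T \<le> B" using bd unfolding bdd_above_def by blast
  have "\<exists>P. (\<forall>T\<in>D. T \<le> P) \<and> (\<forall>U. (\<forall>T\<in>D. T \<le> U) \<longrightarrow> P \<le> U)"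
  proof (rule orth_Sup_ex_directed)
    show "D \<noteq> {}" using ne AD by blast
    show "bdd_above D" using ub[OF B] by (rule bdd_aboveI)
    fix S T assume "S \<in> D" "T \<in> D"
    then obtain F G where FG: "S = Sup_fin F" "T = Sup_fin G"
      "finite F" "finite G" "F \<noteq> {}" "G \<noteq> {}" "F \<subseteq> A" "G \<subseteq> A"
      unfolding D_def by blast
    have "Sup_fin (F \<union> G) \<in> D" using FG unfolding D_def by blast
    moreover have "S \<le> Sup_fin (F \<union> G)" "T \<le> Sup_fin (F \<union> G)"
      using FG by (auto intro!: Sup_fin.subset_imp)
    ultimately show "\<exists>U\<in>D. S \<le> U \<and> T \<le> U" by blast
  qed
  then obtain P where P: "\<forall>T\<in>D. T \<le> P" "\<And>U. (\<forall>T\<in>D. T \<le> U) \<Longrightarrow> P \<le> U" by blast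
  have "\<forall>T\<in>A. T \<le> P" using P(1) AD by blast
  moreover have "P \<le> U" if "\<forall>T\<in>A. T \<le> U" for U using ub[OF that] by (intro P(2)) blast
  ultimately show ?thesis by blast
qed

instantiation orth :: (dedekind_vector_lattice) dedekind_vector_lattice
begin

definition Sup_orth :: "'a orth set \<Rightarrow> 'a orth"
  where "Sup_orth A = (THE P. (\<forall>T\<in>A. T \<le> P) \<and> (\<forall>U. (\<forall>T\<in>A. T \<le> U) \<longrightarrow> P \<le> U))"
definition Inf_orth :: "'a orth set \<Rightarrow> 'a orth"
  where "Inf_orth A = - Sup (uminus ` A)"

instance
proof
  have Sup: "(\<forall>T\<in>A. T \<le> Sup A) \<and> (\<forall>U. (\<forall>T\<in>A. T \<le> U) \<longrightarrow> Sup A \<le> U)"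
    if "A \<noteq> {}" "bdd_above A" for A :: "'a orth set"
    unfolding Sup_orth_def
    by (rule theI', rule ex_ex1I[OF orth_Sup_ex[OF that]]) (meson order_antisym)
  fix A :: "'a orth set" and T U :: "'a orth"
  have neg: "bdd_above (uminus ` A)" if "bdd_below A" for A :: "'a orth set"
    using that unfolding bdd_below_def by (auto intro!: bdd_aboveI)
  show "T \<le> Sup A" if "T \<in> A" "bdd_above A" using Sup[of A] that by blast
  show "Sup A \<le> U" if "A \<noteq> {}" "\<And>T. T \<in> A \<Longrightarrow> T \<le> U"
  proof -
    have "bdd_above A" using that(2) by (rule bdd_aboveI)
    from Sup[OF that(1) this] show ?thesis using that(2) by simp
  qed
  show "Inf A \<le> T" if "T \<in> A" "bdd_below A"
  proof -
    have "- T \<le> Sup (uminus ` A)" using Sup[OF _ neg[OF that(2)]] that(1) by blast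
    thus ?thesis unfolding Inf_orth_def by (simp add: minus_le_iff)
  qed
  show "U \<le> Inf A" if "A \<noteq> {}" "\<And>T. T \<in> A \<Longrightarrow> U \<le> T"
  proof -
    have "bdd_below A" using that(2) by (rule bdd_belowI)
    hence "Sup (uminus ` A) \<le> - U" using Sup[OF _ neg] that by auto
    thus ?thesis unfolding Inf_orth_def by (simp add: le_minus_iff)
  qed
qed

end

section \<open>Band projections and partitions of unity\<close>

text \<open>
  Orthomorphisms of \<open>E\<close> form the type \<^typ>\<open>'e orth\<close>; \<open>1\<close> is the identity and multiplication
  is composition.
\<close>

definition band_projections :: "'e::dedekind_vector_lattice orth set"
  where "band_projections =
    {\<pi>. \<exists>K. is_band K \<and> (\<forall>x. orth_apply \<pi> x \<in> K \<and> x - orth_apply \<pi> x \<in> disjoint_compl K)}"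

text \<open>The supremum is taken in the Boolean algebra of band projections.\<close>

definition partition_of_unity :: "'i set \<Rightarrow> ('i \<Rightarrow> 'e::dedekind_vector_lattice orth) \<Rightarrow> bool"
  where "partition_of_unity I \<pi> \<longleftrightarrow>
    (\<forall>i\<in>I. \<pi> i \<in> band_projections) \<and>
    (\<forall>i\<in>I. \<forall>j\<in>I. i \<noteq> j \<longrightarrow> inf (\<pi> i) (\<pi> j) = 0) \<and>
    (\<forall>\<rho>\<in>band_projections. (\<forall>i\<in>I. \<pi> i \<le> \<rho>) \<longrightarrow> \<rho> = 1)"

section \<open>Convergence\<close>

text \<open>
  Nets are rendered by filters.  A function \<open>f\<close> along \<open>F\<close> order converges to \<open>l\<close> if some
  \<open>D \<down> 0\<close> dominates \<open>\<bar>f - l\<bar>\<close>, each member of \<open>D\<close> from some index on.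
\<close>

definition o_tendsto :: "('a \<Rightarrow> 'e::dedekind_vector_lattice) \<Rightarrow> 'e \<Rightarrow> 'a filter \<Rightarrow> bool"
  where "o_tendsto f l F \<longleftrightarrow> (\<exists>D. D \<noteq> {} \<and>
    (\<forall>d\<in>D. \<forall>d'\<in>D. \<exists>d''\<in>D. d'' \<le> d \<and> d'' \<le> d') \<and>
    (\<forall>d\<in>D. 0 \<le> d) \<and> Inf D = 0 \<and>
    (\<forall>d\<in>D. eventually (\<lambda>a. \<bar>f a - l\<bar> \<le> d) F))"

definition o_sum :: "('i \<Rightarrow> 'e::dedekind_vector_lattice) \<Rightarrow> 'i set \<Rightarrow> 'e"
  where "o_sum f I = (THE l. o_tendsto (sum f) l (finite_subsets_at_top I))"

definition norm_o_tendsto ::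
    "('y::minus \<Rightarrow> 'e::dedekind_vector_lattice) \<Rightarrow> ('a \<Rightarrow> 'y) \<Rightarrow> 'y \<Rightarrow> 'a filter \<Rightarrow> bool"
  where "norm_o_tendsto nrm f x F \<longleftrightarrow> o_tendsto (\<lambda>a. nrm (x - f a)) 0 F"

definition norm_r_tendsto ::
    "('y::minus \<Rightarrow> 'e::dedekind_vector_lattice) \<Rightarrow> 'e \<Rightarrow> ('a \<Rightarrow> 'y) \<Rightarrow> 'y \<Rightarrow> 'a filter \<Rightarrow> bool"
  where "norm_r_tendsto nrm e f x F \<longleftrightarrow>
    (\<forall>\<epsilon>::real. \<epsilon> > 0 \<longrightarrow> eventually (\<lambda>a. nrm (x - f a) \<le> \<epsilon> *\<^sub>R e) F)"

text \<open>
  A net in \<open>A\<close> corresponds to a proper filter that contains \<open>A\<close> (its image filter).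
\<close>

definition norm_o_dense_in ::
    "('y::minus \<Rightarrow> 'e::dedekind_vector_lattice) \<Rightarrow> 'y set \<Rightarrow> 'y set \<Rightarrow> bool"
  where "norm_o_dense_in nrm A C \<longleftrightarrow> A \<subseteq> C \<and>
    (\<forall>x\<in>C. \<exists>F. F \<noteq> bot \<and> eventually (\<lambda>y. y \<in> A) F \<and> norm_o_tendsto nrm (\<lambda>y. y) x F)"

definition norm_r_dense_in ::
    "('y::minus \<Rightarrow> 'e::dedekind_vector_lattice) \<Rightarrow> 'e \<Rightarrow> 'y set \<Rightarrow> 'y set \<Rightarrow> bool"
  where "norm_r_dense_in nrm e A C \<longleftrightarrow> A \<subseteq> C \<and>
    (\<forall>x\<in>C. \<exists>F. F \<noteq> bot \<and> eventually (\<lambda>y. y \<in> A) F \<and> norm_r_tendsto nrm e (\<lambda>y. y) x F)"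

section \<open>Banach--Kantorovich spaces\<close>

text \<open>
  By the Gelfand--Mazur theorem the fields of class \<^class>\<open>real_normed_field\<close> are, up to
  isometric isomorphism, exactly the real and the complex numbers.
\<close>

locale lattice_normed_space = vector_space scale
  for scale :: "'k::real_normed_field \<Rightarrow> 'x::ab_group_add \<Rightarrow> 'x" +
  fixes nrm :: "'x \<Rightarrow> 'e::dedekind_vector_lattice"
  assumes nrm_nonneg: "0 \<le> nrm x"
    and nrm_eq_0: "nrm x = 0 \<Longrightarrow> x = 0"
    and nrm_scale: "nrm (scale c x) = norm c *\<^sub>R nrm x"
    and nrm_triangle: "nrm (x + y) \<le> nrm x + nrm y"
    and nrm_range: "disjoint_compl (disjoint_compl (range nrm)) = UNIV"

locale banach_kantorovich = lattice_normed_space scale nrm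
  for scale :: "'k::real_normed_field \<Rightarrow> 'x::ab_group_add \<Rightarrow> 'x"
    and nrm :: "'x \<Rightarrow> 'e::dedekind_vector_lattice" +
  assumes decomposable: "0 \<le> e1 \<Longrightarrow> 0 \<le> e2 \<Longrightarrow> nrm x = e1 + e2 \<Longrightarrow>
      \<exists>x1 x2. x = x1 + x2 \<and> nrm x1 = e1 \<and> nrm x2 = e2"
    and norm_o_complete: "F \<noteq> bot \<Longrightarrow> norm_o_tendsto nrm (\<lambda>(x, y). x - y) 0 (F \<times>\<^sub>F F) \<Longrightarrow>
      \<exists>x. norm_o_tendsto nrm (\<lambda>y. y) x F"

text \<open>
  A Banach--Kantorovich space carries exactly one action of the orthomorphisms of its norm lattice
  with the following properties; faithfulness is a consequence of them.
\<close>

definition is_orth_action ::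
    "('k::real_normed_field \<Rightarrow> 'x::ab_group_add \<Rightarrow> 'x) \<Rightarrow> ('x \<Rightarrow> 'e::dedekind_vector_lattice) \<Rightarrow>
      ('e orth \<Rightarrow> 'x \<Rightarrow> 'x) \<Rightarrow> bool"
  where "is_orth_action scale nrm act \<longleftrightarrow>
    (\<forall>l x y. act l (x + y) = act l x + act l y) \<and>
    (\<forall>l c x. act l (scale c x) = scale c (act l x)) \<and>
    (\<forall>l m x. act (l + m) x = act l x + act m x) \<and>
    (\<forall>r l x. act (r *\<^sub>R l) x = scale (of_real r) (act l x)) \<and>
    (\<forall>l m x. act (l * m) x = act l (act m x)) \<and>
    (\<forall>x. act 1 x = x) \<and>
    (\<forall>\<pi>\<in>band_projections. \<forall>x y. nrm (act \<pi> x + act (1 - \<pi>) y) =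
      orth_apply \<pi> (nrm x) + orth_apply (1 - \<pi>) (nrm y)) \<and>
    (\<forall>l x. nrm (act l x) = orth_apply \<bar>l\<bar> (nrm x))"

definition orth_action ::
    "('k::real_normed_field \<Rightarrow> 'x::ab_group_add \<Rightarrow> 'x) \<Rightarrow> ('x \<Rightarrow> 'e::dedekind_vector_lattice) \<Rightarrow>
      'e orth \<Rightarrow> 'x \<Rightarrow> 'x"
  where "orth_action scale nrm = (THE act. is_orth_action scale nrm act)"

section \<open>Mixings\<close>

text \<open>
  \<open>C\<close> is the ambient space and \<open>act\<close> the action of the band projections on it.  Only nonzero
  projections matter and these are pairwise distinct, so a family can always be indexed by a set
  of orthomorphisms.
\<close>

definition mix :: "('e::dedekind_vector_lattice orth \<Rightarrow> 'y \<Rightarrow> 'y) \<Rightarrow> 'y set \<Rightarrow> 'y set \<Rightarrow> 'y set"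
  where "mix act C U = {y\<in>C. \<exists>(I :: 'e orth set) \<pi> u. partition_of_unity I \<pi> \<and>
    (\<forall>i\<in>I. u i \<in> U \<and> act (\<pi> i) y = act (\<pi> i) (u i))}"

definition mix_fin :: "('e::dedekind_vector_lattice orth \<Rightarrow> 'y \<Rightarrow> 'y) \<Rightarrow> 'y set \<Rightarrow> 'y set \<Rightarrow> 'y set"
  where "mix_fin act C U = {y\<in>C. \<exists>(I :: 'e orth set) \<pi> u. finite I \<and> partition_of_unity I \<pi> \<and>
    (\<forall>i\<in>I. u i \<in> U \<and> act (\<pi> i) y = act (\<pi> i) (u i))}"

section \<open>Uniformly order continuous functions\<close>

text \<open>
  On a compact Hausdorff space, \<^term>\<open>uniformity\<close> is the only uniformity that induces the topology.
\<close>

definition cuo :: "('x::minus \<Rightarrow> 'e::dedekind_vector_lattice) \<Rightarrow> ('s::uniform_space \<Rightarrow> 'x) set"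
  where "cuo nrm = {f. (\<exists>e. \<forall>s. nrm (f s) \<le> e) \<and>
    (INF U \<in> {U. eventually (\<lambda>p. p \<in> U) uniformity}. SUP (s, t) \<in> U. nrm (f s - f t)) = 0}"

definition cuo_norm :: "('x \<Rightarrow> 'e::dedekind_vector_lattice) \<Rightarrow> ('s \<Rightarrow> 'x) \<Rightarrow> 'e"
  where "cuo_norm nrm f = (SUP s. nrm (f s))"

abbreviation cuo_orth :: "('s::uniform_space \<Rightarrow> 'e::dedekind_vector_lattice orth) set"
  where "cuo_orth \<equiv> cuo abs"

section \<open>States\<close>

text \<open>
  Operators on \<^const>\<open>cuo_orth\<close> are functions that are undefined outside of it.
\<close>

definition subdiff_sup ::
    "(('s::uniform_space \<Rightarrow> 'e::dedekind_vector_lattice orth) \<Rightarrow> 'e orth) set"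
  where "subdiff_sup = {T \<in> extensional cuo_orth.
    (\<forall>\<phi>\<in>cuo_orth. \<forall>\<psi>\<in>cuo_orth. T (\<lambda>s. \<phi> s + \<psi> s) = T \<phi> + T \<psi>) \<and>
    (\<forall>r::real. \<forall>\<phi>\<in>cuo_orth. T (\<lambda>s. r *\<^sub>R \<phi> s) = r *\<^sub>R T \<phi>) \<and>
    (\<forall>\<phi>\<in>cuo_orth. T \<phi> \<le> (SUP s. \<phi> s))}"

definition extreme_states ::
    "(('s::uniform_space \<Rightarrow> 'e::dedekind_vector_lattice orth) \<Rightarrow> 'e orth) set"
  where "extreme_states = {\<sigma> \<in> subdiff_sup. \<forall>T1\<in>subdiff_sup. \<forall>T2\<in>subdiff_sup. \<forall>t::real.
    0 < t \<and> t < 1 \<and> (\<forall>\<phi>\<in>cuo_orth. \<sigma> \<phi> = (1 - t) *\<^sub>R T1 \<phi> + t *\<^sub>R T2 \<phi>) \<longrightarrow> T1 = T2}"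

definition pure_state ::
    "('s::uniform_space \<Rightarrow> 'e::dedekind_vector_lattice orth) \<Rightarrow> ('s \<Rightarrow> 'e orth) \<Rightarrow> 'e orth"
  where "pure_state \<pi> = restrict (\<lambda>\<phi>. o_sum (\<lambda>s. \<pi> s * \<phi> s) UNIV) cuo_orth"

text \<open>
  The value of \<open>f\<close> at a pure state is the mixing of the values of \<open>f\<close>.  The value at \<open>\<sigma>\<close> is
  the common norm \<open>o\<close>-limit of the values along all nets of pure states that converge
  relatively uniformly to \<open>\<sigma>\<close> pointwise; for a pure \<open>\<sigma>\<close> the constant nets are among these.
  Pure states are represented by their partitions of unity.
\<close>

definition pure_value ::
    "('e::dedekind_vector_lattice orth \<Rightarrow> 'x \<Rightarrow> 'x) \<Rightarrow> ('s \<Rightarrow> 'x) \<Rightarrow> ('s \<Rightarrow> 'e orth) \<Rightarrow> 'x"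
  where "pure_value act f \<pi> = (THE y. \<forall>s. act (\<pi> s) y = act (\<pi> s) (f s))"

definition pure_net_tendsto ::
    "('s::uniform_space \<Rightarrow> 'e::dedekind_vector_lattice orth) filter \<Rightarrow>
      (('s \<Rightarrow> 'e orth) \<Rightarrow> 'e orth) \<Rightarrow> bool"
  where "pure_net_tendsto F \<sigma> \<longleftrightarrow> F \<noteq> bot \<and> eventually (partition_of_unity UNIV) F \<and>
    (\<forall>\<phi>\<in>cuo_orth. \<exists>e\<ge>0. norm_r_tendsto abs e (\<lambda>\<pi>. pure_state \<pi> \<phi>) (\<sigma> \<phi>) F)"

definition state_value ::
    "('x::minus \<Rightarrow> 'e::dedekind_vector_lattice) \<Rightarrow> ('e orth \<Rightarrow> 'x \<Rightarrow> 'x) \<Rightarrow>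
      ('s::uniform_space \<Rightarrow> 'x) \<Rightarrow> (('s \<Rightarrow> 'e orth) \<Rightarrow> 'e orth) \<Rightarrow> 'x"
  where "state_value nrm act f \<sigma> =
    (THE y. \<forall>F. pure_net_tendsto F \<sigma> \<longrightarrow> norm_o_tendsto nrm (pure_value act f) y F)"

definition separates_states ::
    "('s::uniform_space \<Rightarrow> 'e::dedekind_vector_lattice orth) set \<Rightarrow> bool"
  where "separates_states A \<longleftrightarrow>
    (\<forall>\<sigma>\<in>extreme_states. \<forall>\<tau>\<in>extreme_states. \<forall>b\<in>band_projections.
      (\<forall>\<phi>\<in>A. b * \<sigma> \<phi> = b * \<tau> \<phi>) \<longrightarrow> (\<forall>\<phi>\<in>cuo_orth. b * \<sigma> \<phi> = b * \<tau> \<phi>))"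

definition approximates ::
    "('x::minus \<Rightarrow> 'e::dedekind_vector_lattice) \<Rightarrow> 'x set \<Rightarrow> 'x \<Rightarrow> bool"
  where "approximates nrm Y x \<longleftrightarrow> (INF y\<in>Y. nrm (x - y)) = 0"

end

theory Submission
  imports Defs "HOL-Analysis.Weierstrass_Theorems"
begin

text \<open>
  Every pair of distances \<open>cuo_norm nrm (f - h)\<close>, with \<open>h\<close> in the finite mixings of \<open>W\<close>, dominates
  a third one, and an exhaustion argument puts the good approximations on the parts of a partition
  together.  So both claims follow once the infimum \<open>l\<close> of \<open>cuo_norm nrm (f - g)\<close> over \<open>g\<close> in \<open>W\<close>
  is known to vanish.

  The analysis is local: below each nonzero band projection there is another one on which finitely
  many given orthomorphisms are within \<open>\<epsilon>\<close> of real scalars, so that inequalities between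
  orthomorphisms need only be checked for numbers.  The points of \<open>S\<close> are replaced by ultrafilters on
  \<open>S\<close> with values in the band projections.  Uniformly order continuous functions converge along
  these; the limits define states in \<open>\<Sigma>\<close>, and the value of \<open>g\<close> at such a state is the limit of \<open>g\<close>.

  Suppose that \<open>l \<noteq> 0\<close> and let \<open>F\<close> be a maximal filter on which \<open>f\<close> keeps the distance \<open>l\<close> from \<open>W\<close>.
  If some \<open>\<phi>\<close> in \<open>A\<close> had different limits along two ultrafilters that contain \<open>F\<close>, then \<open>F\<close> could
  be enlarged by a set on which \<open>\<phi>\<close> is at most a number \<open>c\<close>, and also by one on which \<open>\<phi>\<close> is at
  least some smaller number; on each of the two sets \<open>f\<close> comes closer to \<open>W\<close> than \<open>l\<close>, by
  maximality, and a polynomial in \<open>\<phi>\<close> glues the two approximations, contrary to the choice of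
  \<open>F\<close> (compare the proof of Machado's theorem by Ransford).  Thus all ultrafilters above \<open>F\<close>
  define the same state on \<open>A\<close>, and by separation on all of \<open>C\<^sub>u\<^sub>o(S,\<Lambda>)\<close>.  A member \<open>g\<close> of \<open>W\<close>
  whose value at this state is close to that of \<open>f\<close> is then close to \<open>f\<close> on a set of \<open>F\<close>.
\<close>

section \<open>Band projections\<close>

text \<open>In spirit this is the classical argument carried out in a Boolean-valued universe over
  the band projections: ultrafilters with values in the projections play the points of
  \<open>S\<close> there, and \<open>densely\<close> plays the forcing relation. Ordinary points do
  not suffice, because members of \<Sigma> can be glued from different points on different bands.
  Two obstacles shape the details. \<open>E\<close> has no unit in general, so closeness is measured
  against a regulator \<open>e\<close>, and real numbers can be compared only where \<open>e\<close>
  is \<open>full\<close>, that is on its carrier; off the carrier everything dominated by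
  \<open>e\<close> vanishes. Moreover, states act on \<Lambda>-valued functions only, whereas the
  distances \<open>nrm (f s - y)\<close> lie in \<open>E\<close>; \<open>cuo_divide\<close> writes
  such a distance as an orthomorphism applied to a fixed positive element and so brings it within
  reach of the states. The lemma \<open>bisect\<close> does the work of a spectral representation.
  New elements are produced by \<open>glue\<close> and \<open>glue_lattice\<close> from systems of
  demands, each consisting of a centre and a tolerance.\<close>

lemma lat_disjoint_sym: "lat_disjoint x y \<longleftrightarrow> lat_disjoint y (x::'e::dedekind_vector_lattice)"
  by (simp add: lat_disjoint_def inf.commute)

lemma lat_disjoint_self: "lat_disjoint x x \<longleftrightarrow> x = (0::'e::dedekind_vector_lattice)"
  by (simp add: lat_disjoint_def)

text \<open>With \<open>y\<close> the positive part of \<open>x\<close>, all multiples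
  \<open>n y\<close> stay below the positive part of \<open>e\<close>; their supremum
  \<open>s\<close> then satisfies \<open>s + y \<le> s\<close>. This is how the tolerances
  \<epsilon> are removed later.\<close>

lemma archimedean_le_0:
  fixes x e :: "'e::dedekind_vector_lattice"
  assumes "\<And>r. 0 < r \<Longrightarrow> x \<le> r *\<^sub>R e"
  shows "x \<le> 0"
proof -
  define y where "y = sup x 0"
  define c where "c = sup e 0"
  have y: "0 \<le> y" "x \<le> y" unfolding y_def by auto
  have yc: "y \<le> r *\<^sub>R c" if "0 < r" for r
  proof -
    have "r *\<^sub>R e \<le> r *\<^sub>R c" "0 \<le> r *\<^sub>R c"
      using that by (auto simp: c_def intro!: scaleR_left_mono scaleR_nonneg_nonneg)
    thus ?thesis using assms[OF that] unfolding y_def by (auto intro: order_trans)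
  qed
  define A where "A = (\<lambda>n::nat. real n *\<^sub>R y) ` UNIV"
  have "a \<le> c" if a: "a \<in> A" for a
  proof -
    obtain n where n: "a = real n *\<^sub>R y" using a by (auto simp: A_def)
    show ?thesis
    proof (cases "n = 0")
      case True then show ?thesis using n by (simp add: c_def)
    next
      case False
      then have "real n *\<^sub>R y \<le> real n *\<^sub>R ((1 / real n) *\<^sub>R c)"
        using yc[of "1 / real n"] by (intro scaleR_left_mono) auto
      then show ?thesis using n False by simp
    qed
  qed
  hence bdd: "bdd_above A" by (rule bdd_aboveI)
  have "a \<le> Sup A - y" if a: "a \<in> A" for a
  proof -
    obtain n where n: "a = real n *\<^sub>R y" using a by (auto simp: A_def)
    have "a + y = real (Suc n) *\<^sub>R y" using n by (simp add: algebra_simps)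
    also have "\<dots> \<le> Sup A" unfolding A_def by (rule cSup_upper[OF _ bdd[unfolded A_def]]) blast
    finally show ?thesis by (simp add: le_diff_eq)
  qed
  hence "Sup A \<le> Sup A - y" by (intro cSup_least) (auto simp: A_def)
  hence "y \<le> 0" by simp
  thus ?thesis using y by simp
qed

lemma disjoint_compl_triple: "disjoint_compl (disjoint_compl (disjoint_compl A)) = disjoint_compl A"
  unfolding disjoint_compl_def using lat_disjoint_sym by blast

lemma disjoint_compl_add: "x \<in> disjoint_compl A \<Longrightarrow> y \<in> disjoint_compl A \<Longrightarrow> x + y \<in> disjoint_compl A"
  unfolding disjoint_compl_def by (auto intro: lat_disjoint_add)

lemma disjoint_compl_diff: "x \<in> disjoint_compl A \<Longrightarrow> y \<in> disjoint_compl A \<Longrightarrow> x - y \<in> disjoint_compl A"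
  unfolding disjoint_compl_def by (auto intro: lat_disjoint_diff)

lemma disjoint_compl_solid: "x \<in> disjoint_compl A \<Longrightarrow> \<bar>y\<bar> \<le> \<bar>x\<bar> \<Longrightarrow> y \<in> disjoint_compl A"
  unfolding disjoint_compl_def by (auto intro: lat_disjoint_abs_mono)

text \<open>The projection theorem of F. Riesz. On the positive cone the projection is the supremum
  of the members of \<open>K\<close> below \<open>x\<close>; it is additive because a member
  \<open>z\<close> of \<open>K\<close> below \<open>x + y\<close> splits into \<open>inf z x\<close>
  and a remainder below \<open>y\<close>, and both pieces stay in the solid set
  \<open>K\<close>.\<close>

lemma band_decomposition:
  fixes B :: "'e::dedekind_vector_lattice set"
  defines "K \<equiv> disjoint_compl B"
  shows "\<exists>\<pi>. (\<forall>x. 0 \<le> x \<longrightarrow> 0 \<le> orth_apply \<pi> x \<and> orth_apply \<pi> x \<le> x) \<and>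
    (\<forall>x. orth_apply \<pi> x \<in> K \<and> x - orth_apply \<pi> x \<in> disjoint_compl K)"
proof -
  define p where "p x = Sup {y. 0 \<le> y \<and> y \<le> x \<and> y \<in> K}" for x
  have K0: "0 \<in> K" unfolding K_def disjoint_compl_def by (simp add: lat_disjoint_zero)
  have bdd: "bdd_above {y. 0 \<le> y \<and> y \<le> x \<and> y \<in> K}" for x by (rule bdd_aboveI[of _ x]) auto
  have up: "y \<le> p x" if "0 \<le> y" "y \<le> x" "y \<in> K" for x y
    unfolding p_def using that by (intro cSup_upper bdd) auto
  have least: "p x \<le> u" if "0 \<le> x" "\<And>y. 0 \<le> y \<Longrightarrow> y \<le> x \<Longrightarrow> y \<in> K \<Longrightarrow> y \<le> u" for x u
    unfolding p_def using that K0 by (intro cSup_least) auto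
  have p0: "0 \<le> p x" if "0 \<le> x" for x using up[OF order_refl that K0] .
  have px: "p x \<le> x" if "0 \<le> x" for x by (rule least[OF that])
  have pK: "p x \<in> K" if "0 \<le> x" for x
    unfolding K_def disjoint_compl_def p_def using that K0
    by (auto intro!: lat_disjoint_Sup bdd) (auto simp: K_def disjoint_compl_def)
  have Ksolid: "y \<in> K" if "x \<in> K" "0 \<le> y" "y \<le> x" for x y
    using disjoint_compl_solid[of x B y] that by (auto simp: K_def)
  have hom1: "p (r *\<^sub>R x) \<le> r *\<^sub>R p x" if r: "0 < r" and x: "0 \<le> x" for r x
  proof (rule least)
    show "0 \<le> r *\<^sub>R x" using r x by (simp add: scaleR_nonneg_nonneg)
    fix y assume y: "0 \<le> y" "y \<le> r *\<^sub>R x" "y \<in> K"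
    have "(1/r) *\<^sub>R y \<le> (1/r) *\<^sub>R (r *\<^sub>R x)" using y r by (intro scaleR_left_mono) auto
    moreover have "(1/r) *\<^sub>R y \<in> K" using y(3) unfolding K_def disjoint_compl_def
      by (auto intro: lat_disjoint_scaleR)
    ultimately have "(1/r) *\<^sub>R y \<le> p x" using y r by (intro up) (auto simp: scaleR_nonneg_nonneg)
    hence "r *\<^sub>R ((1/r) *\<^sub>R y) \<le> r *\<^sub>R p x" using r by (intro scaleR_left_mono) auto
    thus "y \<le> r *\<^sub>R p x" using r by simp
  qed
  interpret cone_map p
  proof
    fix x y :: 'e assume xy: "0 \<le> x" "0 \<le> y"
    show "p (x + y) = p x + p y"
    proof (rule order_antisym)
      show "p (x + y) \<le> p x + p y"
      proof (rule least)
        show "0 \<le> x + y" using xy by simp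
        fix z assume z: "0 \<le> z" "z \<le> x + y" "z \<in> K"
        have i: "0 \<le> inf z x" using z xy by simp
        have 1: "inf z x \<le> p x" using z xy by (intro up Ksolid[OF z(3)]) auto
        have "z - y \<le> inf z x" using z xy by (intro inf_greatest) (simp_all add: diff_le_eq)
        hence zy: "z - inf z x \<le> y" by (simp only: diff_le_eq add.commute[of y])
        have z0: "0 \<le> z - inf z x" by (rule iffD2[OF diff_ge_0_iff_ge inf_le1])
        moreover have "z - inf z x \<le> z" using i by (simp only: diff_le_eq le_add_same_cancel1)
        ultimately have "z - inf z x \<in> K" using Ksolid[OF z(3)] by blast
        hence 2: "z - inf z x \<le> p y" using zy z0 up by blast
        have "z = inf z x + (z - inf z x)" by (simp only: add_diff_eq add_diff_cancel_left')
        thus "z \<le> p x + p y" using add_mono[OF 1 2] by metis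
      qed
      have "p x + p y \<le> p (x + y)"
      proof (rule up)
        show "p x + p y \<in> K" using pK xy by (simp add: K_def disjoint_compl_add)
      qed (auto intro: add_mono add_nonneg_nonneg p0 px xy)
      thus "p x + p y \<le> p (x + y)" .
    qed
  next
    fix r :: real and x :: 'e assume r: "0 < r" and x: "0 \<le> x"
    have "p ((1/r) *\<^sub>R (r *\<^sub>R x)) \<le> (1/r) *\<^sub>R p (r *\<^sub>R x)"
      using r x by (intro hom1) (auto simp: scaleR_nonneg_nonneg)
    hence "r *\<^sub>R p x \<le> r *\<^sub>R ((1/r) *\<^sub>R p (r *\<^sub>R x))" using r by (intro scaleR_left_mono) auto
    hence "r *\<^sub>R p x \<le> p (r *\<^sub>R x)" using r by simp
    with hom1[OF r x] show "p (r *\<^sub>R x) = r *\<^sub>R p x" by (rule order_antisym)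
  qed
  let ?P = "cone_ext p"
  have "band_preserving ?P"
  proof (rule ext_band_preserving)
    fix x z :: 'e assume "0 \<le> x" "lat_disjoint x z"
    thus "lat_disjoint (p x) z" using lat_disjoint_abs_mono[of x z "p x"] p0 px by simp
  qed
  moreover have "order_bounded_map ?P"
    by (intro order_bounded_mono ext_linear) (simp add: ext_nonneg p0)
  ultimately have "orthomorphism ?P" by (simp add: orthomorphism_def ext_linear)
  hence ap: "orth_apply (Abs_orth ?P) x = ?P x" for x by (simp add: Abs_orth_inverse)
  have d: "x - p x \<in> disjoint_compl K" if "0 \<le> x" for x
    unfolding disjoint_compl_def
  proof (intro CollectI ballI)
    fix w assume w: "w \<in> K"
    \<comment> \<open>\<open>p x + v\<close> is again a member of \<open>K\<close> below
      \<open>x\<close>, so maximality of \<open>p x\<close> leaves no room for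
      \<open>v\<close>.\<close>
    define v where "v = inf (x - p x) \<bar>w\<bar>"
    have v0: "0 \<le> v" using px[OF that] by (simp add: v_def)
    have "v \<in> K" using disjoint_compl_solid[of w B v] w v0 by (simp add: K_def v_def)
    hence "p x + v \<in> K" using pK[OF that] by (simp add: K_def disjoint_compl_add)
    moreover have "v \<le> x - p x" by (simp add: v_def)
    hence "p x + v \<le> x" by (simp add: le_diff_eq add.commute)
    ultimately have "p x + v \<le> p x" using v0 p0[OF that] by (intro up) auto
    hence "v = 0" using v0 by (simp add: order_antisym)
    thus "lat_disjoint (x - p x) w" using px[OF that] by (simp add: lat_disjoint_def v_def)
  qed
  have "?P x \<in> K \<and> x - ?P x \<in> disjoint_compl K" for x
  proof -
    obtain a b where x: "x = a - b" "0 \<le> a" "0 \<le> b" by (rule pos_part_obtain)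
    have e: "?P x = p a - p b" unfolding x(1) by (rule ext_diff[OF x(2,3)])
    have "x - ?P x = (a - b) - (p a - p b)" using e x(1) by metis
    also have "\<dots> = (a - p a) - (b - p b)" by simp
    also have "\<dots> \<in> disjoint_compl K" by (intro disjoint_compl_diff d x)
    finally show ?thesis unfolding e using pK x by (auto simp: K_def disjoint_compl_diff)
  qed
  thus ?thesis by (intro exI[of _ "Abs_orth ?P"]) (auto simp: ap ext_nonneg p0 px)
qed

lemma orth_eqI: "(\<And>x. 0 \<le> x \<Longrightarrow> orth_apply S x = orth_apply T x) \<Longrightarrow> S = T"
  by (rule order_antisym) (auto simp: orth_le_iff)

lemma orth_apply_diff: "orth_apply T (x - y) = orth_apply T x - orth_apply T y"
  by (rule linear_diff[OF linear_orth_apply])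
lemma orth_apply_add: "orth_apply T (x + y) = orth_apply T x + orth_apply T y"
  by (rule linear_add[OF linear_orth_apply])
lemma orth_apply_scaleR: "orth_apply T (r *\<^sub>R x) = r *\<^sub>R orth_apply T x"
  by (rule linear_cmul[OF linear_orth_apply])
lemma orth_apply_0: "orth_apply T 0 = 0"
  by (rule linear_0[OF linear_orth_apply])

lemmas orth_simps = orth_apply_diff orth_apply_add orth_apply_scaleR orth_apply_0
  plus_orth.rep_eq minus_orth.rep_eq uminus_orth.rep_eq scaleR_orth.rep_eq zero_orth.rep_eq
  one_orth.rep_eq times_orth.rep_eq

lemma orth_apply_disjoint: "lat_disjoint x y \<Longrightarrow> lat_disjoint (orth_apply T x) y"
  using orth_apply_orthomorphism[of T] by (auto simp: orthomorphism_def band_preserving_def)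

lemma orth_apply_mono: "0 \<le> T \<Longrightarrow> x \<le> y \<Longrightarrow> orth_apply T x \<le> orth_apply T y"
  using orth_le_iff[of 0 T] by (metis diff_ge_0_iff_ge orth_apply_diff zero_orth.rep_eq)

lemma orth_apply_nonneg: "0 \<le> T \<Longrightarrow> 0 \<le> x \<Longrightarrow> 0 \<le> orth_apply T x"
  using orth_apply_mono[of T 0 x] by (simp add: orth_simps)

lemma orth_apply_abs_le: "0 \<le> T \<Longrightarrow> \<bar>orth_apply T x\<bar> \<le> orth_apply T \<bar>x\<bar>"
  by (intro abs_leI)
     (metis abs_ge_self orth_apply_mono, metis abs_ge_minus_self diff_0 orth_apply_diff orth_apply_0 orth_apply_mono)

text \<open>One direction compares with the Riesz projection, using that a splitting into
  \<open>K\<close> and its complement is unique; for the other one the band is the range of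
  \<open>\<pi>\<close>.\<close>

lemma band_projections_iff:
  "\<pi> \<in> band_projections \<longleftrightarrow> 0 \<le> \<pi> \<and> \<pi> \<le> 1 \<and> \<pi> * \<pi> = \<pi>"
proof
  assume "\<pi> \<in> band_projections"
  then obtain K where K: "is_band K" and p: "\<And>x. orth_apply \<pi> x \<in> K" "\<And>x. x - orth_apply \<pi> x \<in> disjoint_compl K"
    unfolding band_projections_def by blast
  define B where "B = disjoint_compl K"
  have KB: "K = disjoint_compl B" using K by (simp add: is_band_def B_def)
  obtain \<rho> where r: "\<And>x. 0 \<le> x \<Longrightarrow> 0 \<le> orth_apply \<rho> x \<and> orth_apply \<rho> x \<le> x"
    "\<And>x. orth_apply \<rho> x \<in> K" "\<And>x. x - orth_apply \<rho> x \<in> disjoint_compl K"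
    unfolding KB using band_decomposition[of B] by blast
  have uniq: "a = b" if "a \<in> K" "b \<in> K" "x - a \<in> disjoint_compl K" "x - b \<in> disjoint_compl K" for a b x
  proof -
    have "a - b \<in> K" using that KB disjoint_compl_diff by metis
    moreover have "(x - b) - (x - a) \<in> disjoint_compl K" by (intro disjoint_compl_diff that)
    ultimately have "lat_disjoint (a - b) (a - b)" by (auto simp: disjoint_compl_def)
    thus ?thesis by (simp add: lat_disjoint_self)
  qed
  have "\<pi> = \<rho>" by (rule orth_eqI) (use uniq p r in blast)
  moreover have "0 \<in> disjoint_compl K" by (simp add: disjoint_compl_def lat_disjoint_zero)
  hence "orth_apply \<pi> (orth_apply \<pi> x) = orth_apply \<pi> x" for x
    using uniq[of "orth_apply \<pi> (orth_apply \<pi> x)" "orth_apply \<pi> x" "orth_apply \<pi> x"] p by simp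
  ultimately show "0 \<le> \<pi> \<and> \<pi> \<le> 1 \<and> \<pi> * \<pi> = \<pi>"
    using r by (auto simp: orth_le_iff orth_simps intro!: orth_eqI)
next
  assume a: "0 \<le> \<pi> \<and> \<pi> \<le> 1 \<and> \<pi> * \<pi> = \<pi>"
  have idem: "orth_apply \<pi> (orth_apply \<pi> x) = orth_apply \<pi> x" for x
    using a by (metis times_orth.rep_eq)
  have comp: "0 \<le> 1 - \<pi>" using a by simp
  have disj: "lat_disjoint (orth_apply \<pi> x) (y - orth_apply \<pi> y)" for x y
  proof -
    have e: "y - orth_apply \<pi> y = orth_apply (1 - \<pi>) y" for y by (simp add: orth_simps)
    have "\<bar>orth_apply (1 - \<pi>) y\<bar> \<le> orth_apply (1 - \<pi>) \<bar>y\<bar>" by (rule orth_apply_abs_le[OF comp])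
    hence 1: "\<bar>y - orth_apply \<pi> y\<bar> \<le> \<bar>y\<bar> - orth_apply \<pi> \<bar>y\<bar>" by (simp add: orth_simps)
    have 2: "\<bar>orth_apply \<pi> x\<bar> \<le> orth_apply \<pi> \<bar>x\<bar>" using a by (intro orth_apply_abs_le) blast
    \<comment> \<open>\<open>1 - \<pi>\<close> kills the first of these two bounds and
      \<open>\<pi>\<close> the second, so \<open>z\<close> is below its own image under
      \<open>\<pi>\<close>, which in turn is at most 0.\<close>
    define z where "z = inf (orth_apply \<pi> \<bar>x\<bar>) (\<bar>y\<bar> - orth_apply \<pi> \<bar>y\<bar>)"
    have z0: "0 \<le> z" unfolding z_def using a orth_apply_nonneg[OF comp, of "\<bar>y\<bar>"]
      by (auto intro: orth_apply_nonneg simp: orth_simps)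
    have "orth_apply (1 - \<pi>) z \<le> orth_apply (1 - \<pi>) (orth_apply \<pi> \<bar>x\<bar>)"
      unfolding z_def by (intro orth_apply_mono comp inf_le1)
    hence z1: "z \<le> orth_apply \<pi> z" by (simp add: orth_simps idem)
    have "orth_apply \<pi> z \<le> orth_apply \<pi> (\<bar>y\<bar> - orth_apply \<pi> \<bar>y\<bar>)"
      unfolding z_def using a by (intro orth_apply_mono inf_le2) blast
    hence "orth_apply \<pi> z \<le> 0" by (simp add: orth_simps idem)
    hence "z = 0" using z0 z1 by (meson order_antisym order_trans)
    moreover have "inf \<bar>orth_apply \<pi> x\<bar> \<bar>y - orth_apply \<pi> y\<bar> \<le> z"
      unfolding z_def using 1 2 by (rule inf_mono[rotated])
    ultimately show ?thesis unfolding lat_disjoint_def by (simp add: order_antisym)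
  qed
  define K where "K = range (orth_apply \<pi>)"
  have Kd: "x \<in> disjoint_compl K \<longleftrightarrow> orth_apply \<pi> x = 0" for x
  proof
    assume "x \<in> disjoint_compl K"
    hence "lat_disjoint x (orth_apply \<pi> x)" by (auto simp: disjoint_compl_def K_def)
    moreover have "lat_disjoint (x - orth_apply \<pi> x) (orth_apply \<pi> x)" using disj lat_disjoint_sym by blast
    ultimately have "lat_disjoint (x - (x - orth_apply \<pi> x)) (orth_apply \<pi> x)" by (rule lat_disjoint_diff)
    thus "orth_apply \<pi> x = 0" by (simp add: lat_disjoint_self)
  next
    assume "orth_apply \<pi> x = 0"
    hence "lat_disjoint x (orth_apply \<pi> y)" for y using disj[of y x] lat_disjoint_sym[of x] by simp
    thus "x \<in> disjoint_compl K" by (auto simp: disjoint_compl_def K_def)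
  qed
  have Kdd: "x \<in> disjoint_compl (disjoint_compl K) \<Longrightarrow> x \<in> K" for x
  proof -
    assume x: "x \<in> disjoint_compl (disjoint_compl K)"
    have "x - orth_apply \<pi> x \<in> disjoint_compl K" by (simp add: Kd orth_simps idem)
    hence "lat_disjoint x (x - orth_apply \<pi> x)" using x by (auto simp: disjoint_compl_def)
    hence "lat_disjoint (x - orth_apply \<pi> x) (x - orth_apply \<pi> x)" using disj by (intro lat_disjoint_diff) auto
    hence "x = orth_apply \<pi> x" by (simp add: lat_disjoint_self)
    thus "x \<in> K" unfolding K_def by blast
  qed
  moreover have "K \<subseteq> disjoint_compl (disjoint_compl K)"
    unfolding disjoint_compl_def using lat_disjoint_sym by blast
  ultimately have "is_band K" unfolding is_band_def by blast
  moreover have "orth_apply \<pi> x \<in> K" "x - orth_apply \<pi> x \<in> disjoint_compl K" for x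
    unfolding Kd by (auto simp: K_def orth_simps idem)
  ultimately show "\<pi> \<in> band_projections" unfolding band_projections_def by blast
qed

text \<open>An orthomorphism preserves disjointness, so it maps the range of \<open>\<pi>\<close>
  and the range of \<open>1 - \<pi>\<close> into themselves.\<close>

lemma band_projection_commute:
  assumes "\<pi> \<in> band_projections"
  shows "\<pi> * T = T * \<pi>"
proof -
  have pi: "0 \<le> \<pi>" "\<pi> \<le> 1" "\<pi> * \<pi> = \<pi>" using assms by (auto simp: band_projections_iff)
  obtain K where K: "is_band K" "\<And>x. orth_apply \<pi> x \<in> K" "\<And>x. x - orth_apply \<pi> x \<in> disjoint_compl K"
    using assms unfolding band_projections_def by blast
  have disj: "lat_disjoint (orth_apply \<pi> x) (y - orth_apply \<pi> y)" for x y
    using K(2)[of x] K(3)[of y] lat_disjoint_sym unfolding disjoint_compl_def by blast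
  have idem: "orth_apply \<pi> (orth_apply \<pi> x) = orth_apply \<pi> x" for x using pi by (metis times_orth.rep_eq)
  have 1: "orth_apply \<pi> (orth_apply T (orth_apply \<pi> x)) = orth_apply T (orth_apply \<pi> x)" for x
  proof -
    let ?z = "orth_apply T (orth_apply \<pi> x)"
    have "lat_disjoint ?z (?z - orth_apply \<pi> ?z)" by (intro orth_apply_disjoint disj)
    hence "lat_disjoint (?z - orth_apply \<pi> ?z) (?z - orth_apply \<pi> ?z)" using disj by (intro lat_disjoint_diff)
    thus ?thesis by (simp add: lat_disjoint_self)
  qed
  have 2: "orth_apply \<pi> (orth_apply T (x - orth_apply \<pi> x)) = 0" for x
  proof -
    let ?z = "orth_apply T (x - orth_apply \<pi> x)"
    have "lat_disjoint (x - orth_apply \<pi> x) (orth_apply \<pi> ?z)" using disj lat_disjoint_sym by blast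
    hence "lat_disjoint ?z (orth_apply \<pi> ?z)" by (rule orth_apply_disjoint)
    hence "lat_disjoint (orth_apply \<pi> ?z) (orth_apply \<pi> ?z)" by (rule orth_apply_disjoint)
    thus ?thesis by (simp add: lat_disjoint_self)
  qed
  show ?thesis
  proof (rule orth_eqI)
    fix x :: 'a
    have "orth_apply \<pi> (orth_apply T x)
        = orth_apply \<pi> (orth_apply T (orth_apply \<pi> x)) + orth_apply \<pi> (orth_apply T (x - orth_apply \<pi> x))"
      by (simp add: orth_apply_add[symmetric])
    thus "orth_apply (\<pi> * T) x = orth_apply (T * \<pi>) x" using 1 2 by (simp add: times_orth.rep_eq)
  qed
qed

lemma orth_mult_mono: "0 \<le> S \<Longrightarrow> T \<le> U \<Longrightarrow> S * T \<le> S * (U :: 'e::dedekind_vector_lattice orth)"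
  by (simp add: orth_le_iff times_orth.rep_eq) (simp add: orth_apply_mono orth_le_iff)

lemma orth_mult_mono_right: "0 \<le> S \<Longrightarrow> T \<le> U \<Longrightarrow> T * S \<le> U * (S :: 'e::dedekind_vector_lattice orth)"
  by (auto simp: orth_le_iff times_orth.rep_eq orth_simps)

lemma orth_mult_nonneg: "0 \<le> S \<Longrightarrow> 0 \<le> T \<Longrightarrow> 0 \<le> S * (T :: 'e::dedekind_vector_lattice orth)"
  using orth_mult_mono[of S 0 T] by simp

lemma orth_zero_le_one: "0 \<le> (1 :: 'e::dedekind_vector_lattice orth)"
  by (simp add: orth_le_iff orth_simps)

lemma bp_zero [simp]: "0 \<in> band_projections" and bp_one [simp]: "1 \<in> band_projections"
  by (auto simp: band_projections_iff orth_zero_le_one)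

lemma bp_nonneg: "\<pi> \<in> band_projections \<Longrightarrow> 0 \<le> \<pi>"
  and bp_le_one: "\<pi> \<in> band_projections \<Longrightarrow> \<pi> \<le> 1"
  and bp_idem: "\<pi> \<in> band_projections \<Longrightarrow> \<pi> * \<pi> = \<pi>"
  by (auto simp: band_projections_iff)

lemma bp_compl [simp]: "\<pi> \<in> band_projections \<Longrightarrow> 1 - \<pi> \<in> band_projections"
  by (auto simp: band_projections_iff algebra_simps)

lemma bp_mult [simp]:
  assumes "\<pi> \<in> band_projections" "\<rho> \<in> band_projections"
  shows "\<pi> * \<rho> \<in> band_projections"
proof -
  have "\<pi> * \<rho> * (\<pi> * \<rho>) = \<pi> * (\<rho> * \<pi>) * \<rho>" by (simp add: mult.assoc)
  also have "\<dots> = (\<pi> * \<pi>) * (\<rho> * \<rho>)"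
    unfolding band_projection_commute[OF assms(2), of \<pi>] by (simp add: mult.assoc)
  also have "\<dots> = \<pi> * \<rho>" using assms by (simp add: bp_idem)
  finally have "\<pi> * \<rho> * (\<pi> * \<rho>) = \<pi> * \<rho>" .
  moreover have "\<pi> * \<rho> \<le> \<pi> * 1" using assms by (intro orth_mult_mono bp_nonneg bp_le_one)
  hence "\<pi> * \<rho> \<le> 1" using bp_le_one[OF assms(1)] by simp
  ultimately show ?thesis using assms by (auto simp: band_projections_iff orth_mult_nonneg bp_nonneg)
qed

lemma bp_le_iff:
  assumes "\<pi> \<in> band_projections" "\<rho> \<in> band_projections"
  shows "\<pi> \<le> \<rho> \<longleftrightarrow> \<pi> * \<rho> = \<pi>"
proof
  assume le: "\<pi> \<le> \<rho>"
  have "\<pi> * \<pi> \<le> \<pi> * \<rho>" using assms le by (intro orth_mult_mono bp_nonneg)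
  moreover have "\<pi> * \<rho> \<le> \<pi> * 1" using assms by (intro orth_mult_mono bp_nonneg bp_le_one)
  ultimately show "\<pi> * \<rho> = \<pi>" using assms by (simp add: bp_idem)
next
  assume e: "\<pi> * \<rho> = \<pi>"
  have "\<pi> * \<rho> \<le> 1 * \<rho>" using assms by (intro orth_mult_mono_right bp_nonneg bp_le_one)
  thus "\<pi> \<le> \<rho>" using e by simp
qed

lemma bp_mult_le:
  assumes "\<pi> \<in> band_projections" "\<rho> \<in> band_projections"
  shows "\<pi> * \<rho> \<le> \<pi>" "\<pi> * \<rho> \<le> \<rho>"
  using orth_mult_mono[OF bp_nonneg[OF assms(1)] bp_le_one[OF assms(2)]]
    orth_mult_mono_right[OF bp_nonneg[OF assms(2)] bp_le_one[OF assms(1)]] by simp_all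

lemma bp_compl_mult: "\<pi> \<in> band_projections \<Longrightarrow> \<pi> * (1 - \<pi>) = 0" "\<pi> \<in> band_projections \<Longrightarrow> (1 - \<pi>) * \<pi> = 0"
  by (simp_all add: algebra_simps bp_idem)

text \<open>Anything between 0 and \<open>\<pi>\<close> is annihilated by \<open>1 - \<pi>\<close>,
  hence fixed under multiplication by \<open>\<pi>\<close>.\<close>

lemma bp_inf:
  assumes "\<pi> \<in> band_projections" "\<rho> \<in> band_projections"
  shows "inf \<pi> \<rho> = \<pi> * \<rho>"
proof (rule order_antisym)
  show "\<pi> * \<rho> \<le> inf \<pi> \<rho>" using bp_mult_le[OF assms] by simp
  define z where "z = inf \<pi> \<rho>"
  have z: "0 \<le> z" "z \<le> \<pi>" "z \<le> \<rho>" using assms by (auto simp: z_def bp_nonneg)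
  have "(1 - \<pi>) * z \<le> (1 - \<pi>) * \<pi>" using assms z by (intro orth_mult_mono bp_nonneg) auto
  moreover have "0 \<le> (1 - \<pi>) * z" using assms z by (intro orth_mult_nonneg[OF bp_nonneg]) auto
  ultimately have "z = \<pi> * z" using assms by (simp add: algebra_simps bp_idem order_antisym)
  also have "\<dots> \<le> \<pi> * \<rho>" using assms z by (intro orth_mult_mono bp_nonneg) auto
  finally show "inf \<pi> \<rho> \<le> \<pi> * \<rho>" unfolding z_def .
qed

text \<open>\<open>\<tau>\<close> is the projection onto the band generated by \<open>A\<close>. The
  two listed properties are what supports and suprema require of it.\<close>

lemma bp_ex:
  fixes A :: "'e::dedekind_vector_lattice set"
  shows "\<exists>\<tau>\<in>band_projections. (\<forall>a\<in>A. orth_apply \<tau> a = a) \<and>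
    (\<forall>x. (\<forall>a\<in>A. lat_disjoint x a) \<longrightarrow> orth_apply \<tau> x = 0)"
proof -
  let ?K = "disjoint_compl (disjoint_compl A)"
  obtain \<tau> where t: "\<And>x. orth_apply \<tau> x \<in> ?K \<and> x - orth_apply \<tau> x \<in> disjoint_compl ?K"
    using band_decomposition[of "disjoint_compl A"] by blast
  have "\<tau> \<in> band_projections" unfolding band_projections_def is_band_def
    using t by (intro CollectI exI[of _ ?K]) (simp add: disjoint_compl_triple)
  moreover have "orth_apply \<tau> a = a" if "a \<in> A" for a
  proof -
    have "a \<in> ?K" using that lat_disjoint_sym unfolding disjoint_compl_def by blast
    hence "a - orth_apply \<tau> a \<in> ?K" using t by (intro disjoint_compl_diff) auto
    hence "lat_disjoint (a - orth_apply \<tau> a) (a - orth_apply \<tau> a)" using t unfolding disjoint_compl_def by blast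
    thus ?thesis by (simp add: lat_disjoint_self)
  qed
  moreover have "orth_apply \<tau> x = 0" if "\<forall>a\<in>A. lat_disjoint x a" for x
  proof -
    have "x \<in> disjoint_compl A" using that by (simp add: disjoint_compl_def)
    moreover have "x - orth_apply \<tau> x \<in> disjoint_compl A"
      using t[of x] unfolding disjoint_compl_triple by blast
    ultimately have "x - (x - orth_apply \<tau> x) \<in> disjoint_compl A" by (rule disjoint_compl_diff)
    hence "orth_apply \<tau> x \<in> disjoint_compl A" by simp
    hence "lat_disjoint (orth_apply \<tau> x) (orth_apply \<tau> x)" using t[of x] unfolding disjoint_compl_def
      using lat_disjoint_sym by blast
    thus ?thesis by (simp add: lat_disjoint_self)
  qed
  ultimately show ?thesis by blast
qed

lemma bp_disjoint:
  assumes "\<pi> \<in> band_projections"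
  shows "lat_disjoint (orth_apply \<pi> x) (orth_apply (1 - \<pi>) y)"
proof -
  obtain K where "\<And>x. orth_apply \<pi> x \<in> K" "\<And>x. x - orth_apply \<pi> x \<in> disjoint_compl K"
    using assms unfolding band_projections_def by blast
  thus ?thesis using lat_disjoint_sym by (fastforce simp: disjoint_compl_def orth_simps)
qed

text \<open>Completeness of the Boolean algebra: the supremum projects onto the band generated by
  all ranges. An upper bound \<open>\<rho>\<close> fixes these ranges, so the range of
  \<open>1 - \<rho>\<close> is disjoint from them and is killed by \<open>\<tau>\<close>.\<close>

lemma bp_Sup_ex:
  fixes P :: "'e::dedekind_vector_lattice orth set"
  assumes "P \<subseteq> band_projections"
  shows "\<exists>\<tau>\<in>band_projections. (\<forall>\<pi>\<in>P. \<pi> \<le> \<tau>) \<and> (\<forall>\<rho>\<in>band_projections. (\<forall>\<pi>\<in>P. \<pi> \<le> \<rho>) \<longrightarrow> \<tau> \<le> \<rho>)"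
proof -
  define A where "A = (\<Union>\<pi>\<in>P. range (orth_apply \<pi>))"
  obtain \<tau> where t: "\<tau> \<in> band_projections" "\<And>a. a \<in> A \<Longrightarrow> orth_apply \<tau> a = a"
    "\<And>x. (\<forall>a\<in>A. lat_disjoint x a) \<Longrightarrow> orth_apply \<tau> x = 0" using bp_ex[of A] by blast
  have "\<pi> \<le> \<tau>" if "\<pi> \<in> P" for \<pi>
  proof -
    have "\<tau> * \<pi> = \<pi>" using t(2) that by (intro orth_eqI) (auto simp: A_def times_orth.rep_eq)
    thus ?thesis using assms that t(1) by (subst bp_le_iff) (auto simp: band_projection_commute)
  qed
  moreover have "\<tau> \<le> \<rho>" if r: "\<rho> \<in> band_projections" "\<forall>\<pi>\<in>P. \<pi> \<le> \<rho>" for \<rho>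
  proof -
    have "lat_disjoint (orth_apply (1 - \<rho>) x) a" if a: "a \<in> A" for x a
    proof -
      obtain \<pi> y where y: "\<pi> \<in> P" "a = orth_apply \<pi> y" using a by (auto simp: A_def)
      hence "\<pi> * \<rho> = \<pi>" using r assms bp_le_iff by blast
      hence "\<rho> * \<pi> = \<pi>" using band_projection_commute[OF r(1)] by metis
      hence "a = orth_apply \<rho> a" using y by (metis times_orth.rep_eq)
      thus ?thesis using bp_disjoint[OF r(1), of a x] lat_disjoint_sym by metis
    qed
    hence "orth_apply \<tau> (orth_apply (1 - \<rho>) x) = 0" for x using t(3) by blast
    hence "\<tau> * (1 - \<rho>) = 0" by (intro orth_eqI) (simp add: orth_simps)
    thus ?thesis using t(1) r(1) by (subst bp_le_iff) (auto simp: algebra_simps)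
  qed
  ultimately show ?thesis using t(1) by blast
qed

section \<open>Local calculus\<close>

text \<open>The forcing relation. For hereditary \<open>Q\<close> it says that \<open>\<pi>\<close>
  lies below the Boolean truth value of \<open>Q\<close>.\<close>

definition densely ::
    "'e::dedekind_vector_lattice orth \<Rightarrow> ('e orth \<Rightarrow> bool) \<Rightarrow> bool"
  where "densely \<pi> Q \<longleftrightarrow> (\<forall>\<kappa>\<in>band_projections. \<kappa> \<le> \<pi> \<longrightarrow> \<kappa> \<noteq> 0 \<longrightarrow>
    (\<exists>\<rho>\<in>band_projections. \<rho> \<noteq> 0 \<and> \<rho> \<le> \<kappa> \<and> Q \<rho>))"

lemma densely_ex:
  "densely \<pi> Q \<Longrightarrow> \<kappa> \<in> band_projections \<Longrightarrow> \<kappa> \<le> \<pi> \<Longrightarrow> \<kappa> \<noteq> 0 \<Longrightarrow>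
    \<exists>\<rho>\<in>band_projections. \<rho> \<noteq> 0 \<and> \<rho> \<le> \<kappa> \<and> Q \<rho>"
  unfolding densely_def by blast

lemma densely_mono: "densely \<pi> Q \<Longrightarrow> (\<And>\<rho>. \<rho> \<in> band_projections \<Longrightarrow> \<rho> \<noteq> 0 \<Longrightarrow> \<rho> \<le> \<pi> \<Longrightarrow> Q \<rho> \<Longrightarrow> R \<rho>) \<Longrightarrow> densely \<pi> R"
  unfolding densely_def by (meson order_trans)

lemma densely_subset: "densely \<pi> Q \<Longrightarrow> \<rho> \<le> \<pi> \<Longrightarrow> densely \<rho> Q"
  unfolding densely_def by (meson order_trans)

text \<open>One of the two properties has to be hereditary: \<open>Q\<close> is secured first and
  must survive the passage to the smaller part on which \<open>R\<close> holds.\<close>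

lemma densely_conj:
  assumes "densely \<pi> Q" "densely \<pi> R"
    and "\<And>\<rho> \<kappa>. \<rho> \<in> band_projections \<Longrightarrow> \<kappa> \<in> band_projections \<Longrightarrow> \<kappa> \<le> \<rho> \<Longrightarrow> Q \<rho> \<Longrightarrow> Q \<kappa>"
  shows "densely \<pi> (\<lambda>\<rho>. Q \<rho> \<and> R \<rho>)"
  unfolding densely_def
proof (intro ballI impI)
  fix \<kappa> :: "'a orth" assume k: "\<kappa> \<in> band_projections" "\<kappa> \<le> \<pi>" "\<kappa> \<noteq> 0"
  obtain \<rho> where r: "\<rho> \<in> band_projections" "\<rho> \<noteq> 0" "\<rho> \<le> \<kappa>" "Q \<rho>" using densely_ex[OF assms(1) k] by blast
  have "\<rho> \<le> \<pi>" using r k by (meson order_trans)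
  then obtain \<tau> where t: "\<tau> \<in> band_projections" "\<tau> \<noteq> 0" "\<tau> \<le> \<rho>" "R \<tau>"
    using densely_ex[OF assms(2) r(1) _ r(2)] by blast
  thus "\<exists>\<rho>\<in>band_projections. \<rho> \<noteq> 0 \<and> \<rho> \<le> \<kappa> \<and> Q \<rho> \<and> R \<rho>"
    using r assms(3)[OF r(1) t(1) t(3) r(4)] by (meson order_trans)
qed

lemma densely_densely:
  assumes "densely \<pi> Q" "\<And>\<rho>. \<rho> \<in> band_projections \<Longrightarrow> \<rho> \<noteq> 0 \<Longrightarrow> \<rho> \<le> \<pi> \<Longrightarrow> Q \<rho> \<Longrightarrow> densely \<rho> R"
  shows "densely \<pi> R"
  using assms unfolding densely_def by (meson order_trans order_refl)

lemma densely_ball: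
  assumes "finite I" "\<And>i. i \<in> I \<Longrightarrow> densely \<pi> (Q i)"
    and "\<And>i \<rho> \<kappa>. i \<in> I \<Longrightarrow> \<rho> \<in> band_projections \<Longrightarrow> \<kappa> \<in> band_projections \<Longrightarrow> \<kappa> \<le> \<rho> \<Longrightarrow> Q i \<rho> \<Longrightarrow> Q i \<kappa>"
  shows "densely \<pi> (\<lambda>\<rho>. \<forall>i\<in>I. Q i \<rho>)"
  using assms
proof (induction I rule: finite_induct)
  case empty
  show ?case unfolding densely_def by (auto intro!: bexI)
next
  case (insert i I)
  have "densely \<pi> (\<lambda>\<rho>. Q i \<rho> \<and> (\<forall>i\<in>I. Q i \<rho>))"
  proof (rule densely_conj)
    show "densely \<pi> (Q i)" using insert.prems(1) by blast
    show "densely \<pi> (\<lambda>\<rho>. \<forall>i\<in>I. Q i \<rho>)" using insert.prems by (intro insert.IH) blast+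
  qed (use insert.prems(2) in blast)
  thus ?case by simp
qed

text \<open>The case distinction behind most density proofs. The second alternative is taken only if
  \<open>\<kappa>\<close> misses \<open>\<tau>\<close> altogether, whence the extra fact
  \<open>\<kappa> * \<tau> = 0\<close>.\<close>

lemma bp_split:
  assumes "\<kappa> \<in> band_projections" "\<kappa> \<noteq> 0" "\<tau> \<in> band_projections"
  obtains "\<kappa> * \<tau> \<in> band_projections" "\<kappa> * \<tau> \<noteq> 0" "\<kappa> * \<tau> \<le> \<kappa>" "\<kappa> * \<tau> \<le> \<tau>"
  | "\<kappa> * (1 - \<tau>) \<in> band_projections" "\<kappa> * (1 - \<tau>) \<noteq> 0" "\<kappa> * (1 - \<tau>) \<le> \<kappa>" "\<kappa> * (1 - \<tau>) \<le> 1 - \<tau>"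
    "\<kappa> * \<tau> = 0"
proof (cases "\<kappa> * \<tau> = 0")
  case True
  hence "\<kappa> * (1 - \<tau>) = \<kappa>" by (simp add: algebra_simps)
  thus ?thesis using that(2) True assms bp_mult_le[of \<kappa> "1 - \<tau>"] by simp
next
  case False
  thus ?thesis using that(1) assms bp_mult_le[of \<kappa> \<tau>] by simp
qed

text \<open>Order intervals whose ends are compatible in pairs have a common point, namely the
  supremum of the lower ends \<open>x - d\<close>: each of these is below every upper end
  \<open>x + d\<close>.\<close>

lemma glue_lattice:
  fixes T :: "('v::dedekind_vector_lattice \<times> 'v) set"
  assumes "T \<noteq> {}" "\<And>x d x' d'. (x, d) \<in> T \<Longrightarrow> (x', d') \<in> T \<Longrightarrow> x - x' \<le> d + d'"
  shows "\<exists>y. \<forall>(x, d)\<in>T. \<bar>y - x\<bar> \<le> d"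
proof -
  define A where "A = (\<lambda>(x, d). x - d) ` T"
  have b: "a \<le> x + d" if "a \<in> A" "(x, d) \<in> T" for a x d
  proof -
    obtain x' d' where a: "(x', d') \<in> T" "a = x' - d'" using \<open>a \<in> A\<close> by (auto simp: A_def)
    show ?thesis using assms(2)[OF a(1) \<open>(x, d) \<in> T\<close>] unfolding a(2) by (simp add: diff_le_eq ac_simps)
  qed
  obtain x0 d0 where "(x0, d0) \<in> T" using assms(1) by auto
  hence bdd: "bdd_above A" using b by (intro bdd_aboveI[of _ "x0 + d0"])
  have "\<bar>Sup A - x\<bar> \<le> d" if t: "(x, d) \<in> T" for x d
  proof (rule abs_leI)
    have "Sup A \<le> x + d" using b[OF _ t] t by (intro cSup_least) (auto simp: A_def)
    thus "Sup A - x \<le> d" by (simp add: algebra_simps)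
    have "x - d \<le> Sup A" using t by (intro cSup_upper bdd) (force simp: A_def)
    thus "- (Sup A - x) \<le> d" by (simp add: algebra_simps)
  qed
  thus ?thesis by auto
qed

text \<open>Common frame for \<open>E\<close> under application of orthomorphisms and for \<Lambda>
  under multiplication from the left. \<open>P_cut\<close> singles out the part on which
  \<open>x\<close> is positive; its last clause says that \<open>x\<close> vanishes on no nonzero
  piece of that part, which makes comparisons on it strict.\<close>

locale band_module =
  fixes P :: "'e::dedekind_vector_lattice orth \<Rightarrow> 'v::dedekind_vector_lattice \<Rightarrow> 'v"
  assumes P_add: "P T (x + y) = P T x + P T y"
    and P_scaleR: "P T (r *\<^sub>R x) = r *\<^sub>R P T x"
    and P_mult: "P (S * T) x = P S (P T x)"
    and P_one: "P 1 x = x"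
    and P_plus: "P (S + T) x = P S x + P T x"
    and P_nonneg: "0 \<le> T \<Longrightarrow> 0 \<le> x \<Longrightarrow> 0 \<le> P T x"
    and P_cut: "\<exists>\<tau>\<in>band_projections. 0 \<le> P \<tau> x \<and> P (1 - \<tau>) x \<le> 0 \<and>
      (\<forall>\<rho>\<in>band_projections. \<rho> \<le> \<tau> \<longrightarrow> P \<rho> x = 0 \<longrightarrow> \<rho> = 0)"
begin

lemma P_0: "P T 0 = 0" using P_add[of T 0 0] by simp
lemma P_zero: "P 0 x = 0" using P_plus[of 0 0 x] by simp
lemma P_diff: "P T (x - y) = P T x - P T y" using P_add[of T "x - y" y] by (simp add: algebra_simps)
lemma P_minus: "P T (- x) = - P T x" using P_diff[of T 0 x] P_0 by simp
lemma P_sub: "P (S - T) x = P S x - P T x" using P_plus[of "S - T" T x] by (simp add: algebra_simps)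
lemma P_compl: "P (1 - T) x = x - P T x" by (simp add: P_sub P_one)
lemma P_split: "x = P T x + P (1 - T) x" by (simp add: P_compl)

lemmas P_simps = P_add P_scaleR P_0 P_zero P_diff P_minus P_one

lemma P_mono: "0 \<le> T \<Longrightarrow> x \<le> y \<Longrightarrow> P T x \<le> P T y"
  using P_nonneg[of T "y - x"] by (simp add: P_diff)

lemma P_down:
  assumes "\<kappa> \<in> band_projections" "\<rho> \<in> band_projections" "\<kappa> \<le> \<rho>"
  shows "P \<kappa> (P \<rho> x) = P \<kappa> x" "P \<rho> (P \<kappa> x) = P \<kappa> x"
  using assms bp_le_iff[OF assms(1,2)] band_projection_commute[OF assms(1), of \<rho>]
  by (metis P_mult)+

definition le_on :: "'e orth \<Rightarrow> 'v \<Rightarrow> 'v \<Rightarrow> bool"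
  where "le_on \<rho> x y \<longleftrightarrow> P \<rho> x \<le> P \<rho> y"

lemma le_on_refl: "le_on \<rho> x x" by (simp add: le_on_def)
lemma le_on_trans: "le_on \<rho> x y \<Longrightarrow> le_on \<rho> y z \<Longrightarrow> le_on \<rho> x z" unfolding le_on_def by (rule order_trans)
lemma le_onI: "x \<le> y \<Longrightarrow> \<rho> \<in> band_projections \<Longrightarrow> le_on \<rho> x y"
  unfolding le_on_def by (intro P_mono bp_nonneg)
lemma le_on_add: "le_on \<rho> x y \<Longrightarrow> le_on \<rho> z w \<Longrightarrow> le_on \<rho> (x + z) (y + w)"
  unfolding le_on_def by (simp add: P_add add_mono)
lemma le_on_scaleR: "0 \<le> r \<Longrightarrow> le_on \<rho> x y \<Longrightarrow> le_on \<rho> (r *\<^sub>R x) (r *\<^sub>R y)"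
  unfolding le_on_def by (simp add: P_scaleR scaleR_left_mono)
lemma le_on_down:
  assumes "le_on \<rho> x y" "\<kappa> \<in> band_projections" "\<rho> \<in> band_projections" "\<kappa> \<le> \<rho>"
  shows "le_on \<kappa> x y"
  using P_mono[OF bp_nonneg[OF assms(2)] assms(1)[unfolded le_on_def]] P_down[OF assms(2-4)]
  by (simp add: le_on_def)
lemma le_on_1: "le_on 1 x y \<longleftrightarrow> x \<le> y" by (simp add: le_on_def P_one)
lemma le_on_diff: "le_on \<rho> x y \<longleftrightarrow> le_on \<rho> (x - y) 0" by (simp add: le_on_def P_diff P_0)
lemma le_on_diff_le: "le_on \<rho> (x - y) z \<longleftrightarrow> le_on \<rho> x (z + y)"
  by (simp add: le_on_def P_diff P_add diff_le_eq)

lemma le_on_Sup: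
  assumes "\<rho> \<in> band_projections" "A \<noteq> {}" "bdd_above A" "\<And>a. a \<in> A \<Longrightarrow> le_on \<rho> a c"
  shows "le_on \<rho> (Sup A) c"
proof -
  \<comment> \<open>This bound agrees with \<open>c\<close> on \<open>\<rho>\<close> and with the
    supremum elsewhere, so it dominates \<open>A\<close> globally.\<close>
  let ?u = "P \<rho> c + P (1 - \<rho>) (Sup A)"
  have "a \<le> ?u" if a: "a \<in> A" for a
  proof -
    have "P (1 - \<rho>) a \<le> P (1 - \<rho>) (Sup A)"
      using assms(1) cSup_upper[OF a assms(3)] by (intro P_mono bp_nonneg) auto
    moreover have "P \<rho> a \<le> P \<rho> c" using assms(4)[OF a] by (simp add: le_on_def)
    ultimately show ?thesis by (subst P_split[of a \<rho>]) (rule add_mono)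
  qed
  hence "Sup A \<le> ?u" by (rule cSup_least[OF assms(2)])
  hence "P \<rho> (Sup A) \<le> P \<rho> ?u" using assms(1) by (intro P_mono bp_nonneg)
  thus ?thesis using assms(1)
    by (simp add: le_on_def P_add P_mult[symmetric] bp_idem bp_compl_mult P_zero)
qed

lemma le_on_sup: "\<rho> \<in> band_projections \<Longrightarrow> le_on \<rho> a c \<Longrightarrow> le_on \<rho> b c \<Longrightarrow> le_on \<rho> (sup a b) c"
  using le_on_Sup[of \<rho> "{a, b}" c] by (auto simp: cSup_insert)

lemma le_on_abs: "\<rho> \<in> band_projections \<Longrightarrow> le_on \<rho> x d \<Longrightarrow> le_on \<rho> (- x) d \<Longrightarrow> le_on \<rho> \<bar>x\<bar> d"
  by (simp add: abs_lattice le_on_sup)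

lemma le_on_abs_iff: "\<rho> \<in> band_projections \<Longrightarrow> le_on \<rho> \<bar>x\<bar> d \<longleftrightarrow> le_on \<rho> x d \<and> le_on \<rho> (- x) d"
  using le_on_abs le_on_trans le_onI[OF abs_ge_self, of \<rho> x] le_onI[OF abs_ge_minus_self, of \<rho> x] by blast

lemma le_on_Inf:
  assumes "\<rho> \<in> band_projections" "A \<noteq> {}" "bdd_below A" "\<And>a. a \<in> A \<Longrightarrow> le_on \<rho> c a"
  shows "le_on \<rho> c (Inf A)"
proof -
  let ?u = "P \<rho> c + P (1 - \<rho>) (Inf A)"
  have "?u \<le> a" if a: "a \<in> A" for a
  proof -
    have "P (1 - \<rho>) (Inf A) \<le> P (1 - \<rho>) a"
      using assms(1) cInf_lower[OF a assms(3)] by (intro P_mono bp_nonneg) auto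
    moreover have "P \<rho> c \<le> P \<rho> a" using assms(4)[OF a] by (simp add: le_on_def)
    ultimately have "?u \<le> P \<rho> a + P (1 - \<rho>) a" by (intro add_mono)
    thus ?thesis by (simp only: P_split[symmetric])
  qed
  hence "?u \<le> Inf A" by (rule cInf_greatest[OF assms(2)])
  hence "P \<rho> ?u \<le> P \<rho> (Inf A)" using assms(1) by (intro P_mono bp_nonneg)
  thus ?thesis using assms(1)
    by (simp add: le_on_def P_add P_mult[symmetric] bp_idem bp_compl_mult P_zero)
qed

lemma le_on_inf: "\<rho> \<in> band_projections \<Longrightarrow> le_on \<rho> c a \<Longrightarrow> le_on \<rho> c b \<Longrightarrow> le_on \<rho> c (inf a b)"
  using le_on_Inf[of \<rho> "{a, b}" c] by (auto simp: cInf_insert)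

lemma cut:
  obtains \<tau> where "\<tau> \<in> band_projections" "le_on \<tau> y x" "le_on (1 - \<tau>) x y"
    "\<And>\<rho>. \<rho> \<in> band_projections \<Longrightarrow> \<rho> \<le> \<tau> \<Longrightarrow> le_on \<rho> x y \<Longrightarrow> \<rho> = 0"
proof -
  obtain \<tau> where t: "\<tau> \<in> band_projections" "0 \<le> P \<tau> (x - y)" "P (1 - \<tau>) (x - y) \<le> 0"
    "\<And>\<rho>. \<rho> \<in> band_projections \<Longrightarrow> \<rho> \<le> \<tau> \<Longrightarrow> P \<rho> (x - y) = 0 \<Longrightarrow> \<rho> = 0" using P_cut by blast
  have 1: "le_on \<tau> y x" "le_on (1 - \<tau>) x y" using t by (auto simp: le_on_def P_diff)
  show ?thesis
  proof (rule that[OF t(1) 1])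
    fix \<rho> assume r: "\<rho> \<in> band_projections" "\<rho> \<le> \<tau>" "le_on \<rho> x y"
    have "le_on \<rho> y x" using le_on_down[OF 1(1) r(1) t(1) r(2)] .
    hence "P \<rho> (x - y) = 0" using r(3) by (simp add: le_on_def P_diff)
    thus "\<rho> = 0" using t(4) r by blast
  qed
qed

text \<open>If the inequality failed, \<open>cut\<close> would give a nonzero part of
  \<open>\<pi>\<close> on no piece of which it holds, against density. This is what permits the
  later estimates to be made on arbitrarily small parts.\<close>

lemma local_le:
  assumes p: "\<pi> \<in> band_projections" and d: "densely \<pi> (\<lambda>\<rho>. le_on \<rho> x y)"
  shows "le_on \<pi> x y"
proof -
  obtain \<tau> where t: "\<tau> \<in> band_projections" "le_on \<tau> y x" "le_on (1 - \<tau>) x y"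
    "\<And>\<rho>. \<rho> \<in> band_projections \<Longrightarrow> \<rho> \<le> \<tau> \<Longrightarrow> le_on \<rho> x y \<Longrightarrow> \<rho> = 0" using cut[of y x] by blast
  have "\<pi> * \<tau> = 0"
  proof (rule ccontr)
    assume "\<pi> * \<tau> \<noteq> 0"
    then obtain \<rho> where "\<rho> \<in> band_projections" "\<rho> \<noteq> 0" "\<rho> \<le> \<pi> * \<tau>" "le_on \<rho> x y"
      using densely_ex[OF d, of "\<pi> * \<tau>"] p t(1) bp_mult_le[OF p t(1)] by auto
    thus False using t(4)[of \<rho>] bp_mult_le(2)[OF p t(1)] by (meson order_trans)
  qed
  hence "\<pi> \<le> 1 - \<tau>" using p t(1) by (subst bp_le_iff) (auto simp: algebra_simps)
  thus ?thesis using le_on_down[OF t(3) p] t(1) by simp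
qed

lemma local_le1: "densely 1 (\<lambda>\<rho>. le_on \<rho> x y) \<Longrightarrow> x \<le> y"
  using local_le[of 1 x y] by (simp add: le_on_1)

lemma le_on_archimedean:
  assumes "\<And>r. 0 < r \<Longrightarrow> le_on \<rho> x (y + r *\<^sub>R e)"
  shows "le_on \<rho> x y"
proof -
  have "P \<rho> x - P \<rho> y \<le> 0"
  proof (rule archimedean_le_0)
    fix r :: real assume "0 < r"
    from assms[OF this] show "P \<rho> x - P \<rho> y \<le> r *\<^sub>R P \<rho> e"
      by (simp add: le_on_def P_add P_scaleR diff_le_eq add.commute)
  qed
  thus ?thesis by (simp add: le_on_def)
qed

text \<open>By the Archimedean property some \<open>y + r e\<close> with \<open>r > 0\<close> still
  fails to dominate \<open>x\<close>, and \<open>cut\<close> turns this failure into the reverse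
  inequality on a part. The unit of measurement \<open>e\<close> is free.\<close>

lemma not_le_on:
  assumes "\<pi> \<in> band_projections" "\<not> le_on \<pi> x y"
  obtains \<rho> \<delta> where "\<rho> \<in> band_projections" "\<rho> \<noteq> 0" "\<rho> \<le> \<pi>" "0 < \<delta>" "le_on \<rho> (y + \<delta> *\<^sub>R e) x"
proof -
  obtain r where r: "0 < r" "\<not> le_on \<pi> x (y + r *\<^sub>R e)" using assms(2) le_on_archimedean[of \<pi> x y e] by blast
  obtain \<tau> where t: "\<tau> \<in> band_projections" "le_on \<tau> (y + r *\<^sub>R e) x" "le_on (1 - \<tau>) x (y + r *\<^sub>R e)"
    using cut[of "y + r *\<^sub>R e" x] by blast
  have "\<pi> * \<tau> \<noteq> 0"
  proof
    assume "\<pi> * \<tau> = 0"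
    hence "\<pi> \<le> 1 - \<tau>" using assms(1) t(1) by (subst bp_le_iff) (auto simp: algebra_simps)
    thus False using le_on_down[OF t(3) assms(1)] t(1) r by simp
  qed
  thus ?thesis using that[of "\<pi> * \<tau>" r] assms(1) t(1) bp_mult_le[OF assms(1) t(1)] r(1)
      le_on_down[OF t(2), of "\<pi> * \<tau>"] by simp
qed

text \<open>Halve the interval \<open>[a, b]\<close> and let \<open>cut\<close> decide, on a smaller
  part, which half contains \<open>x\<close>. After \<open>n\<close> halvings the interval has
  length at most \<open>\<epsilon>\<close>, and its left end is the number sought.\<close>

lemma bisect:
  assumes "0 \<le> e" "0 < \<epsilon>" "\<pi> \<in> band_projections" "\<pi> \<noteq> 0"
    "le_on \<pi> (a *\<^sub>R e) x" "le_on \<pi> x (b *\<^sub>R e)" "a \<le> b"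
  shows "\<exists>\<rho>\<in>band_projections. \<exists>c. \<rho> \<noteq> 0 \<and> \<rho> \<le> \<pi> \<and> a \<le> c \<and> c \<le> b \<and> le_on \<rho> \<bar>x - c *\<^sub>R e\<bar> (\<epsilon> *\<^sub>R e)"
proof -
  obtain n :: nat where "(b - a) / \<epsilon> < 2 ^ n" using real_arch_pow[of 2 "(b - a) / \<epsilon>"] by auto
  hence "b - a \<le> 2 ^ n * \<epsilon>" using assms(2) by (simp add: field_simps)
  thus ?thesis using assms(3-7)
  proof (induction n arbitrary: a b \<pi>)
    case 0
    have e: "(b - a) *\<^sub>R e \<le> \<epsilon> *\<^sub>R e" "0 \<le> \<epsilon> *\<^sub>R e"
      using 0 assms(1,2) by (auto intro!: scaleR_right_mono scaleR_nonneg_nonneg)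
    have "le_on \<pi> (x - a *\<^sub>R e) ((b - a) *\<^sub>R e)" using 0 by (simp add: le_on_diff_le algebra_simps)
    hence 1: "le_on \<pi> (x - a *\<^sub>R e) (\<epsilon> *\<^sub>R e)" using e(1) le_onI le_on_trans 0 by blast
    have "le_on \<pi> (a *\<^sub>R e - x) 0" using 0 by (simp add: le_on_diff_le)
    hence "le_on \<pi> (- (x - a *\<^sub>R e)) (\<epsilon> *\<^sub>R e)" using e(2) le_onI le_on_trans 0 by simp
    with 1 show ?case using 0 by (intro bexI[of _ \<pi>] exI[of _ a]) (auto intro: le_on_abs)
  next
    case (Suc n)
    define m where "m = (a + b) / 2"
    have m: "a \<le> m" "m \<le> b" "m - a \<le> 2 ^ n * \<epsilon>" "b - m \<le> 2 ^ n * \<epsilon>"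
      using Suc.prems by (auto simp: m_def field_simps)
    obtain \<tau> where t: "\<tau> \<in> band_projections" "le_on \<tau> (m *\<^sub>R e) x" "le_on (1 - \<tau>) x (m *\<^sub>R e)"
      using cut[of "m *\<^sub>R e" x] by blast
    show ?case
    proof (rule bp_split[OF Suc.prems(2,3) t(1)])
      assume k: "\<pi> * \<tau> \<in> band_projections" "\<pi> * \<tau> \<noteq> 0" "\<pi> * \<tau> \<le> \<pi>" "\<pi> * \<tau> \<le> \<tau>"
      have "\<exists>\<rho>\<in>band_projections. \<exists>c. \<rho> \<noteq> 0 \<and> \<rho> \<le> \<pi> * \<tau> \<and> m \<le> c \<and> c \<le> b \<and> le_on \<rho> \<bar>x - c *\<^sub>R e\<bar> (\<epsilon> *\<^sub>R e)"
        using m k t Suc.prems le_on_down by (intro Suc.IH) blast+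
      thus ?thesis using k m by (meson order_trans)
    next
      assume k: "\<pi> * (1 - \<tau>) \<in> band_projections" "\<pi> * (1 - \<tau>) \<noteq> 0" "\<pi> * (1 - \<tau>) \<le> \<pi>" "\<pi> * (1 - \<tau>) \<le> 1 - \<tau>"
      have "1 - \<tau> \<in> band_projections" using t(1) by simp
      hence "\<exists>\<rho>\<in>band_projections. \<exists>c. \<rho> \<noteq> 0 \<and> \<rho> \<le> \<pi> * (1 - \<tau>) \<and> a \<le> c \<and> c \<le> m \<and> le_on \<rho> \<bar>x - c *\<^sub>R e\<bar> (\<epsilon> *\<^sub>R e)"
        using m k t Suc.prems le_on_down by (intro Suc.IH) blast+
      thus ?thesis using k m by (meson order_trans)
    qed
  qed
qed

lemma real_approx:
  assumes "0 \<le> e" "0 < \<epsilon>" "\<pi> \<in> band_projections" "le_on \<pi> (a *\<^sub>R e) x" "le_on \<pi> x (b *\<^sub>R e)" "a \<le> b"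
  shows "densely \<pi> (\<lambda>\<rho>. \<exists>c. a \<le> c \<and> c \<le> b \<and> le_on \<rho> \<bar>x - c *\<^sub>R e\<bar> (\<epsilon> *\<^sub>R e))"
  unfolding densely_def
proof (intro ballI impI)
  fix \<kappa> assume k: "\<kappa> \<in> band_projections" "\<kappa> \<le> \<pi>" "\<kappa> \<noteq> 0"
  show "\<exists>\<rho>\<in>band_projections. \<rho> \<noteq> 0 \<and> \<rho> \<le> \<kappa> \<and> (\<exists>c. a \<le> c \<and> c \<le> b \<and> le_on \<rho> \<bar>x - c *\<^sub>R e\<bar> (\<epsilon> *\<^sub>R e))"
    using bisect[OF assms(1,2) k(1,3) le_on_down[OF assms(4) k(1) assms(3) k(2)]
        le_on_down[OF assms(5) k(1) assms(3) k(2)] assms(6)] by blast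
qed

text \<open>For positive \<open>e\<close> this makes \<open>e\<close> a weak order unit on the part
  \<open>\<pi>\<close>. Where a regulator is full, inequalities between its real multiples carry
  over to the numbers (\<open>le_on_real\<close>).\<close>

definition full :: "'e orth \<Rightarrow> 'v \<Rightarrow> bool"
  where "full \<pi> e \<longleftrightarrow> (\<forall>\<rho>\<in>band_projections. \<rho> \<le> \<pi> \<longrightarrow> P \<rho> e = 0 \<longrightarrow> \<rho> = 0)"

lemma full_down: "full \<pi> e \<Longrightarrow> \<rho> \<le> \<pi> \<Longrightarrow> full \<rho> e"
  unfolding full_def by (meson order_trans)

text \<open>\<open>\<tau>\<close> is the carrier of \<open>e\<close>. Proofs with a regulator split
  along it: on \<open>\<tau>\<close> numbers can be compared, and outside of it whatever
  \<open>e\<close> dominates vanishes.\<close>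

lemma support_ex:
  assumes "0 \<le> e"
  obtains \<tau> where "\<tau> \<in> band_projections" "P \<tau> e = e" "full \<tau> e"
proof -
  obtain \<tau> where t: "\<tau> \<in> band_projections" "0 \<le> P \<tau> e" "P (1 - \<tau>) e \<le> 0"
    "\<And>\<rho>. \<rho> \<in> band_projections \<Longrightarrow> \<rho> \<le> \<tau> \<Longrightarrow> P \<rho> e = 0 \<Longrightarrow> \<rho> = 0" using P_cut by blast
  have "0 \<le> P (1 - \<tau>) e" using t assms by (intro P_nonneg bp_nonneg) auto
  hence "P \<tau> e = e" using t(3) by (simp add: P_compl)
  thus ?thesis using that t by (auto simp: full_def)
qed

lemma le_on_real:
  assumes "0 \<le> e" "full \<rho> e" "\<rho> \<in> band_projections" "\<rho> \<noteq> 0" "le_on \<rho> (a *\<^sub>R e) (b *\<^sub>R e)"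
  shows "a \<le> b"
proof (rule ccontr)
  assume "\<not> a \<le> b"
  have "a *\<^sub>R P \<rho> e \<le> b *\<^sub>R P \<rho> e" using assms(5) by (simp add: le_on_def P_scaleR)
  hence "(a - b) *\<^sub>R P \<rho> e \<le> 0" by (simp add: algebra_simps)
  hence "(1 / (a - b)) *\<^sub>R ((a - b) *\<^sub>R P \<rho> e) \<le> (1 / (a - b)) *\<^sub>R 0"
    using \<open>\<not> a \<le> b\<close> by (intro scaleR_left_mono) auto
  hence "P \<rho> e \<le> 0" using \<open>\<not> a \<le> b\<close> by simp
  moreover have "0 \<le> P \<rho> e" using assms by (intro P_nonneg bp_nonneg)
  ultimately have "P \<rho> e = 0" by (rule order_antisym)
  thus False using assms by (auto simp: full_def)
qed

text \<open>Otherwise \<open>cut\<close> gives \<open>n e \<le> x\<close> on all of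
  \<open>\<kappa>\<close> for every \<open>n\<close>, which the Archimedean property forbids. The
  lemma serves to exchange one regulator for another and to turn lattice bounds into real
  ones.\<close>

lemma bounded_densely:
  assumes "0 \<le> e" "full \<pi> e" "\<pi> \<in> band_projections"
  shows "densely \<pi> (\<lambda>\<rho>. \<exists>n::nat. le_on \<rho> x (real n *\<^sub>R e))"
  unfolding densely_def
proof (intro ballI impI, rule ccontr)
  fix \<kappa> assume k: "\<kappa> \<in> band_projections" "\<kappa> \<le> \<pi>" "\<kappa> \<noteq> 0"
    and n: "\<not> (\<exists>\<rho>\<in>band_projections. \<rho> \<noteq> 0 \<and> \<rho> \<le> \<kappa> \<and> (\<exists>n::nat. le_on \<rho> x (real n *\<^sub>R e)))"
  have *: "le_on \<kappa> (real n *\<^sub>R e) x" for n :: nat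
  proof -
    obtain \<tau> where t: "\<tau> \<in> band_projections" "le_on \<tau> (real n *\<^sub>R e) x" "le_on (1 - \<tau>) x (real n *\<^sub>R e)"
      using cut[of "real n *\<^sub>R e" x] by blast
    have "\<kappa> * (1 - \<tau>) = 0"
    proof (rule ccontr)
      assume "\<kappa> * (1 - \<tau>) \<noteq> 0"
      moreover have "1 - \<tau> \<in> band_projections" using t(1) by simp
      moreover from this have "le_on (\<kappa> * (1 - \<tau>)) x (real n *\<^sub>R e)"
        using le_on_down[OF t(3)] k(1) bp_mult_le[of \<kappa> "1 - \<tau>"] by simp
      ultimately show False using n k(1) bp_mult_le(1)[of \<kappa> "1 - \<tau>"] bp_mult[of \<kappa> "1 - \<tau>"] by metis
    qed
    hence "\<kappa> \<le> \<tau>" using k t(1) by (subst bp_le_iff) (auto simp: algebra_simps)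
    thus ?thesis using le_on_down[OF t(2) k(1) t(1)] by blast
  qed
  have "P \<kappa> e \<le> r *\<^sub>R P \<kappa> (sup x 0)" if "0 < r" for r
  proof -
    obtain n :: nat where n: "1 / r < real n" using reals_Archimedean2 by blast
    hence n0: "0 < real n" using that by (meson less_trans zero_less_divide_1_iff)
    have e0: "0 \<le> P \<kappa> e" using k assms by (intro P_nonneg bp_nonneg)
    have "P \<kappa> x \<le> P \<kappa> (sup x 0)" using k by (intro P_mono bp_nonneg) auto
    hence "real n *\<^sub>R P \<kappa> e \<le> P \<kappa> (sup x 0)" using *[of n] by (simp add: le_on_def P_scaleR)
    hence "r *\<^sub>R (real n *\<^sub>R P \<kappa> e) \<le> r *\<^sub>R P \<kappa> (sup x 0)" using that by (intro scaleR_left_mono) auto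
    moreover have "1 \<le> r * real n" using n that by (simp add: field_simps)
    hence "1 *\<^sub>R P \<kappa> e \<le> (r * real n) *\<^sub>R P \<kappa> e" using e0 by (intro scaleR_right_mono)
    ultimately show ?thesis by simp
  qed
  hence "P \<kappa> e \<le> 0" by (rule archimedean_le_0)
  moreover have "0 \<le> P \<kappa> e" using k assms by (intro P_nonneg bp_nonneg)
  ultimately have "P \<kappa> e = 0" by (rule order_antisym)
  thus False using assms(2) k by (auto simp: full_def)
qed

text \<open>If no member of \<open>D\<close> were below \<open>\<epsilon> e\<close> on any nonzero
  piece of \<open>\<kappa>\<close>, all would be above it on \<open>\<kappa>\<close>, and so would
  their infimum 0. This converts an infimum into a single good member, at the price of shrinking the
  part.\<close>

lemma Inf_densely:
  assumes "0 \<le> e" "full \<pi> e" "\<pi> \<in> band_projections" "0 < \<epsilon>"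
    and D: "D \<noteq> {}" "\<And>d. d \<in> D \<Longrightarrow> 0 \<le> d" "Inf D = 0"
  shows "densely \<pi> (\<lambda>\<rho>. \<exists>d\<in>D. le_on \<rho> d (\<epsilon> *\<^sub>R e))"
  unfolding densely_def
proof (intro ballI impI, rule ccontr)
  fix \<kappa> assume k: "\<kappa> \<in> band_projections" "\<kappa> \<le> \<pi>" "\<kappa> \<noteq> 0"
    and n: "\<not> (\<exists>\<rho>\<in>band_projections. \<rho> \<noteq> 0 \<and> \<rho> \<le> \<kappa> \<and> (\<exists>d\<in>D. le_on \<rho> d (\<epsilon> *\<^sub>R e)))"
  have "le_on \<kappa> (\<epsilon> *\<^sub>R e) (Inf D)"
  proof (rule le_on_Inf[OF k(1) D(1)])
    show "bdd_below D" using D(2) by (rule bdd_belowI)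
    fix d assume d: "d \<in> D"
    obtain \<tau> where t: "\<tau> \<in> band_projections" "le_on \<tau> (\<epsilon> *\<^sub>R e) d" "le_on (1 - \<tau>) d (\<epsilon> *\<^sub>R e)"
      using cut[of "\<epsilon> *\<^sub>R e" d] by blast
    show "le_on \<kappa> (\<epsilon> *\<^sub>R e) d"
    proof (rule bp_split[OF k(1,3), of "1 - \<tau>"])
      show "1 - \<tau> \<in> band_projections" using t(1) by simp
      assume a: "\<kappa> * (1 - \<tau>) \<in> band_projections" "\<kappa> * (1 - \<tau>) \<noteq> 0" "\<kappa> * (1 - \<tau>) \<le> \<kappa>" "\<kappa> * (1 - \<tau>) \<le> 1 - \<tau>"
      have "le_on (\<kappa> * (1 - \<tau>)) d (\<epsilon> *\<^sub>R e)" using le_on_down[OF t(3) a(1) _ a(4)] t(1) by simp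
      hence False using n d a by blast
      thus ?thesis ..
    next
      assume "\<kappa> * (1 - \<tau>) = 0"
      hence "\<kappa> \<le> \<tau>" using k t(1) by (subst bp_le_iff) (auto simp: algebra_simps)
      thus ?thesis using le_on_down[OF t(2) k(1) t(1)] by blast
    qed
  qed
  hence "le_on \<kappa> (\<epsilon> *\<^sub>R e) (0 *\<^sub>R e)" using D by simp
  hence "\<epsilon> \<le> 0" using assms k by (intro le_on_real[of e \<kappa>] full_down[of \<pi> e \<kappa>])
  thus False using assms(4) by simp
qed

end

subsection \<open>The two instances\<close>

text \<open>\<open>\<tau>\<close> is the projection onto the band generated by the positive part
  \<open>a\<close>; the negative part is disjoint from \<open>a\<close> and dies on
  \<open>\<tau>\<close>.\<close>

lemma bp_supp_ex:
  fixes x :: "'e::dedekind_vector_lattice"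
  shows "\<exists>\<tau>\<in>band_projections. 0 \<le> orth_apply \<tau> x \<and> orth_apply (1 - \<tau>) x \<le> 0 \<and>
      (\<forall>\<rho>\<in>band_projections. \<rho> \<le> \<tau> \<longrightarrow> orth_apply \<rho> x = 0 \<longrightarrow> \<rho> = 0)"
proof -
  obtain a b where ab: "a = sup x 0" "b = sup (- x) 0" "x = a - b" "0 \<le> a" "0 \<le> b" by (rule pos_part_obtain)
  obtain \<tau> where t: "\<tau> \<in> band_projections" "orth_apply \<tau> a = a"
    "\<And>y. lat_disjoint y a \<Longrightarrow> orth_apply \<tau> y = 0" using bp_ex[of "{a}"] by auto
  have "inf a b = 0"
  proof -
    have e: "a - b = x" using ab(3) ..
    have "inf (a - b) 0 + b = inf a b" by (simp add: add_inf_distrib_right)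
    moreover have "inf x 0 = - b" unfolding ab(2) by (rule inf_eq_neg_sup[of x 0, unfolded minus_zero])
    ultimately show ?thesis unfolding e by simp
  qed
  hence d: "lat_disjoint b a" using ab(4,5) by (simp add: lat_disjoint_def inf.commute)
  have 1: "orth_apply \<tau> x = a" using t(2) t(3)[OF d] ab(3) by (metis orth_apply_diff diff_zero)
  have "orth_apply (1 - \<tau>) x = x - a" using 1 by (simp add: orth_simps)
  also have "\<dots> = - b" by (subst ab(3)) simp
  finally have 2: "orth_apply (1 - \<tau>) x \<le> 0" using ab(5) by simp
  have 3: "0 \<le> orth_apply \<tau> x" unfolding 1 by (rule ab(4))
  have "\<rho> = 0" if r: "\<rho> \<in> band_projections" "\<rho> \<le> \<tau>" "orth_apply \<rho> x = 0" for \<rho>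
  proof -
    have rt: "\<rho> * \<tau> = \<rho>" "\<tau> * \<rho> = \<rho>"
      using r(1,2) t(1) bp_le_iff band_projection_commute by metis+
    have "orth_apply \<rho> a = orth_apply (\<rho> * \<tau>) x" unfolding times_orth.rep_eq 1 ..
    hence ra: "orth_apply \<rho> a = 0" using r rt by simp
    have "lat_disjoint (orth_apply \<rho> y) a" for y
      using bp_disjoint[OF r(1), of y a] ra by (simp add: orth_simps)
    hence "orth_apply \<tau> (orth_apply \<rho> y) = 0" for y using t(3) by blast
    hence "\<tau> * \<rho> = 0" by (intro orth_eqI) (simp add: orth_simps)
    thus ?thesis using rt by simp
  qed
  thus ?thesis using t(1) 2 3 by blast
qed

interpretation E: band_module orth_apply
  by (standard; (rule bp_supp_ex)?) (simp_all add: orth_simps orth_apply_nonneg)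

lemma orth_abs_le: "\<bar>orth_apply T x\<bar> \<le> orth_apply \<bar>T\<bar> \<bar>x\<bar>"
proof -
  have p: "\<bar>orth_apply T y\<bar> \<le> orth_apply \<bar>T\<bar> y" if "0 \<le> y" for y
  proof (rule abs_leI)
    show "orth_apply T y \<le> orth_apply \<bar>T\<bar> y" using that abs_ge_self[of T] by (simp only: orth_le_iff)
    show "- orth_apply T y \<le> orth_apply \<bar>T\<bar> y" using that abs_ge_minus_self[of T] by (simp add: orth_le_iff orth_simps)
  qed
  obtain a b where ab: "a = sup x 0" "b = sup (- x) 0" "x = a - b" "0 \<le> a" "0 \<le> b" by (rule pos_part_obtain)
  have e: "\<bar>x\<bar> = a + b"
  proof -
    have "\<bar>x\<bar> = pprt x - nprt x" by (rule abs_prts)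
    also have "nprt x = - b" unfolding ab(2) nprt_def by (rule inf_eq_neg_sup[of x 0, unfolded minus_zero])
    finally show ?thesis unfolding ab(1) pprt_def by simp
  qed
  have "\<bar>orth_apply T x\<bar> = \<bar>orth_apply T a - orth_apply T b\<bar>" using ab(3) by (metis orth_apply_diff)
  also have "\<dots> \<le> \<bar>orth_apply T a\<bar> + \<bar>orth_apply T b\<bar>" by (rule abs_triangle_ineq4)
  also have "\<dots> \<le> orth_apply \<bar>T\<bar> a + orth_apply \<bar>T\<bar> b" using ab by (intro add_mono p)
  finally show ?thesis unfolding e by (simp add: orth_apply_add)
qed

text \<open>The sign of \<open>T\<close> on a band does not depend on the argument: locally
  \<open>x\<close> and \<open>y\<close> are, up to \<open>\<epsilon>\<close>, the multiples
  \<open>c z\<close> and \<open>(1 - c) z\<close> of their sum, so that \<open>T x\<close> and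
  \<open>T y\<close> are close to nonnegative multiples of the same element
  \<open>T z\<close>.\<close>

lemma orth_pos_neg_disjoint:
  assumes "0 \<le> x" "0 \<le> y"
  shows "lat_disjoint (sup (- orth_apply T y) 0) (sup (orth_apply T x) 0)"
proof -
  define z where "z = x + y"
  define m where "m = orth_apply \<bar>T\<bar> z"
  have z: "0 \<le> z" "x \<le> z" using assms by (auto simp: z_def)
  have m0: "0 \<le> m" using z by (simp add: m_def orth_apply_nonneg)
  let ?w = "inf (sup (- orth_apply T y) 0) (sup (orth_apply T x) 0)"
  have "?w \<le> \<epsilon> *\<^sub>R m" if e: "0 < \<epsilon>" for \<epsilon>
  proof (rule E.local_le1, unfold densely_def, intro ballI impI)
    fix \<kappa> :: "'a orth" assume k: "\<kappa> \<in> band_projections" "\<kappa> \<le> 1" "\<kappa> \<noteq> 0"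
    have em: "0 \<le> \<epsilon> *\<^sub>R m" using e m0 by (simp add: scaleR_nonneg_nonneg)
    obtain \<rho> c where r: "\<rho> \<in> band_projections" "\<rho> \<noteq> 0" "\<rho> \<le> \<kappa>" "0 \<le> c" "c \<le> 1"
      "E.le_on \<rho> \<bar>x - c *\<^sub>R z\<bar> (\<epsilon> *\<^sub>R z)"
      using E.bisect[OF z(1) e k(1,3), of 0 x 1] E.le_onI[OF _ k(1)] assms z by auto
    have close: "E.le_on \<rho> (orth_apply T v) (\<epsilon> *\<^sub>R m)" if v: "\<bar>v\<bar> = \<bar>x - c *\<^sub>R z\<bar>" for v
    proof -
      have "orth_apply T v \<le> \<bar>orth_apply T v\<bar>" by (rule abs_ge_self)
      also have "\<dots> \<le> orth_apply \<bar>T\<bar> \<bar>x - c *\<^sub>R z\<bar>" using orth_abs_le[of T v] v by simp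
      finally have "E.le_on \<rho> (orth_apply T v) (orth_apply \<bar>T\<bar> \<bar>x - c *\<^sub>R z\<bar>)" using r(1) by (intro E.le_onI)
      moreover have "E.le_on \<rho> (orth_apply \<bar>T\<bar> \<bar>x - c *\<^sub>R z\<bar>) (orth_apply \<bar>T\<bar> (\<epsilon> *\<^sub>R z))"
        unfolding E.le_on_def E.P_mult[symmetric] band_projection_commute[OF r(1)]
        unfolding E.P_mult by (rule orth_apply_mono[OF abs_ge_zero r(6)[unfolded E.le_on_def]])
      ultimately show ?thesis using E.le_on_trans by (simp add: m_def orth_simps)
    qed
    have Tx: "E.le_on \<rho> (orth_apply T x) (\<epsilon> *\<^sub>R m + c *\<^sub>R orth_apply T z)"
      using close[of "x - c *\<^sub>R z"] by (simp add: orth_simps E.le_on_diff_le)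
    \<comment> \<open>Both arguments miss their multiple of \<open>z\<close> by the same amount, so
      one error bound covers both.\<close>
    have yz: "(1 - c) *\<^sub>R z - y = x - c *\<^sub>R z" unfolding z_def by (simp add: algebra_simps)
    have Ty: "E.le_on \<rho> (- orth_apply T y) (\<epsilon> *\<^sub>R m - (1 - c) *\<^sub>R orth_apply T z)"
    proof -
      have "E.le_on \<rho> (orth_apply T ((1 - c) *\<^sub>R z - y)) (\<epsilon> *\<^sub>R m)" by (rule close) (simp only: yz)
      moreover have "orth_apply T ((1 - c) *\<^sub>R z - y) - \<epsilon> *\<^sub>R m
          = - orth_apply T y - (\<epsilon> *\<^sub>R m - (1 - c) *\<^sub>R orth_apply T z)"
        by (simp add: orth_simps algebra_simps)
      ultimately show ?thesis by (metis E.le_on_diff)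
    qed
    \<comment> \<open>The sign of \<open>T z\<close> decides which of the two parts is
      negligible.\<close>
    obtain \<tau> where t: "\<tau> \<in> band_projections" "E.le_on \<tau> 0 (orth_apply T z)" "E.le_on (1 - \<tau>) (orth_apply T z) 0"
      using E.cut[of 0 "orth_apply T z"] by blast
    show "\<exists>\<rho>\<in>band_projections. \<rho> \<noteq> 0 \<and> \<rho> \<le> \<kappa> \<and> E.le_on \<rho> ?w (\<epsilon> *\<^sub>R m)"
    proof (rule bp_split[OF r(1,2) t(1)])
      let ?k = "\<rho> * \<tau>"
      assume a: "?k \<in> band_projections" "?k \<noteq> 0" "?k \<le> \<rho>" "?k \<le> \<tau>"
      have "E.le_on ?k 0 ((1 - c) *\<^sub>R orth_apply T z)"
        using E.le_on_scaleR[OF _ E.le_on_down[OF t(2) a(1) t(1) a(4)], of "1 - c"] r(5) by simp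
      hence "E.le_on ?k (\<epsilon> *\<^sub>R m - (1 - c) *\<^sub>R orth_apply T z) (\<epsilon> *\<^sub>R m)"
        by (simp add: E.le_on_def E.P_simps)
      hence "E.le_on ?k (- orth_apply T y) (\<epsilon> *\<^sub>R m)"
        using E.le_on_down[OF Ty a(1) r(1) a(3)] E.le_on_trans by blast
      hence "E.le_on ?k (sup (- orth_apply T y) 0) (\<epsilon> *\<^sub>R m)"
        using a em by (intro E.le_on_sup) (simp_all add: E.le_onI)
      hence "E.le_on ?k ?w (\<epsilon> *\<^sub>R m)" using E.le_on_trans E.le_onI[OF inf_le1 a(1)] by blast
      thus ?thesis using a r by (meson order_trans)
    next
      let ?k = "\<rho> * (1 - \<tau>)"
      assume a: "?k \<in> band_projections" "?k \<noteq> 0" "?k \<le> \<rho>" "?k \<le> 1 - \<tau>"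
      have "E.le_on ?k (c *\<^sub>R orth_apply T z) 0"
        using E.le_on_scaleR[OF _ E.le_on_down[OF t(3) a(1) _ a(4)], of c] t(1) r(4) by simp
      hence "E.le_on ?k (\<epsilon> *\<^sub>R m + c *\<^sub>R orth_apply T z) (\<epsilon> *\<^sub>R m)"
        by (simp add: E.le_on_def E.P_simps)
      hence "E.le_on ?k (orth_apply T x) (\<epsilon> *\<^sub>R m)"
        using E.le_on_down[OF Tx a(1) r(1) a(3)] E.le_on_trans by blast
      hence "E.le_on ?k (sup (orth_apply T x) 0) (\<epsilon> *\<^sub>R m)"
        using a em by (intro E.le_on_sup) (simp_all add: E.le_onI)
      hence "E.le_on ?k ?w (\<epsilon> *\<^sub>R m)" using E.le_on_trans E.le_onI[OF inf_le2 a(1)] by blast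
      thus ?thesis using a r by (meson order_trans)
    qed
  qed
  hence "?w \<le> 0" by (rule archimedean_le_0)
  moreover have "0 \<le> ?w" by simp
  ultimately show ?thesis by (simp add: lat_disjoint_def order_antisym)
qed

text \<open>\<open>\<tau>\<close> carries all positive parts \<open>sup (T x) 0\<close> at once. The
  previous lemma shows that no negative part of \<open>T\<close> reaches this band, so
  \<open>T\<close> is positive on it.\<close>

lemma orth_supp_ex:
  fixes T :: "'e::dedekind_vector_lattice orth"
  shows "\<exists>\<tau>\<in>band_projections. 0 \<le> \<tau> * T \<and> (1 - \<tau>) * T \<le> 0 \<and>
      (\<forall>\<rho>\<in>band_projections. \<rho> \<le> \<tau> \<longrightarrow> \<rho> * T = 0 \<longrightarrow> \<rho> = 0)"
proof -
  define A where "A = {sup (orth_apply T x) 0 | x. 0 \<le> x}"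
  obtain \<tau> where t: "\<tau> \<in> band_projections" "\<And>a. a \<in> A \<Longrightarrow> orth_apply \<tau> a = a"
    "\<And>y. (\<forall>a\<in>A. lat_disjoint y a) \<Longrightarrow> orth_apply \<tau> y = 0" using bp_ex[of A] by blast
  have "orth_apply (1 - \<tau>) (orth_apply T x) \<le> 0" if x: "0 \<le> x" for x
  proof -
    have "orth_apply (1 - \<tau>) (orth_apply T x) \<le> orth_apply (1 - \<tau>) (sup (orth_apply T x) 0)"
      using t(1) by (intro orth_apply_mono bp_nonneg) auto
    also have "orth_apply \<tau> (sup (orth_apply T x) 0) = sup (orth_apply T x) 0"
      using x by (intro t(2)) (auto simp: A_def)
    hence "orth_apply (1 - \<tau>) (sup (orth_apply T x) 0) = 0" by (simp add: orth_simps)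
    finally show ?thesis .
  qed
  moreover have "0 \<le> orth_apply \<tau> (orth_apply T y)" if y: "0 \<le> y" for y
  proof -
    have "orth_apply \<tau> (sup (- orth_apply T y) 0) = 0"
      using orth_pos_neg_disjoint[OF _ y, of _ T] by (intro t(3)) (auto simp: A_def)
    moreover have "orth_apply \<tau> (- orth_apply T y) \<le> orth_apply \<tau> (sup (- orth_apply T y) 0)"
      using t(1) by (intro orth_apply_mono bp_nonneg) auto
    ultimately show ?thesis by (simp add: E.P_minus)
  qed
  moreover have "\<rho> = 0" if r: "\<rho> \<in> band_projections" "\<rho> \<le> \<tau>" "\<rho> * T = 0" for \<rho>
  proof -
    have rt: "\<tau> * \<rho> = \<rho>"
      using r(1,2) t(1) bp_le_iff band_projection_commute by metis
    have ra: "orth_apply \<rho> a = 0" if a: "a \<in> A" for a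
    proof -
      obtain z where z: "a = sup (orth_apply T z) 0" using a by (auto simp: A_def)
      have "orth_apply \<rho> (orth_apply T z) = 0" using r(3) by (metis times_orth.rep_eq zero_orth.rep_eq)
      hence "E.le_on \<rho> a 0" unfolding z using r(1)
        by (intro E.le_on_sup) (auto simp: E.le_on_def orth_simps)
      moreover have "0 \<le> orth_apply \<rho> a" using r(1) z by (intro orth_apply_nonneg bp_nonneg) auto
      ultimately show ?thesis by (simp add: E.le_on_def orth_simps)
    qed
    have "lat_disjoint (orth_apply \<rho> y) a" if "a \<in> A" for y a
      using bp_disjoint[OF r(1), of y a] ra[OF that] by (simp add: orth_simps)
    hence "orth_apply \<tau> (orth_apply \<rho> y) = 0" for y using t(3) by blast
    hence "\<tau> * \<rho> = 0" by (intro orth_eqI) (simp add: orth_simps)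
    thus ?thesis using rt by simp
  qed
  ultimately show ?thesis using t(1) by (intro bexI[of _ \<tau>]) (auto simp: orth_le_iff orth_simps)
qed

lemma orth_scaleR_mult: "(r *\<^sub>R S) * T = r *\<^sub>R (S * (T::'e::dedekind_vector_lattice orth))"
  "S * (r *\<^sub>R T) = r *\<^sub>R (S * T)"
  by (auto intro!: orth_eqI simp: orth_simps)

interpretation L: band_module "(*)"
  by (standard; (rule orth_supp_ex)?) (simp_all add: algebra_simps orth_scaleR_mult orth_mult_nonneg)

section \<open>Uniformly order continuous functions\<close>

text \<open>Total boundedness. Two points of \<open>N s\<close> are joined through \<open>s\<close>
  in two steps of \<open>V\<close>, which explains the symmetric form of \<open>N s\<close>.\<close>

lemma compact_uniform_cover:
  assumes "compact (UNIV :: 's::uniform_space set)" "eventually (\<lambda>p. p \<in> U) (uniformity :: ('s \<times> 's) filter)"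
  shows "\<exists>C. finite C \<and> \<Union>C = (UNIV :: 's set) \<and> (\<forall>A\<in>C. A \<times> A \<subseteq> U)"
proof -
  obtain V where V: "eventually V (uniformity :: ('s \<times> 's) filter)" "\<And>x y z. V (x, y) \<Longrightarrow> V (y, z) \<Longrightarrow> (x, z) \<in> U"
    using uniformity_transE[OF assms(2)] by blast
  define N where "N s = {t. V (s, t) \<and> V (t, s)}" for s
  have ev: "eventually (\<lambda>t. t \<in> N s) (nhds s)" for s
  proof -
    have 1: "eventually (\<lambda>(x', y). x' = s \<longrightarrow> V (x', y)) uniformity"
      using V(1) by eventually_elim auto
    have "eventually (\<lambda>(x, y). V (y, x)) uniformity" using V(1) by (rule uniformity_sym)
    hence "eventually (\<lambda>(x', y). x' = s \<longrightarrow> V (y, x')) uniformity"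
      by eventually_elim auto
    with 1 have "eventually (\<lambda>t. V (s, t)) (nhds s)" "eventually (\<lambda>t. V (t, s)) (nhds s)"
      by (simp_all add: eventually_nhds_uniformity)
    thus ?thesis by eventually_elim (simp add: N_def)
  qed
  have "\<exists>G. open G \<and> s \<in> G \<and> G \<subseteq> N s" for s
    using ev[of s] unfolding eventually_nhds by blast
  then obtain G where G: "\<And>s. open (G s)" "\<And>s. s \<in> G s" "\<And>s. G s \<subseteq> N s" by metis
  obtain K where K: "finite K" "UNIV \<subseteq> (\<Union>s\<in>K. G s)"
  proof (rule compactE_image[OF assms(1), of UNIV G])
    show "open (G s)" for s by (rule G)
    show "UNIV \<subseteq> (\<Union>s\<in>UNIV. G s)" using G(2) by blast
  qed
  have "N s \<times> N s \<subseteq> U" for s unfolding N_def using V(2) by blast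
  thus ?thesis using K G by (intro exI[of _ "G ` K"]) blast
qed

text \<open>Just the group part of a lattice norm, without scalars or definiteness, so that
  \<open>X\<close>, \<open>E\<close> and \<Lambda> with their respective norms are all
  instances.\<close>

locale band_normed = band_module P
  for P :: "'e::dedekind_vector_lattice orth \<Rightarrow> 'v::dedekind_vector_lattice \<Rightarrow> 'v" +
  fixes nrm :: "'x::ab_group_add \<Rightarrow> 'v"
  assumes nrm_ge_0: "0 \<le> nrm x"
    and nrm_0: "nrm 0 = 0"
    and nrm_minus: "nrm (- x) = nrm x"
    and nrm_add: "nrm (x + y) \<le> nrm x + nrm y"
begin

lemma nrm_minus_commute: "nrm (x - y) = nrm (y - x)"
  using nrm_minus[of "x - y"] by simp

lemma nrm_diff_le: "nrm (x - y) \<le> nrm x + nrm y"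
  using nrm_add[of x "- y"] nrm_minus[of y] by simp

lemma nrm_triangle3: "nrm (x - z) \<le> nrm (x - y) + nrm (y - z)"
  using nrm_add[of "x - y" "y - z"] by simp

lemma nrm_reverse: "\<bar>nrm x - nrm y\<bar> \<le> nrm (x - y)"
proof (rule abs_leI)
  show "nrm x - nrm y \<le> nrm (x - y)" using nrm_add[of "x - y" y] by (simp add: diff_le_eq)
  show "- (nrm x - nrm y) \<le> nrm (x - y)"
    using nrm_add[of "y - x" x] by (simp add: diff_le_eq nrm_minus_commute)
qed

definition small_on :: "'e orth \<Rightarrow> ('s \<Rightarrow> 'x) \<Rightarrow> 'v \<Rightarrow> ('s \<times> 's) set \<Rightarrow> bool"
  where "small_on \<rho> f d U \<longleftrightarrow> (\<forall>(s, t)\<in>U. le_on \<rho> (nrm (f s - f t)) d)"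

lemma small_on_down: "small_on \<rho> f d U \<Longrightarrow> \<kappa> \<in> band_projections \<Longrightarrow> \<rho> \<in> band_projections \<Longrightarrow> \<kappa> \<le> \<rho>
    \<Longrightarrow> V \<subseteq> U \<Longrightarrow> small_on \<kappa> f d V"
  unfolding small_on_def using le_on_down by blast

lemma cuo_bounded:
  fixes f :: "'s::uniform_space \<Rightarrow> 'x"
  assumes "f \<in> cuo nrm"
  obtains e where "0 \<le> e" "\<And>s. nrm (f s) \<le> e"
  using assms nrm_ge_0 unfolding cuo_def by (blast intro: order_trans)

lemma bdd_modulus:
  fixes f :: "'s::uniform_space \<Rightarrow> 'x"
  assumes "\<And>s. nrm (f s) \<le> e"
  shows "bdd_above ((\<lambda>(s, t). nrm (f s - f t)) ` U)"
  by (rule bdd_aboveI[of _ "e + e"]) (auto intro: order_trans[OF nrm_diff_le] add_mono assms)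

lemma modulus_nonneg:
  fixes f :: "'s::uniform_space \<Rightarrow> 'x"
  assumes "\<And>s. nrm (f s) \<le> e" "eventually (\<lambda>p. p \<in> U) uniformity"
  shows "0 \<le> (SUP (s, t) \<in> U. nrm (f s - f t))"
proof -
  \<comment> \<open>Any point of \<open>S\<close> would do: entourages contain the diagonal.\<close>
  have "(undefined, undefined) \<in> U" using uniformity_refl[of "\<lambda>p. p \<in> U", OF assms(2)] .
  hence "nrm (f undefined - f undefined) \<le> (SUP (s, t) \<in> U. nrm (f s - f t))"
    by (intro cSup_upper bdd_modulus[of f e] assms(1)) force
  thus ?thesis by (simp add: nrm_0)
qed

text \<open>\<open>Inf_densely\<close> applied to the set of all moduli of continuity: on a small
  part one entourage already makes the oscillation small.\<close>

lemma cuo_modulus: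
  fixes f :: "'s::uniform_space \<Rightarrow> 'x"
  assumes f: "f \<in> cuo nrm" and e: "0 \<le> e" "full \<pi> e" "\<pi> \<in> band_projections" "0 < \<epsilon>"
  shows "densely \<pi> (\<lambda>\<rho>. \<exists>U. eventually (\<lambda>p. p \<in> U) uniformity \<and> small_on \<rho> f (\<epsilon> *\<^sub>R e) U)"
proof -
  obtain b where b: "\<And>s. nrm (f s) \<le> b" using cuo_bounded[OF f] by blast
  let ?D = "(\<lambda>U. SUP (s, t) \<in> U. nrm (f s - f t)) ` {U. eventually (\<lambda>p. p \<in> U) uniformity}"
  have "densely \<pi> (\<lambda>\<rho>. \<exists>d\<in>?D. le_on \<rho> d (\<epsilon> *\<^sub>R e))"
  proof (rule Inf_densely[OF e])
    have "UNIV \<in> {U. eventually (\<lambda>p. p \<in> U) uniformity}" by simp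
    thus "?D \<noteq> {}" by blast
    show "0 \<le> d" if "d \<in> ?D" for d using that modulus_nonneg[of f b, OF b] by auto
    show "Inf ?D = 0" using f by (simp add: cuo_def)
  qed
  thus ?thesis
  proof (rule densely_mono)
    fix \<rho> assume r: "\<rho> \<in> band_projections" and "\<exists>d\<in>?D. le_on \<rho> d (\<epsilon> *\<^sub>R e)"
    then obtain U where U: "eventually (\<lambda>p. p \<in> U) uniformity"
      "le_on \<rho> (SUP (s, t) \<in> U. nrm (f s - f t)) (\<epsilon> *\<^sub>R e)" by blast
    have "le_on \<rho> (nrm (f s - f t)) (\<epsilon> *\<^sub>R e)" if st: "(s, t) \<in> U" for s t
    proof -
      have "nrm (f s - f t) \<le> (SUP (s, t) \<in> U. nrm (f s - f t))"
        using st by (intro cSup_upper bdd_modulus[of f b, OF b]) force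
      thus ?thesis by (rule le_on_trans[OF le_onI[OF _ r] U(2)])
    qed
    thus "\<exists>U. eventually (\<lambda>p. p \<in> U) uniformity \<and> small_on \<rho> f (\<epsilon> *\<^sub>R e) U"
      using U(1) unfolding small_on_def by blast
  qed
qed

text \<open>Converse of \<open>cuo_modulus\<close>. The local condition can speak only about the
  carrier of the regulator \<open>e\<close>; on parts that \<open>e\<close> misses,
  \<open>null\<close> requires the function to be constant.\<close>

lemma cuoI_gen:
  fixes f :: "'s::uniform_space \<Rightarrow> 'x"
  assumes b: "\<And>s. nrm (f s) \<le> b" and e: "0 \<le> e"
    and null: "\<And>\<rho>. \<rho> \<in> band_projections \<Longrightarrow> P \<rho> e = 0 \<Longrightarrow> small_on \<rho> f 0 UNIV"
    and loc: "\<And>\<pi> \<epsilon>. \<pi> \<in> band_projections \<Longrightarrow> full \<pi> e \<Longrightarrow> 0 < \<epsilon> \<Longrightarrow>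
      densely \<pi> (\<lambda>\<rho>. \<exists>U. eventually (\<lambda>p. p \<in> U) uniformity \<and> small_on \<rho> f (\<epsilon> *\<^sub>R e) U)"
  shows "f \<in> cuo nrm"
proof -
  let ?D = "(\<lambda>U. SUP (s, t) \<in> U. nrm (f s - f t)) ` {U. eventually (\<lambda>p. p \<in> U) uniformity}"
  obtain \<tau> where t: "\<tau> \<in> band_projections" "P \<tau> e = e" "full \<tau> e" using support_ex[OF e] by blast
  have ne: "?D \<noteq> {}"
  proof -
    have "UNIV \<in> {U. eventually (\<lambda>p. p \<in> U) uniformity}" by simp
    thus ?thesis by blast
  qed
  have D0: "0 \<le> d" if "d \<in> ?D" for d using that modulus_nonneg[of f b, OF b] by auto
  have h: "le_on \<rho> (Inf ?D) d" if r: "\<rho> \<in> band_projections" and U: "eventually (\<lambda>p. p \<in> U) uniformity" "small_on \<rho> f d U" for \<rho> d U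
  proof -
    have "Inf ?D \<le> (SUP (s, t) \<in> U. nrm (f s - f t))"
      using U(1) by (intro cInf_lower bdd_belowI[of ?D 0]) (use D0 in auto)
    moreover have "le_on \<rho> (SUP (s, t) \<in> U. nrm (f s - f t)) d"
    proof (rule le_on_Sup[OF r _ bdd_modulus[of f b, OF b]])
      show "(\<lambda>(s, t). nrm (f s - f t)) ` U \<noteq> {}" using uniformity_refl[of "\<lambda>p. p \<in> U", OF U(1)] by auto
    qed (use U(2) in \<open>auto simp: small_on_def\<close>)
    ultimately show ?thesis by (rule le_on_trans[OF le_onI[OF _ r]])
  qed
  have "Inf ?D \<le> \<epsilon> *\<^sub>R e" if eps: "0 < \<epsilon>" for \<epsilon>
  proof (rule local_le1, unfold densely_def, intro ballI impI)
    fix \<kappa> :: "'e orth" assume k: "\<kappa> \<in> band_projections" "\<kappa> \<le> 1" "\<kappa> \<noteq> 0"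
    show "\<exists>\<rho>\<in>band_projections. \<rho> \<noteq> 0 \<and> \<rho> \<le> \<kappa> \<and> le_on \<rho> (Inf ?D) (\<epsilon> *\<^sub>R e)"
    proof (rule bp_split[OF k(1,3) t(1)])
      assume a: "\<kappa> * \<tau> \<in> band_projections" "\<kappa> * \<tau> \<noteq> 0" "\<kappa> * \<tau> \<le> \<kappa>" "\<kappa> * \<tau> \<le> \<tau>"
      obtain \<rho> U where r: "\<rho> \<in> band_projections" "\<rho> \<noteq> 0" "\<rho> \<le> \<kappa> * \<tau>"
        "eventually (\<lambda>p. p \<in> U) uniformity" "small_on \<rho> f (\<epsilon> *\<^sub>R e) U"
        using densely_ex[OF loc[OF t(1,3) eps] a(1,4,2)] by blast
      thus ?thesis using h[OF r(1,4,5)] a by (meson order_trans)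
    next
      assume "\<kappa> * \<tau> = 0"
      hence "P \<kappa> e = 0" using t(2) by (metis P_mult P_zero)
      hence "small_on \<kappa> f (\<epsilon> *\<^sub>R e) UNIV" using null[OF k(1)] by (simp add: small_on_def le_on_def P_simps)
      hence "le_on \<kappa> (Inf ?D) (\<epsilon> *\<^sub>R e)" using h[OF k(1), of UNIV] by simp
      thus ?thesis using k by blast
    qed
  qed
  hence "Inf ?D \<le> 0" by (rule archimedean_le_0)
  moreover have "0 \<le> Inf ?D" using ne D0 by (rule cInf_greatest)
  ultimately have "Inf ?D = 0" by (rule order_antisym)
  thus ?thesis using b by (auto simp: cuo_def)
qed

text \<open>A norm bound serves as regulator, since \<open>f\<close> vanishes wherever its bound
  does.\<close>

lemma cuoI:
  fixes f :: "'s::uniform_space \<Rightarrow> 'x"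
  assumes b: "\<And>s. nrm (f s) \<le> b"
    and loc: "\<And>\<pi> \<epsilon>. \<pi> \<in> band_projections \<Longrightarrow> full \<pi> b \<Longrightarrow> 0 < \<epsilon> \<Longrightarrow>
      densely \<pi> (\<lambda>\<rho>. \<exists>U. eventually (\<lambda>p. p \<in> U) uniformity \<and> small_on \<rho> f (\<epsilon> *\<^sub>R b) U)"
  shows "f \<in> cuo nrm"
proof (rule cuoI_gen[of f b b, OF b _ _ loc])
  show "0 \<le> b" by (rule order_trans[OF nrm_ge_0 b])
  fix \<rho> assume r: "\<rho> \<in> band_projections" "P \<rho> b = 0"
  have "le_on \<rho> (nrm (f s - f t)) 0" for s t
  proof -
    have "le_on \<rho> (nrm (f s - f t)) (b + b)"
      by (intro le_onI r order_trans[OF nrm_diff_le] add_mono b)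
    thus ?thesis using r(2) by (simp add: le_on_def P_simps)
  qed
  thus "small_on \<rho> f 0 UNIV" by (simp add: small_on_def)
qed

lemma cuo_uniform_pair:
  fixes f g :: "'s::uniform_space \<Rightarrow> 'x"
  assumes "f \<in> cuo nrm" "g \<in> cuo nrm" "0 \<le> e" "full \<pi> e" "\<pi> \<in> band_projections" "0 < \<epsilon>"
  shows "densely \<pi> (\<lambda>\<rho>. \<exists>U. eventually (\<lambda>p. p \<in> U) uniformity \<and> small_on \<rho> f (\<epsilon> *\<^sub>R e) U \<and> small_on \<rho> g (\<epsilon> *\<^sub>R e) U)"
proof -
  have "densely \<pi> (\<lambda>\<rho>. (\<exists>U. eventually (\<lambda>p. p \<in> U) uniformity \<and> small_on \<rho> f (\<epsilon> *\<^sub>R e) U) \<and>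
     (\<exists>U. eventually (\<lambda>p. p \<in> U) uniformity \<and> small_on \<rho> g (\<epsilon> *\<^sub>R e) U))"
    using assms by (intro densely_conj cuo_modulus) (auto intro: small_on_down)
  thus ?thesis
  proof (rule densely_mono)
    fix \<rho> :: "'e orth" assume r: "\<rho> \<in> band_projections" "(\<exists>U. eventually (\<lambda>p. p \<in> U) uniformity \<and> small_on \<rho> f (\<epsilon> *\<^sub>R e) U) \<and>
     (\<exists>U. eventually (\<lambda>p. p \<in> U) uniformity \<and> small_on \<rho> g (\<epsilon> *\<^sub>R e) U)"
    then obtain U V where "eventually (\<lambda>p. p \<in> U) uniformity" "small_on \<rho> f (\<epsilon> *\<^sub>R e) U"
      "eventually (\<lambda>p. p \<in> V) uniformity" "small_on \<rho> g (\<epsilon> *\<^sub>R e) V" by blast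
    thus "\<exists>U. eventually (\<lambda>p. p \<in> U) uniformity \<and> small_on \<rho> f (\<epsilon> *\<^sub>R e) U \<and> small_on \<rho> g (\<epsilon> *\<^sub>R e) U"
      using r(1) by (intro exI[of _ "U \<inter> V"]) (auto intro: eventually_conj small_on_down)
  qed
qed

lemma cuo_diff:
  fixes f g :: "'s::uniform_space \<Rightarrow> 'x"
  assumes "f \<in> cuo nrm" "g \<in> cuo nrm"
  shows "(\<lambda>s. f s - g s) \<in> cuo nrm"
proof -
  obtain a where a: "0 \<le> a" "\<And>s. nrm (f s) \<le> a" using cuo_bounded[OF assms(1)] by blast
  obtain b where b: "0 \<le> b" "\<And>s. nrm (g s) \<le> b" using cuo_bounded[OF assms(2)] by blast
  show ?thesis
  proof (rule cuoI)
    show "nrm (f s - g s) \<le> a + b" for s by (intro order_trans[OF nrm_diff_le] add_mono a b)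
    fix \<pi> :: "'e orth" and \<epsilon> :: real assume p: "\<pi> \<in> band_projections" "full \<pi> (a + b)" "0 < \<epsilon>"
    have "densely \<pi> (\<lambda>\<rho>. \<exists>U. eventually (\<lambda>p. p \<in> U) uniformity \<and> small_on \<rho> f ((\<epsilon>/2) *\<^sub>R (a + b)) U \<and> small_on \<rho> g ((\<epsilon>/2) *\<^sub>R (a + b)) U)"
      using a b p by (intro cuo_uniform_pair assms) auto
    thus "densely \<pi> (\<lambda>\<rho>. \<exists>U. eventually (\<lambda>p. p \<in> U) uniformity \<and> small_on \<rho> (\<lambda>s. f s - g s) (\<epsilon> *\<^sub>R (a + b)) U)"
    proof (rule densely_mono, elim exE conjE, intro exI conjI)
      fix \<rho> :: "'e orth" and U
      assume r: "\<rho> \<in> band_projections" and s: "small_on \<rho> f ((\<epsilon>/2) *\<^sub>R (a + b)) U" "small_on \<rho> g ((\<epsilon>/2) *\<^sub>R (a + b)) U"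
      have "le_on \<rho> (nrm (f s - g s - (f t - g t))) (\<epsilon> *\<^sub>R (a + b))" if st: "(s, t) \<in> U" for s t
      proof -
        have "f s - g s - (f t - g t) = (f s - f t) - (g s - g t)" by simp
        hence "le_on \<rho> (nrm (f s - g s - (f t - g t))) (nrm (f s - f t) + nrm (g s - g t))"
          using nrm_diff_le r by (metis le_onI)
        moreover have "le_on \<rho> (nrm (f s - f t) + nrm (g s - g t)) ((\<epsilon>/2) *\<^sub>R (a + b) + (\<epsilon>/2) *\<^sub>R (a + b))"
          using s st by (intro le_on_add) (auto simp: small_on_def)
        moreover have "(\<epsilon>/2) *\<^sub>R (a + b) + (\<epsilon>/2) *\<^sub>R (a + b) = \<epsilon> *\<^sub>R (a + b)"
          by (simp flip: scaleR_add_left)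
        ultimately show ?thesis using le_on_trans by metis
      qed
      thus "small_on \<rho> (\<lambda>s. f s - g s) (\<epsilon> *\<^sub>R (a + b)) U" by (auto simp: small_on_def)
    qed
  qed
qed

lemma cuo_const: "(\<lambda>s. c) \<in> cuo nrm"
proof (rule cuoI)
  show "nrm c \<le> nrm c" ..
  fix \<pi> :: "'e orth" and \<epsilon> :: real assume p: "\<pi> \<in> band_projections" "0 < \<epsilon>"
  have "small_on \<rho> (\<lambda>s. c) (\<epsilon> *\<^sub>R nrm c) UNIV" if "\<rho> \<in> band_projections" for \<rho>
    using that p nrm_ge_0 by (auto simp: small_on_def nrm_0 intro!: le_onI scaleR_nonneg_nonneg)
  thus "densely \<pi> (\<lambda>\<rho>. \<exists>U. eventually (\<lambda>p. p \<in> U) uniformity \<and> small_on \<rho> (\<lambda>s. c) (\<epsilon> *\<^sub>R nrm c) U)"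
    unfolding densely_def by (metis UNIV_I always_eventually order_refl)
qed

lemma cuo_minus: "f \<in> cuo nrm \<Longrightarrow> (\<lambda>s. - f s) \<in> cuo nrm"
  using cuo_diff[OF cuo_const[of 0]] by simp

lemma cuo_add: "f \<in> cuo nrm \<Longrightarrow> g \<in> cuo nrm \<Longrightarrow> (\<lambda>s. f s + g s) \<in> cuo nrm"
  using cuo_diff[OF _ cuo_minus, of f g] by simp

text \<open>Membership is itself a local matter: the dominating function \<open>f\<close> may change
  from part to part. This is what puts mixings of uniformly order continuous functions back into the
  space.\<close>

lemma cuo_local:
  fixes h :: "'s::uniform_space \<Rightarrow> 'x"
  assumes b: "\<And>s. nrm (h s) \<le> b"
    and loc: "densely 1 (\<lambda>\<rho>. \<exists>f\<in>cuo nrm. \<forall>s t. le_on \<rho> (nrm (h s - h t)) (nrm (f s - f t)))"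
  shows "h \<in> cuo nrm"
proof (rule cuoI)
  show "nrm (h s) \<le> b" for s by (rule b)
  have b0: "0 \<le> b" by (rule order_trans[OF nrm_ge_0 b])
  fix \<pi> :: "'e orth" and \<epsilon> :: real assume p: "\<pi> \<in> band_projections" "full \<pi> b" "0 < \<epsilon>"
  have "densely \<pi> (\<lambda>\<rho>. \<exists>f\<in>cuo nrm. \<forall>s t. le_on \<rho> (nrm (h s - h t)) (nrm (f s - f t)))"
    using loc bp_le_one[OF p(1)] by (rule densely_subset)
  thus "densely \<pi> (\<lambda>\<rho>. \<exists>U. eventually (\<lambda>p. p \<in> U) uniformity \<and> small_on \<rho> h (\<epsilon> *\<^sub>R b) U)"
  proof (rule densely_densely)
    fix \<rho> assume r: "\<rho> \<in> band_projections" "\<rho> \<le> \<pi>"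
      and "\<exists>f\<in>cuo nrm. \<forall>s t. le_on \<rho> (nrm (h s - h t)) (nrm (f s - f t))"
    then obtain f where f: "f \<in> cuo nrm" "\<And>s t. le_on \<rho> (nrm (h s - h t)) (nrm (f s - f t))" by blast
    have "densely \<rho> (\<lambda>\<rho>. \<exists>U. eventually (\<lambda>p. p \<in> U) uniformity \<and> small_on \<rho> f (\<epsilon> *\<^sub>R b) U)"
      using cuo_modulus[OF f(1) b0 full_down[OF p(2) r(2)] r(1) p(3)] .
    thus "densely \<rho> (\<lambda>\<rho>. \<exists>U. eventually (\<lambda>p. p \<in> U) uniformity \<and> small_on \<rho> h (\<epsilon> *\<^sub>R b) U)"
    proof (rule densely_mono, elim exE conjE, intro exI conjI)
      fix \<kappa> U assume k: "\<kappa> \<in> band_projections" "\<kappa> \<le> \<rho>" "small_on \<kappa> f (\<epsilon> *\<^sub>R b) U"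
      have "le_on \<kappa> (nrm (h s - h t)) (\<epsilon> *\<^sub>R b)" if "(s, t) \<in> U" for s t
        using le_on_trans[OF le_on_down[OF f(2) k(1) r(1) k(2)]] k(3) that by (auto simp: small_on_def)
      thus "small_on \<kappa> h (\<epsilon> *\<^sub>R b) U" by (auto simp: small_on_def)
    qed
  qed
qed

text \<open>The place where compactness of \<open>S\<close> enters; limits along ultrafilters and
  step approximations both rest on the finiteness of this cover.\<close>

lemma cuo_cover:
  assumes "compact (UNIV :: 's::uniform_space set)" and f: "(f :: 's \<Rightarrow> 'x) \<in> cuo nrm"
    and e: "0 \<le> e" "full \<pi> e" "\<pi> \<in> band_projections" "0 < \<epsilon>"
  shows "densely \<pi> (\<lambda>\<rho>. \<exists>C. finite C \<and> \<Union>C = UNIV \<and> (\<forall>A\<in>C. small_on \<rho> f (\<epsilon> *\<^sub>R e) (A \<times> A)))"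
  using cuo_modulus[OF f e]
proof (rule densely_mono)
  fix \<rho> assume r: "\<rho> \<in> band_projections" "\<exists>U. eventually (\<lambda>p. p \<in> U) uniformity \<and> small_on \<rho> f (\<epsilon> *\<^sub>R e) U"
  then obtain U where U: "eventually (\<lambda>p. p \<in> U) uniformity" "small_on \<rho> f (\<epsilon> *\<^sub>R e) U" by blast
  obtain C where C: "finite C" "\<Union>C = (UNIV :: 's set)" "\<forall>A\<in>C. A \<times> A \<subseteq> U"
    using compact_uniform_cover[OF assms(1) U(1)] by blast
  thus "\<exists>C. finite C \<and> \<Union>C = UNIV \<and> (\<forall>A\<in>C. small_on \<rho> f (\<epsilon> *\<^sub>R e) (A \<times> A))"
    by (intro exI[of _ C]) (simp add: small_on_down[OF U(2) r(1) r(1) order_refl])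
qed

end

interpretation E: band_normed orth_apply abs
  by standard (simp_all add: abs_triangle_ineq)

interpretation L: band_normed "(*)" abs
  by standard (simp_all add: abs_triangle_ineq)

text \<open>Allows the two norms to live on different spaces: a typical use is the passage from
  \<open>f\<close> to the lattice-valued function \<open>nrm (f s - y)\<close>.\<close>

lemma cuo_lipschitz:
  assumes N: "band_normed P nrm" and M: "band_normed P nrm'"
    and f: "f \<in> cuo nrm" and b: "\<And>s. nrm' (h s) \<le> b"
    and l: "\<And>s t. nrm' (h s - h t) \<le> nrm (f s - f t)"
  shows "h \<in> cuo nrm'"
proof -
  interpret N: band_normed P nrm by (rule N)
  interpret M: band_normed P nrm' by (rule M)
  have b0: "0 \<le> b" by (rule order_trans[OF M.nrm_ge_0 b])
  show ?thesis
  proof (rule M.cuoI)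
    show "nrm' (h s) \<le> b" for s by (rule b)
    fix \<pi> :: "'a orth" and \<epsilon> :: real assume p: "\<pi> \<in> band_projections" "N.full \<pi> b" "0 < \<epsilon>"
    have "densely \<pi> (\<lambda>\<rho>. \<exists>U. eventually (\<lambda>p. p \<in> U) uniformity \<and> N.small_on \<rho> f (\<epsilon> *\<^sub>R b) U)"
      using N.cuo_modulus[OF f b0 p(2,1,3)] .
    thus "densely \<pi> (\<lambda>\<rho>. \<exists>U. eventually (\<lambda>p. p \<in> U) uniformity \<and> M.small_on \<rho> h (\<epsilon> *\<^sub>R b) U)"
    proof (rule densely_mono, elim exE conjE, intro exI conjI)
      fix \<rho> U assume r: "\<rho> \<in> band_projections" "N.small_on \<rho> f (\<epsilon> *\<^sub>R b) U"
      thus "M.small_on \<rho> h (\<epsilon> *\<^sub>R b) U"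
        unfolding N.small_on_def M.small_on_def by (auto intro: N.le_on_trans[OF N.le_onI[OF l r(1)]])
    qed
  qed
qed

text \<open>In \<Lambda> the identity is a regulator that is full everywhere, so no carrier has to
  be split off there.\<close>

lemma full_one: "L.full \<pi> 1" by (simp add: L.full_def)

lemma cuo_orthI:
  assumes b: "\<And>s. \<bar>\<phi> s\<bar> \<le> b"
    and loc: "\<And>\<epsilon>. 0 < \<epsilon> \<Longrightarrow>
      densely 1 (\<lambda>\<rho>. \<exists>U. eventually (\<lambda>p. p \<in> U) uniformity \<and> L.small_on \<rho> \<phi> (\<epsilon> *\<^sub>R 1) U)"
  shows "\<phi> \<in> cuo_orth"
proof (rule L.cuoI_gen[of \<phi> b 1, OF b orth_zero_le_one])
  show "L.small_on \<rho> \<phi> 0 UNIV" if "\<rho> * 1 = 0" for \<rho>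
    using that by (simp add: L.small_on_def L.le_on_def)
  show "densely \<pi> (\<lambda>\<rho>. \<exists>U. eventually (\<lambda>p. p \<in> U) uniformity \<and> L.small_on \<rho> \<phi> (\<epsilon> *\<^sub>R 1) U)"
    if "\<pi> \<in> band_projections" "0 < \<epsilon>" for \<pi> \<epsilon>
    using densely_subset[OF loc[OF that(2)] bp_le_one[OF that(1)]] .
qed

lemma orth_abs_mult_le: "\<bar>S * T\<bar> \<le> \<bar>S\<bar> * \<bar>T::'e::dedekind_vector_lattice orth\<bar>"
proof (rule abs_leI)
  have "orth_apply (S * T) x \<le> orth_apply (\<bar>S\<bar> * \<bar>T\<bar>) x \<and> orth_apply (- (S * T)) x \<le> orth_apply (\<bar>S\<bar> * \<bar>T\<bar>) x"
    if "0 \<le> x" for x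
  proof -
    have "\<bar>orth_apply S (orth_apply T x)\<bar> \<le> orth_apply \<bar>S\<bar> \<bar>orth_apply T x\<bar>" by (rule orth_abs_le)
    also have "\<dots> \<le> orth_apply \<bar>S\<bar> (orth_apply \<bar>T\<bar> x)"
      using orth_abs_le[of T x] that by (intro orth_apply_mono) auto
    finally show ?thesis by (simp add: orth_simps abs_le_iff)
  qed
  thus "S * T \<le> \<bar>S\<bar> * \<bar>T\<bar>" "- (S * T) \<le> \<bar>S\<bar> * \<bar>T\<bar>" by (simp_all add: orth_le_iff)
qed

lemma le_on_mult_left:
  assumes "L.le_on \<rho> x y" "0 \<le> a" "\<rho> \<in> band_projections"
  shows "L.le_on \<rho> (a * x) (a * y)"
proof -
  have "a * (\<rho> * x) \<le> a * (\<rho> * y)" by (rule orth_mult_mono[OF assms(2) assms(1)[unfolded L.le_on_def]])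
  moreover have "a * (\<rho> * z) = \<rho> * (a * z)" for z
    using band_projection_commute[OF assms(3), of a] by (simp flip: mult.assoc)
  ultimately show ?thesis by (simp add: L.le_on_def)
qed

lemma le_on_mult_right:
  assumes "L.le_on \<rho> x y" "0 \<le> a"
  shows "L.le_on \<rho> (x * a) (y * a)"
proof -
  have "(\<rho> * x) * a \<le> (\<rho> * y) * a" by (rule orth_mult_mono_right[OF assms(2) assms(1)[unfolded L.le_on_def]])
  thus ?thesis by (simp add: L.le_on_def mult.assoc)
qed

lemma cuo_orth_mult:
  assumes "\<phi> \<in> cuo_orth" "\<psi> \<in> cuo_orth"
  shows "(\<lambda>s. \<phi> s * \<psi> s) \<in> cuo_orth"
proof -
  obtain a where a: "0 \<le> a" "\<And>s. \<bar>\<phi> s\<bar> \<le> a" using L.cuo_bounded[OF assms(1)] by blast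
  obtain b where b: "0 \<le> b" "\<And>s. \<bar>\<psi> s\<bar> \<le> b" using L.cuo_bounded[OF assms(2)] by blast
  show ?thesis
  proof (rule L.cuoI_gen)
    \<comment> \<open>The product rule produces the error \<open>\<epsilon> (a + b)\<close>; adding
      1 makes the regulator vanish on no nonzero part.\<close>
    let ?e = "a + b + 1 :: 'b orth"
    show "\<bar>\<phi> s * \<psi> s\<bar> \<le> a * b" for s
    proof -
      have "\<bar>\<phi> s * \<psi> s\<bar> \<le> \<bar>\<phi> s\<bar> * \<bar>\<psi> s\<bar>" by (rule orth_abs_mult_le)
      also have "\<dots> \<le> a * \<bar>\<psi> s\<bar>" by (intro orth_mult_mono_right a) simp
      also have "\<dots> \<le> a * b" by (intro orth_mult_mono a b)
      finally show ?thesis .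
    qed
    show e0: "0 \<le> ?e" by (intro add_nonneg_nonneg a(1) b(1) orth_zero_le_one)
    fix \<rho> :: "'b orth"
    assume r: "\<rho> \<in> band_projections" "\<rho> * ?e = 0"
    have "1 \<le> ?e" using add_nonneg_nonneg[OF a(1) b(1)] by simp
    hence "\<rho> * 1 \<le> \<rho> * ?e" by (intro orth_mult_mono bp_nonneg r)
    hence "\<rho> = 0" using r bp_nonneg[OF r(1)] by (simp add: order_antisym)
    thus "L.small_on \<rho> (\<lambda>s. \<phi> s * \<psi> s) 0 UNIV" by (simp add: L.small_on_def L.le_on_def)
  next
    let ?e = "a + b + 1 :: 'b orth"
    fix \<pi> :: "'b orth" and \<epsilon> :: real assume p: "\<pi> \<in> band_projections" "0 < \<epsilon>"
    have "densely \<pi> (\<lambda>\<rho>. \<exists>U. eventually (\<lambda>p. p \<in> U) uniformity \<and> L.small_on \<rho> \<phi> (\<epsilon> *\<^sub>R 1) U \<and> L.small_on \<rho> \<psi> (\<epsilon> *\<^sub>R 1) U)"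
      using p orth_zero_le_one by (intro L.cuo_uniform_pair assms full_one)
    thus "densely \<pi> (\<lambda>\<rho>. \<exists>U. eventually (\<lambda>p. p \<in> U) uniformity \<and> L.small_on \<rho> (\<lambda>s. \<phi> s * \<psi> s) (\<epsilon> *\<^sub>R ?e) U)"
    proof (rule densely_mono, elim exE conjE, intro exI conjI)
      fix \<rho> :: "'b orth" and U
      assume r: "\<rho> \<in> band_projections" and s: "L.small_on \<rho> \<phi> (\<epsilon> *\<^sub>R 1) U" "L.small_on \<rho> \<psi> (\<epsilon> *\<^sub>R 1) U"
      have "L.le_on \<rho> \<bar>\<phi> s * \<psi> s - \<phi> t * \<psi> t\<bar> (\<epsilon> *\<^sub>R ?e)" if st: "(s, t) \<in> U" for s t
      proof -
        have "\<phi> s * \<psi> s - \<phi> t * \<psi> t = \<phi> s * (\<psi> s - \<psi> t) + (\<phi> s - \<phi> t) * \<psi> t"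
          by (simp add: algebra_simps)
        hence "\<bar>\<phi> s * \<psi> s - \<phi> t * \<psi> t\<bar> \<le> \<bar>\<phi> s * (\<psi> s - \<psi> t)\<bar> + \<bar>(\<phi> s - \<phi> t) * \<psi> t\<bar>"
          by (simp only: abs_triangle_ineq)
        also have "\<dots> \<le> \<bar>\<phi> s\<bar> * \<bar>\<psi> s - \<psi> t\<bar> + \<bar>\<phi> s - \<phi> t\<bar> * \<bar>\<psi> t\<bar>"
          by (intro add_mono orth_abs_mult_le)
        also have "\<dots> \<le> a * \<bar>\<psi> s - \<psi> t\<bar> + \<bar>\<phi> s - \<phi> t\<bar> * b"
          by (intro add_mono orth_mult_mono orth_mult_mono_right a b) auto
        finally have 1: "L.le_on \<rho> \<bar>\<phi> s * \<psi> s - \<phi> t * \<psi> t\<bar> (a * \<bar>\<psi> s - \<psi> t\<bar> + \<bar>\<phi> s - \<phi> t\<bar> * b)"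
          using r by (rule L.le_onI)
        have 2: "L.le_on \<rho> (a * \<bar>\<psi> s - \<psi> t\<bar> + \<bar>\<phi> s - \<phi> t\<bar> * b) (a * (\<epsilon> *\<^sub>R 1) + (\<epsilon> *\<^sub>R 1) * b)"
          using s st a b r by (intro L.le_on_add le_on_mult_left le_on_mult_right) (auto simp: L.small_on_def)
        have "a * (\<epsilon> *\<^sub>R 1) + (\<epsilon> *\<^sub>R 1) * b = \<epsilon> *\<^sub>R (a + b)" by (simp add: orth_scaleR_mult algebra_simps)
        also have "\<dots> \<le> \<epsilon> *\<^sub>R ?e" using p orth_zero_le_one by (intro scaleR_left_mono) simp_all
        finally show ?thesis by (rule L.le_on_trans[OF L.le_on_trans[OF 1 2] L.le_onI[OF _ r]])
      qed
      thus "L.small_on \<rho> (\<lambda>s. \<phi> s * \<psi> s) (\<epsilon> *\<^sub>R ?e) U" by (auto simp: L.small_on_def)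
    qed
  qed
qed

lemma cuo_orth_scaleR: "\<phi> \<in> cuo_orth \<Longrightarrow> (\<lambda>s. r *\<^sub>R \<phi> s) \<in> cuo_orth"
  using cuo_orth_mult[OF L.cuo_const[of "r *\<^sub>R 1"], of \<phi>] by (simp add: orth_scaleR_mult)

section \<open>Banach--Kantorovich spaces\<close>

lemma (in band_module) le_on_split:
  assumes "le_on (\<rho> * \<tau>) x y" "le_on (\<rho> * (1 - \<tau>)) x y"
  shows "le_on \<rho> x y"
proof -
  have "P \<rho> z = P (\<rho> * \<tau>) z + P (\<rho> * (1 - \<tau>)) z" for z
    by (simp add: P_plus[symmetric] algebra_simps)
  thus ?thesis using assms unfolding le_on_def by (simp add: add_mono)
qed

lemma (in band_module) le_on_zero: "le_on 0 x y" by (simp add: le_on_def P_zero)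

lemma (in band_module) le_on_mult:
  assumes "le_on \<rho> x y" "\<kappa> \<in> band_projections" "\<rho> \<in> band_projections"
  shows "le_on (\<rho> * \<kappa>) x y" "le_on (\<kappa> * \<rho>) x y"
  by (rule le_on_down[OF assms(1) bp_mult[OF assms(3,2)] assms(3) bp_mult_le(1)[OF assms(3,2)]],
      rule le_on_down[OF assms(1) bp_mult[OF assms(2,3)] assms(3) bp_mult_le(2)[OF assms(2,3)]])

lemma (in band_module) P_comp:
  "\<pi> \<in> band_projections \<Longrightarrow> P \<pi> (P \<pi> x) = P \<pi> x"
  "\<pi> \<in> band_projections \<Longrightarrow> P \<pi> (P (1 - \<pi>) x) = 0"
  "\<pi> \<in> band_projections \<Longrightarrow> P (1 - \<pi>) (P \<pi> x) = 0"
  by (simp_all add: P_mult[symmetric] bp_idem bp_compl_mult P_zero)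

text \<open>A part that meets no \<open>\<pi> i\<close> would make \<open>1 - \<kappa>\<close> an
  upper bound of the whole family.\<close>

lemma partition_densely:
  assumes "partition_of_unity I \<pi>"
  shows "densely 1 (\<lambda>\<rho>. \<exists>i\<in>I. \<rho> \<le> \<pi> i)"
  unfolding densely_def
proof (intro ballI impI, rule ccontr)
  fix \<kappa> :: "'b orth" assume k: "\<kappa> \<in> band_projections" "\<kappa> \<noteq> 0"
    and n: "\<not> (\<exists>\<rho>\<in>band_projections. \<rho> \<noteq> 0 \<and> \<rho> \<le> \<kappa> \<and> (\<exists>i\<in>I. \<rho> \<le> \<pi> i))"
  have "\<pi> i \<le> 1 - \<kappa>" if i: "i \<in> I" for i
  proof -
    have p: "\<pi> i \<in> band_projections" using assms i by (auto simp: partition_of_unity_def)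
    have "\<pi> i * \<kappa> = 0" using n i bp_mult[OF p k(1)] bp_mult_le[OF p k(1)] by blast
    thus ?thesis using p k(1) by (subst bp_le_iff) (auto simp: algebra_simps)
  qed
  hence "1 - \<kappa> = 1" using assms k(1) bp_compl by (auto simp: partition_of_unity_def)
  thus False using k by simp
qed

lemma (in band_module) partition_le:
  assumes "partition_of_unity I \<pi>" "\<And>i. i \<in> I \<Longrightarrow> le_on (\<pi> i) x y"
  shows "x \<le> y"
proof (rule local_le1[OF densely_mono[OF partition_densely[OF assms(1)]]])
  fix \<rho> assume r: "\<rho> \<in> band_projections" "\<exists>i\<in>I. \<rho> \<le> \<pi> i"
  then obtain i where i: "i \<in> I" "\<rho> \<le> \<pi> i" by blast
  have "\<pi> i \<in> band_projections" using assms(1) i by (auto simp: partition_of_unity_def)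
  thus "le_on \<rho> x y" using le_on_down[OF assms(2)[OF i(1)] r(1)] i(2) by blast
qed

section \<open>Local approximation of orthomorphisms by real numbers\<close>

lemma le_on_orth_apply:
  assumes "L.le_on \<rho> S T" "0 \<le> x"
  shows "E.le_on \<rho> (orth_apply S x) (orth_apply T x)"
  using assms by (auto simp: L.le_on_def E.le_on_def orth_le_iff orth_simps)

lemma orth_bounded: "densely 1 (\<lambda>\<rho>. \<exists>n::nat. L.le_on \<rho> \<bar>\<alpha>\<bar> (real n *\<^sub>R 1))"
  by (rule L.bounded_densely[OF orth_zero_le_one full_one bp_one])

text \<open>The bound \<open>M\<close> on the approximating number is recorded because polynomials
  will be compared with continuous functions only on a bounded interval.\<close>

lemma orth_approx_on:
  assumes "\<pi> \<in> band_projections" "L.le_on \<pi> \<bar>\<alpha>\<bar> (M *\<^sub>R 1)" "0 \<le> M" "0 < \<epsilon>"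
  shows "densely \<pi> (\<lambda>\<rho>. \<exists>t. \<bar>t\<bar> \<le> M \<and> L.le_on \<rho> \<bar>\<alpha> - t *\<^sub>R 1\<bar> (\<epsilon> *\<^sub>R 1))"
proof -
  have "L.le_on \<pi> (- \<alpha>) (M *\<^sub>R 1)" using assms by (simp add: L.le_on_abs_iff)
  hence "- (\<pi> * \<alpha>) \<le> M *\<^sub>R \<pi>" by (simp add: L.le_on_def orth_scaleR_mult)
  hence "- (M *\<^sub>R \<pi>) \<le> \<pi> * \<alpha>" by (simp only: minus_le_iff)
  hence "L.le_on \<pi> ((- M) *\<^sub>R 1) \<alpha>" by (simp add: L.le_on_def orth_scaleR_mult)
  hence "densely \<pi> (\<lambda>\<rho>. \<exists>c. - M \<le> c \<and> c \<le> M \<and> L.le_on \<rho> \<bar>\<alpha> - c *\<^sub>R 1\<bar> (\<epsilon> *\<^sub>R 1))"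
    using assms by (intro L.real_approx orth_zero_le_one) (auto simp: L.le_on_abs_iff)
  thus ?thesis by (rule densely_mono) (meson abs_leI minus_le_iff)
qed

lemma orth_approx:
  assumes "0 < \<epsilon>"
  shows "densely 1 (\<lambda>\<rho>. \<exists>t. L.le_on \<rho> \<bar>\<alpha> - t *\<^sub>R 1\<bar> (\<epsilon> *\<^sub>R 1))"
proof (rule densely_densely[OF orth_bounded])
  fix \<rho> assume "\<rho> \<in> band_projections" "\<exists>n::nat. L.le_on \<rho> \<bar>\<alpha>\<bar> (real n *\<^sub>R 1)"
  then obtain n :: nat where n: "\<rho> \<in> band_projections" "L.le_on \<rho> \<bar>\<alpha>\<bar> (real n *\<^sub>R 1)" by blast
  show "densely \<rho> (\<lambda>\<rho>. \<exists>t. L.le_on \<rho> \<bar>\<alpha> - t *\<^sub>R 1\<bar> (\<epsilon> *\<^sub>R 1))"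
    by (rule densely_mono[OF orth_approx_on[OF n _ assms]]) auto
qed

lemma scaleR_abs: "\<bar>r *\<^sub>R x\<bar> = \<bar>r\<bar> *\<^sub>R \<bar>x::'v::dedekind_vector_lattice\<bar>"
proof -
  have le: "\<bar>s *\<^sub>R y\<bar> \<le> \<bar>s\<bar> *\<^sub>R \<bar>y\<bar>" for s and y :: 'v
  proof (cases "0 \<le> s")
    case True
    have "s *\<^sub>R y \<le> s *\<^sub>R \<bar>y\<bar>" "s *\<^sub>R (- y) \<le> s *\<^sub>R \<bar>y\<bar>"
      using True by (intro scaleR_left_mono abs_ge_self abs_ge_minus_self; simp)+
    thus ?thesis using True by (intro abs_leI) auto
  next
    case False
    have "(- s) *\<^sub>R y \<le> (- s) *\<^sub>R \<bar>y\<bar>" "(- s) *\<^sub>R (- y) \<le> (- s) *\<^sub>R \<bar>y\<bar>"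
      using False by (intro scaleR_left_mono abs_ge_self abs_ge_minus_self; simp)+
    thus ?thesis using False by (intro abs_leI) auto
  qed
  show ?thesis
  proof (cases "r = 0")
    case False
    have "\<bar>r\<bar> *\<^sub>R \<bar>(1/r) *\<^sub>R (r *\<^sub>R x)\<bar> \<le> \<bar>r\<bar> *\<^sub>R (\<bar>1/r\<bar> *\<^sub>R \<bar>r *\<^sub>R x\<bar>)"
      by (intro scaleR_left_mono le) simp
    hence "\<bar>r\<bar> *\<^sub>R \<bar>x\<bar> \<le> \<bar>r *\<^sub>R x\<bar>" using False by simp
    thus ?thesis using le[of r x] by (rule order_antisym[rotated])
  qed simp
qed

lemma abs_real_one: "\<bar>t *\<^sub>R (1::'e::dedekind_vector_lattice orth)\<bar> = \<bar>t\<bar> *\<^sub>R 1"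
  by (simp add: scaleR_abs orth_zero_le_one)

text \<open>Approximate evaluation: the rules below reduce arithmetic in \<Lambda> to that of real
  numbers with error terms.\<close>

definition near :: "'e::dedekind_vector_lattice orth \<Rightarrow> 'e orth \<Rightarrow> real \<Rightarrow> real \<Rightarrow> bool"
  where "near \<rho> \<alpha> t \<epsilon> \<longleftrightarrow> L.le_on \<rho> \<bar>\<alpha> - t *\<^sub>R 1\<bar> (\<epsilon> *\<^sub>R 1)"

lemma near_unique: "near \<rho> \<alpha> t \<epsilon> \<Longrightarrow> near \<rho> \<alpha> t' \<epsilon>' \<Longrightarrow> \<rho> \<in> band_projections \<Longrightarrow> \<rho> \<noteq> 0 \<Longrightarrow> \<bar>t - t'\<bar> \<le> \<epsilon> + \<epsilon>'"
proof -
  assume a: "near \<rho> \<alpha> t \<epsilon>" "near \<rho> \<alpha> t' \<epsilon>'" "\<rho> \<in> band_projections" "\<rho> \<noteq> 0"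
  have "\<bar>t - t'\<bar> *\<^sub>R 1 = \<bar>(\<alpha> - t' *\<^sub>R 1) - (\<alpha> - t *\<^sub>R 1)\<bar>"
    unfolding abs_real_one[symmetric] by (simp add: algebra_simps)
  also have "\<dots> \<le> \<bar>\<alpha> - t' *\<^sub>R 1\<bar> + \<bar>\<alpha> - t *\<^sub>R 1\<bar>" by (rule abs_triangle_ineq4)
  finally have "L.le_on \<rho> (\<bar>t - t'\<bar> *\<^sub>R 1) (\<bar>\<alpha> - t' *\<^sub>R 1\<bar> + \<bar>\<alpha> - t *\<^sub>R 1\<bar>)" using a by (intro L.le_onI)
  moreover have "L.le_on \<rho> (\<bar>\<alpha> - t' *\<^sub>R 1\<bar> + \<bar>\<alpha> - t *\<^sub>R 1\<bar>) (\<epsilon>' *\<^sub>R 1 + \<epsilon> *\<^sub>R 1)"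
    using a by (intro L.le_on_add) (auto simp: near_def)
  ultimately have "L.le_on \<rho> (\<bar>t - t'\<bar> *\<^sub>R 1) ((\<epsilon> + \<epsilon>') *\<^sub>R 1)"
    using L.le_on_trans by (simp add: scaleR_add_left add.commute)
  thus ?thesis using L.le_on_real[OF orth_zero_le_one full_one] a by blast
qed

lemma near_densely: "0 < \<epsilon> \<Longrightarrow> densely 1 (\<lambda>\<rho>. \<exists>t. near \<rho> \<alpha> t \<epsilon>)"
  unfolding near_def by (rule orth_approx)

lemma near_down: "near \<rho> \<alpha> t \<epsilon> \<Longrightarrow> \<kappa> \<in> band_projections \<Longrightarrow> \<rho> \<in> band_projections \<Longrightarrow> \<kappa> \<le> \<rho> \<Longrightarrow> near \<kappa> \<alpha> t \<epsilon>"
  unfolding near_def by (rule L.le_on_down)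

lemma near_densely2:
  assumes "0 < \<epsilon>"
  shows "densely 1 (\<lambda>\<rho>. (\<exists>t. near \<rho> \<alpha> t \<epsilon>) \<and> (\<exists>u. near \<rho> \<mu> u \<epsilon>))"
  using near_densely[OF assms] by (intro densely_conj) (auto intro: near_down)

lemma near_add: "near \<rho> \<alpha> t \<epsilon> \<Longrightarrow> near \<rho> \<mu> u \<delta> \<Longrightarrow> \<rho> \<in> band_projections \<Longrightarrow> near \<rho> (\<alpha> + \<mu>) (t + u) (\<epsilon> + \<delta>)"
proof -
  assume a: "near \<rho> \<alpha> t \<epsilon>" "near \<rho> \<mu> u \<delta>" "\<rho> \<in> band_projections"
  have "\<alpha> + \<mu> - (t + u) *\<^sub>R 1 = (\<alpha> - t *\<^sub>R 1) + (\<mu> - u *\<^sub>R 1)" by (simp add: algebra_simps)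
  hence "\<bar>\<alpha> + \<mu> - (t + u) *\<^sub>R 1\<bar> \<le> \<bar>\<alpha> - t *\<^sub>R 1\<bar> + \<bar>\<mu> - u *\<^sub>R 1\<bar>" by (simp only: abs_triangle_ineq)
  from L.le_onI[OF this a(3)] L.le_on_add[OF a(1,2)[unfolded near_def]]
  show ?thesis unfolding near_def scaleR_add_left by (rule L.le_on_trans)
qed

lemma near_scaleR: "near \<rho> \<alpha> t \<epsilon> \<Longrightarrow> near \<rho> (r *\<^sub>R \<alpha>) (r * t) (\<bar>r\<bar> * \<epsilon>)"
proof -
  assume "near \<rho> \<alpha> t \<epsilon>"
  hence "L.le_on \<rho> (\<bar>r\<bar> *\<^sub>R \<bar>\<alpha> - t *\<^sub>R 1\<bar>) (\<bar>r\<bar> *\<^sub>R (\<epsilon> *\<^sub>R 1))" unfolding near_def by (intro L.le_on_scaleR) auto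
  thus ?thesis by (simp add: near_def scaleR_abs[symmetric] scaleR_diff_right)
qed

lemma near_bound: "near \<rho> \<alpha> t \<epsilon> \<Longrightarrow> \<rho> \<in> band_projections \<Longrightarrow> L.le_on \<rho> \<bar>\<alpha>\<bar> ((\<bar>t\<bar> + \<epsilon>) *\<^sub>R 1)"
proof -
  assume a: "near \<rho> \<alpha> t \<epsilon>" "\<rho> \<in> band_projections"
  have "\<bar>\<alpha>\<bar> \<le> \<bar>t *\<^sub>R 1\<bar> + \<bar>\<alpha> - t *\<^sub>R 1\<bar>" using abs_triangle_ineq[of "t *\<^sub>R 1" "\<alpha> - t *\<^sub>R 1"] by simp
  from L.le_onI[OF this a(2)] L.le_on_add[OF L.le_on_refl a(1)[unfolded near_def]]
  show ?thesis unfolding abs_real_one scaleR_add_left by (rule L.le_on_trans)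
qed

text \<open>The error comes from
  \<open>\<alpha> \<mu> - t u = (\<alpha> - t) \<mu> + t (\<mu> - u)\<close> together with the bound
  \<open>\<bar>u\<bar> + \<delta>\<close> for the modulus of \<open>\<mu>\<close>.\<close>

lemma near_mult:
  assumes "near \<rho> \<alpha> t \<epsilon>" "near \<rho> \<mu> u \<delta>" "\<rho> \<in> band_projections" "0 \<le> \<epsilon>" "0 \<le> \<delta>"
  shows "near \<rho> (\<alpha> * \<mu>) (t * u) (\<epsilon> * (\<bar>u\<bar> + \<delta>) + \<bar>t\<bar> * \<delta>)"
proof -
  have "\<alpha> * \<mu> - (t * u) *\<^sub>R 1 = (\<alpha> - t *\<^sub>R 1) * \<mu> + t *\<^sub>R (\<mu> - u *\<^sub>R 1)"
    by (simp add: algebra_simps orth_scaleR_mult)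
  hence "\<bar>\<alpha> * \<mu> - (t * u) *\<^sub>R 1\<bar> \<le> \<bar>(\<alpha> - t *\<^sub>R 1) * \<mu>\<bar> + \<bar>t *\<^sub>R (\<mu> - u *\<^sub>R 1)\<bar>"
    by (simp only: abs_triangle_ineq)
  also have "\<dots> \<le> \<bar>\<alpha> - t *\<^sub>R 1\<bar> * \<bar>\<mu>\<bar> + \<bar>t\<bar> *\<^sub>R \<bar>\<mu> - u *\<^sub>R 1\<bar>"
    unfolding scaleR_abs by (intro add_right_mono orth_abs_mult_le)
  finally have 1: "L.le_on \<rho> \<bar>\<alpha> * \<mu> - (t * u) *\<^sub>R 1\<bar> (\<bar>\<alpha> - t *\<^sub>R 1\<bar> * \<bar>\<mu>\<bar> + \<bar>t\<bar> *\<^sub>R \<bar>\<mu> - u *\<^sub>R 1\<bar>)"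
    using assms(3) by (rule L.le_onI)
  have 2: "L.le_on \<rho> (\<bar>\<alpha> - t *\<^sub>R 1\<bar> * \<bar>\<mu>\<bar> + \<bar>t\<bar> *\<^sub>R \<bar>\<mu> - u *\<^sub>R 1\<bar>) ((\<epsilon> *\<^sub>R 1) * \<bar>\<mu>\<bar> + \<bar>t\<bar> *\<^sub>R (\<delta> *\<^sub>R 1))"
    using assms by (intro L.le_on_add le_on_mult_right L.le_on_scaleR) (auto simp: near_def)
  have "L.le_on \<rho> ((\<epsilon> *\<^sub>R 1) * \<bar>\<mu>\<bar>) ((\<epsilon> *\<^sub>R 1) * ((\<bar>u\<bar> + \<delta>) *\<^sub>R 1))"
    using assms by (intro le_on_mult_left near_bound scaleR_nonneg_nonneg orth_zero_le_one)
  hence 3: "L.le_on \<rho> ((\<epsilon> *\<^sub>R 1) * \<bar>\<mu>\<bar> + \<bar>t\<bar> *\<^sub>R (\<delta> *\<^sub>R 1)) ((\<epsilon> *\<^sub>R 1) * ((\<bar>u\<bar> + \<delta>) *\<^sub>R 1) + \<bar>t\<bar> *\<^sub>R (\<delta> *\<^sub>R 1))"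
    by (intro L.le_on_add L.le_on_refl)
  have 4: "(\<epsilon> *\<^sub>R 1) * ((\<bar>u\<bar> + \<delta>) *\<^sub>R 1) + \<bar>t\<bar> *\<^sub>R (\<delta> *\<^sub>R 1) = (\<epsilon> * (\<bar>u\<bar> + \<delta>) + \<bar>t\<bar> * \<delta>) *\<^sub>R (1 :: 'a orth)"
    by (simp only: orth_scaleR_mult mult_1_left scaleR_scaleR) (simp add: scaleR_add_left mult.commute)
  show ?thesis using L.le_on_trans[OF L.le_on_trans[OF 1 2] 3] unfolding near_def 4 .
qed

lemma near_abs: "near \<rho> \<alpha> t \<epsilon> \<Longrightarrow> \<rho> \<in> band_projections \<Longrightarrow> near \<rho> \<bar>\<alpha>\<bar> \<bar>t\<bar> \<epsilon>"
  unfolding near_def using L.le_on_trans[OF L.le_onI[OF L.nrm_reverse]] abs_real_one by metis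

sublocale lattice_normed_space \<subseteq> X: band_normed orth_apply nrm
proof
  show "nrm 0 = 0" using nrm_scale[of 0 0] by simp
  show "nrm (- x) = nrm x" for x using nrm_scale[of "- 1" x] by simp
qed (rule nrm_nonneg nrm_triangle)+

section \<open>Band parts obtained from decomposability\<close>

context banach_kantorovich
begin

text \<open>Stands in for the action of \<open>\<pi>\<close> until the latter is constructed.
  Decomposability provides a candidate; \<open>band_part_unique\<close> shows that there is only
  one.\<close>

definition band_part :: "'e orth \<Rightarrow> 'x \<Rightarrow> 'x"
  where "band_part \<pi> x = (SOME a. nrm a = orth_apply \<pi> (nrm x) \<and> nrm (x - a) = orth_apply (1 - \<pi>) (nrm x))"

lemma nrm_band_part:
  assumes "\<pi> \<in> band_projections"
  shows "nrm (band_part \<pi> x) = orth_apply \<pi> (nrm x)" "nrm (x - band_part \<pi> x) = orth_apply (1 - \<pi>) (nrm x)"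
proof -
  have "0 \<le> orth_apply \<pi> (nrm x)" "0 \<le> orth_apply (1 - \<pi>) (nrm x)"
    using assms by (auto intro!: orth_apply_nonneg bp_nonneg nrm_nonneg simp del: diff_ge_0_iff_ge)
  then obtain a b where "x = a + b" "nrm a = orth_apply \<pi> (nrm x)" "nrm b = orth_apply (1 - \<pi>) (nrm x)"
    using decomposable[of "orth_apply \<pi> (nrm x)" "orth_apply (1 - \<pi>) (nrm x)" x] E.P_split by blast
  hence "\<exists>a. nrm a = orth_apply \<pi> (nrm x) \<and> nrm (x - a) = orth_apply (1 - \<pi>) (nrm x)"
    by (intro exI[of _ a]) simp
  from someI_ex[OF this]
  show "nrm (band_part \<pi> x) = orth_apply \<pi> (nrm x)" "nrm (x - band_part \<pi> x) = orth_apply (1 - \<pi>) (nrm x)"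
    unfolding band_part_def by auto
qed

text \<open>Two candidates both vanish outside \<open>\<pi>\<close> and both agree with
  \<open>x\<close> on \<open>\<pi>\<close>, so their difference has norm 0. The algebraic rules for
  band parts follow from this.\<close>

lemma band_part_unique:
  assumes p: "\<pi> \<in> band_projections" and a: "orth_apply (1 - \<pi>) (nrm a) = 0" "orth_apply \<pi> (nrm (x - a)) = 0"
  shows "band_part \<pi> x = a"
proof -
  let ?b = "band_part \<pi> x"
  have b: "orth_apply (1 - \<pi>) (nrm ?b) = 0" "orth_apply \<pi> (nrm (x - ?b)) = 0"
    using nrm_band_part[OF p, of x] E.P_comp[OF p] by auto
  have "E.le_on (1 - \<pi>) (nrm (?b - a)) (nrm ?b + nrm a)" using p by (intro E.le_onI X.nrm_diff_le) simp
  moreover have "E.le_on \<pi> (nrm (?b - a)) (nrm (x - a) + nrm (x - ?b))"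
    using X.nrm_diff_le[of "x - a" "x - ?b"] p by (intro E.le_onI) auto
  ultimately have "E.le_on (1 - \<pi>) (nrm (?b - a)) 0" "E.le_on \<pi> (nrm (?b - a)) 0"
    unfolding E.le_on_def E.P_add a b by (auto simp: E.P_simps)
  hence "E.le_on 1 (nrm (?b - a)) 0" using E.le_on_split[of 1 \<pi> "nrm (?b - a)" 0] by simp
  hence "nrm (?b - a) = 0" using nrm_nonneg by (simp add: E.le_on_1 order_antisym)
  thus ?thesis using nrm_eq_0 by fastforce
qed

lemma band_part_null:
  assumes "\<pi> \<in> band_projections"
  shows "orth_apply (1 - \<pi>) (nrm (band_part \<pi> x)) = 0" "orth_apply \<pi> (nrm (x - band_part \<pi> x)) = 0"
  using nrm_band_part[OF assms] E.P_comp[OF assms] by auto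

lemma null_add:
  assumes "\<pi> \<in> band_projections" "orth_apply \<pi> (nrm a) = 0" "orth_apply \<pi> (nrm b) = 0"
  shows "orth_apply \<pi> (nrm (a + b)) = 0"
proof -
  have "orth_apply \<pi> (nrm (a + b)) \<le> orth_apply \<pi> (nrm a + nrm b)"
    using assms(1) by (intro orth_apply_mono bp_nonneg nrm_triangle)
  moreover have "0 \<le> orth_apply \<pi> (nrm (a + b))" using assms(1) by (intro orth_apply_nonneg bp_nonneg nrm_nonneg)
  ultimately show ?thesis using assms by (simp add: orth_simps order_antisym)
qed

lemma band_part_add:
  assumes p: "\<pi> \<in> band_projections" shows "band_part \<pi> (x + y) = band_part \<pi> x + band_part \<pi> y"
proof (rule band_part_unique[OF p])
  show "orth_apply (1 - \<pi>) (nrm (band_part \<pi> x + band_part \<pi> y)) = 0"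
    using p band_part_null by (intro null_add) auto
  have "x + y - (band_part \<pi> x + band_part \<pi> y) = (x - band_part \<pi> x) + (y - band_part \<pi> y)" by simp
  thus "orth_apply \<pi> (nrm (x + y - (band_part \<pi> x + band_part \<pi> y))) = 0"
    using p band_part_null by (metis null_add)
qed

lemma band_part_scale:
  assumes p: "\<pi> \<in> band_projections" shows "band_part \<pi> (scale c x) = scale c (band_part \<pi> x)"
proof (rule band_part_unique[OF p])
  show "orth_apply (1 - \<pi>) (nrm (scale c (band_part \<pi> x))) = 0"
    using band_part_null[OF p] by (simp add: nrm_scale E.P_scaleR)
  show "orth_apply \<pi> (nrm (scale c x - scale c (band_part \<pi> x))) = 0"
    using band_part_null[OF p] by (simp add: scale_right_diff_distrib[symmetric] nrm_scale E.P_scaleR)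
qed

lemma band_part_minus: "\<pi> \<in> band_projections \<Longrightarrow> band_part \<pi> (- x) = - band_part \<pi> x"
  using band_part_scale[of \<pi> "- 1" x] by simp

lemma band_part_diff: "\<pi> \<in> band_projections \<Longrightarrow> band_part \<pi> (x - y) = band_part \<pi> x - band_part \<pi> y"
  using band_part_add[of \<pi> x "- y"] band_part_minus[of \<pi> y] by simp

lemma band_part_compl:
  assumes p: "\<pi> \<in> band_projections" shows "band_part (1 - \<pi>) x = x - band_part \<pi> x"
  using p by (intro band_part_unique) (auto simp: band_part_null)

lemma band_part_mult:
  assumes p: "\<pi> \<in> band_projections" "\<rho> \<in> band_projections"
  shows "band_part (\<pi> * \<rho>) x = band_part \<pi> (band_part \<rho> x)"
proof (rule band_part_unique)
  have n: "nrm (band_part \<pi> (band_part \<rho> x)) = orth_apply (\<pi> * \<rho>) (nrm x)"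
    using p by (simp add: nrm_band_part times_orth.rep_eq)
  show "orth_apply (1 - \<pi> * \<rho>) (nrm (band_part \<pi> (band_part \<rho> x))) = 0"
    unfolding n E.P_mult[symmetric] using p by (simp add: bp_compl_mult orth_simps)
  have 1: "orth_apply (\<pi> * \<rho>) (nrm (x - band_part \<rho> x)) = 0"
    unfolding E.P_mult band_part_null[OF p(2)] by (simp add: orth_simps)
  have 2: "orth_apply (\<pi> * \<rho>) (nrm (band_part \<rho> x - band_part \<pi> (band_part \<rho> x))) = 0"
    unfolding band_projection_commute[OF p(1)] E.P_mult band_part_null[OF p(1)] by (simp add: orth_simps)
  show "orth_apply (\<pi> * \<rho>) (nrm (x - band_part \<pi> (band_part \<rho> x))) = 0"
    using null_add[OF _ 1 2] p by simp
qed (use p in simp)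

lemma nrm_band_mix:
  assumes p: "\<pi> \<in> band_projections"
  shows "nrm (band_part \<pi> x + band_part (1 - \<pi>) y) = orth_apply \<pi> (nrm x) + orth_apply (1 - \<pi>) (nrm y)"
proof -
  let ?z = "band_part \<pi> x + band_part (1 - \<pi>) y"
  have b: "band_part \<pi> ?z = band_part \<pi> x"
  proof (rule band_part_unique[OF p])
    show "orth_apply \<pi> (nrm (?z - band_part \<pi> x)) = 0"
      using band_part_null(1)[of "1 - \<pi>" y] p by simp
  qed (rule band_part_null[OF p])
  hence "orth_apply \<pi> (nrm ?z) = orth_apply \<pi> (nrm x)" using nrm_band_part[OF p] by metis
  moreover have "band_part (1 - \<pi>) ?z = band_part (1 - \<pi>) y" using b p by (simp add: band_part_compl)
  hence "orth_apply (1 - \<pi>) (nrm ?z) = orth_apply (1 - \<pi>) (nrm y)" using nrm_band_part[of "1 - \<pi>"] p by (metis bp_compl)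
  ultimately show ?thesis using E.P_split[of "nrm ?z" \<pi>] by simp
qed

lemma le_on_band_part:
  assumes p: "\<pi> \<in> band_projections" "\<rho> \<in> band_projections" "\<rho> \<le> \<pi>"
  shows "orth_apply \<rho> (nrm (band_part \<pi> x - y)) = orth_apply \<rho> (nrm (x - y))"
proof -
  have "band_part \<rho> (band_part \<pi> x) = band_part \<rho> x"
    using band_part_mult[OF p(2,1)] bp_le_iff[OF p(2,1)] p(3) by metis
  hence "band_part \<rho> (band_part \<pi> x - y) = band_part \<rho> (x - y)" using p by (simp add: band_part_diff)
  thus ?thesis using nrm_band_part(1)[OF p(2)] by metis
qed

end

lemma Inf_eq_0I:
  fixes D :: "'e::dedekind_vector_lattice set"
  assumes "D \<noteq> {}" "\<And>d. d \<in> D \<Longrightarrow> 0 \<le> d" "\<And>h. (\<And>d. d \<in> D \<Longrightarrow> h \<le> d) \<Longrightarrow> h \<le> 0"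
  shows "Inf D = 0"
proof (rule order_antisym)
  show "Inf D \<le> 0" by (rule assms(3)) (rule cInf_lower, auto intro: bdd_belowI[of D 0] assms(2))
  show "0 \<le> Inf D" using assms(1,2) by (rule cInf_greatest)
qed

context banach_kantorovich
begin

text \<open>
  The completeness statement behind all constructions of elements of the space: each \<open>(x, d)\<close>
  demands that the element sought be within \<open>d\<close> of \<open>x\<close>.  Cutting and pasting along
  projections makes the system of all compatible demands directed.
\<close>

lemma glue:
  assumes ne: "T \<noteq> {}"
    and con: "\<And>x d x' d'. (x, d) \<in> T \<Longrightarrow> (x', d') \<in> T \<Longrightarrow> nrm (x - x') \<le> d + d'"
    and inf: "\<And>h. (\<And>x d. (x, d) \<in> T \<Longrightarrow> h \<le> d) \<Longrightarrow> h \<le> 0"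
  shows "\<exists>y. \<forall>(x, d)\<in>T. nrm (y - x) \<le> d"
proof -
  \<comment> \<open>All demands that are compatible with those of \<open>T\<close>. The given ones
    are among them, and the enlarged system is directed, which \<open>T\<close> itself need not
    be.\<close>
  define T' where "T' = {(x, d). \<forall>(x', d')\<in>T. nrm (x - x') \<le> d + d'}"
  define D where "D = snd ` T'"
  define B where "B d = {x. (x, d) \<in> T'}" for d
  have TT': "T \<subseteq> T'" unfolding T'_def using con by auto
  have con': "nrm (x - x') \<le> d + d'" if x: "(x, d) \<in> T'" "(x', d') \<in> T'" for x d x' d'
  proof -
    define h where "h = nrm (x - x') - (d + d')"
    have hle: "h \<le> d'' + d''" if t: "(x'', d'') \<in> T" for x'' d''
    proof -
      have "nrm (x - x') \<le> nrm (x - x'') + nrm (x' - x'')"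
        using X.nrm_triangle3[of x x' x''] X.nrm_minus_commute[of x'' x'] by simp
      also have "\<dots> \<le> (d + d'') + (d' + d'')" using x t by (intro add_mono) (auto simp: T'_def)
      finally show ?thesis unfolding h_def by (simp add: diff_le_eq ac_simps)
    qed
    \<comment> \<open>Two new demands are compared through a member of \<open>T\<close>; as no
      positive element is below all tolerances in \<open>T\<close>, the detour costs
      nothing.\<close>
    have "(1/2) *\<^sub>R h \<le> 0"
    proof (rule inf)
      fix x'' d'' assume "(x'', d'') \<in> T"
      hence "(1/2) *\<^sub>R h \<le> (1/2) *\<^sub>R (d'' + d'')" using hle by (intro scaleR_left_mono) auto
      thus "(1/2) *\<^sub>R h \<le> d''" by (simp add: scaleR_add_right scaleR_add_left[symmetric])
    qed
    hence "2 *\<^sub>R ((1/2) *\<^sub>R h) \<le> 2 *\<^sub>R 0" by (intro scaleR_left_mono) auto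
    thus ?thesis by (simp add: h_def)
  qed
  have D0: "0 \<le> d" if "d \<in> D" for d
  proof -
    obtain x where "(x, d) \<in> T'" using \<open>d \<in> D\<close> by (auto simp: D_def)
    from con'[OF this this] show ?thesis by (simp add: X.nrm_0)
  qed
  have dir: "\<exists>x. (x, inf d1 d2) \<in> T'" if t: "(x1, d1) \<in> T'" "(x2, d2) \<in> T'" for x1 d1 x2 d2
  proof -
    obtain \<tau> where c: "\<tau> \<in> band_projections" "E.le_on \<tau> d1 d2" "E.le_on (1 - \<tau>) d2 d1"
      using E.cut[of d1 d2] by blast
    have i: "E.le_on \<tau> d1 (inf d1 d2)" "E.le_on (1 - \<tau>) d2 (inf d1 d2)"
      using c by (auto intro!: E.le_on_inf simp: E.le_on_refl)
    \<comment> \<open>On each part the centre with the smaller tolerance is taken, which realises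
      \<open>inf d1 d2\<close>.\<close>
    let ?z = "band_part \<tau> x1 + band_part (1 - \<tau>) x2"
    have "nrm (?z - x') \<le> inf d1 d2 + d'" if t': "(x', d') \<in> T" for x' d'
    proof -
      have "?z - x' = band_part \<tau> (x1 - x') + band_part (1 - \<tau>) (x2 - x')"
        using c(1) by (simp add: band_part_diff band_part_compl)
      hence "nrm (?z - x') = orth_apply \<tau> (nrm (x1 - x')) + orth_apply (1 - \<tau>) (nrm (x2 - x'))"
        using nrm_band_mix[OF c(1)] by metis
      also have "\<dots> \<le> orth_apply \<tau> (inf d1 d2 + d') + orth_apply (1 - \<tau>) (inf d1 d2 + d')"
      proof (rule add_mono)
        have "E.le_on \<tau> (nrm (x1 - x')) (d1 + d')" using t t' c(1) by (intro E.le_onI) (auto simp: T'_def)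
        thus "orth_apply \<tau> (nrm (x1 - x')) \<le> orth_apply \<tau> (inf d1 d2 + d')"
          using E.le_on_trans[OF _ E.le_on_add[OF i(1) E.le_on_refl]] by (simp add: E.le_on_def)
        have "E.le_on (1 - \<tau>) (nrm (x2 - x')) (d2 + d')" using t t' c(1) by (intro E.le_onI) (auto simp: T'_def)
        thus "orth_apply (1 - \<tau>) (nrm (x2 - x')) \<le> orth_apply (1 - \<tau>) (inf d1 d2 + d')"
          using E.le_on_trans[OF _ E.le_on_add[OF i(2) E.le_on_refl]] by (simp add: E.le_on_def)
      qed
      also have "\<dots> = inf d1 d2 + d'" by (rule E.P_split[symmetric])
      finally show ?thesis .
    qed
    thus ?thesis by (auto simp: T'_def)
  qed
  have Dinf: "h \<le> 0" if "\<And>d. d \<in> D \<Longrightarrow> h \<le> d" for h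
    using that TT' by (intro inf) (force simp: D_def)
  have Dne: "D \<noteq> {}" using ne TT' by (auto simp: D_def)
  have Bne: "B d \<noteq> {}" if "d \<in> D" for d using that by (auto simp: D_def B_def)
  \<comment> \<open>The centres, sorted by tolerance, form a Cauchy filter: two centres of tolerance
    \<open>d\<close> are at distance at most \<open>d + d\<close>.\<close>
  define F where "F = (INF d\<in>D. principal (B d))"
  have Bmono: "B d \<subseteq> B d'" if "d \<le> d'" for d d'
    unfolding B_def T'_def using that by (auto intro: order_trans add_right_mono)
  have Dinf2: "inf d d' \<in> D" if "d \<in> D" "d' \<in> D" for d d'
    using that dir unfolding D_def by (force simp: image_iff)
  have evF: "eventually Q F \<longleftrightarrow> (\<exists>d\<in>D. \<forall>x\<in>B d. Q x)" for Q
    unfolding F_def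
  proof (subst eventually_INF_base[OF Dne])
    fix d d' assume "d \<in> D" "d' \<in> D"
    thus "\<exists>x\<in>D. principal (B x) \<le> inf (principal (B d)) (principal (B d'))"
      using Dinf2 Bmono[of "inf d d'" d] Bmono[of "inf d d'" d'] by (intro bexI[of _ "inf d d'"]) auto
  qed (simp add: eventually_principal)
  have Fnb: "F \<noteq> bot" unfolding trivial_limit_def evF using Bne by blast
  have "norm_o_tendsto nrm (\<lambda>(x, y). x - y) 0 (F \<times>\<^sub>F F)"
    unfolding norm_o_tendsto_def o_tendsto_def
  proof (intro exI[of _ "(\<lambda>d. d + d) ` D"] conjI ballI)
    show "(\<lambda>d. d + d) ` D \<noteq> {}" using Dne by simp
    show "0 \<le> d" if "d \<in> (\<lambda>d. d + d) ` D" for d using that D0 by (auto intro: add_nonneg_nonneg)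
    show "Inf ((\<lambda>d. d + d) ` D) = 0"
    proof (rule Inf_eq_0I)
      fix h assume h: "\<And>d. d \<in> (\<lambda>d. d + d) ` D \<Longrightarrow> h \<le> d"
      have "(1/2) *\<^sub>R h \<le> d" if "d \<in> D" for d
      proof -
        have "(1/2) *\<^sub>R h \<le> (1/2) *\<^sub>R (d + d)" using h that by (intro scaleR_left_mono) auto
        thus ?thesis by (simp add: scaleR_add_right scaleR_add_left[symmetric])
      qed
      hence "(1/2) *\<^sub>R h \<le> 0" by (rule Dinf)
      hence "2 *\<^sub>R ((1/2) *\<^sub>R h) \<le> 2 *\<^sub>R 0" by (intro scaleR_left_mono) auto
      thus "h \<le> 0" by simp
    qed (use Dne D0 in \<open>auto intro: add_nonneg_nonneg\<close>)
    show "\<exists>d''\<in>(\<lambda>d. d + d) ` D. d'' \<le> d \<and> d'' \<le> d'" if dd: "d \<in> (\<lambda>d. d + d) ` D" "d' \<in> (\<lambda>d. d + d) ` D" for d d'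
    proof -
      obtain a b where ab: "a \<in> D" "d = a + a" "b \<in> D" "d' = b + b" using dd by auto
      thus ?thesis using Dinf2[of a b] by (intro bexI[of _ "inf a b + inf a b"]) (auto intro!: add_mono)
    qed
    show "eventually (\<lambda>a. \<bar>nrm (0 - (case a of (x, y) \<Rightarrow> x - y)) - 0\<bar> \<le> d) (F \<times>\<^sub>F F)" if dd: "d \<in> (\<lambda>d. d + d) ` D" for d
    proof -
      obtain a where a: "a \<in> D" "d = a + a" using dd by auto
      have "eventually (\<lambda>x. x \<in> B a) F" unfolding evF using a by blast
      moreover have "\<bar>nrm (y - x)\<bar> \<le> d" if "x \<in> B a" "y \<in> B a" for x y
        using con'[of y a x a] that a(2) nrm_nonneg by (auto simp: B_def)
      ultimately show ?thesis unfolding eventually_prod_filter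
        by (intro exI[of _ "\<lambda>x. x \<in> B a"]) auto
    qed
  qed
  then obtain y where "norm_o_tendsto nrm (\<lambda>y. y) y F" using norm_o_complete[OF Fnb] by blast
  then obtain D3 where D3: "D3 \<noteq> {}" "Inf D3 = 0" "\<And>d. d \<in> D3 \<Longrightarrow> 0 \<le> d"
    "\<And>d. d \<in> D3 \<Longrightarrow> eventually (\<lambda>a. \<bar>nrm (y - a) - 0\<bar> \<le> d) F"
    unfolding norm_o_tendsto_def o_tendsto_def by blast
  have "nrm (y - x) \<le> d" if x: "(x, d) \<in> T" for x d
  proof -
    define h where "h = nrm (y - x) - d"
    \<comment> \<open>The detour over a centre \<open>a\<close> close to \<open>y\<close> costs
      \<open>d3 + d'\<close>; first \<open>d'\<close> and then \<open>d3\<close> is sent to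
      0.\<close>
    have "h - d3 \<le> d'" if d3: "d3 \<in> D3" and d': "d' \<in> D" for d3 d'
    proof -
      have "eventually (\<lambda>a. a \<in> B d') F" unfolding evF using d' by blast
      hence "eventually (\<lambda>a. a \<in> B d' \<and> \<bar>nrm (y - a) - 0\<bar> \<le> d3) F" using D3(4)[OF d3] by (rule eventually_conj)
      then obtain a where a: "a \<in> B d'" "nrm (y - a) \<le> d3"
        using eventually_happens'[OF Fnb] nrm_nonneg by (auto simp: abs_le_iff)
      have "nrm (y - x) \<le> nrm (y - a) + nrm (a - x)" by (rule X.nrm_triangle3)
      also have "\<dots> \<le> d3 + (d' + d)" using a x by (intro add_mono) (auto simp: B_def T'_def)
      finally show ?thesis by (simp add: h_def diff_le_eq ac_simps)
    qed
    hence "h - d3 \<le> 0" if "d3 \<in> D3" for d3 using that by (intro Dinf)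
    hence "h \<le> Inf D3" by (intro cInf_greatest D3(1)) simp
    thus ?thesis using D3(2) by (simp add: h_def)
  qed
  thus ?thesis by blast
qed

subsection \<open>The action of the orthomorphisms\<close>

definition sc :: "real \<Rightarrow> 'x \<Rightarrow> 'x" where "sc t = scale (of_real t)"

lemma nrm_sc: "nrm (sc t x) = \<bar>t\<bar> *\<^sub>R nrm x" by (simp add: sc_def nrm_scale)

lemma sc_simps: "sc t (x + y) = sc t x + sc t y" "sc t (x - y) = sc t x - sc t y"
  "sc (t + u) x = sc t x + sc u x" "sc (t - u) x = sc t x - sc u x" "sc 1 x = x" "sc 0 x = 0"
  "sc (t * u) x = sc t (sc u x)" "sc t (scale c x) = scale c (sc t x)"
  by (simp_all add: sc_def scale_right_distrib scale_right_diff_distrib scale_left_distrib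
      scale_left_diff_distrib mult.commute)

text \<open>Wherever \<open>\<alpha>\<close> is close to a number \<open>t\<close>, the element
  \<open>\<alpha> x\<close> has to be close to \<open>t x\<close>. These requirements are collected
  as demands for \<open>glue\<close>; the infimum condition on the tolerances holds because
  \<open>\<alpha>\<close> is densely close to numbers.\<close>

lemma act_ex: "\<exists>y. \<forall>\<pi>\<in>band_projections. \<forall>t \<epsilon>. near \<pi> \<alpha> t \<epsilon> \<longrightarrow> E.le_on \<pi> (nrm (y - sc t x)) (\<epsilon> *\<^sub>R nrm x)"
proof -
  define b where "b = orth_apply \<bar>\<alpha>\<bar> (nrm x)"
  \<comment> \<open>The centre \<open>band_part \<pi> (sc t x)\<close> says nothing outside
    \<open>\<pi>\<close>; there the tolerance is \<open>b\<close>, the norm that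
    \<open>\<alpha> x\<close> is expected to have.\<close>
  define dd where "dd \<pi> \<epsilon> = \<epsilon> *\<^sub>R nrm x + orth_apply (1 - \<pi>) b" for \<pi> \<epsilon>
  define T where "T = {(band_part \<pi> (sc t x), dd \<pi> \<epsilon>) | \<pi> t \<epsilon>. \<pi> \<in> band_projections \<and> 0 \<le> \<epsilon> \<and> near \<pi> \<alpha> t \<epsilon>}"
  have b0: "0 \<le> b" by (simp add: b_def orth_apply_nonneg nrm_nonneg)
  have d0: "0 \<le> \<epsilon> *\<^sub>R nrm x" "0 \<le> orth_apply (1 - \<pi>) b" if "\<pi> \<in> band_projections" "0 \<le> \<epsilon>" for \<pi> \<epsilon>
    using that b0 nrm_nonneg by (auto intro!: scaleR_nonneg_nonneg orth_apply_nonneg bp_nonneg simp del: diff_ge_0_iff_ge)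
  have tb: "E.le_on \<pi> (\<bar>t\<bar> *\<^sub>R nrm x) (\<epsilon> *\<^sub>R nrm x + b)" if n: "near \<pi> \<alpha> t \<epsilon>" "\<pi> \<in> band_projections" for \<pi> t \<epsilon>
  proof -
    have "\<bar>t\<bar> *\<^sub>R 1 = \<bar>\<alpha> - (\<alpha> - t *\<^sub>R 1)\<bar>" unfolding abs_real_one[symmetric] by simp
    also have "\<dots> \<le> \<bar>\<alpha>\<bar> + \<bar>\<alpha> - t *\<^sub>R 1\<bar>" by (rule abs_triangle_ineq4)
    finally have "L.le_on \<pi> (\<bar>t\<bar> *\<^sub>R 1) (\<bar>\<alpha>\<bar> + \<bar>\<alpha> - t *\<^sub>R 1\<bar>)" using n(2) by (rule L.le_onI)
    hence "L.le_on \<pi> (\<bar>t\<bar> *\<^sub>R 1) (\<bar>\<alpha>\<bar> + \<epsilon> *\<^sub>R 1)"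
      by (rule L.le_on_trans) (intro L.le_on_add L.le_on_refl n(1)[unfolded near_def])
    from le_on_orth_apply[OF this nrm_nonneg, of x] show ?thesis by (simp add: orth_simps b_def add.commute)
  qed
  \<comment> \<open>Compatibility is checked on the four parts cut out by \<open>\<pi>\<close> and
    \<open>\<pi>'\<close>. On the common part \<open>t\<close> and \<open>t'\<close> differ by at
    most \<open>\<epsilon> + \<epsilon>'\<close>; where just one centre lives, its size is covered
    by its own \<open>\<epsilon>\<close> term and the outer tolerance \<open>b\<close> of the other
    demand; on the fourth part both centres vanish.\<close>
  have half: "nrm (band_part \<pi> (sc t x) - band_part \<pi>' (sc t' x)) \<le> dd \<pi> \<epsilon> + dd \<pi>' \<epsilon>'"
    if p: "\<pi> \<in> band_projections" "0 \<le> \<epsilon>" "near \<pi> \<alpha> t \<epsilon>"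
      and p': "\<pi>' \<in> band_projections" "0 \<le> \<epsilon>'" "near \<pi>' \<alpha> t' \<epsilon>'" for \<pi> \<epsilon> t \<pi>' \<epsilon>' t'
  proof -
    let ?n = "nrm (band_part \<pi> (sc t x) - band_part \<pi>' (sc t' x))" and ?d = "dd \<pi> \<epsilon> + dd \<pi>' \<epsilon>'"
    note q = p(1) p'(1) bp_compl[OF p(1)] bp_compl[OF p'(1)]
    have sub: "\<epsilon> *\<^sub>R nrm x + orth_apply (1 - \<pi>') b \<le> ?d" "\<epsilon>' *\<^sub>R nrm x + orth_apply (1 - \<pi>) b \<le> ?d"
      "\<epsilon> *\<^sub>R nrm x + \<epsilon>' *\<^sub>R nrm x \<le> ?d" "0 \<le> ?d"
      unfolding dd_def using d0[OF p(1,2)] d0[OF p'(1,2)]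
      by (simp_all add: algebra_simps add_increasing add_increasing2 add_nonneg_nonneg)
    have n: "?n \<le> nrm (band_part \<pi> (sc t x)) + nrm (band_part \<pi>' (sc t' x))" by (rule X.nrm_diff_le)
    have nn: "nrm (band_part \<pi> (sc t x)) = \<bar>t\<bar> *\<^sub>R orth_apply \<pi> (nrm x)"
      "nrm (band_part \<pi>' (sc t' x)) = \<bar>t'\<bar> *\<^sub>R orth_apply \<pi>' (nrm x)"
      using q by (simp_all add: nrm_band_part nrm_sc orth_simps)
    have c1: "E.le_on (\<pi> * \<pi>') ?n ?d"
    proof (cases "\<pi> * \<pi>' = 0")
      case False
      have le: "\<pi> * \<pi>' \<le> \<pi>" "\<pi> * \<pi>' \<le> \<pi>'" "\<pi> * \<pi>' \<in> band_projections" using q bp_mult_le by auto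
      have "near (\<pi> * \<pi>') \<alpha> t \<epsilon>" "near (\<pi> * \<pi>') \<alpha> t' \<epsilon>'"
        using p(3) p'(3) q by (auto simp: near_def intro: L.le_on_mult)
      hence "\<bar>t - t'\<bar> \<le> \<epsilon> + \<epsilon>'" using near_unique False le(3) by blast
      hence "\<bar>t - t'\<bar> *\<^sub>R nrm x \<le> ?d"
        using sub(3) scaleR_right_mono[OF _ nrm_nonneg[of x]] by (force simp: scaleR_add_left intro: order_trans)
      moreover have "orth_apply (\<pi> * \<pi>') ?n = orth_apply (\<pi> * \<pi>') (nrm (sc t x - sc t' x))"
        using le_on_band_part[OF p(1) le(3) le(1), of "sc t x" "band_part \<pi>' (sc t' x)"]
          le_on_band_part[OF p'(1) le(3) le(2), of "sc t' x" "sc t x"]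
        by (simp add: X.nrm_minus_commute)
      ultimately show ?thesis using le(3)
        by (simp add: E.le_on_def sc_simps(4)[symmetric] nrm_sc bp_nonneg orth_apply_mono)
    qed (simp add: E.le_on_zero)
    have c2: "E.le_on (\<pi> * (1 - \<pi>')) ?n ?d"
    proof -
      let ?k = "\<pi> * (1 - \<pi>')"
      have k: "?k \<in> band_projections" using q by simp
      have z: "orth_apply ?k (orth_apply \<pi>' y) = 0" for y
        using q by (simp add: E.P_mult E.P_comp orth_simps)
      have e: "orth_apply ?k (orth_apply \<pi> y) = orth_apply ?k y" for y
        using E.P_down(1)[OF k q(1)] bp_mult_le(1)[OF q(1,4)] by simp
      have e': "orth_apply ?k (orth_apply (1 - \<pi>') y) = orth_apply ?k y" for y
        using E.P_down(1)[OF k q(4)] bp_mult_le(2)[OF q(1,4)] by simp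
      have "E.le_on ?k ?n (\<bar>t\<bar> *\<^sub>R nrm x)"
        using E.le_onI[OF n k] unfolding nn E.le_on_def by (simp only: E.P_simps z e) simp
      moreover have "E.le_on ?k (\<bar>t\<bar> *\<^sub>R nrm x) (\<epsilon> *\<^sub>R nrm x + b)"
        by (rule E.le_on_mult(1)[OF tb[OF p(3,1)] q(4,1)])
      moreover have "E.le_on ?k (\<epsilon> *\<^sub>R nrm x + b) (\<epsilon> *\<^sub>R nrm x + orth_apply (1 - \<pi>') b)"
        unfolding E.le_on_def by (simp only: E.P_simps e' order_refl)
      ultimately show ?thesis using E.le_onI[OF sub(1) k] by (meson E.le_on_trans)
    qed
    have c3: "E.le_on ((1 - \<pi>) * \<pi>') ?n ?d"
    proof -
      let ?k = "(1 - \<pi>) * \<pi>'"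
      have k: "?k \<in> band_projections" using q by simp
      have k': "?k = \<pi>' * (1 - \<pi>)" using band_projection_commute[OF q(3)] by simp
      have z: "orth_apply ?k (orth_apply \<pi> y) = 0" for y
        unfolding k' using q by (simp add: E.P_mult E.P_comp orth_simps)
      have e: "orth_apply ?k (orth_apply \<pi>' y) = orth_apply ?k y" for y
        using E.P_down(1)[OF k q(2)] bp_mult_le(2)[OF q(3,2)] by simp
      have e': "orth_apply ?k (orth_apply (1 - \<pi>) y) = orth_apply ?k y" for y
        using E.P_down(1)[OF k q(3)] bp_mult_le(1)[OF q(3,2)] by simp
      have "E.le_on ?k ?n (\<bar>t'\<bar> *\<^sub>R nrm x)"
        using E.le_onI[OF n k] unfolding nn E.le_on_def by (simp only: E.P_simps z e) simp
      moreover have "E.le_on ?k (\<bar>t'\<bar> *\<^sub>R nrm x) (\<epsilon>' *\<^sub>R nrm x + b)"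
        by (rule E.le_on_mult(2)[OF tb[OF p'(3,1)] q(3,2)])
      moreover have "E.le_on ?k (\<epsilon>' *\<^sub>R nrm x + b) (\<epsilon>' *\<^sub>R nrm x + orth_apply (1 - \<pi>) b)"
        unfolding E.le_on_def by (simp only: E.P_simps e' order_refl)
      ultimately show ?thesis using E.le_onI[OF sub(2) k] by (meson E.le_on_trans)
    qed
    have c4: "E.le_on ((1 - \<pi>) * (1 - \<pi>')) ?n ?d"
    proof -
      let ?k = "(1 - \<pi>) * (1 - \<pi>')"
      have k: "?k \<in> band_projections" using q by simp
      have k': "?k = (1 - \<pi>') * (1 - \<pi>)" using band_projection_commute[OF q(3)] by simp
      have z: "orth_apply ?k (orth_apply \<pi> y) = 0" for y
        unfolding k' using q by (simp add: E.P_mult E.P_comp orth_simps)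
      have z': "orth_apply ?k (orth_apply \<pi>' y) = 0" for y
        using q by (simp add: E.P_mult E.P_comp orth_simps)
      have "E.le_on ?k ?n 0"
        using E.le_onI[OF n k] unfolding nn E.le_on_def by (simp only: E.P_simps z z') simp
      thus ?thesis using E.le_onI[OF sub(4) k] by (meson E.le_on_trans)
    qed
    have "E.le_on \<pi> ?n ?d" using c1 c2 by (rule E.le_on_split)
    moreover have "E.le_on (1 - \<pi>) ?n ?d" using c3 c4 by (rule E.le_on_split)
    ultimately show ?thesis using E.le_on_split[of 1 \<pi> ?n ?d] by (simp add: E.le_on_1)
  qed
  have "\<exists>y. \<forall>(z, d)\<in>T. nrm (y - z) \<le> d"
  proof (rule glue)
    have "near 0 \<alpha> 0 0" by (simp add: near_def L.le_on_zero)
    hence "(band_part 0 (sc 0 x), dd 0 0) \<in> T" unfolding T_def using bp_zero by blast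
    thus "T \<noteq> {}" by blast
    show "nrm (z - z') \<le> d + d'" if "(z, d) \<in> T" "(z', d') \<in> T" for z d z' d'
      using that half unfolding T_def by blast
    fix h assume h: "\<And>z d. (z, d) \<in> T \<Longrightarrow> h \<le> d"
    show "h \<le> 0"
    proof (rule archimedean_le_0)
      fix \<epsilon> :: real assume eps: "0 < \<epsilon>"
      show "h \<le> \<epsilon> *\<^sub>R nrm x"
      proof (rule E.local_le1[OF densely_mono[OF orth_approx[OF eps, of \<alpha>]]])
        fix \<rho> assume r: "\<rho> \<in> band_projections" "\<exists>t. L.le_on \<rho> \<bar>\<alpha> - t *\<^sub>R 1\<bar> (\<epsilon> *\<^sub>R 1)"
        then obtain t where "near \<rho> \<alpha> t \<epsilon>" by (auto simp: near_def)
        hence "(band_part \<rho> (sc t x), dd \<rho> \<epsilon>) \<in> T" unfolding T_def using r(1) eps by (intro CollectI exI conjI) auto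
        from E.le_onI[OF h[OF this] r(1)] show "E.le_on \<rho> h (\<epsilon> *\<^sub>R nrm x)"
          using r(1) by (simp add: E.le_on_def dd_def E.P_simps E.P_comp)
      qed
    qed
  qed
  then obtain y where y: "\<And>z d. (z, d) \<in> T \<Longrightarrow> nrm (y - z) \<le> d" by blast
  have "E.le_on \<pi> (nrm (y - sc t x)) (\<epsilon> *\<^sub>R nrm x)" if p: "\<pi> \<in> band_projections" "near \<pi> \<alpha> t \<epsilon>" for \<pi> t \<epsilon>
  proof (cases "\<pi> = 0")
    case False
    have "0 \<le> \<epsilon>" using near_unique[OF p(2,2,1) False] by simp
    hence "(band_part \<pi> (sc t x), dd \<pi> \<epsilon>) \<in> T" unfolding T_def using p by (intro CollectI exI conjI) auto
    from E.le_onI[OF y[OF this] p(1)]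
    have "E.le_on \<pi> (nrm (band_part \<pi> (sc t x) - y)) (\<epsilon> *\<^sub>R nrm x)"
      using p(1) by (simp add: E.le_on_def dd_def E.P_simps E.P_comp X.nrm_minus_commute)
    thus ?thesis using le_on_band_part[OF p(1,1) order_refl, of "sc t x" y]
      by (simp add: E.le_on_def X.nrm_minus_commute)
  qed (simp add: E.le_on_zero)
  thus ?thesis by blast
qed

definition orth_act :: "'e orth \<Rightarrow> 'x \<Rightarrow> 'x"
  where "orth_act \<alpha> x = (SOME y. \<forall>\<pi>\<in>band_projections. \<forall>t \<epsilon>. near \<pi> \<alpha> t \<epsilon> \<longrightarrow> E.le_on \<pi> (nrm (y - sc t x)) (\<epsilon> *\<^sub>R nrm x))"

lemma orth_act_near: "near \<pi> \<alpha> t \<epsilon> \<Longrightarrow> \<pi> \<in> band_projections \<Longrightarrow> E.le_on \<pi> (nrm (orth_act \<alpha> x - sc t x)) (\<epsilon> *\<^sub>R nrm x)"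
  using someI_ex[OF act_ex[of \<alpha> x]] unfolding orth_act_def by blast

text \<open>The local approximate values determine \<open>\<alpha> x\<close>. Each law of the action
  is therefore proved by verifying it for real numbers up to an error, measured by any regulator
  \<open>e\<close>.\<close>

lemma orth_act_unique:
  assumes "0 \<le> e" "\<And>\<epsilon>. 0 < \<epsilon> \<Longrightarrow> densely 1 (\<lambda>\<rho>. \<exists>t. near \<rho> \<alpha> t \<epsilon> \<and> E.le_on \<rho> (nrm (y - sc t x)) (\<epsilon> *\<^sub>R e))"
  shows "orth_act \<alpha> x = y"
proof -
  have "nrm (orth_act \<alpha> x - y) \<le> 0"
  proof (rule archimedean_le_0)
    fix \<epsilon> :: real assume eps: "0 < \<epsilon>"
    show "nrm (orth_act \<alpha> x - y) \<le> \<epsilon> *\<^sub>R (nrm x + e)"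
    proof (rule E.local_le1[OF densely_mono[OF assms(2)[OF eps]]])
      fix \<rho> assume r: "\<rho> \<in> band_projections" "\<exists>t. near \<rho> \<alpha> t \<epsilon> \<and> E.le_on \<rho> (nrm (y - sc t x)) (\<epsilon> *\<^sub>R e)"
      then obtain t where t: "near \<rho> \<alpha> t \<epsilon>" "E.le_on \<rho> (nrm (sc t x - y)) (\<epsilon> *\<^sub>R e)"
        by (auto simp: X.nrm_minus_commute)
      have "E.le_on \<rho> (nrm (orth_act \<alpha> x - sc t x) + nrm (sc t x - y)) (\<epsilon> *\<^sub>R nrm x + \<epsilon> *\<^sub>R e)"
        using t r by (intro E.le_on_add orth_act_near)
      thus "E.le_on \<rho> (nrm (orth_act \<alpha> x - y)) (\<epsilon> *\<^sub>R (nrm x + e))"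
        using E.le_on_trans[OF E.le_onI[OF X.nrm_triangle3 r(1)]] by (simp add: scaleR_add_right)
    qed
  qed
  hence "nrm (orth_act \<alpha> x - y) = 0" using nrm_nonneg by (simp add: order_antisym)
  thus ?thesis using nrm_eq_0 by fastforce
qed

lemma orth_act_add: "orth_act \<alpha> (x + y) = orth_act \<alpha> x + orth_act \<alpha> y"
proof (rule orth_act_unique)
  show "0 \<le> nrm x + nrm y" by (intro add_nonneg_nonneg nrm_nonneg)
  fix \<epsilon> :: real assume eps: "0 < \<epsilon>"
  show "densely 1 (\<lambda>\<rho>. \<exists>t. near \<rho> \<alpha> t \<epsilon> \<and> E.le_on \<rho> (nrm (orth_act \<alpha> x + orth_act \<alpha> y - sc t (x + y))) (\<epsilon> *\<^sub>R (nrm x + nrm y)))"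
  proof (rule densely_mono[OF near_densely[OF eps]], elim exE, intro exI conjI)
    fix \<rho> t assume r: "\<rho> \<in> band_projections" and t: "near \<rho> \<alpha> t \<epsilon>"
    have "orth_act \<alpha> x + orth_act \<alpha> y - sc t (x + y) = (orth_act \<alpha> x - sc t x) + (orth_act \<alpha> y - sc t y)"
      by (simp add: sc_simps)
    hence "E.le_on \<rho> (nrm (orth_act \<alpha> x + orth_act \<alpha> y - sc t (x + y))) (nrm (orth_act \<alpha> x - sc t x) + nrm (orth_act \<alpha> y - sc t y))"
      using E.le_onI[OF nrm_triangle r] by metis
    moreover have "E.le_on \<rho> (nrm (orth_act \<alpha> x - sc t x) + nrm (orth_act \<alpha> y - sc t y)) (\<epsilon> *\<^sub>R nrm x + \<epsilon> *\<^sub>R nrm y)"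
      using r t by (intro E.le_on_add orth_act_near)
    ultimately show "E.le_on \<rho> (nrm (orth_act \<alpha> x + orth_act \<alpha> y - sc t (x + y))) (\<epsilon> *\<^sub>R (nrm x + nrm y))"
      unfolding scaleR_add_right by (rule E.le_on_trans)
  qed
qed

lemma orth_act_scale: "orth_act \<alpha> (scale c x) = scale c (orth_act \<alpha> x)"
proof (rule orth_act_unique)
  show "0 \<le> norm c *\<^sub>R nrm x" by (intro scaleR_nonneg_nonneg nrm_nonneg) simp
  fix \<epsilon> :: real assume eps: "0 < \<epsilon>"
  show "densely 1 (\<lambda>\<rho>. \<exists>t. near \<rho> \<alpha> t \<epsilon> \<and> E.le_on \<rho> (nrm (scale c (orth_act \<alpha> x) - sc t (scale c x))) (\<epsilon> *\<^sub>R (norm c *\<^sub>R nrm x)))"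
  proof (rule densely_mono[OF near_densely[OF eps]], elim exE, intro exI conjI)
    fix \<rho> t assume r: "\<rho> \<in> band_projections" and t: "near \<rho> \<alpha> t \<epsilon>"
    have "E.le_on \<rho> (norm c *\<^sub>R nrm (orth_act \<alpha> x - sc t x)) (norm c *\<^sub>R (\<epsilon> *\<^sub>R nrm x))"
      using r t by (intro E.le_on_scaleR orth_act_near) auto
    thus "E.le_on \<rho> (nrm (scale c (orth_act \<alpha> x) - sc t (scale c x))) (\<epsilon> *\<^sub>R (norm c *\<^sub>R nrm x))"
      by (simp add: sc_simps(8) scale_right_diff_distrib[symmetric] nrm_scale mult.commute)
  qed
qed

lemma orth_act_plus: "orth_act (\<alpha> + \<mu>) x = orth_act \<alpha> x + orth_act \<mu> x"
proof (rule orth_act_unique)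
  show "0 \<le> nrm x" by (rule nrm_nonneg)
  fix \<epsilon> :: real assume eps: "0 < \<epsilon>"
  hence e2: "0 < \<epsilon> / 2" by simp
  show "densely 1 (\<lambda>\<rho>. \<exists>t. near \<rho> (\<alpha> + \<mu>) t \<epsilon> \<and> E.le_on \<rho> (nrm (orth_act \<alpha> x + orth_act \<mu> x - sc t x)) (\<epsilon> *\<^sub>R nrm x))"
  proof (rule densely_mono[OF near_densely2[OF e2]], elim exE conjE, intro exI conjI)
    fix \<rho> t u assume r: "\<rho> \<in> band_projections" and t: "near \<rho> \<alpha> t (\<epsilon>/2)" "near \<rho> \<mu> u (\<epsilon>/2)"
    show "near \<rho> (\<alpha> + \<mu>) (t + u) \<epsilon>" using near_add[OF t r] by simp
    have "orth_act \<alpha> x + orth_act \<mu> x - sc (t + u) x = (orth_act \<alpha> x - sc t x) + (orth_act \<mu> x - sc u x)"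
      by (simp add: sc_simps)
    hence "E.le_on \<rho> (nrm (orth_act \<alpha> x + orth_act \<mu> x - sc (t + u) x)) (nrm (orth_act \<alpha> x - sc t x) + nrm (orth_act \<mu> x - sc u x))"
      using E.le_onI[OF nrm_triangle r] by metis
    moreover have "E.le_on \<rho> (nrm (orth_act \<alpha> x - sc t x) + nrm (orth_act \<mu> x - sc u x)) ((\<epsilon>/2) *\<^sub>R nrm x + (\<epsilon>/2) *\<^sub>R nrm x)"
      using r t by (intro E.le_on_add orth_act_near)
    ultimately show "E.le_on \<rho> (nrm (orth_act \<alpha> x + orth_act \<mu> x - sc (t + u) x)) (\<epsilon> *\<^sub>R nrm x)"
      unfolding scaleR_add_left[symmetric] using E.le_on_trans by simp
  qed
qed

lemma orth_act_scaleR: "orth_act (r *\<^sub>R \<alpha>) x = scale (of_real r) (orth_act \<alpha> x)"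
proof (rule orth_act_unique)
  show "0 \<le> nrm x" by (rule nrm_nonneg)
  fix \<epsilon> :: real assume eps: "0 < \<epsilon>"
  \<comment> \<open>The denominator carries an extra 1 because \<open>r\<close> may be 0.\<close>
  define \<delta> where "\<delta> = \<epsilon> / (\<bar>r\<bar> + 1)"
  have d: "0 < \<delta>" "\<bar>r\<bar> * \<delta> \<le> \<epsilon>" using eps by (auto simp: \<delta>_def field_simps intro: add_pos_nonneg)
  show "densely 1 (\<lambda>\<rho>. \<exists>t. near \<rho> (r *\<^sub>R \<alpha>) t \<epsilon> \<and> E.le_on \<rho> (nrm (scale (of_real r) (orth_act \<alpha> x) - sc t x)) (\<epsilon> *\<^sub>R nrm x))"
  proof (rule densely_mono[OF near_densely[OF d(1)]], elim exE, intro exI conjI)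
    fix \<rho> t assume r: "\<rho> \<in> band_projections" and t: "near \<rho> \<alpha> t \<delta>"
    have "(\<bar>r\<bar> * \<delta>) *\<^sub>R (1 :: 'e orth) \<le> \<epsilon> *\<^sub>R 1" "(\<bar>r\<bar> * \<delta>) *\<^sub>R nrm x \<le> \<epsilon> *\<^sub>R nrm x"
      by (intro scaleR_right_mono d orth_zero_le_one nrm_nonneg)+
    note le = L.le_onI[OF this(1) r] E.le_onI[OF this(2) r]
    show "near \<rho> (r *\<^sub>R \<alpha>) (r * t) \<epsilon>"
      using near_scaleR[OF t, of r] le(1) L.le_on_trans unfolding near_def by blast
    have "E.le_on \<rho> (\<bar>r\<bar> *\<^sub>R nrm (orth_act \<alpha> x - sc t x)) (\<bar>r\<bar> *\<^sub>R (\<delta> *\<^sub>R nrm x))"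
      using r t by (intro E.le_on_scaleR orth_act_near) auto
    hence "E.le_on \<rho> (nrm (scale (of_real r) (orth_act \<alpha> x) - sc (r * t) x)) ((\<bar>r\<bar> * \<delta>) *\<^sub>R nrm x)"
      unfolding nrm_sc[symmetric] by (simp add: sc_simps) (simp add: sc_def)
    thus "E.le_on \<rho> (nrm (scale (of_real r) (orth_act \<alpha> x) - sc (r * t) x)) (\<epsilon> *\<^sub>R nrm x)"
      using le(2) by (rule E.le_on_trans)
  qed
qed

lemma orth_act_mult: "orth_act (\<alpha> * \<mu>) x = orth_act \<alpha> (orth_act \<mu> x)"
proof (rule orth_act_unique)
  let ?y = "orth_act \<mu> x"
  show e0: "0 \<le> nrm ?y + nrm x" by (intro add_nonneg_nonneg nrm_nonneg)
  fix \<epsilon> :: real assume eps: "0 < \<epsilon>"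
  have "densely 1 (\<lambda>\<rho>. (\<exists>t. near \<rho> \<alpha> t 1) \<and> (\<exists>u. near \<rho> \<mu> u 1))" by (rule near_densely2) simp
  thus "densely 1 (\<lambda>\<rho>. \<exists>t. near \<rho> (\<alpha> * \<mu>) t \<epsilon> \<and> E.le_on \<rho> (nrm (orth_act \<alpha> ?y - sc t x)) (\<epsilon> *\<^sub>R (nrm ?y + nrm x)))"
  proof (rule densely_densely)
    fix \<rho> assume r: "\<rho> \<in> band_projections" "\<rho> \<le> 1" "(\<exists>t. near \<rho> \<alpha> t 1) \<and> (\<exists>u. near \<rho> \<mu> u 1)"
    then obtain t0 u0 where tu: "near \<rho> \<alpha> t0 1" "near \<rho> \<mu> u0 1" by blast
    \<comment> \<open>A bound for the scalars must be known before \<open>\<delta>\<close> is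
      chosen. Approximations within 1 supply it: every finer value differs from \<open>t0\<close> or
      \<open>u0\<close> by at most 2.\<close>
    define M where "M = \<bar>t0\<bar> + \<bar>u0\<bar> + 2"
    define \<delta> where "\<delta> = min 1 (\<epsilon> / (2 * M + 1))"
    have M: "0 < 2 * M + 1" "2 \<le> M" by (auto simp: M_def)
    have "\<delta> * (2 * M + 1) \<le> (\<epsilon> / (2 * M + 1)) * (2 * M + 1)"
      using M by (intro mult_right_mono) (auto simp: \<delta>_def)
    hence d: "0 < \<delta>" "\<delta> \<le> 1" "\<delta> * (2 * M + 1) \<le> \<epsilon>"
      using M eps by (auto simp: \<delta>_def)
    have "densely \<rho> (\<lambda>\<rho>. (\<exists>t. near \<rho> \<alpha> t \<delta>) \<and> (\<exists>u. near \<rho> \<mu> u \<delta>))"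
      using near_densely2[OF d(1)] r(2) by (rule densely_subset)
    thus "densely \<rho> (\<lambda>\<rho>. \<exists>t. near \<rho> (\<alpha> * \<mu>) t \<epsilon> \<and> E.le_on \<rho> (nrm (orth_act \<alpha> ?y - sc t x)) (\<epsilon> *\<^sub>R (nrm ?y + nrm x)))"
    proof (rule densely_mono, elim exE conjE, intro exI conjI)
      fix \<kappa> t u assume k: "\<kappa> \<in> band_projections" "\<kappa> \<noteq> 0" "\<kappa> \<le> \<rho>" and n: "near \<kappa> \<alpha> t \<delta>" "near \<kappa> \<mu> u \<delta>"
      have "\<bar>t0 - t\<bar> \<le> 1 + \<delta>" "\<bar>u0 - u\<bar> \<le> 1 + \<delta>"
        using near_unique[OF near_down[OF tu(1) k(1) r(1) k(3)] n(1) k(1,2)]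
          near_unique[OF near_down[OF tu(2) k(1) r(1) k(3)] n(2) k(1,2)] .
      hence b: "\<bar>t\<bar> \<le> M" "\<bar>u\<bar> \<le> M" using d unfolding M_def by linarith+
      have "\<delta> * (\<bar>u\<bar> + \<delta>) + \<bar>t\<bar> * \<delta> = \<delta> * (\<bar>u\<bar> + \<bar>t\<bar> + \<delta>)" by (simp add: algebra_simps)
      also have "\<dots> \<le> \<delta> * (2 * M + 1)" using d b by (intro mult_left_mono) auto
      finally have "\<delta> * (\<bar>u\<bar> + \<delta>) + \<bar>t\<bar> * \<delta> \<le> \<epsilon>" using d by linarith
      hence "(\<delta> * (\<bar>u\<bar> + \<delta>) + \<bar>t\<bar> * \<delta>) *\<^sub>R (1 :: 'e orth) \<le> \<epsilon> *\<^sub>R 1" by (intro scaleR_right_mono orth_zero_le_one)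
      from L.le_onI[OF this k(1)] near_mult[OF n k(1)] d
      show "near \<kappa> (\<alpha> * \<mu>) (t * u) \<epsilon>" unfolding near_def using L.le_on_trans by auto
      have "orth_act \<alpha> ?y - sc (t * u) x = (orth_act \<alpha> ?y - sc t ?y) + sc t (?y - sc u x)" by (simp add: sc_simps)
      hence 1: "E.le_on \<kappa> (nrm (orth_act \<alpha> ?y - sc (t * u) x)) (nrm (orth_act \<alpha> ?y - sc t ?y) + \<bar>t\<bar> *\<^sub>R nrm (?y - sc u x))"
        using E.le_onI[OF nrm_triangle k(1)] nrm_sc by metis
      have 2: "E.le_on \<kappa> (nrm (orth_act \<alpha> ?y - sc t ?y) + \<bar>t\<bar> *\<^sub>R nrm (?y - sc u x)) (\<delta> *\<^sub>R nrm ?y + \<bar>t\<bar> *\<^sub>R (\<delta> *\<^sub>R nrm x))"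
        using n k by (intro E.le_on_add E.le_on_scaleR orth_act_near) auto
      have "\<bar>t\<bar> * \<delta> \<le> \<epsilon>"
      proof -
        have "\<bar>t\<bar> * \<delta> \<le> (2 * M + 1) * \<delta>" using b d M by (intro mult_right_mono) auto
        thus ?thesis using d(3) by (metis mult.commute order_trans)
      qed
      moreover have "\<delta> \<le> \<epsilon>"
      proof -
        have "\<delta> * 1 \<le> \<delta> * (2 * M + 1)" using d M by (intro mult_left_mono) auto
        thus ?thesis using d(3) by (metis order_trans mult.right_neutral)
      qed
      ultimately have "\<delta> *\<^sub>R nrm ?y + (\<bar>t\<bar> * \<delta>) *\<^sub>R nrm x \<le> \<epsilon> *\<^sub>R nrm ?y + \<epsilon> *\<^sub>R nrm x"
        by (intro add_mono scaleR_right_mono nrm_nonneg)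
      hence 3: "E.le_on \<kappa> (\<delta> *\<^sub>R nrm ?y + \<bar>t\<bar> *\<^sub>R (\<delta> *\<^sub>R nrm x)) (\<epsilon> *\<^sub>R (nrm ?y + nrm x))"
        using k by (intro E.le_onI) (simp_all add: scaleR_add_right)
      show "E.le_on \<kappa> (nrm (orth_act \<alpha> ?y - sc (t * u) x)) (\<epsilon> *\<^sub>R (nrm ?y + nrm x))"
        by (rule E.le_on_trans[OF E.le_on_trans[OF 1 2] 3])
    qed
  qed
qed

text \<open>On suitable small parts a projection is the number 1 or the number 0.\<close>

lemma orth_act_band:
  assumes p: "\<pi> \<in> band_projections"
  shows "orth_act \<pi> x = band_part \<pi> x"
proof (rule orth_act_unique)
  show "0 \<le> nrm x" by (rule nrm_nonneg)
  fix \<epsilon> :: real assume eps: "0 < \<epsilon>"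
  have e: "0 \<le> \<epsilon> *\<^sub>R (1 :: 'e orth)" "0 \<le> \<epsilon> *\<^sub>R nrm x"
    using eps orth_zero_le_one nrm_nonneg by (auto intro!: scaleR_nonneg_nonneg)
  show "densely 1 (\<lambda>\<rho>. \<exists>t. near \<rho> \<pi> t \<epsilon> \<and> E.le_on \<rho> (nrm (band_part \<pi> x - sc t x)) (\<epsilon> *\<^sub>R nrm x))"
    unfolding densely_def
  proof (intro ballI impI)
    fix \<kappa> :: "'e orth" assume k: "\<kappa> \<in> band_projections" "\<kappa> \<le> 1" "\<kappa> \<noteq> 0"
    show "\<exists>\<rho>\<in>band_projections. \<rho> \<noteq> 0 \<and> \<rho> \<le> \<kappa> \<and> (\<exists>t. near \<rho> \<pi> t \<epsilon> \<and> E.le_on \<rho> (nrm (band_part \<pi> x - sc t x)) (\<epsilon> *\<^sub>R nrm x))"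
    proof (rule bp_split[OF k(1,3) p])
      let ?k = "\<kappa> * \<pi>"
      assume a: "?k \<in> band_projections" "?k \<noteq> 0" "?k \<le> \<kappa>" "?k \<le> \<pi>"
      have "L.le_on ?k (\<pi> - 1 *\<^sub>R 1) 0" "L.le_on ?k (- (\<pi> - 1 *\<^sub>R 1)) 0"
        using p by (auto simp: L.le_on_def algebra_simps bp_idem)
      hence "L.le_on ?k \<bar>\<pi> - 1 *\<^sub>R 1\<bar> 0" using a(1) by (intro L.le_on_abs)
      hence "near ?k \<pi> 1 \<epsilon>" unfolding near_def using L.le_on_trans L.le_onI[OF e(1) a(1)] by blast
      moreover have "orth_apply ?k (nrm (band_part \<pi> x - sc 1 x)) = 0"
        using le_on_band_part[OF p a(1,4), of x "sc 1 x"] by (simp add: sc_simps X.nrm_0 orth_simps)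
      hence "E.le_on ?k (nrm (band_part \<pi> x - sc 1 x)) (\<epsilon> *\<^sub>R nrm x)"
        using orth_apply_nonneg[OF bp_nonneg[OF a(1)] e(2)] by (simp add: E.le_on_def)
      ultimately show ?thesis using a by blast
    next
      let ?k = "\<kappa> * (1 - \<pi>)"
      assume a: "?k \<in> band_projections" "?k \<noteq> 0" "?k \<le> \<kappa>" "?k \<le> 1 - \<pi>"
      have "L.le_on ?k (\<pi> - 0 *\<^sub>R 1) 0" "L.le_on ?k (- (\<pi> - 0 *\<^sub>R 1)) 0"
        using p by (auto simp: L.le_on_def algebra_simps bp_idem)
      hence "L.le_on ?k \<bar>\<pi> - 0 *\<^sub>R 1\<bar> 0" using a(1) by (intro L.le_on_abs)
      hence "near ?k \<pi> 0 \<epsilon>" unfolding near_def using L.le_on_trans L.le_onI[OF e(1) a(1)] by blast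
      moreover have "orth_apply ?k (nrm (band_part \<pi> x - sc 0 x)) = 0"
        using p by (simp add: sc_simps nrm_band_part E.P_mult E.P_comp orth_simps)
      hence "E.le_on ?k (nrm (band_part \<pi> x - sc 0 x)) (\<epsilon> *\<^sub>R nrm x)"
        using orth_apply_nonneg[OF bp_nonneg[OF a(1)] e(2)] by (simp add: E.le_on_def)
      ultimately show ?thesis using a by blast
    qed
  qed
qed

lemma nrm_orth_act: "nrm (orth_act \<alpha> x) = orth_apply \<bar>\<alpha>\<bar> (nrm x)"
proof -
  have "\<bar>nrm (orth_act \<alpha> x) - orth_apply \<bar>\<alpha>\<bar> (nrm x)\<bar> \<le> 0"
  proof (rule archimedean_le_0)
    fix \<epsilon> :: real assume eps: "0 < \<epsilon>"
    show "\<bar>nrm (orth_act \<alpha> x) - orth_apply \<bar>\<alpha>\<bar> (nrm x)\<bar> \<le> \<epsilon> *\<^sub>R (nrm x + nrm x)"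
    proof (rule E.local_le1[OF densely_mono[OF near_densely[OF eps, of \<alpha>]]], elim exE)
      fix \<rho> t assume r: "\<rho> \<in> band_projections" and t: "near \<rho> \<alpha> t \<epsilon>"
      have 1: "E.le_on \<rho> \<bar>nrm (orth_act \<alpha> x) - \<bar>t\<bar> *\<^sub>R nrm x\<bar> (\<epsilon> *\<^sub>R nrm x)"
        using E.le_on_trans[OF E.le_onI[OF X.nrm_reverse r] orth_act_near[OF t r]] nrm_sc by metis
      have "L.le_on \<rho> (\<bar>\<alpha>\<bar> - \<bar>t\<bar> *\<^sub>R 1) (\<epsilon> *\<^sub>R 1)" "L.le_on \<rho> (\<bar>t\<bar> *\<^sub>R 1 - \<bar>\<alpha>\<bar>) (\<epsilon> *\<^sub>R 1)"
        using near_abs[OF t r] r by (auto simp: near_def L.le_on_abs_iff)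
      from le_on_orth_apply[OF this(1) nrm_nonneg[of x]] le_on_orth_apply[OF this(2) nrm_nonneg[of x]]
      have 2: "E.le_on \<rho> \<bar>\<bar>t\<bar> *\<^sub>R nrm x - orth_apply \<bar>\<alpha>\<bar> (nrm x)\<bar> (\<epsilon> *\<^sub>R nrm x)"
        using r by (simp add: E.le_on_abs_iff orth_simps)
      have "E.le_on \<rho> \<bar>nrm (orth_act \<alpha> x) - orth_apply \<bar>\<alpha>\<bar> (nrm x)\<bar>
          (\<bar>nrm (orth_act \<alpha> x) - \<bar>t\<bar> *\<^sub>R nrm x\<bar> + \<bar>\<bar>t\<bar> *\<^sub>R nrm x - orth_apply \<bar>\<alpha>\<bar> (nrm x)\<bar>)"
        using E.nrm_triangle3 r by (rule E.le_onI)
      from E.le_on_trans[OF this E.le_on_add[OF 1 2]]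
      show "E.le_on \<rho> \<bar>nrm (orth_act \<alpha> x) - orth_apply \<bar>\<alpha>\<bar> (nrm x)\<bar> (\<epsilon> *\<^sub>R (nrm x + nrm x))"
        by (simp only: scaleR_add_right)
    qed
  qed
  thus ?thesis by simp
qed

lemma orth_act_one: "orth_act 1 x = x"
  unfolding orth_act_band[OF bp_one]
  by (rule band_part_unique) (auto simp: X.nrm_0 orth_simps)

lemma is_orth_action_orth_act: "is_orth_action scale nrm orth_act"
  unfolding is_orth_action_def
  by (intro conjI allI ballI)
    (simp_all add: orth_act_add orth_act_scale orth_act_plus orth_act_scaleR orth_act_mult
      orth_act_one nrm_orth_act orth_act_band nrm_band_mix)

text \<open>Additivity, the rule for real multiples of 1 and the norm formula force the value at
  every \<open>\<alpha>\<close> by local approximation. Hence the description operator in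
  \<open>orth_action\<close> is meaningful.\<close>

lemma is_orth_action_unique:
  assumes "is_orth_action scale nrm act"
  shows "act = orth_act"
proof (intro ext)
  fix \<alpha> x
  have plus: "act (\<mu> + \<nu>) x = act \<mu> x + act \<nu> x" for \<mu> \<nu> using assms unfolding is_orth_action_def by blast
  have "act (r *\<^sub>R 1) x = sc r (act 1 x)" for r using assms unfolding is_orth_action_def sc_def by blast
  moreover have "act 1 x = x" using assms unfolding is_orth_action_def by blast
  ultimately have r: "act (r *\<^sub>R 1) x = sc r x" for r by simp
  have n: "nrm (act \<mu> x) = orth_apply \<bar>\<mu>\<bar> (nrm x)" for \<mu> using assms unfolding is_orth_action_def by blast
  have "orth_act \<alpha> x = act \<alpha> x"
  proof (rule orth_act_unique[OF nrm_nonneg[of x]])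
    fix \<epsilon> :: real assume eps: "0 < \<epsilon>"
    show "densely 1 (\<lambda>\<rho>. \<exists>t. near \<rho> \<alpha> t \<epsilon> \<and> E.le_on \<rho> (nrm (act \<alpha> x - sc t x)) (\<epsilon> *\<^sub>R nrm x))"
    proof (rule densely_mono[OF near_densely[OF eps]], elim exE, intro exI conjI)
      fix \<rho> t assume p: "\<rho> \<in> band_projections" and t: "near \<rho> \<alpha> t \<epsilon>"
      have "act \<alpha> x - sc t x = act (\<alpha> - t *\<^sub>R 1) x"
        using plus[of "\<alpha> - t *\<^sub>R 1" "t *\<^sub>R 1"] r by simp
      hence "nrm (act \<alpha> x - sc t x) = orth_apply \<bar>\<alpha> - t *\<^sub>R 1\<bar> (nrm x)" using n by metis
      thus "E.le_on \<rho> (nrm (act \<alpha> x - sc t x)) (\<epsilon> *\<^sub>R nrm x)"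
        using le_on_orth_apply[OF t[unfolded near_def] nrm_nonneg[of x]] by (simp add: orth_simps)
    qed
  qed
  thus "act \<alpha> x = orth_act \<alpha> x" ..
qed

lemma is_orth_action_orth_action: "is_orth_action scale nrm (orth_action scale nrm)"
  unfolding orth_action_def
  by (rule theI[of _ orth_act]) (simp_all add: is_orth_action_orth_act is_orth_action_unique)

end

section \<open>The module structure and the existence of mixings\<close>

locale bk_action = banach_kantorovich scale nrm
  for scale :: "'k::real_normed_field \<Rightarrow> 'x::ab_group_add \<Rightarrow> 'x"
    and nrm :: "'x \<Rightarrow> 'e::dedekind_vector_lattice" +
  fixes act :: "'e orth \<Rightarrow> 'x \<Rightarrow> 'x"
  assumes action: "is_orth_action scale nrm act"
begin

lemma act_add: "act l (x + y) = act l x + act l y"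
  using action by (simp add: is_orth_action_def)
lemma act_plus: "act (l + m) x = act l x + act m x"
  using action by (simp add: is_orth_action_def)
lemma act_scaleR: "act (r *\<^sub>R l) x = scale (of_real r) (act l x)"
  using action by (simp add: is_orth_action_def)
lemma act_mult: "act (l * m) x = act l (act m x)"
  using action by (simp add: is_orth_action_def)
lemma act_one: "act 1 x = x"
  using action by (simp add: is_orth_action_def)
lemma nrm_act: "nrm (act l x) = orth_apply \<bar>l\<bar> (nrm x)"
  using action by (simp add: is_orth_action_def)

lemma act_0: "act l 0 = 0" using act_add[of l 0 0] by simp
lemma act_diff: "act l (x - y) = act l x - act l y" using act_add[of l "x - y" y] by (simp add: algebra_simps)
lemma act_zero: "act 0 x = 0" using act_plus[of 0 0 x] by simp
lemma act_sub: "act (l - m) x = act l x - act m x" using act_plus[of "l - m" m x] by (simp add: algebra_simps)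

lemma nrm_act_bp: "\<pi> \<in> band_projections \<Longrightarrow> nrm (act \<pi> x) = orth_apply \<pi> (nrm x)"
  by (simp add: nrm_act bp_nonneg)

lemma act_eq_iff:
  assumes "\<pi> \<in> band_projections"
  shows "act \<pi> x = act \<pi> y \<longleftrightarrow> E.le_on \<pi> (nrm (x - y)) 0"
proof -
  have "act \<pi> x = act \<pi> y \<longleftrightarrow> nrm (act \<pi> (x - y)) = 0"
    using nrm_eq_0[of "act \<pi> (x - y)"] X.nrm_0 by (auto simp: act_diff)
  also have "\<dots> \<longleftrightarrow> E.le_on \<pi> (nrm (x - y)) 0"
    using orth_apply_nonneg[OF bp_nonneg[OF assms] nrm_nonneg]
    by (auto simp: nrm_act_bp[OF assms] E.le_on_def orth_simps intro: order_antisym)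
  finally show ?thesis .
qed

lemma orth_apply_nrm_cong:
  assumes "\<pi> \<in> band_projections" "act \<pi> x = act \<pi> y"
  shows "orth_apply \<pi> (nrm (x - z)) = orth_apply \<pi> (nrm (y - z))"
  using assms by (simp add: nrm_act_bp[symmetric] act_diff)

lemma act_eq_down:
  assumes "act \<pi> x = act \<pi> y" "\<pi> \<in> band_projections" "\<rho> \<in> band_projections" "\<rho> \<le> \<pi>"
  shows "act \<rho> x = act \<rho> y"
proof -
  have "\<rho> * \<pi> = \<rho>" using bp_le_iff[OF assms(3,2)] assms(4) by simp
  thus ?thesis using assms(1) by (metis act_mult)
qed

lemma act_idem: "\<pi> \<in> band_projections \<Longrightarrow> act \<pi> (act \<pi> x) = act \<pi> x"
  by (simp add: act_mult[symmetric] bp_idem)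

lemma mixing_unique:
  assumes "partition_of_unity I \<pi>" "\<And>i. i \<in> I \<Longrightarrow> act (\<pi> i) x = act (\<pi> i) y"
  shows "x = y"
proof -
  have "nrm (x - y) \<le> 0"
  proof (rule E.partition_le[OF assms(1)])
    fix i assume i: "i \<in> I"
    hence "\<pi> i \<in> band_projections" using assms(1) by (auto simp: partition_of_unity_def)
    thus "E.le_on (\<pi> i) (nrm (x - y)) 0" using assms(2)[OF i] act_eq_iff by blast
  qed
  hence "nrm (x - y) = 0" using nrm_nonneg by (simp add: order_antisym)
  thus ?thesis using nrm_eq_0 by fastforce
qed

text \<open>The demands for \<open>glue\<close> are exact on \<open>\<pi> i\<close> and allow the
  common bound \<open>e\<close> elsewhere. Two of them are compatible because each centre lives on a
  part where the other demand is tolerant; a common lower bound of the tolerances is at most 0 on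
  every \<open>\<pi> i\<close>, hence everywhere.\<close>

lemma mixing_ex:
  assumes part: "partition_of_unity I \<pi>" and b: "\<And>i. i \<in> I \<Longrightarrow> E.le_on (\<pi> i) (nrm (x i)) e" and e: "0 \<le> e"
  shows "\<exists>y. \<forall>i\<in>I. act (\<pi> i) y = act (\<pi> i) (x i)"
proof (cases "I = {}")
  case False
  define T where "T = (\<lambda>i. (act (\<pi> i) (x i), orth_apply (1 - \<pi> i) e)) ` I"
  have p: "\<pi> i \<in> band_projections" if "i \<in> I" for i using part that by (auto simp: partition_of_unity_def)
  have q: "1 - \<pi> i \<in> band_projections" if "i \<in> I" for i using p[OF that] by simp
  have d0: "0 \<le> orth_apply (1 - \<pi> i) e" if "i \<in> I" for i
    by (rule orth_apply_nonneg[OF bp_nonneg[OF q[OF that]] e])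
  have bb: "nrm (act (\<pi> i) (x i)) \<le> orth_apply (1 - \<pi> j) e" if ij: "i \<in> I" "j \<in> I" "i \<noteq> j" for i j
  proof -
    have "\<pi> i * \<pi> j = 0" using part ij bp_inf[OF p p] unfolding partition_of_unity_def by metis
    hence le: "\<pi> i \<le> 1 - \<pi> j" using p q ij by (subst bp_le_iff) (auto simp: algebra_simps)
    have "nrm (act (\<pi> i) (x i)) \<le> orth_apply (\<pi> i) e"
      using b[OF ij(1)] p[OF ij(1)] by (simp add: nrm_act_bp E.le_on_def)
    also have "\<dots> \<le> orth_apply (1 - \<pi> j) e" using le e by (simp only: orth_le_iff)
    finally show ?thesis .
  qed
  have "\<exists>y. \<forall>(z, d)\<in>T. nrm (y - z) \<le> d"
  proof (rule glue)
    show "T \<noteq> {}" using False by (simp add: T_def)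
    fix z d z' d' assume "(z, d) \<in> T" "(z', d') \<in> T"
    then obtain i j where ij: "i \<in> I" "j \<in> I" "z = act (\<pi> i) (x i)" "z' = act (\<pi> j) (x j)"
      "d = orth_apply (1 - \<pi> i) e" "d' = orth_apply (1 - \<pi> j) e" by (auto simp: T_def)
    show "nrm (z - z') \<le> d + d'"
    proof (cases "i = j")
      case True
      then show ?thesis using ij add_nonneg_nonneg[OF d0[OF ij(1)] d0[OF ij(2)]] by (simp add: X.nrm_0)
    next
      case False
      have "nrm (z - z') \<le> nrm z + nrm z'" by (rule X.nrm_diff_le)
      also have "\<dots> \<le> d' + d" using ij False bb by (intro add_mono) auto
      finally show ?thesis by (simp add: add.commute)
    qed
  next
    fix h assume h: "\<And>z d. (z, d) \<in> T \<Longrightarrow> h \<le> d"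
    show "h \<le> 0"
    proof (rule E.partition_le[OF part])
      fix i assume i: "i \<in> I"
      have "h \<le> orth_apply (1 - \<pi> i) e" using i by (intro h) (auto simp: T_def)
      from E.le_onI[OF this p[OF i]] show "E.le_on (\<pi> i) h 0"
        using p[OF i] by (simp add: E.le_on_def E.P_comp orth_simps)
    qed
  qed
  then obtain y where y: "\<And>i. i \<in> I \<Longrightarrow> nrm (y - act (\<pi> i) (x i)) \<le> orth_apply (1 - \<pi> i) e"
    by (auto simp: T_def)
  have "act (\<pi> i) y = act (\<pi> i) (x i)" if i: "i \<in> I" for i
  proof -
    have "act (\<pi> i) y = act (\<pi> i) (act (\<pi> i) (x i))"
      using E.le_onI[OF y[OF i] p[OF i]] p[OF i] by (simp add: act_eq_iff E.le_on_def E.P_comp orth_simps)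
    thus ?thesis using p[OF i] by (simp add: act_idem)
  qed
  thus ?thesis by blast
qed simp

lemma mixing_norm_le:
  assumes part: "partition_of_unity I \<pi>" and b: "\<And>i. i \<in> I \<Longrightarrow> E.le_on (\<pi> i) (nrm (x i - z)) e"
    and y: "\<And>i. i \<in> I \<Longrightarrow> act (\<pi> i) y = act (\<pi> i) (x i)"
  shows "nrm (y - z) \<le> e"
proof (rule E.partition_le[OF part])
  fix i assume i: "i \<in> I"
  hence "\<pi> i \<in> band_projections" using part by (auto simp: partition_of_unity_def)
  thus "E.le_on (\<pi> i) (nrm (y - z)) e"
    using b[OF i] orth_apply_nrm_cong[OF _ y[OF i]] by (simp add: E.le_on_def)
qed

end

section \<open>Dividing by a fixed positive element\<close>

text \<open>If \<open>\<mu>\<close> exceeded \<open>r\<close> by some \<open>\<delta>\<close> on a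
  part, \<open>\<mu> e\<close> would exceed \<open>r e\<close> by \<open>\<delta> e\<close> there,
  and fullness of \<open>e\<close> forbids this.\<close>

lemma le_on_cancel:
  assumes "0 \<le> e" "E.full \<rho> e" "\<rho> \<in> band_projections" "E.le_on \<rho> (orth_apply \<mu> e) (r *\<^sub>R e)"
  shows "L.le_on \<rho> \<mu> (r *\<^sub>R 1)"
proof (rule ccontr)
  assume "\<not> L.le_on \<rho> \<mu> (r *\<^sub>R 1)"
  then obtain \<kappa> \<delta> where k: "\<kappa> \<in> band_projections" "\<kappa> \<noteq> 0" "\<kappa> \<le> \<rho>" "0 < \<delta>" "L.le_on \<kappa> (r *\<^sub>R 1 + \<delta> *\<^sub>R 1) \<mu>"
    using L.not_le_on[OF assms(3), of \<mu> "r *\<^sub>R 1" 1] by metis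
  have "E.le_on \<kappa> ((r + \<delta>) *\<^sub>R e) (orth_apply \<mu> e)"
    using le_on_orth_apply[OF k(5) assms(1)] by (simp add: orth_simps scaleR_add_left)
  hence "E.le_on \<kappa> ((r + \<delta>) *\<^sub>R e) (r *\<^sub>R e)"
    using E.le_on_trans E.le_on_down[OF assms(4) k(1) assms(3) k(3)] by blast
  hence "r + \<delta> \<le> r" using E.le_on_real[OF assms(1) E.full_down[OF assms(2) k(3)] k(1,2)] by blast
  thus False using k by simp
qed

text \<open>A Radon--Nikodym statement: \<open>\<mu>\<close> is the density of \<open>x\<close> with
  respect to \<open>e\<close>. It is built as the supremum of the one-step elements
  \<open>c \<rho>\<close> with \<open>c e \<le> x\<close> on \<open>\<rho>\<close>; vanishing
  outside the carrier normalises it.\<close>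

lemma divide_ex:
  assumes x: "0 \<le> x" "x \<le> e" and t: "\<tau> \<in> band_projections" "orth_apply \<tau> e = e" "E.full \<tau> e"
  shows "\<exists>\<mu>. 0 \<le> \<mu> \<and> \<mu> \<le> 1 \<and> orth_apply \<mu> e = x \<and> (1 - \<tau>) * \<mu> = 0"
proof -
  have e: "0 \<le> e" using x by (rule order_trans)
  define A where "A = {c *\<^sub>R \<rho> | c \<rho>. 0 \<le> c \<and> \<rho> \<in> band_projections \<and> \<rho> \<le> \<tau> \<and> E.le_on \<rho> (c *\<^sub>R e) x}"
  define \<mu> where "\<mu> = Sup A"
  have cb: "c' \<le> c" if "\<rho> \<in> band_projections" "\<rho> \<noteq> 0" "\<rho> \<le> \<tau>" "E.le_on \<rho> (c' *\<^sub>R e) x" "E.le_on \<rho> x (c *\<^sub>R e)" for c c' \<rho>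
    using E.le_on_real[OF e E.full_down[OF t(3) that(3)] that(1,2) E.le_on_trans[OF that(4,5)]] .
  have a1: "a \<le> 1" if a: "a \<in> A" for a
  proof -
    obtain c \<rho> where c: "a = c *\<^sub>R \<rho>" "0 \<le> c" "\<rho> \<in> band_projections" "\<rho> \<le> \<tau>" "E.le_on \<rho> (c *\<^sub>R e) x"
      using a by (auto simp: A_def)
    show ?thesis
    proof (cases "\<rho> = 0")
      case True
      then show ?thesis using c orth_zero_le_one by simp
    next
      case False
      have "E.le_on \<rho> x (1 *\<^sub>R e)" using x(2) c(3) by (intro E.le_onI) auto
      hence "c \<le> 1" using cb[OF c(3) False c(4,5)] by blast
      hence "c *\<^sub>R \<rho> \<le> 1 *\<^sub>R \<rho>" using c by (intro scaleR_right_mono bp_nonneg)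
      thus ?thesis using bp_le_one[OF c(3)] c(1) by simp
    qed
  qed
  hence bdd: "bdd_above A" by (rule bdd_aboveI)
  have "0 *\<^sub>R (0 :: 'a orth) \<in> A" unfolding A_def using bp_nonneg[OF t(1)]
    by (intro CollectI exI[of _ 0] exI[of _ "0 :: 'a orth"]) (auto simp: E.le_on_zero)
  hence A0: "0 \<in> A" by simp
  have m0: "0 \<le> \<mu>" unfolding \<mu>_def by (rule cSup_upper[OF A0 bdd])
  have m1: "\<mu> \<le> 1" unfolding \<mu>_def using A0 by (intro cSup_least a1) auto
  have outside: "(1 - \<tau>) * \<mu> = 0"
  proof -
    have "L.le_on (1 - \<tau>) (Sup A) 0"
    proof (rule L.le_on_Sup[OF _ _ bdd])
      fix a assume "a \<in> A"
      then obtain c \<rho> where c: "a = c *\<^sub>R \<rho>" "\<rho> \<in> band_projections" "\<rho> \<le> \<tau>" by (auto simp: A_def)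
      have "(1 - \<tau>) * \<rho> = \<rho> * (1 - \<tau>)" using band_projection_commute[OF c(2)] by simp
      also have "\<dots> = 0" using bp_le_iff[OF c(2) t(1)] c(3) by (simp add: algebra_simps)
      finally show "L.le_on (1 - \<tau>) a 0" by (simp add: L.le_on_def c(1) orth_scaleR_mult)
    qed (use A0 bp_compl[OF t(1)] in auto)
    moreover have "0 \<le> (1 - \<tau>) * \<mu>" by (rule orth_mult_nonneg[OF bp_nonneg[OF bp_compl[OF t(1)]] m0])
    ultimately show ?thesis unfolding L.le_on_def \<mu>_def by (simp only: mult_zero_right order_antisym)
  qed
  \<comment> \<open>Where \<open>x\<close> is \<open>c e\<close> up to \<open>\<epsilon> e\<close>,
    no member of \<open>A\<close> exceeds \<open>c + \<epsilon>\<close>, while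
    \<open>(c - \<epsilon>) \<rho>\<close> belongs to \<open>A\<close> unless its coefficient is
    negative. So \<open>\<mu>\<close> is \<open>c\<close> up to \<open>\<epsilon>\<close>, and
    \<open>\<mu> e\<close> misses \<open>x\<close> by at most \<open>2 \<epsilon> e\<close>.\<close>
  have close: "E.le_on \<rho> \<bar>orth_apply \<mu> e - x\<bar> (\<epsilon> *\<^sub>R (e + e))"
    if r: "\<rho> \<in> band_projections" "\<rho> \<noteq> 0" "\<rho> \<le> \<tau>" and c: "0 \<le> c" "E.le_on \<rho> \<bar>x - c *\<^sub>R e\<bar> (\<epsilon> *\<^sub>R e)" and eps: "0 < \<epsilon>" for \<rho> c \<epsilon>
  proof -
    have xc: "E.le_on \<rho> (x - c *\<^sub>R e) (\<epsilon> *\<^sub>R e)" "E.le_on \<rho> (c *\<^sub>R e - x) (\<epsilon> *\<^sub>R e)"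
      using c(2) r(1) by (auto simp: E.le_on_abs_iff)
    have xu: "E.le_on \<rho> x ((c + \<epsilon>) *\<^sub>R e)" using xc(1) by (simp add: E.le_on_diff_le scaleR_add_left add.commute)
    have xl: "E.le_on \<rho> ((c - \<epsilon>) *\<^sub>R e) x"
    proof -
      have "E.le_on \<rho> ((c *\<^sub>R e - x) - \<epsilon> *\<^sub>R e) 0" using xc(2) by (simp only: E.le_on_diff[symmetric])
      moreover have "(c *\<^sub>R e - x) - \<epsilon> *\<^sub>R e = (c - \<epsilon>) *\<^sub>R e - x" by (simp add: algebra_simps)
      ultimately show ?thesis by (simp only: E.le_on_diff[of \<rho> _ x])
    qed
    have up: "L.le_on \<rho> \<mu> ((c + \<epsilon>) *\<^sub>R 1)" unfolding \<mu>_def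
    proof (rule L.le_on_Sup[OF r(1) _ bdd])
      show "A \<noteq> {}" using A0 by blast
      fix a assume "a \<in> A"
      then obtain c' \<rho>' where a: "a = c' *\<^sub>R \<rho>'" "0 \<le> c'" "\<rho>' \<in> band_projections" "\<rho>' \<le> \<tau>" "E.le_on \<rho>' (c' *\<^sub>R e) x"
        by (auto simp: A_def)
      show "L.le_on \<rho> a ((c + \<epsilon>) *\<^sub>R 1)"
      proof (cases "\<rho> * \<rho>' = 0")
        case True
        thus ?thesis using a(1) c(1) eps bp_nonneg[OF r(1)]
          by (simp add: L.le_on_def orth_scaleR_mult scaleR_nonneg_nonneg)
      next
        case False
        have k: "\<rho> * \<rho>' \<in> band_projections" "\<rho> * \<rho>' \<le> \<tau>" "\<rho> * \<rho>' \<le> \<rho>"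
          using r a bp_mult_le[OF r(1) a(3)] by (auto intro: order_trans)
        have "c' \<le> c + \<epsilon>" using cb[OF k(1) False k(2) E.le_on_mult(2)[OF a(5) r(1) a(3)] E.le_on_mult(1)[OF xu a(3) r(1)]] .
        hence "c' *\<^sub>R (\<rho> * \<rho>') \<le> (c + \<epsilon>) *\<^sub>R (\<rho> * \<rho>')" by (intro scaleR_right_mono bp_nonneg k)
        also have "\<dots> \<le> (c + \<epsilon>) *\<^sub>R \<rho>" using c(1) eps k by (intro scaleR_left_mono) auto
        finally show ?thesis by (simp add: L.le_on_def a(1) orth_scaleR_mult)
      qed
    qed
    have low: "L.le_on \<rho> ((c - \<epsilon>) *\<^sub>R 1) \<mu>"
    proof (cases "0 \<le> c - \<epsilon>")
      case True
      have "(c - \<epsilon>) *\<^sub>R \<rho> \<in> A" unfolding A_def using True r xl by blast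
      hence "(c - \<epsilon>) *\<^sub>R \<rho> \<le> \<mu>" unfolding \<mu>_def by (rule cSup_upper[OF _ bdd])
      from L.le_onI[OF this r(1)] show ?thesis using r(1) by (simp add: L.le_on_def orth_scaleR_mult bp_idem)
    next
      case False
      have "(c - \<epsilon>) *\<^sub>R (1 :: 'a orth) \<le> 0" using False orth_zero_le_one by (intro scaleR_nonpos_nonneg) auto
      thus ?thesis using m0 by (intro L.le_onI r(1)) (rule order_trans)
    qed
    have "E.le_on \<rho> (orth_apply \<mu> e) ((c + \<epsilon>) *\<^sub>R e)" "E.le_on \<rho> ((c - \<epsilon>) *\<^sub>R e) (orth_apply \<mu> e)"
      using le_on_orth_apply[OF up e] le_on_orth_apply[OF low e] by (simp_all add: orth_simps)
    hence "E.le_on \<rho> (orth_apply \<mu> e - x) ((c + \<epsilon>) *\<^sub>R e - (c - \<epsilon>) *\<^sub>R e)" "E.le_on \<rho> (x - orth_apply \<mu> e) ((c + \<epsilon>) *\<^sub>R e - (c - \<epsilon>) *\<^sub>R e)"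
      using xu xl by (auto simp: E.le_on_def E.P_diff intro: diff_mono)
    moreover have "(c + \<epsilon>) *\<^sub>R e - (c - \<epsilon>) *\<^sub>R e = \<epsilon> *\<^sub>R (e + e)" by (simp add: algebra_simps)
    ultimately show ?thesis using r(1) by (simp add: E.le_on_abs_iff)
  qed
  have "orth_apply \<mu> e = x"
  proof -
    have "\<bar>orth_apply \<mu> e - x\<bar> \<le> 0"
    proof (rule archimedean_le_0)
      fix \<epsilon> :: real assume eps: "0 < \<epsilon>"
      have e2: "0 \<le> \<epsilon> *\<^sub>R (e + e)" using eps e by (simp add: scaleR_nonneg_nonneg)
      have 1: "E.le_on \<tau> \<bar>orth_apply \<mu> e - x\<bar> (\<epsilon> *\<^sub>R (e + e))"
      proof (rule E.local_le[OF t(1)])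
        have "densely \<tau> (\<lambda>\<rho>. \<exists>c. 0 \<le> c \<and> c \<le> 1 \<and> E.le_on \<rho> \<bar>x - c *\<^sub>R e\<bar> (\<epsilon> *\<^sub>R e))"
          using x t(1) by (intro E.real_approx e eps) (auto intro: E.le_onI)
        thus "densely \<tau> (\<lambda>\<rho>. E.le_on \<rho> \<bar>orth_apply \<mu> e - x\<bar> (\<epsilon> *\<^sub>R (e + e)))"
          by (rule densely_mono) (use close eps in blast)
      qed
      have "E.le_on (1 - \<tau>) x e" using x t(1) by (intro E.le_onI) auto
      moreover have te: "orth_apply (1 - \<tau>) e = 0" using t(2) by (simp add: orth_simps)
      moreover have "0 \<le> orth_apply (1 - \<tau>) x" using x t(1) by (intro orth_apply_nonneg[OF bp_nonneg]) auto
      ultimately have "orth_apply (1 - \<tau>) x = 0" by (simp add: E.le_on_def order_antisym)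
      moreover have "orth_apply (1 - \<tau>) (orth_apply \<mu> e) = 0"
        using outside by (metis E.P_mult E.P_zero)
      ultimately have z: "orth_apply (1 - \<tau>) (orth_apply \<mu> e - x) = 0" "orth_apply (1 - \<tau>) (- (orth_apply \<mu> e - x)) = 0"
        by (simp_all only: E.P_diff E.P_minus) simp_all
      have "E.le_on (1 - \<tau>) \<bar>orth_apply \<mu> e - x\<bar> 0"
        using t(1) z by (intro E.le_on_abs) (auto simp: E.le_on_def E.P_0)
      hence "E.le_on (1 - \<tau>) \<bar>orth_apply \<mu> e - x\<bar> (\<epsilon> *\<^sub>R (e + e))"
        using E.le_on_trans E.le_onI[OF e2, of "1 - \<tau>"] t(1) bp_compl by blast
      with 1 show "\<bar>orth_apply \<mu> e - x\<bar> \<le> \<epsilon> *\<^sub>R (e + e)"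
        using E.le_on_split[of 1 \<tau>] by (simp add: E.le_on_1)
    qed
    thus ?thesis by simp
  qed
  thus ?thesis using m0 m1 outside by blast
qed

text \<open>Turns an \<open>E\<close>-valued function into one on which states act. On the carrier
  the oscillation of the quotient is that of \<open>\<psi>\<close> with \<open>e\<close> cancelled;
  outside of it the quotients are 0, so nothing can oscillate.\<close>

lemma cuo_divide:
  fixes \<psi> :: "'s::uniform_space \<Rightarrow> 'e::dedekind_vector_lattice"
  assumes psi: "\<psi> \<in> cuo abs" "\<And>s. 0 \<le> \<psi> s" "\<And>s. \<psi> s \<le> e" and t: "\<tau> \<in> band_projections" "orth_apply \<tau> e = e" "E.full \<tau> e"
  shows "\<exists>\<phi>\<in>cuo_orth. \<forall>s. 0 \<le> \<phi> s \<and> orth_apply (\<phi> s) e = \<psi> s \<and> (1 - \<tau>) * \<phi> s = 0"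
proof -
  have e: "0 \<le> e" using psi order_trans by blast
  have "\<exists>\<phi>. \<forall>s. 0 \<le> \<phi> s \<and> \<phi> s \<le> 1 \<and> orth_apply (\<phi> s) e = \<psi> s \<and> (1 - \<tau>) * \<phi> s = 0"
    using divide_ex[OF psi(2,3) t] by (intro choice) blast
  then obtain \<phi> where phi: "\<And>s. 0 \<le> \<phi> s" "\<And>s. \<phi> s \<le> 1" "\<And>s. orth_apply (\<phi> s) e = \<psi> s" "\<And>s. (1 - \<tau>) * \<phi> s = 0" by blast
  have "\<phi> \<in> cuo_orth"
  proof (rule cuo_orthI)
    show "\<bar>\<phi> s\<bar> \<le> 1" for s using phi by simp
    fix \<epsilon> :: real assume eps: "0 < \<epsilon>"
    show "densely 1 (\<lambda>\<rho>. \<exists>U. eventually (\<lambda>p. p \<in> U) uniformity \<and> L.small_on \<rho> \<phi> (\<epsilon> *\<^sub>R 1) U)"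
      unfolding densely_def
    proof (intro ballI impI)
      fix \<kappa> :: "'e orth" assume k: "\<kappa> \<in> band_projections" "\<kappa> \<le> 1" "\<kappa> \<noteq> 0"
      show "\<exists>\<rho>\<in>band_projections. \<rho> \<noteq> 0 \<and> \<rho> \<le> \<kappa> \<and> (\<exists>U. eventually (\<lambda>p. p \<in> U) uniformity \<and> L.small_on \<rho> \<phi> (\<epsilon> *\<^sub>R 1) U)"
      proof (rule bp_split[OF k(1,3) t(1)])
        assume a: "\<kappa> * \<tau> \<in> band_projections" "\<kappa> * \<tau> \<noteq> 0" "\<kappa> * \<tau> \<le> \<kappa>" "\<kappa> * \<tau> \<le> \<tau>"
        obtain \<rho> U where r: "\<rho> \<in> band_projections" "\<rho> \<noteq> 0" "\<rho> \<le> \<kappa> * \<tau>"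
          and U: "eventually (\<lambda>p. p \<in> U) uniformity" "E.small_on \<rho> \<psi> (\<epsilon> *\<^sub>R e) U"
          using densely_ex[OF E.cuo_modulus[OF psi(1) e t(3,1) eps] a(1,4,2)] by blast
        have fr: "E.full \<rho> e" using E.full_down[OF t(3)] r(3) a(4) order_trans by blast
        have one: "L.le_on \<rho> (\<phi> s - \<phi> t) (\<epsilon> *\<^sub>R 1) \<and> L.le_on \<rho> (\<phi> t - \<phi> s) (\<epsilon> *\<^sub>R 1)" if st: "(s, t) \<in> U" for s t
        proof -
          have "E.le_on \<rho> \<bar>\<psi> s - \<psi> t\<bar> (\<epsilon> *\<^sub>R e)" using U(2) st by (auto simp: E.small_on_def)
          hence "E.le_on \<rho> (orth_apply (\<phi> s - \<phi> t) e) (\<epsilon> *\<^sub>R e)" "E.le_on \<rho> (orth_apply (\<phi> t - \<phi> s) e) (\<epsilon> *\<^sub>R e)"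
            using r(1) by (auto simp: E.le_on_abs_iff minus_orth.rep_eq phi(3))
          thus ?thesis using le_on_cancel[OF e fr r(1)] by blast
        qed
        hence "L.small_on \<rho> \<phi> (\<epsilon> *\<^sub>R 1) U" using r(1) by (auto simp: L.small_on_def L.le_on_abs_iff)
        thus ?thesis using r U(1) a(3) order_trans by blast
      next
        assume a: "\<kappa> * (1 - \<tau>) \<in> band_projections" "\<kappa> * (1 - \<tau>) \<noteq> 0" "\<kappa> * (1 - \<tau>) \<le> \<kappa>"
        have "0 \<le> \<epsilon> *\<^sub>R (\<kappa> * (1 - \<tau>))" using eps a(1) by (intro scaleR_nonneg_nonneg bp_nonneg) auto
        moreover have z: "\<kappa> * (1 - \<tau>) * \<phi> s = 0" for s by (simp only: mult.assoc phi(4) mult_zero_right)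
        have "\<kappa> * (1 - \<tau>) * (\<phi> s - \<phi> t) = 0" for s t by (simp only: right_diff_distrib[of _ "\<phi> s"] z diff_self)
        moreover from this have "\<kappa> * (1 - \<tau>) * (- (\<phi> s - \<phi> t)) = 0" for s t by (simp only: minus_diff_eq)
        ultimately have "L.le_on (\<kappa> * (1 - \<tau>)) \<bar>\<phi> s - \<phi> t\<bar> (\<epsilon> *\<^sub>R 1)" for s t
          unfolding L.le_on_abs_iff[OF a(1)] unfolding L.le_on_def orth_scaleR_mult mult_1_right by (simp only: simp_thms)
        hence "L.small_on (\<kappa> * (1 - \<tau>)) \<phi> (\<epsilon> *\<^sub>R 1) UNIV" by (simp add: L.small_on_def)
        thus ?thesis using a by (metis UNIV_I always_eventually)
      qed
    qed
  qed
  thus ?thesis using phi by blast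
qed

section \<open>Filters with values in the band projections\<close>

text \<open>
  A pair \<open>(\<pi>, A)\<close> in \<open>R\<close> reads: on the part \<open>\<pi>\<close>, the set \<open>A\<close> belongs to the filter.
\<close>

definition bfilter :: "('e::dedekind_vector_lattice orth \<times> 's set) set \<Rightarrow> bool"
  where "bfilter R \<longleftrightarrow>
    (\<forall>\<pi> A. (\<pi>, A) \<in> R \<longrightarrow> \<pi> \<in> band_projections) \<and> (\<forall>A. (0, A) \<in> R) \<and> (1, UNIV) \<in> R \<and>
    (\<forall>\<pi> A \<rho> B. (\<pi>, A) \<in> R \<longrightarrow> \<rho> \<in> band_projections \<longrightarrow> \<rho> \<le> \<pi> \<longrightarrow> A \<subseteq> B \<longrightarrow> (\<rho>, B) \<in> R) \<and>
    (\<forall>\<pi> A B. (\<pi>, A) \<in> R \<longrightarrow> (\<pi>, B) \<in> R \<longrightarrow> (\<pi>, A \<inter> B) \<in> R) \<and>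
    (\<forall>\<pi>. (\<pi>, {}) \<in> R \<longrightarrow> \<pi> = 0)"

lemma bfilter_bp: "bfilter R \<Longrightarrow> (\<pi>, A) \<in> R \<Longrightarrow> \<pi> \<in> band_projections"
  unfolding bfilter_def by (elim conjE) blast
lemma bfilter_zero: "bfilter R \<Longrightarrow> (0, A) \<in> R"
  unfolding bfilter_def by (elim conjE) (erule spec)
lemma bfilter_top: "bfilter R \<Longrightarrow> (1, UNIV) \<in> R"
  unfolding bfilter_def by (elim conjE)
lemma bfilter_down: "bfilter R \<Longrightarrow> (\<pi>, A) \<in> R \<Longrightarrow> \<rho> \<in> band_projections \<Longrightarrow> \<rho> \<le> \<pi> \<Longrightarrow> A \<subseteq> B \<Longrightarrow> (\<rho>, B) \<in> R"
  unfolding bfilter_def by (elim conjE) metis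
lemma bfilter_int: "bfilter R \<Longrightarrow> (\<pi>, A) \<in> R \<Longrightarrow> (\<pi>, B) \<in> R \<Longrightarrow> (\<pi>, A \<inter> B) \<in> R"
  unfolding bfilter_def by (elim conjE) metis
lemma bfilter_empty: "bfilter R \<Longrightarrow> (\<pi>, {}) \<in> R \<Longrightarrow> \<pi> = 0"
  unfolding bfilter_def by (elim conjE) metis

lemma bfilter_UNIV: "bfilter R \<Longrightarrow> \<pi> \<in> band_projections \<Longrightarrow> (\<pi>, UNIV) \<in> R"
  by (rule bfilter_down[OF _ bfilter_top]) (auto simp: bp_le_one)

lemma bfilter_int2:
  assumes "bfilter R" "(\<pi>, A) \<in> R" "(\<rho>, B) \<in> R" "\<kappa> \<in> band_projections" "\<kappa> \<le> \<pi>" "\<kappa> \<le> \<rho>"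
  shows "(\<kappa>, A \<inter> B) \<in> R"
  using bfilter_int[OF assms(1) bfilter_down[OF assms(1,2,4,5) order_refl] bfilter_down[OF assms(1,3,4,6) order_refl]] .

lemma bfilter_nonempty:
  assumes "bfilter R" "(\<pi>, A) \<in> R" "\<pi> \<noteq> 0"
  obtains s where "s \<in> A"
  using assms bfilter_empty by (metis ex_in_conv)

text \<open>Outside \<open>\<rho>\<close> nothing changes; inside, a set need only belong to
  \<open>R\<close> after the complement of \<open>A\<close> has been added, which is what assuming
  \<open>A\<close> there amounts to.\<close>

definition adjoin :: "('e::dedekind_vector_lattice orth \<times> 's set) set \<Rightarrow> 'e orth \<Rightarrow> 's set \<Rightarrow> ('e orth \<times> 's set) set"
  where "adjoin R \<rho> A = {(\<pi>, B). \<pi> \<in> band_projections \<and> (\<pi> * (1 - \<rho>), B) \<in> R \<and> (\<pi> * \<rho>, B \<union> - A) \<in> R}"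

text \<open>Properness is the critical point: the empty set inside \<open>\<rho>\<close> would mean
  that \<open>R\<close> already contains the complement of \<open>A\<close> there, which
  \<open>con\<close> excludes.\<close>

lemma adjoin:
  assumes R: "bfilter R" and \<rho>: "\<rho> \<in> band_projections"
    and con: "\<And>\<kappa>. \<kappa> \<in> band_projections \<Longrightarrow> \<kappa> \<le> \<rho> \<Longrightarrow> (\<kappa>, - A) \<in> R \<Longrightarrow> \<kappa> = 0"
  shows "bfilter (adjoin R \<rho> A)" "R \<subseteq> adjoin R \<rho> A" "(\<rho>, A) \<in> adjoin R \<rho> A"
proof -
  have c: "1 - \<rho> \<in> band_projections" using \<rho> by simp
  have mono: "\<pi>' * \<kappa> \<in> band_projections \<and> \<pi>' * \<kappa> \<le> \<pi> * \<kappa>"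
    if "\<pi>' \<in> band_projections" "\<pi>' \<le> \<pi>" "\<kappa> \<in> band_projections" for \<pi> \<pi>' \<kappa> :: "'a orth"
    using that by (simp add: orth_mult_mono_right bp_nonneg)
  show "bfilter (adjoin R \<rho> A)"
    unfolding bfilter_def
  proof (intro conjI allI impI)
    fix \<pi> B assume a: "(\<pi>, B) \<in> adjoin R \<rho> A"
    show "\<pi> \<in> band_projections" using a by (simp add: adjoin_def)
  next
    show "(0, B) \<in> adjoin R \<rho> A" for B using R by (simp add: adjoin_def bfilter_zero)
    show "(1, UNIV) \<in> adjoin R \<rho> A"
      unfolding adjoin_def using bfilter_UNIV[OF R \<rho>] bfilter_UNIV[OF R c] by simp
  next
    fix \<pi> B \<pi>' B' assume a: "(\<pi>, B) \<in> adjoin R \<rho> A" "\<pi>' \<in> band_projections" "\<pi>' \<le> \<pi>" "B \<subseteq> B'"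
    have b: "(\<pi> * (1 - \<rho>), B) \<in> R" "(\<pi> * \<rho>, B \<union> - A) \<in> R" using a(1) by (simp_all add: adjoin_def)
    have 1: "(\<pi>' * (1 - \<rho>), B') \<in> R"
      using mono[OF a(2,3) c] by (elim conjE) (rule bfilter_down[OF R b(1) _ _ a(4)])
    have 2: "(\<pi>' * \<rho>, B' \<union> - A) \<in> R"
      using mono[OF a(2,3) \<rho>] by (elim conjE) (rule bfilter_down[OF R b(2) _ _ Un_mono[OF a(4) order_refl]])
    show "(\<pi>', B') \<in> adjoin R \<rho> A" using 1 2 a(2) by (simp add: adjoin_def)
  next
    fix \<pi> B C assume a: "(\<pi>, B) \<in> adjoin R \<rho> A" "(\<pi>, C) \<in> adjoin R \<rho> A"
    have "(\<pi> * \<rho>, (B \<union> - A) \<inter> (C \<union> - A)) \<in> R" using a by (intro bfilter_int R) (auto simp: adjoin_def)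
    moreover have "(B \<union> - A) \<inter> (C \<union> - A) = B \<inter> C \<union> - A" by blast
    ultimately show "(\<pi>, B \<inter> C) \<in> adjoin R \<rho> A" using a bfilter_int[OF R] by (simp add: adjoin_def)
  next
    fix \<pi> assume a: "(\<pi>, {}) \<in> adjoin R \<rho> A"
    have p: "\<pi> \<in> band_projections" using a by (simp add: adjoin_def)
    have "\<pi> * (1 - \<rho>) = 0" using a bfilter_empty[OF R] by (simp add: adjoin_def)
    moreover have "\<pi> * \<rho> = 0" using a con[of "\<pi> * \<rho>"] p \<rho> bp_mult_le[OF p \<rho>] by (simp add: adjoin_def)
    moreover have "\<pi> = \<pi> * (1 - \<rho>) + \<pi> * \<rho>" by (simp add: algebra_simps)
    ultimately show "\<pi> = 0" by simp
  qed
  show "R \<subseteq> adjoin R \<rho> A"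
  proof clarify
    fix \<pi> B assume a: "(\<pi>, B) \<in> R"
    have p: "\<pi> \<in> band_projections" using bfilter_bp[OF R a] .
    have "(\<pi> * (1 - \<rho>), B) \<in> R" using bp_mult[OF p c] bp_mult_le(1)[OF p c] by (intro bfilter_down[OF R a]) auto
    moreover have "(\<pi> * \<rho>, B \<union> - A) \<in> R" using bp_mult[OF p \<rho>] bp_mult_le(1)[OF p \<rho>] by (intro bfilter_down[OF R a]) auto
    ultimately show "(\<pi>, B) \<in> adjoin R \<rho> A" using p by (simp add: adjoin_def)
  qed
  show "(\<rho>, A) \<in> adjoin R \<rho> A"
    using \<rho> R by (simp add: adjoin_def bp_compl_mult bp_idem bfilter_zero bfilter_UNIV Compl_partition)
qed

lemma bfilter_chain:
  assumes "C \<noteq> {}" "subset.chain {R. bfilter R} C"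
  shows "bfilter (\<Union>C)"
proof -
  have C: "bfilter R" if "R \<in> C" for R using assms(2) that by (auto simp: subset.chain_def)
  obtain R0 where R0: "R0 \<in> C" using assms(1) by blast
  have lin: "\<exists>R\<in>C. x \<in> R \<and> y \<in> R" if xy: "x \<in> \<Union>C" "y \<in> \<Union>C" for x y
  proof -
    obtain R1 R2 where R: "R1 \<in> C" "x \<in> R1" "R2 \<in> C" "y \<in> R2" using xy by blast
    hence "R1 \<subseteq> R2 \<or> R2 \<subseteq> R1" using assms(2) by (auto simp: subset.chain_def)
    thus ?thesis using R by blast
  qed
  show ?thesis
    unfolding bfilter_def
  proof (intro conjI allI impI)
    show "(0, A) \<in> \<Union>C" for A using R0 bfilter_zero[OF C[OF R0]] by blast
    show "(1, UNIV) \<in> \<Union>C" using R0 bfilter_top[OF C[OF R0]] by blast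
    show "\<pi> \<in> band_projections" if "(\<pi>, A) \<in> \<Union>C" for \<pi> A using that C bfilter_bp by blast
    show "(\<rho>, B) \<in> \<Union>C" if "(\<pi>, A) \<in> \<Union>C" "\<rho> \<in> band_projections" "\<rho> \<le> \<pi>" "A \<subseteq> B" for \<pi> A \<rho> B
      using that C bfilter_down by (meson UnionE UnionI)
    show "(\<pi>, A \<inter> B) \<in> \<Union>C" if "(\<pi>, A) \<in> \<Union>C" "(\<pi>, B) \<in> \<Union>C" for \<pi> A B
      using lin[OF that] C bfilter_int by (meson UnionI)
    show "\<pi> = 0" if "(\<pi>, {}) \<in> \<Union>C" for \<pi> using that C bfilter_empty by blast
  qed
qed

text \<open>The decision between \<open>A\<close> and its complement may fall differently on
  different parts, so only a dense set of parts can be asked to decide.\<close>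

definition bultra :: "('e::dedekind_vector_lattice orth \<times> 's set) set \<Rightarrow> bool"
  where "bultra G \<longleftrightarrow> bfilter G \<and> (\<forall>A. densely 1 (\<lambda>\<rho>. (\<rho>, A) \<in> G \<or> (\<rho>, - A) \<in> G))"

lemma bultra_bfilter: "bultra G \<Longrightarrow> bfilter G"
  by (simp add: bultra_def)

text \<open>For a maximal filter: if it contains the complement of \<open>A\<close> on no nonzero
  part of \<open>\<kappa>\<close>, then \<open>A\<close> can be adjoined on \<open>\<kappa>\<close>,
  hence is already there.\<close>

lemma bultra_ex:
  assumes R: "bfilter R"
  shows "\<exists>G. R \<subseteq> G \<and> bultra G"
proof -
  let ?X = "{G. bfilter G \<and> R \<subseteq> G}"
  have "\<exists>M\<in>?X. \<forall>X\<in>?X. M \<subseteq> X \<longrightarrow> X = M"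
  proof (rule subset_Zorn_nonempty)
    show "?X \<noteq> {}" using R by blast
    fix C assume C: "C \<noteq> {}" "subset.chain ?X C"
    hence "subset.chain {R. bfilter R} C" by (auto simp: subset.chain_def)
    hence "bfilter (\<Union>C)" using C(1) by (intro bfilter_chain)
    moreover obtain R0 where "R0 \<in> C" using C(1) by blast
    hence "R \<subseteq> \<Union>C" using C(2) unfolding subset.chain_def by blast
    ultimately show "\<Union>C \<in> ?X" by blast
  qed
  then obtain M where M0: "M \<in> ?X" "\<forall>X\<in>?X. M \<subseteq> X \<longrightarrow> X = M" by (elim bexE)
  have M: "bfilter M" "R \<subseteq> M" using M0(1) by simp_all
  have max: "X = M" if "bfilter X" "M \<subseteq> X" for X
    using M0(2)[rule_format, of X] that M(2) by (simp add: order_trans)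
  have "densely 1 (\<lambda>\<rho>. (\<rho>, A) \<in> M \<or> (\<rho>, - A) \<in> M)" for A
    unfolding densely_def
  proof (intro ballI impI)
    fix \<kappa> :: "'a orth" assume k: "\<kappa> \<in> band_projections" "\<kappa> \<le> 1" "\<kappa> \<noteq> 0"
    show "\<exists>\<rho>\<in>band_projections. \<rho> \<noteq> 0 \<and> \<rho> \<le> \<kappa> \<and> ((\<rho>, A) \<in> M \<or> (\<rho>, - A) \<in> M)"
    proof (cases "\<exists>\<rho>\<in>band_projections. \<rho> \<noteq> 0 \<and> \<rho> \<le> \<kappa> \<and> (\<rho>, - A) \<in> M")
      case False
      hence ad: "bfilter (adjoin M \<kappa> A)" "M \<subseteq> adjoin M \<kappa> A" "(\<kappa>, A) \<in> adjoin M \<kappa> A"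
        using adjoin[OF M(1) k(1), of A] by blast+
      hence "(\<kappa>, A) \<in> M" using max[OF ad(1,2)] by simp
      thus ?thesis using k by blast
    qed blast
  qed
  thus ?thesis using M by (auto simp: bultra_def)
qed

text \<open>The induction carries the alternative that all sets considered so far were rejected; for
  a cover that alternative would put the empty set into the filter.\<close>

lemma bultra_cover:
  assumes G: "bultra (G :: ('e::dedekind_vector_lattice orth \<times> 's set) set)" and C: "finite C" "\<Union>C = UNIV"
  shows "densely 1 (\<lambda>\<rho>. \<exists>A\<in>C. (\<rho>, A) \<in> G)"
proof -
  note F = bultra_bfilter[OF G]
  have "densely 1 (\<lambda>\<rho>. (\<exists>A\<in>C. (\<rho>, A) \<in> G) \<or> (\<rho>, - \<Union>C) \<in> G)"
    using C(1)
  proof (induction C rule: finite_induct)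
    case empty
    show ?case unfolding densely_def using bfilter_UNIV[OF F] by auto
  next
    case (insert A C)
    have "densely 1 (\<lambda>\<rho>. ((\<rho>, A) \<in> G \<or> (\<rho>, - A) \<in> G) \<and> ((\<exists>A\<in>C. (\<rho>, A) \<in> G) \<or> (\<rho>, - \<Union>C) \<in> G))"
    proof (rule densely_conj[OF _ insert.IH])
      show "densely 1 (\<lambda>\<rho>. (\<rho>, A) \<in> G \<or> (\<rho>, - A) \<in> G)" using G by (simp add: bultra_def)
    qed (use bfilter_down[OF F] in blast)
    thus ?case
    proof (rule densely_mono)
      fix \<rho> assume "((\<rho>, A) \<in> G \<or> (\<rho>, - A) \<in> G) \<and> ((\<exists>A\<in>C. (\<rho>, A) \<in> G) \<or> (\<rho>, - \<Union>C) \<in> G)"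
      moreover have "(\<rho>, - \<Union>(insert A C)) \<in> G" if "(\<rho>, - A) \<in> G" "(\<rho>, - \<Union>C) \<in> G"
        using bfilter_int[OF F that] by (simp add: Int_commute)
      ultimately show "(\<exists>A\<in>insert A C. (\<rho>, A) \<in> G) \<or> (\<rho>, - \<Union>(insert A C)) \<in> G" by blast
    qed
  qed
  thus ?thesis by (rule densely_mono) (use C(2) bfilter_empty[OF F] in auto)
qed

section \<open>Limits\<close>

context band_normed
begin

definition close_on :: "('e orth \<times> 's set) set \<Rightarrow> ('s \<Rightarrow> 'x) \<Rightarrow> 'x \<Rightarrow> 'v \<Rightarrow> 'e orth \<Rightarrow> bool"
  where "close_on G f y d \<rho> \<longleftrightarrow> (\<exists>A. (\<rho>, A) \<in> G \<and> (\<forall>s\<in>A. le_on \<rho> (nrm (f s - y)) d))"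

text \<open>Convergence in the Boolean-valued sense: the set that witnesses
  \<open>\<epsilon>\<close> may depend on the part, but one regulator \<open>e\<close> serves for
  all parts and all \<open>\<epsilon>\<close>.\<close>

definition blim :: "('e orth \<times> 's set) set \<Rightarrow> ('s \<Rightarrow> 'x) \<Rightarrow> 'x \<Rightarrow> bool"
  where "blim G f y \<longleftrightarrow> (\<exists>e\<ge>0. \<forall>\<epsilon>>0. densely 1 (close_on G f y (\<epsilon> *\<^sub>R e)))"

lemma close_on_down:
  assumes "bfilter G" "close_on G f y d \<rho>" "\<rho> \<in> band_projections" "\<kappa> \<in> band_projections" "\<kappa> \<le> \<rho>"
  shows "close_on G f y d \<kappa>"
proof -
  obtain A where A: "(\<rho>, A) \<in> G" "\<forall>s\<in>A. le_on \<rho> (nrm (f s - y)) d" using assms(2) by (auto simp: close_on_def)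
  have "(\<kappa>, A) \<in> G" using bfilter_down[OF assms(1) A(1) assms(4,5)] by blast
  thus ?thesis using A(2) le_on_down[OF _ assms(4,3,5)] unfolding close_on_def by blast
qed

text \<open>On a nonzero part the two witnessing sets have a common point, and the estimate runs
  through the value of \<open>f\<close> there.\<close>

lemma blim_dist:
  assumes G: "bfilter G" and l: "densely 1 (close_on G f y d)" "densely 1 (close_on G f y' d')"
  shows "nrm (y - y') \<le> d + d'"
proof (rule local_le1)
  have "densely 1 (\<lambda>\<rho>. close_on G f y d \<rho> \<and> close_on G f y' d' \<rho>)"
    using l by (rule densely_conj) (erule (3) close_on_down[OF G])
  thus "densely 1 (\<lambda>\<rho>. le_on \<rho> (nrm (y - y')) (d + d'))"
  proof (rule densely_mono)
    fix \<rho> assume r: "\<rho> \<in> band_projections" "\<rho> \<noteq> 0" "close_on G f y d \<rho> \<and> close_on G f y' d' \<rho>"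
    then obtain A B where AB: "(\<rho>, A) \<in> G" "\<forall>s\<in>A. le_on \<rho> (nrm (f s - y)) d" "(\<rho>, B) \<in> G" "\<forall>s\<in>B. le_on \<rho> (nrm (f s - y')) d'"
      by (auto simp: close_on_def)
    obtain s where s: "s \<in> A \<inter> B" using bfilter_nonempty[OF G bfilter_int[OF G AB(1,3)] r(2)] by blast
    have "le_on \<rho> (nrm (y - y')) (nrm (y - f s) + nrm (f s - y'))" by (rule le_onI[OF nrm_triangle3 r(1)])
    moreover have "le_on \<rho> (nrm (y - f s) + nrm (f s - y')) (d + d')"
      using s AB by (intro le_on_add) (auto simp: nrm_minus_commute)
    ultimately show "le_on \<rho> (nrm (y - y')) (d + d')" by (rule le_on_trans)
  qed
qed

text \<open>Phrased through the norm because definiteness is not among the assumptions of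
  \<open>band_normed\<close>.\<close>

lemma blim_unique:
  assumes G: "bfilter G" and l: "blim G f y" "blim G f y'"
  shows "nrm (y - y') = 0"
proof -
  obtain e e' where e: "\<And>\<epsilon>. 0 < \<epsilon> \<Longrightarrow> densely 1 (close_on G f y (\<epsilon> *\<^sub>R e))"
    "\<And>\<epsilon>. 0 < \<epsilon> \<Longrightarrow> densely 1 (close_on G f y' (\<epsilon> *\<^sub>R e'))" using l unfolding blim_def by blast
  have "nrm (y - y') \<le> 0"
  proof (rule archimedean_le_0)
    fix \<epsilon> :: real assume "0 < \<epsilon>"
    thus "nrm (y - y') \<le> \<epsilon> *\<^sub>R (e + e')" using blim_dist[OF G e] by (simp add: scaleR_add_right)
  qed
  thus ?thesis using nrm_ge_0 by (simp add: order_antisym)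
qed

text \<open>The Cauchy property: locally, some set of a finite cover by sets of small oscillation
  belongs to the ultrafilter. Outside the carrier of the bound \<open>e\<close> the function
  vanishes.\<close>

lemma cuo_bultra:
  assumes comp: "compact (UNIV :: 's::uniform_space set)" and f: "(f :: 's \<Rightarrow> 'x) \<in> cuo nrm"
    and G: "bultra G" and b: "\<And>s. nrm (f s) \<le> e" and eps: "0 < \<epsilon>"
  shows "densely 1 (\<lambda>\<rho>. \<exists>A. (\<rho>, A) \<in> G \<and> small_on \<rho> f (\<epsilon> *\<^sub>R e) (A \<times> A))"
  unfolding densely_def
proof (intro ballI impI)
  note F = bultra_bfilter[OF G]
  have e: "0 \<le> e" by (rule order_trans[OF nrm_ge_0 b])
  obtain \<tau> where t: "\<tau> \<in> band_projections" "P \<tau> e = e" "full \<tau> e" using support_ex[OF e] by blast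
  fix \<kappa> :: "'e orth" assume k: "\<kappa> \<in> band_projections" "\<kappa> \<le> 1" "\<kappa> \<noteq> 0"
  show "\<exists>\<rho>\<in>band_projections. \<rho> \<noteq> 0 \<and> \<rho> \<le> \<kappa> \<and> (\<exists>A. (\<rho>, A) \<in> G \<and> small_on \<rho> f (\<epsilon> *\<^sub>R e) (A \<times> A))"
  proof (rule bp_split[OF k(1,3) t(1)])
    assume a: "\<kappa> * \<tau> \<in> band_projections" "\<kappa> * \<tau> \<noteq> 0" "\<kappa> * \<tau> \<le> \<kappa>" "\<kappa> * \<tau> \<le> \<tau>"
    obtain \<rho> C where r: "\<rho> \<in> band_projections" "\<rho> \<noteq> 0" "\<rho> \<le> \<kappa> * \<tau>" "finite C" "\<Union>C = UNIV" "\<forall>A\<in>C. small_on \<rho> f (\<epsilon> *\<^sub>R e) (A \<times> A)"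
      using densely_ex[OF cuo_cover[OF comp f e t(3,1) eps] a(1,4,2)] by blast
    obtain \<rho>' A where r': "\<rho>' \<in> band_projections" "\<rho>' \<noteq> 0" "\<rho>' \<le> \<rho>" "A \<in> C" "(\<rho>', A) \<in> G"
      using densely_ex[OF bultra_cover[OF G r(4,5)] r(1) bp_le_one[OF r(1)] r(2)] by blast
    have "small_on \<rho>' f (\<epsilon> *\<^sub>R e) (A \<times> A)"
      using small_on_down[OF r(6)[rule_format, OF r'(4)] r'(1) r(1) r'(3) order_refl] .
    moreover have "\<rho>' \<le> \<kappa>" using r'(3) r(3) a(3) by (meson order_trans)
    ultimately show ?thesis using r' by blast
  next
    assume "\<kappa> * \<tau> = 0"
    hence z: "P \<kappa> e = 0" using t(2) by (metis P_mult P_zero)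
    have "le_on \<kappa> (nrm (f s - f t)) (\<epsilon> *\<^sub>R e)" for s t
    proof -
      have "le_on \<kappa> (nrm (f s - f t)) (e + e)"
        using k(1) order_trans[OF nrm_diff_le add_mono[OF b b]] by (intro le_onI)
      thus ?thesis using z by (simp add: le_on_def P_simps)
    qed
    hence "small_on \<kappa> f (\<epsilon> *\<^sub>R e) (UNIV \<times> UNIV)" by (simp add: small_on_def)
    thus ?thesis using k bfilter_UNIV[OF F k(1)] by blast
  qed
qed

text \<open>\<open>part\<close> and \<open>glue\<close> abstract from the source of new elements,
  which is the lattice structure for \<Lambda> and norm completeness for \<open>X\<close>. The limit
  is glued from all pairs \<open>(x, d)\<close> such that \<open>f\<close> is locally eventually
  within \<open>d\<close> of \<open>x\<close>.\<close>

lemma blim_ex: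
  assumes comp: "compact (UNIV :: 's::uniform_space set)" and f: "(f :: 's \<Rightarrow> 'x) \<in> cuo nrm" and G: "bultra G"
    and part: "\<And>\<pi> x. \<pi> \<in> band_projections \<Longrightarrow>
      \<exists>x'. \<forall>y. P \<pi> (nrm (y - x')) = P \<pi> (nrm (y - x)) \<and> P (1 - \<pi>) (nrm (y - x')) = P (1 - \<pi>) (nrm y)"
    and glue: "\<And>T. T \<noteq> {} \<Longrightarrow> (\<And>x d x' d'. (x, d) \<in> T \<Longrightarrow> (x', d') \<in> T \<Longrightarrow> nrm (x - x') \<le> d + d') \<Longrightarrow>
      (\<And>h. (\<And>x d. (x, d) \<in> T \<Longrightarrow> h \<le> d) \<Longrightarrow> h \<le> 0) \<Longrightarrow> \<exists>y. \<forall>(x, d)\<in>T. nrm (y - x) \<le> d"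
  shows "\<exists>y. blim G f y"
proof -
  note F = bultra_bfilter[OF G]
  obtain e where e: "0 \<le> e" and b: "\<And>s. nrm (f s) \<le> e" using cuo_bounded[OF f] by blast
  define T where "T = {(x, d). densely 1 (close_on G f x d)}"
  \<comment> \<open>A value \<open>f s\<close>, cut down to \<open>\<rho>\<close>, is an admissible
    centre: its tolerance is \<open>\<epsilon> e\<close> on \<open>\<rho>\<close>, and outside,
    where the centre is 0, the bound \<open>e\<close> of \<open>f\<close> is added.\<close>
  have approx: "\<exists>x. P \<rho> (nrm (y - x)) = P \<rho> (nrm (y - f s)) \<and> (x, \<epsilon> *\<^sub>R e + P (1 - \<rho>) e) \<in> T"
    if r: "(\<rho>, A) \<in> G" "small_on \<rho> f (\<epsilon> *\<^sub>R e) (A \<times> A)" "s \<in> A" and eps: "0 < \<epsilon>" for \<rho> A \<epsilon> s y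
  proof -
    have p: "\<rho> \<in> band_projections" "1 - \<rho> \<in> band_projections" using bfilter_bp[OF F r(1)] by auto
    obtain x where x: "\<And>y. P \<rho> (nrm (y - x)) = P \<rho> (nrm (y - f s))" "\<And>y. P (1 - \<rho>) (nrm (y - x)) = P (1 - \<rho>) (nrm y)"
      using part[OF p(1)] by blast
    have pos: "0 \<le> \<epsilon> *\<^sub>R e" "0 \<le> P (1 - \<rho>) e"
      using e eps p by (auto intro!: scaleR_nonneg_nonneg P_nonneg[OF bp_nonneg])
    have "densely 1 (close_on G f x (\<epsilon> *\<^sub>R e + P (1 - \<rho>) e))"
      unfolding densely_def
    proof (intro ballI impI)
      fix \<kappa> :: "'e orth" assume k: "\<kappa> \<in> band_projections" "\<kappa> \<le> 1" "\<kappa> \<noteq> 0"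
      show "\<exists>\<rho>'\<in>band_projections. \<rho>' \<noteq> 0 \<and> \<rho>' \<le> \<kappa> \<and> close_on G f x (\<epsilon> *\<^sub>R e + P (1 - \<rho>) e) \<rho>'"
      proof (rule bp_split[OF k(1,3) p(1)])
        assume a: "\<kappa> * \<rho> \<in> band_projections" "\<kappa> * \<rho> \<noteq> 0" "\<kappa> * \<rho> \<le> \<kappa>" "\<kappa> * \<rho> \<le> \<rho>"
        have "le_on (\<kappa> * \<rho>) (nrm (f t - x)) (\<epsilon> *\<^sub>R e + P (1 - \<rho>) e)" if "t \<in> A" for t
        proof (rule le_on_down[OF _ a(1) p(1) a(4)])
          have "le_on \<rho> (nrm (f t - f s)) (\<epsilon> *\<^sub>R e)" using r that by (auto simp: small_on_def)
          hence "le_on \<rho> (nrm (f t - x)) (\<epsilon> *\<^sub>R e)" by (simp add: le_on_def x(1))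
          moreover have "le_on \<rho> (\<epsilon> *\<^sub>R e) (\<epsilon> *\<^sub>R e + P (1 - \<rho>) e)" using pos p by (intro le_onI) auto
          ultimately show "le_on \<rho> (nrm (f t - x)) (\<epsilon> *\<^sub>R e + P (1 - \<rho>) e)" by (rule le_on_trans)
        qed
        moreover have "(\<kappa> * \<rho>, A) \<in> G" using bfilter_down[OF F r(1) a(1,4)] by blast
        ultimately show ?thesis using a unfolding close_on_def by blast
      next
        assume a: "\<kappa> * (1 - \<rho>) \<in> band_projections" "\<kappa> * (1 - \<rho>) \<noteq> 0" "\<kappa> * (1 - \<rho>) \<le> \<kappa>" "\<kappa> * (1 - \<rho>) \<le> 1 - \<rho>"
        have "le_on (\<kappa> * (1 - \<rho>)) (nrm (f t - x)) (\<epsilon> *\<^sub>R e + P (1 - \<rho>) e)" for t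
        proof (rule le_on_down[OF _ a(1) p(2) a(4)])
          have "P (1 - \<rho>) (nrm (f t)) \<le> P (1 - \<rho>) e" by (intro P_mono bp_nonneg p b)
          hence "le_on (1 - \<rho>) (nrm (f t - x)) (P (1 - \<rho>) e)" using p by (simp only: le_on_def x(2) P_comp)
          moreover have "le_on (1 - \<rho>) (P (1 - \<rho>) e) (\<epsilon> *\<^sub>R e + P (1 - \<rho>) e)" using pos p by (intro le_onI) auto
          ultimately show "le_on (1 - \<rho>) (nrm (f t - x)) (\<epsilon> *\<^sub>R e + P (1 - \<rho>) e)" by (rule le_on_trans)
        qed
        thus ?thesis using a bfilter_UNIV[OF F a(1)] unfolding close_on_def by blast
      qed
    qed
    thus ?thesis using x(1) by (auto simp: T_def)
  qed
  have "\<exists>y. \<forall>(x, d)\<in>T. nrm (y - x) \<le> d"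
  proof (rule glue)
    have "close_on G f 0 e \<rho>" if "\<rho> \<in> band_projections" for \<rho>
      using bfilter_UNIV[OF F that] le_onI[OF b that] by (auto simp: close_on_def)
    hence "(0, e) \<in> T" by (auto simp: T_def densely_def)
    thus "T \<noteq> {}" by blast
    show "nrm (x - x') \<le> d + d'" if "(x, d) \<in> T" "(x', d') \<in> T" for x d x' d'
      using that blim_dist[OF F] by (simp add: T_def)
    fix h assume h: "\<And>x d. (x, d) \<in> T \<Longrightarrow> h \<le> d"
    show "h \<le> 0"
    proof (rule archimedean_le_0)
      fix \<epsilon> :: real assume eps: "0 < \<epsilon>"
      show "h \<le> \<epsilon> *\<^sub>R e"
      proof (rule local_le1[OF densely_mono[OF cuo_bultra[OF comp f G b eps]]])
        fix \<rho> assume r: "\<rho> \<in> band_projections" "\<rho> \<noteq> 0" "\<exists>A. (\<rho>, A) \<in> G \<and> small_on \<rho> f (\<epsilon> *\<^sub>R e) (A \<times> A)"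
        then obtain A where A: "(\<rho>, A) \<in> G" "small_on \<rho> f (\<epsilon> *\<^sub>R e) (A \<times> A)" by blast
        obtain s where s: "s \<in> A" using bfilter_nonempty[OF F A(1) r(2)] by blast
        obtain x where "(x, \<epsilon> *\<^sub>R e + P (1 - \<rho>) e) \<in> T" using approx[OF A s eps] by blast
        from le_onI[OF h[OF this] r(1)] show "le_on \<rho> h (\<epsilon> *\<^sub>R e)"
          using r(1) by (simp add: le_on_def P_simps P_comp)
      qed
    qed
  qed
  then obtain y where y: "\<And>x d. (x, d) \<in> T \<Longrightarrow> nrm (y - x) \<le> d" by blast
  have "densely 1 (close_on G f y (\<epsilon> *\<^sub>R (e + e)))" if eps: "0 < \<epsilon>" for \<epsilon>
  proof (rule densely_mono[OF cuo_bultra[OF comp f G b eps]])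
    fix \<rho> assume r: "\<rho> \<in> band_projections" "\<rho> \<noteq> 0" "\<exists>A. (\<rho>, A) \<in> G \<and> small_on \<rho> f (\<epsilon> *\<^sub>R e) (A \<times> A)"
    then obtain A where A: "(\<rho>, A) \<in> G" "small_on \<rho> f (\<epsilon> *\<^sub>R e) (A \<times> A)" by blast
    have "le_on \<rho> (nrm (f s - y)) (\<epsilon> *\<^sub>R (e + e))" if s: "s \<in> A" for s
    proof -
      obtain x where x: "P \<rho> (nrm (y - x)) = P \<rho> (nrm (y - f s))" "(x, \<epsilon> *\<^sub>R e + P (1 - \<rho>) e) \<in> T"
        using approx[OF A s eps] by blast
      have "le_on \<rho> (nrm (y - x)) (\<epsilon> *\<^sub>R e + P (1 - \<rho>) e)" by (rule le_onI[OF y[OF x(2)] r(1)])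
      hence "le_on \<rho> (nrm (f s - y)) (\<epsilon> *\<^sub>R e)"
        using r(1) x(1) by (simp add: le_on_def P_simps P_comp nrm_minus_commute)
      moreover have "\<epsilon> *\<^sub>R e \<le> \<epsilon> *\<^sub>R (e + e)" using e eps by (intro scaleR_left_mono) auto
      ultimately show ?thesis using le_on_trans le_onI[OF _ r(1)] by metis
    qed
    thus "close_on G f y (\<epsilon> *\<^sub>R (e + e)) \<rho>" using A(1) by (auto simp: close_on_def)
  qed
  moreover have "0 \<le> e + e" using e by simp
  ultimately have "blim G f y" unfolding blim_def by blast
  thus ?thesis by blast
qed

end

lemma blim_lipschitz:
  assumes N: "band_normed P nrm" and M: "band_normed P nrm'"
    and f: "band_normed.blim P nrm G f y" and l: "\<And>s. nrm' (h s - z) \<le> nrm (f s - y)"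
  shows "band_normed.blim P nrm' G h z"
proof -
  interpret N: band_normed P nrm by (rule N)
  interpret M: band_normed P nrm' by (rule M)
  obtain e where e: "0 \<le> e" "\<And>\<epsilon>. 0 < \<epsilon> \<Longrightarrow> densely 1 (N.close_on G f y (\<epsilon> *\<^sub>R e))" using f unfolding N.blim_def by blast
  have "densely 1 (M.close_on G h z (\<epsilon> *\<^sub>R e))" if "0 < \<epsilon>" for \<epsilon>
  proof (rule densely_mono[OF e(2)[OF that]])
    fix \<rho> assume r: "\<rho> \<in> band_projections" "N.close_on G f y (\<epsilon> *\<^sub>R e) \<rho>"
    show "M.close_on G h z (\<epsilon> *\<^sub>R e) \<rho>"
      using r(2) N.le_on_trans[OF N.le_onI[OF l r(1)]] unfolding N.close_on_def M.close_on_def by blast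
  qed
  thus ?thesis using e(1) unfolding M.blim_def by blast
qed

lemma (in band_normed) blim_add:
  assumes G: "bfilter G" and f: "blim G f y" and g: "blim G g z"
  shows "blim G (\<lambda>s. f s + g s) (y + z)"
proof -
  obtain e e' where e: "0 \<le> e" "0 \<le> e'" "\<And>\<epsilon>. 0 < \<epsilon> \<Longrightarrow> densely 1 (close_on G f y (\<epsilon> *\<^sub>R e))"
    "\<And>\<epsilon>. 0 < \<epsilon> \<Longrightarrow> densely 1 (close_on G g z (\<epsilon> *\<^sub>R e'))" using f g unfolding blim_def by blast
  have "densely 1 (close_on G (\<lambda>s. f s + g s) (y + z) (\<epsilon> *\<^sub>R (e + e')))" if eps: "0 < \<epsilon>" for \<epsilon>
  proof -
    have "densely 1 (\<lambda>\<rho>. close_on G f y (\<epsilon> *\<^sub>R e) \<rho> \<and> close_on G g z (\<epsilon> *\<^sub>R e') \<rho>)"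
      using e(3,4)[OF eps] by (rule densely_conj) (erule (3) close_on_down[OF G])
    thus ?thesis
    proof (rule densely_mono)
      fix \<rho> assume r: "\<rho> \<in> band_projections" "close_on G f y (\<epsilon> *\<^sub>R e) \<rho> \<and> close_on G g z (\<epsilon> *\<^sub>R e') \<rho>"
      then obtain A B where AB: "(\<rho>, A) \<in> G" "\<forall>s\<in>A. le_on \<rho> (nrm (f s - y)) (\<epsilon> *\<^sub>R e)" "(\<rho>, B) \<in> G" "\<forall>s\<in>B. le_on \<rho> (nrm (g s - z)) (\<epsilon> *\<^sub>R e')"
        by (auto simp: close_on_def)
      have "le_on \<rho> (nrm (f s + g s - (y + z))) (\<epsilon> *\<^sub>R (e + e'))" if s: "s \<in> A \<inter> B" for s
      proof -
        have "f s + g s - (y + z) = (f s - y) + (g s - z)" by simp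
        hence "le_on \<rho> (nrm (f s + g s - (y + z))) (nrm (f s - y) + nrm (g s - z))"
          using le_onI[OF nrm_add r(1)] by metis
        moreover have "le_on \<rho> (nrm (f s - y) + nrm (g s - z)) (\<epsilon> *\<^sub>R e + \<epsilon> *\<^sub>R e')"
          using s AB by (intro le_on_add) auto
        ultimately show ?thesis unfolding scaleR_add_right by (rule le_on_trans)
      qed
      thus "close_on G (\<lambda>s. f s + g s) (y + z) (\<epsilon> *\<^sub>R (e + e')) \<rho>"
        using bfilter_int[OF G AB(1,3)] unfolding close_on_def by blast
    qed
  qed
  moreover have "0 \<le> e + e'" using e by simp
  ultimately show ?thesis unfolding blim_def by blast
qed

lemma band_normed_L: "band_normed (*) (abs :: 'e::dedekind_vector_lattice orth \<Rightarrow> _)" ..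
lemma band_normed_E: "band_normed orth_apply (abs :: 'e::dedekind_vector_lattice \<Rightarrow> _)" ..

lemma blim_orth_ex:
  assumes comp: "compact (UNIV :: 's::uniform_space set)" and f: "\<phi> \<in> (cuo_orth :: ('s \<Rightarrow> 'e::dedekind_vector_lattice orth) set)" and G: "bultra G"
  shows "\<exists>y. L.blim G \<phi> y"
proof (rule L.blim_ex[OF comp f G])
  fix \<pi> x :: "'e orth" assume p: "\<pi> \<in> band_projections"
  have cong: "\<rho> * \<bar>a\<bar> = \<rho> * \<bar>b\<bar>" if r: "\<rho> \<in> band_projections" "\<rho> * a = \<rho> * b" for \<rho> a b :: "'e orth"
  proof -
    have "L.le_on \<rho> a \<bar>b\<bar>" "L.le_on \<rho> (- a) \<bar>b\<bar>" "L.le_on \<rho> b \<bar>a\<bar>" "L.le_on \<rho> (- b) \<bar>a\<bar>"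
      using L.le_onI[OF abs_ge_self r(1), of a] L.le_onI[OF abs_ge_minus_self r(1), of a]
        L.le_onI[OF abs_ge_self r(1), of b] L.le_onI[OF abs_ge_minus_self r(1), of b] r(2)
      by (auto simp: L.le_on_def)
    hence "L.le_on \<rho> \<bar>a\<bar> \<bar>b\<bar>" "L.le_on \<rho> \<bar>b\<bar> \<bar>a\<bar>" using r(1) by (auto intro: L.le_on_abs)
    thus ?thesis by (simp add: L.le_on_def order_antisym)
  qed
  have "\<pi> * \<bar>y - \<pi> * x\<bar> = \<pi> * \<bar>y - x\<bar> \<and> (1 - \<pi>) * \<bar>y - \<pi> * x\<bar> = (1 - \<pi>) * \<bar>y\<bar>" for y
  proof
    have "\<pi> * (y - \<pi> * x) = \<pi> * (y - x)" using p by (simp add: L.P_diff mult.assoc[symmetric] bp_idem)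
    thus "\<pi> * \<bar>y - \<pi> * x\<bar> = \<pi> * \<bar>y - x\<bar>" by (rule cong[OF p])
    have "(1 - \<pi>) * (y - \<pi> * x) = (1 - \<pi>) * y" using p
      by (simp only: L.P_diff mult.assoc[symmetric] bp_compl_mult) simp
    thus "(1 - \<pi>) * \<bar>y - \<pi> * x\<bar> = (1 - \<pi>) * \<bar>y\<bar>" by (rule cong[OF bp_compl[OF p]])
  qed
  thus "\<exists>x'. \<forall>y. \<pi> * \<bar>y - x'\<bar> = \<pi> * \<bar>y - x\<bar> \<and> (1 - \<pi>) * \<bar>y - x'\<bar> = (1 - \<pi>) * \<bar>y\<bar>" by blast
next
  fix T :: "('e orth \<times> 'e orth) set"
  assume "T \<noteq> {}" "\<And>x d x' d'. (x, d) \<in> T \<Longrightarrow> (x', d') \<in> T \<Longrightarrow> \<bar>x - x'\<bar> \<le> d + d'"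
  thus "\<exists>y. \<forall>(x, d)\<in>T. \<bar>y - x\<bar> \<le> d" using order_trans[OF abs_ge_self] by (intro glue_lattice) blast+
qed

lemma (in bk_action) blim_value_ex:
  assumes comp: "compact (UNIV :: 's::uniform_space set)" and f: "(f :: 's \<Rightarrow> 'x) \<in> cuo nrm" and G: "bultra G"
  shows "\<exists>y. X.blim G f y"
proof (rule X.blim_ex[OF comp f G])
  fix \<pi> :: "'e orth" and x assume p: "\<pi> \<in> band_projections"
  have "orth_apply \<pi> (nrm (y - act \<pi> x)) = orth_apply \<pi> (nrm (y - x)) \<and>
      orth_apply (1 - \<pi>) (nrm (y - act \<pi> x)) = orth_apply (1 - \<pi>) (nrm y)" for y
  proof
    have "act \<pi> (act \<pi> x) = act \<pi> x" by (rule act_idem[OF p])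
    from orth_apply_nrm_cong[OF p this, of y]
    show "orth_apply \<pi> (nrm (y - act \<pi> x)) = orth_apply \<pi> (nrm (y - x))" by (simp add: X.nrm_minus_commute)
    have "act (1 - \<pi>) (act \<pi> x) = act (1 - \<pi>) 0"
      unfolding act_mult[symmetric] bp_compl_mult[OF p] by (simp add: act_0 act_zero)
    from orth_apply_nrm_cong[OF bp_compl[OF p] this, of y]
    show "orth_apply (1 - \<pi>) (nrm (y - act \<pi> x)) = orth_apply (1 - \<pi>) (nrm y)"
      by (simp add: X.nrm_minus_commute X.nrm_minus)
  qed
  thus "\<exists>x'. \<forall>y. orth_apply \<pi> (nrm (y - x')) = orth_apply \<pi> (nrm (y - x)) \<and>
      orth_apply (1 - \<pi>) (nrm (y - x')) = orth_apply (1 - \<pi>) (nrm y)" by blast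
next
  fix T :: "('x \<times> 'e) set"
  assume a: "T \<noteq> {}" "\<And>x d x' d'. (x, d) \<in> T \<Longrightarrow> (x', d') \<in> T \<Longrightarrow> nrm (x - x') \<le> d + d'"
    "\<And>h. (\<And>x d. (x, d) \<in> T \<Longrightarrow> h \<le> d) \<Longrightarrow> h \<le> 0"
  show "\<exists>y. \<forall>(x, d)\<in>T. nrm (y - x) \<le> d" by (rule glue[OF a])
qed

text \<open>The regulator hidden in \<open>blim\<close> can be exchanged for any full one, since
  locally it is at most a multiple \<open>n e\<close>.\<close>

lemma (in band_normed) blim_regulator:
  assumes G: "bfilter G" and f: "blim G f y" and e: "0 \<le> e" "full \<pi> e" "\<pi> \<in> band_projections" and eps: "0 < \<epsilon>"
  shows "densely \<pi> (close_on G f y (\<epsilon> *\<^sub>R e))"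
proof -
  obtain e' where e': "0 \<le> e'" "\<And>\<epsilon>. 0 < \<epsilon> \<Longrightarrow> densely 1 (close_on G f y (\<epsilon> *\<^sub>R e'))" using f unfolding blim_def by blast
  show ?thesis
  proof (rule densely_densely[OF bounded_densely[OF e, of e']])
    fix \<rho> assume r: "\<rho> \<in> band_projections" "\<rho> \<le> \<pi>" "\<exists>n::nat. le_on \<rho> e' (real n *\<^sub>R e)"
    then obtain n :: nat where n: "le_on \<rho> e' (real n *\<^sub>R e)" by blast
    define \<delta> where "\<delta> = \<epsilon> / (real n + 1)"
    have d: "0 < \<delta>" "\<delta> * real n \<le> \<epsilon>" using eps by (auto simp: \<delta>_def field_simps)
    have "le_on \<rho> (\<delta> *\<^sub>R e') (\<delta> *\<^sub>R (real n *\<^sub>R e))" using n d by (intro le_on_scaleR) auto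
    moreover have "le_on \<rho> (\<delta> *\<^sub>R (real n *\<^sub>R e)) (\<epsilon> *\<^sub>R e)"
      using d e r by (intro le_onI) (auto intro!: scaleR_right_mono)
    ultimately have le: "le_on \<rho> (\<delta> *\<^sub>R e') (\<epsilon> *\<^sub>R e)" by (rule le_on_trans)
    show "densely \<rho> (close_on G f y (\<epsilon> *\<^sub>R e))"
    proof (rule densely_mono[OF densely_subset[OF e'(2)[OF d(1)] bp_le_one[OF r(1)]]])
      fix \<kappa> assume k: "\<kappa> \<in> band_projections" "\<kappa> \<le> \<rho>" "close_on G f y (\<delta> *\<^sub>R e') \<kappa>"
      thus "close_on G f y (\<epsilon> *\<^sub>R e) \<kappa>"
        unfolding close_on_def using le_on_trans[OF _ le_on_down[OF le k(1) r(1) k(2)]] by blast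
    qed
  qed
qed

section \<open>The states of ultrafilters\<close>

text \<open>\<open>restrict\<close> matches the convention that operators are undefined outside
  \<open>cuo_orth\<close>.\<close>

definition state_of :: "('e::dedekind_vector_lattice orth \<times> 's::uniform_space set) set \<Rightarrow> ('s \<Rightarrow> 'e orth) \<Rightarrow> 'e orth"
  where "state_of G = restrict (\<lambda>\<phi>. SOME y. L.blim G \<phi> y) cuo_orth"

context
  fixes G :: "('e::dedekind_vector_lattice orth \<times> 's::uniform_space set) set"
  assumes comp: "compact (UNIV :: 's set)" and G: "bultra G"
begin

lemma blim_state_of: "\<phi> \<in> cuo_orth \<Longrightarrow> L.blim G \<phi> (state_of G \<phi>)"
  using someI_ex[OF blim_orth_ex[OF comp _ G]] by (simp add: state_of_def)

lemma state_of_eq: "\<phi> \<in> cuo_orth \<Longrightarrow> L.blim G \<phi> y \<Longrightarrow> state_of G \<phi> = y"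
  using L.blim_unique[OF bultra_bfilter[OF G] blim_state_of] by fastforce

lemma state_of_subdiff: "state_of G \<in> subdiff_sup"
  unfolding subdiff_sup_def
proof (intro CollectI conjI ballI allI)
  note F = bultra_bfilter[OF G]
  show "state_of G \<in> extensional cuo_orth" by (simp add: state_of_def)
  show "state_of G (\<lambda>s. \<phi> s + \<psi> s) = state_of G \<phi> + state_of G \<psi>"
    if "\<phi> \<in> cuo_orth" "\<psi> \<in> cuo_orth" for \<phi> \<psi>
    using that by (intro state_of_eq L.cuo_add L.blim_add[OF F] blim_state_of)
  show "state_of G (\<lambda>s. r *\<^sub>R \<phi> s) = r *\<^sub>R state_of G \<phi>" if phi: "\<phi> \<in> cuo_orth" for r \<phi>
  proof (rule state_of_eq[OF cuo_orth_scaleR[OF phi]])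
    obtain e where e: "0 \<le> e" "\<And>\<epsilon>. 0 < \<epsilon> \<Longrightarrow> densely 1 (L.close_on G \<phi> (state_of G \<phi>) (\<epsilon> *\<^sub>R e))"
      using blim_state_of[OF phi] unfolding L.blim_def by blast
    have "densely 1 (L.close_on G (\<lambda>s. r *\<^sub>R \<phi> s) (r *\<^sub>R state_of G \<phi>) (\<epsilon> *\<^sub>R (\<bar>r\<bar> *\<^sub>R e)))" if "0 < \<epsilon>" for \<epsilon>
    proof (rule densely_mono[OF e(2)[OF that]])
      fix \<rho> assume "L.close_on G \<phi> (state_of G \<phi>) (\<epsilon> *\<^sub>R e) \<rho>"
      then obtain A where A: "(\<rho>, A) \<in> G" "\<And>s. s \<in> A \<Longrightarrow> L.le_on \<rho> \<bar>\<phi> s - state_of G \<phi>\<bar> (\<epsilon> *\<^sub>R e)"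
        by (auto simp: L.close_on_def)
      have "L.le_on \<rho> \<bar>r *\<^sub>R \<phi> s - r *\<^sub>R state_of G \<phi>\<bar> (\<epsilon> *\<^sub>R (\<bar>r\<bar> *\<^sub>R e))" if "s \<in> A" for s
        using L.le_on_scaleR[OF abs_ge_zero A(2)[OF that], of r]
        by (simp add: scaleR_diff_right[symmetric] scaleR_abs mult.commute)
      thus "L.close_on G (\<lambda>s. r *\<^sub>R \<phi> s) (r *\<^sub>R state_of G \<phi>) (\<epsilon> *\<^sub>R (\<bar>r\<bar> *\<^sub>R e)) \<rho>"
        using A(1) unfolding L.close_on_def by blast
    qed
    moreover have "0 \<le> \<bar>r\<bar> *\<^sub>R e" using e(1) by (simp add: scaleR_nonneg_nonneg)
    ultimately show "L.blim G (\<lambda>s. r *\<^sub>R \<phi> s) (r *\<^sub>R state_of G \<phi>)" unfolding L.blim_def by blast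
  qed
  show "state_of G \<phi> \<le> (SUP s. \<phi> s)" if phi: "\<phi> \<in> cuo_orth" for \<phi>
  proof -
    obtain b where b: "\<And>s. \<bar>\<phi> s\<bar> \<le> b" using L.cuo_bounded[OF phi] by blast
    have bdd: "bdd_above (range \<phi>)" using order_trans[OF abs_ge_self b] by (intro bdd_aboveI[of _ b]) auto
    let ?M = "SUP s. \<phi> s"
    have M: "\<phi> s \<le> ?M" for s by (rule cSUP_upper[OF _ bdd]) simp
    obtain e where e: "0 \<le> e" "\<And>\<epsilon>. 0 < \<epsilon> \<Longrightarrow> densely 1 (L.close_on G \<phi> (state_of G \<phi>) (\<epsilon> *\<^sub>R e))"
      using blim_state_of[OF phi] unfolding L.blim_def by blast
    have "state_of G \<phi> - ?M \<le> 0"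
    proof (rule archimedean_le_0)
      fix \<epsilon> :: real assume "0 < \<epsilon>"
      show "state_of G \<phi> - ?M \<le> \<epsilon> *\<^sub>R e"
      proof (rule L.local_le1[OF densely_mono[OF e(2)[OF \<open>0 < \<epsilon>\<close>]]])
        fix \<rho> assume r: "\<rho> \<in> band_projections" "\<rho> \<noteq> 0" "L.close_on G \<phi> (state_of G \<phi>) (\<epsilon> *\<^sub>R e) \<rho>"
        then obtain A where A: "(\<rho>, A) \<in> G" "\<And>s. s \<in> A \<Longrightarrow> L.le_on \<rho> \<bar>\<phi> s - state_of G \<phi>\<bar> (\<epsilon> *\<^sub>R e)"
          by (auto simp: L.close_on_def)
        obtain s where s: "s \<in> A" using bfilter_nonempty[OF F A(1) r(2)] by blast
        have "L.le_on \<rho> (state_of G \<phi> - \<phi> s) (\<epsilon> *\<^sub>R e)" using A(2)[OF s] r(1) by (simp add: L.le_on_abs_iff)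
        moreover have "L.le_on \<rho> (state_of G \<phi> - ?M) (state_of G \<phi> - \<phi> s)"
          using M by (intro L.le_onI r diff_left_mono)
        ultimately show "L.le_on \<rho> (state_of G \<phi> - ?M) (\<epsilon> *\<^sub>R e)" using L.le_on_trans by blast
      qed
    qed
    thus ?thesis by simp
  qed
qed

lemma subdiff_rules:
  assumes T: "T \<in> subdiff_sup"
  shows "\<phi> \<in> cuo_orth \<Longrightarrow> \<psi> \<in> cuo_orth \<Longrightarrow> T (\<lambda>s. \<phi> s + \<psi> s) = T \<phi> + T \<psi>"
    and "\<phi> \<in> cuo_orth \<Longrightarrow> T (\<lambda>s. r *\<^sub>R \<phi> s) = r *\<^sub>R T \<phi>"
    and "\<phi> \<in> cuo_orth \<Longrightarrow> (\<And>s. \<phi> s \<le> m) \<Longrightarrow> T \<phi> \<le> m"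
proof -
  show "\<phi> \<in> cuo_orth \<Longrightarrow> \<psi> \<in> cuo_orth \<Longrightarrow> T (\<lambda>s. \<phi> s + \<psi> s) = T \<phi> + T \<psi>"
    "\<phi> \<in> cuo_orth \<Longrightarrow> T (\<lambda>s. r *\<^sub>R \<phi> s) = r *\<^sub>R T \<phi>" using T by (auto simp: subdiff_sup_def)
  assume phi: "\<phi> \<in> cuo_orth" "\<And>s. \<phi> s \<le> m"
  have "T \<phi> \<le> (SUP s. \<phi> s)" using T phi by (auto simp: subdiff_sup_def)
  also have "\<dots> \<le> m" by (intro cSUP_least phi) simp
  finally show "T \<phi> \<le> m" .
qed

text \<open>With \<open>l\<close> the value of the state at \<open>\<phi>\<close>, the function
  \<open>\<psi> = \<bar>\<phi> - l\<bar>\<close> has limit 0. Both components of a convex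
  combination are positive, so both kill \<open>\<psi>\<close>, hence also
  \<open>\<phi> - l\<close>; as they fix constants, both give \<open>\<phi>\<close> the value
  \<open>l\<close>.\<close>

lemma state_of_extreme: "state_of G \<in> extreme_states"
  unfolding extreme_states_def
proof (intro CollectI conjI ballI allI impI state_of_subdiff)
  note F = bultra_bfilter[OF G]
  fix T1 T2 and t :: real assume T: "T1 \<in> subdiff_sup" "T2 \<in> subdiff_sup"
    and c: "0 < t \<and> t < 1 \<and> (\<forall>\<phi>\<in>cuo_orth. state_of G \<phi> = (1 - t) *\<^sub>R T1 \<phi> + t *\<^sub>R T2 \<phi>)"
  have key: "T \<phi> = state_of G \<phi>" if phi: "\<phi> \<in> cuo_orth" and T: "T \<in> subdiff_sup" and T': "T' \<in> subdiff_sup"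
    and c: "0 < u" "0 < v" "\<And>\<phi>. \<phi> \<in> cuo_orth \<Longrightarrow> state_of G \<phi> = u *\<^sub>R T \<phi> + v *\<^sub>R T' \<phi>" for \<phi> T T' and u v :: real
  proof -
    let ?l = "state_of G \<phi>"
    note R = subdiff_rules[OF T] and R' = subdiff_rules[OF T']
    define \<psi> where "\<psi> s = \<bar>\<phi> s - ?l\<bar>" for s
    have d: "(\<lambda>s. \<phi> s - ?l) \<in> cuo_orth" by (intro L.cuo_diff phi L.cuo_const)
    then obtain b where b: "\<And>s. \<bar>\<phi> s - ?l\<bar> \<le> b" using L.cuo_bounded by blast
    have psi: "\<psi> \<in> cuo_orth"
    proof (rule cuo_lipschitz[OF band_normed_L band_normed_L d])
      show "\<bar>\<psi> s\<bar> \<le> b" for s using b[of s] by (simp add: \<psi>_def)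
      show "\<bar>\<psi> s - \<psi> t\<bar> \<le> \<bar>(\<phi> s - ?l) - (\<phi> t - ?l)\<bar>" for s t unfolding \<psi>_def by (rule L.nrm_reverse)
    qed
    have "L.blim G \<psi> 0"
      by (rule blim_lipschitz[OF band_normed_L band_normed_L blim_state_of[OF phi]]) (simp add: \<psi>_def)
    hence s0: "state_of G \<psi> = 0" by (rule state_of_eq[OF psi])
    have neg: "S (\<lambda>s. - \<zeta> s) = - S \<zeta>" if "S \<in> subdiff_sup" "\<zeta> \<in> cuo_orth" for S \<zeta>
      using subdiff_rules(2)[OF that, of "- 1"] by simp
    have pos: "0 \<le> S \<psi>" if "S \<in> subdiff_sup" for S
      using subdiff_rules(3)[OF that L.cuo_minus[OF psi], of 0] neg[OF that psi] by (simp add: \<psi>_def)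
    have "u *\<^sub>R T \<psi> + v *\<^sub>R T' \<psi> = 0" using c(3)[OF psi] s0 by simp
    moreover have "0 \<le> v *\<^sub>R T' \<psi>" "0 \<le> u *\<^sub>R T \<psi>" using c pos T T' by (auto intro!: scaleR_nonneg_nonneg)
    ultimately have "u *\<^sub>R T \<psi> = 0" by (simp add: add_nonneg_eq_0_iff)
    hence T0: "T \<psi> = 0" using c by simp
    have le: "T \<zeta> \<le> 0" if chi: "\<zeta> \<in> cuo_orth" "\<And>s. \<zeta> s \<le> \<psi> s" for \<zeta>
    proof -
      have m: "(\<lambda>s. - \<psi> s) \<in> cuo_orth" by (rule L.cuo_minus[OF psi])
      have "T (\<lambda>s. \<zeta> s + - \<psi> s) \<le> 0" using chi by (intro R(3) L.cuo_add m) auto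
      thus ?thesis using R(1)[OF chi(1) m] neg[OF T psi] T0 by simp
    qed
    have "T (\<lambda>s. \<phi> s - ?l) \<le> 0" by (rule le[OF d]) (simp add: \<psi>_def abs_ge_self)
    moreover have "T (\<lambda>s. - (\<phi> s - ?l)) \<le> 0"
      by (rule le[OF L.cuo_minus[OF d]]) (use abs_ge_minus_self in \<open>simp only: \<psi>_def\<close>)
    hence "0 \<le> T (\<lambda>s. \<phi> s - ?l)" using neg[OF T d] by simp
    ultimately have z: "T (\<lambda>s. \<phi> s - ?l) = 0" by (rule order_antisym)
    have cm: "(\<lambda>s. ?l) \<in> (cuo_orth :: ('s \<Rightarrow> 'e orth) set)" by (rule L.cuo_const)
    have "T (\<lambda>s. ?l) \<le> ?l" by (rule R(3)[OF cm]) simp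
    moreover have "T (\<lambda>s. - ?l) \<le> - ?l" by (rule R(3)[OF L.cuo_minus[OF cm]]) simp
    hence "?l \<le> T (\<lambda>s. ?l)" using neg[OF T cm] by simp
    ultimately have "T (\<lambda>s. ?l) = ?l" by (rule order_antisym)
    thus ?thesis using R(1)[OF d cm] z by simp
  qed
  have T1: "T1 \<phi> = state_of G \<phi>" if "\<phi> \<in> cuo_orth" for \<phi>
    using c by (intro key[OF that T(1) T(2), of "1 - t" t]) auto
  have T2: "T2 \<phi> = state_of G \<phi>" if "\<phi> \<in> cuo_orth" for \<phi>
    using c by (intro key[OF that T(2) T(1), of t "1 - t"]) (auto simp: add.commute)
  show "T1 = T2"
  proof (rule extensionalityI)
    show "T1 \<in> extensional cuo_orth" "T2 \<in> extensional cuo_orth" using T by (auto simp: subdiff_sup_def)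
  qed (simp add: T1 T2)
qed

end

section \<open>Pure states\<close>

lemma o_tendsto_unique:
  assumes "F \<noteq> bot" "o_tendsto f l F" "o_tendsto f l' F"
  shows "l = (l' :: 'e::dedekind_vector_lattice)"
proof -
  obtain D where D: "D \<noteq> {}" "Inf D = 0" "\<And>d. d \<in> D \<Longrightarrow> eventually (\<lambda>a. \<bar>f a - l\<bar> \<le> d) F"
    using assms(2) unfolding o_tendsto_def by blast
  obtain D' where D': "D' \<noteq> {}" "Inf D' = 0" "\<And>d. d \<in> D' \<Longrightarrow> eventually (\<lambda>a. \<bar>f a - l'\<bar> \<le> d) F"
    using assms(3) unfolding o_tendsto_def by blast
  have le: "\<bar>l - l'\<bar> \<le> d + d'" if "d \<in> D" "d' \<in> D'" for d d'
  proof -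
    have "eventually (\<lambda>a. \<bar>f a - l\<bar> \<le> d \<and> \<bar>f a - l'\<bar> \<le> d') F"
      by (intro eventually_conj D D' that)
    then obtain a where a: "\<bar>f a - l\<bar> \<le> d" "\<bar>f a - l'\<bar> \<le> d'" using eventually_happens'[OF assms(1)] by blast
    have "\<bar>l - l'\<bar> \<le> \<bar>l - f a\<bar> + \<bar>f a - l'\<bar>" by (rule E.nrm_triangle3)
    also have "\<dots> \<le> d + d'" using a by (intro add_mono) (simp_all add: abs_minus_commute)
    finally show ?thesis .
  qed
  hence "\<bar>l - l'\<bar> - d \<le> d'" if "d \<in> D" "d' \<in> D'" for d d' using le[OF that] by (simp add: diff_le_eq add.commute)
  hence "\<bar>l - l'\<bar> - d \<le> Inf D'" if "d \<in> D" for d using that by (intro cInf_greatest D')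
  hence "\<bar>l - l'\<bar> \<le> d" if "d \<in> D" for d using that D' by simp
  hence "\<bar>l - l'\<bar> \<le> Inf D" by (intro cInf_greatest D)
  thus ?thesis using D by simp
qed

text \<open>The counterpart of \<open>mixing_ex\<close> in \<Lambda>, with the same kind of demands
  but glued by \<open>glue_lattice\<close>.\<close>

lemma partition_orth_ex:
  fixes \<pi> :: "'s \<Rightarrow> 'e::dedekind_vector_lattice orth"
  assumes part: "partition_of_unity UNIV \<pi>" and phi: "\<And>s. \<bar>\<phi> s\<bar> \<le> b"
  shows "\<exists>y. \<forall>s. \<pi> s * y = \<pi> s * \<phi> s"
proof -
  have p: "\<pi> s \<in> band_projections" "1 - \<pi> s \<in> band_projections" for s using part by (auto simp: partition_of_unity_def)
  have b0: "0 \<le> b" by (rule order_trans[OF abs_ge_zero phi])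
  define T where "T = range (\<lambda>s. (\<pi> s * \<phi> s, (1 - \<pi> s) * b))"
  have d0: "0 \<le> (1 - \<pi> s) * b" for s by (intro orth_mult_nonneg[OF bp_nonneg[OF p(2)]] b0)
  have bb: "\<pi> s * \<phi> s \<le> (1 - \<pi> t) * b" "- (\<pi> s * \<phi> s) \<le> (1 - \<pi> t) * b" if "s \<noteq> t" for s t
  proof -
    have "\<pi> s * \<pi> t = 0" using part that bp_inf[OF p(1) p(1)] unfolding partition_of_unity_def by (metis UNIV_I)
    hence le: "\<pi> s \<le> 1 - \<pi> t" using p by (subst bp_le_iff) (auto simp: algebra_simps)
    have "\<pi> s * b \<le> (1 - \<pi> t) * b" by (rule orth_mult_mono_right[OF b0 le])
    moreover have "\<phi> s \<le> b" "- \<phi> s \<le> b" using phi[of s] by (simp_all add: abs_le_iff)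
    note this[THEN orth_mult_mono[OF bp_nonneg[OF p(1)[of s]]]]
    ultimately show "\<pi> s * \<phi> s \<le> (1 - \<pi> t) * b" "- (\<pi> s * \<phi> s) \<le> (1 - \<pi> t) * b"
      using order_trans by (auto simp: L.P_minus)
  qed
  have "\<exists>y. \<forall>(x, d)\<in>T. \<bar>y - x\<bar> \<le> d"
  proof (rule glue_lattice)
    show "T \<noteq> {}" by (simp add: T_def)
    fix x d x' d' assume "(x, d) \<in> T" "(x', d') \<in> T"
    then obtain s t where st: "x = \<pi> s * \<phi> s" "d = (1 - \<pi> s) * b" "x' = \<pi> t * \<phi> t" "d' = (1 - \<pi> t) * b"
      by (auto simp: T_def)
    show "x - x' \<le> d + d'"
    proof (cases "s = t")
      case True
      then show ?thesis using st add_nonneg_nonneg[OF d0[of s] d0[of t]] by simp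
    next
      case False
      have "x + - x' \<le> d' + d" unfolding st using bb(1)[OF False] bb(2)[OF False[symmetric]] by (rule add_mono)
      thus ?thesis by (simp add: add.commute)
    qed
  qed
  then obtain y where y: "\<And>s. \<bar>y - \<pi> s * \<phi> s\<bar> \<le> (1 - \<pi> s) * b" by (auto simp: T_def)
  have "\<pi> s * y = \<pi> s * \<phi> s" for s
  proof -
    have z: "\<pi> s * ((1 - \<pi> s) * b) = 0" by (simp only: mult.assoc[symmetric] bp_compl_mult[OF p(1)] mult_zero_left)
    have "L.le_on (\<pi> s) \<bar>y - \<pi> s * \<phi> s\<bar> 0"
      using L.le_onI[OF y p(1), of s s] unfolding L.le_on_def z by simp
    hence "L.le_on (\<pi> s) (y - \<pi> s * \<phi> s) 0" "L.le_on (\<pi> s) (- (y - \<pi> s * \<phi> s)) 0"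
      unfolding L.le_on_abs_iff[OF p(1)] by simp_all
    hence "\<pi> s * (y - \<pi> s * \<phi> s) \<le> 0" "- (\<pi> s * (y - \<pi> s * \<phi> s)) \<le> 0"
      by (simp_all only: L.le_on_def L.P_minus L.P_0)
    hence "\<pi> s * (y - \<pi> s * \<phi> s) = 0" by (intro order_antisym) (simp_all only: neg_le_0_iff_le)
    hence "\<pi> s * y = \<pi> s * (\<pi> s * \<phi> s)" by (simp add: L.P_diff)
    thus ?thesis using p(1)[of s] by (simp add: mult.assoc[symmetric] bp_idem)
  qed
  thus ?thesis by blast
qed

text \<open>The second clause drives the induction: the next summand is disjoint from the sum so
  far, so the sum stays idempotent.\<close>

lemma partition_sum_bp:
  assumes part: "partition_of_unity UNIV \<pi>" and J: "finite J"
  shows "sum \<pi> J \<in> band_projections \<and> (\<forall>s. s \<notin> J \<longrightarrow> \<pi> s * sum \<pi> J = 0)"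
  using J
proof (induction J rule: finite_induct)
  case (insert s J)
  have p: "\<pi> t \<in> band_projections" for t using part by (auto simp: partition_of_unity_def)
  have d: "\<pi> t * \<pi> t' = 0" if "t \<noteq> t'" for t t'
    using part that bp_inf[OF p p] unfolding partition_of_unity_def by (metis UNIV_I)
  let ?q = "sum \<pi> J"
  have q: "?q \<in> band_projections" "\<pi> s * ?q = 0" "?q * \<pi> s = 0"
    using insert band_projection_commute[OF p, of s ?q] by auto
  have "\<pi> s + ?q \<in> band_projections"
    unfolding band_projections_iff
  proof (intro conjI)
    show "0 \<le> \<pi> s + ?q" by (intro add_nonneg_nonneg bp_nonneg p q)
    have "\<pi> s \<le> 1 - ?q" using p[of s] q by (subst bp_le_iff) (auto simp: algebra_simps)
    thus "\<pi> s + ?q \<le> 1" by (simp add: le_diff_eq)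
    show "(\<pi> s + ?q) * (\<pi> s + ?q) = \<pi> s + ?q" using p[of s] q by (simp add: algebra_simps bp_idem)
  qed
  moreover have "\<pi> t * (\<pi> s + ?q) = 0" if "t \<notin> insert s J" for t
    using that insert.IH d[of t s] by (auto simp: algebra_simps)
  ultimately show ?case using insert.hyps by simp
qed simp

text \<open>The \<open>o\<close>-sum is the mixing: as
  \<open>\<pi> s * \<phi> s = \<pi> s * y\<close>, a partial sum over \<open>K\<close> misses
  \<open>y\<close> by no more than \<open>(1 - sum \<pi> K) \<bar>y\<bar>\<close>, and these
  remainders decrease to 0.\<close>

lemma pure_state_eq:
  fixes \<pi> :: "'s::uniform_space \<Rightarrow> 'e::dedekind_vector_lattice orth"
  assumes part: "partition_of_unity UNIV \<pi>" and phi: "\<phi> \<in> cuo_orth" and y: "\<And>s. \<pi> s * y = \<pi> s * \<phi> s"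
  shows "pure_state \<pi> \<phi> = y"
proof -
  let ?F = "finite_subsets_at_top (UNIV :: 's set)"
  have p: "\<pi> s \<in> band_projections" "1 - \<pi> s \<in> band_projections" for s using part by (auto simp: partition_of_unity_def)
  have q: "sum \<pi> J \<in> band_projections" "1 - sum \<pi> J \<in> band_projections" if "finite J" for J
    using partition_sum_bp[OF part that] by auto
  define r where "r J = (1 - sum \<pi> J) * \<bar>y\<bar>" for J
  have r0: "0 \<le> r J" if "finite J" for J
    unfolding r_def by (intro orth_mult_nonneg[OF bp_nonneg[OF q(2)[OF that]]]) simp
  have mono: "r K \<le> r J" if "finite K" "J \<subseteq> K" for J K
  proof -
    have "sum \<pi> J \<le> sum \<pi> K" using that bp_nonneg[OF p(1)] by (intro sum_mono2) auto
    thus ?thesis unfolding r_def by (intro orth_mult_mono_right diff_left_mono) auto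
  qed
  have o: "o_tendsto (sum (\<lambda>s. \<pi> s * \<phi> s)) y ?F"
    unfolding o_tendsto_def
  proof (intro exI[of _ "r ` {J. finite J}"] conjI ballI)
    show "r ` {J. finite J} \<noteq> {}" by auto
    show "0 \<le> d" if "d \<in> r ` {J. finite J}" for d using that r0 by auto
    show "\<exists>d''\<in>r ` {J. finite J}. d'' \<le> d \<and> d'' \<le> d'" if dd: "d \<in> r ` {J. finite J}" "d' \<in> r ` {J. finite J}" for d d'
    proof -
      obtain J K where JK: "finite J" "d = r J" "finite K" "d' = r K" using dd by auto
      thus ?thesis using mono[of "J \<union> K" J] mono[of "J \<union> K" K] by (intro bexI[of _ "r (J \<union> K)"]) auto
    qed
    show "Inf (r ` {J. finite J}) = 0"
    proof (rule Inf_eq_0I)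
      fix h assume h: "\<And>d. d \<in> r ` {J. finite J} \<Longrightarrow> h \<le> d"
      show "h \<le> 0"
      proof (rule L.partition_le[OF part])
        fix s
        have "r {s} \<in> r ` {J. finite J}" by (rule imageI) simp
        from h[OF this] have "h \<le> (1 - \<pi> s) * \<bar>y\<bar>" by (simp add: r_def)
        from L.le_onI[OF this p(1)[of s]] show "L.le_on (\<pi> s) h 0"
          unfolding L.le_on_def by (simp only: mult.assoc[symmetric] bp_compl_mult[OF p(1)] mult_zero_left mult_zero_right)
      qed
    qed (use r0 in auto)
    show "eventually (\<lambda>J. \<bar>sum (\<lambda>s. \<pi> s * \<phi> s) J - y\<bar> \<le> d) ?F" if dd: "d \<in> r ` {J. finite J}" for d
    proof -
      obtain J where J: "finite J" "d = r J" using dd by auto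
      have "\<bar>sum (\<lambda>s. \<pi> s * \<phi> s) K - y\<bar> \<le> d" if K: "finite K" "J \<subseteq> K" for K
      proof -
        have "sum (\<lambda>s. \<pi> s * \<phi> s) K = sum \<pi> K * y" by (simp add: y[symmetric] sum_distrib_right)
        hence "sum (\<lambda>s. \<pi> s * \<phi> s) K - y = - ((1 - sum \<pi> K) * y)" by (simp add: algebra_simps)
        hence "\<bar>sum (\<lambda>s. \<pi> s * \<phi> s) K - y\<bar> = \<bar>(1 - sum \<pi> K) * y\<bar>" by (simp only: abs_minus_cancel)
        also have "\<dots> \<le> \<bar>1 - sum \<pi> K\<bar> * \<bar>y\<bar>" by (rule orth_abs_mult_le)
        also have "\<dots> = r K" unfolding r_def using bp_nonneg[OF q(2)[OF K(1)]] by (simp only: abs_of_nonneg)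
        also have "\<dots> \<le> d" unfolding J(2) by (rule mono[OF K])
        finally show ?thesis .
      qed
      thus ?thesis using J(1) unfolding eventually_finite_subsets_at_top by (intro exI[of _ J]) auto
    qed
  qed
  have "o_sum (\<lambda>s. \<pi> s * \<phi> s) UNIV = y"
    unfolding o_sum_def
  proof (rule the_equality[where P = "\<lambda>l. o_tendsto (sum (\<lambda>s. \<pi> s * \<phi> s)) l ?F", OF o])
    show "l = y" if "o_tendsto (sum (\<lambda>s. \<pi> s * \<phi> s)) l ?F" for l
      by (rule o_tendsto_unique[OF _ that o]) simp
  qed
  thus ?thesis using phi by (simp add: pure_state_def)
qed

lemma pure_state_mult:
  fixes \<pi> :: "'s::uniform_space \<Rightarrow> 'e::dedekind_vector_lattice orth"
  assumes part: "partition_of_unity UNIV \<pi>" and phi: "\<phi> \<in> cuo_orth"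
  shows "\<pi> s * pure_state \<pi> \<phi> = \<pi> s * \<phi> s"
proof -
  obtain b where "\<And>s. \<bar>\<phi> s\<bar> \<le> b" using L.cuo_bounded[OF phi] by blast
  then obtain y where y: "\<And>s. \<pi> s * y = \<pi> s * \<phi> s" using partition_orth_ex[OF part] by blast
  show ?thesis unfolding pure_state_eq[OF part phi y] by (rule y)
qed

subsection \<open>Exhaustion\<close>

text \<open>A maximal pairwise disjoint subset of \<open>D\<close> is a partition: if some
  \<open>1 - \<tau>\<close> were left over, density would supply a further member of
  \<open>D\<close> below it. This is how choices on small parts become one global choice.\<close>

lemma partition_exhaustion:
  assumes D: "D \<subseteq> band_projections - {0 :: 'e::dedekind_vector_lattice orth}" and dense: "densely 1 (\<lambda>\<rho>. \<rho> \<in> D)"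
  shows "\<exists>I\<subseteq>D. partition_of_unity I (\<lambda>\<rho>. \<rho>)"
proof -
  let ?X = "{I. I \<subseteq> D \<and> (\<forall>\<rho>\<in>I. \<forall>\<kappa>\<in>I. \<rho> \<noteq> \<kappa> \<longrightarrow> \<rho> * \<kappa> = 0)}"
  have "\<exists>M\<in>?X. \<forall>X\<in>?X. M \<subseteq> X \<longrightarrow> X = M"
  proof (rule subset_Zorn_nonempty)
    show "?X \<noteq> {}" by blast
    fix C assume C: "C \<noteq> {}" "subset.chain ?X C"
    have "\<rho> * \<kappa> = 0" if rk: "\<rho> \<in> \<Union>C" "\<kappa> \<in> \<Union>C" "\<rho> \<noteq> \<kappa>" for \<rho> \<kappa>
    proof -
      obtain A B where AB: "A \<in> C" "\<rho> \<in> A" "B \<in> C" "\<kappa> \<in> B" using rk(1,2) by (elim UnionE)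
      have sub: "C \<subseteq> ?X" using C(2) by (simp add: subset.chain_def)
      have "A \<subseteq> B \<or> B \<subseteq> A" using subset.chain_total[OF C(2) AB(1,3)] by auto
      then obtain Z where Z: "Z \<in> C" "\<rho> \<in> Z" "\<kappa> \<in> Z" using AB by (elim disjE) (auto dest: subsetD)
      have "Z \<in> ?X" using sub Z(1) by (rule subsetD)
      thus ?thesis using Z rk(3) by simp
    qed
    moreover have "\<Union>C \<subseteq> D" using C(2) unfolding subset.chain_def by auto
    ultimately show "\<Union>C \<in> ?X" by simp
  qed
  then obtain M where M0: "M \<in> ?X" "\<forall>X\<in>?X. M \<subseteq> X \<longrightarrow> X = M" by (elim bexE)
  have MD: "M \<subseteq> D" and disj: "\<And>\<rho> \<kappa>. \<rho> \<in> M \<Longrightarrow> \<kappa> \<in> M \<Longrightarrow> \<rho> \<noteq> \<kappa> \<Longrightarrow> \<rho> * \<kappa> = 0" using M0(1) by auto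
  have bp: "\<rho> \<in> band_projections" "\<rho> \<noteq> 0" if "\<rho> \<in> D" for \<rho> using D that by auto
  have "partition_of_unity M (\<lambda>\<rho>. \<rho>)"
    unfolding partition_of_unity_def
  proof (intro conjI ballI impI)
    show "\<rho> \<in> band_projections" if "\<rho> \<in> M" for \<rho> using bp MD that by blast
    show "inf \<rho> \<kappa> = 0" if "\<rho> \<in> M" "\<kappa> \<in> M" "\<rho> \<noteq> \<kappa>" for \<rho> \<kappa>
      using disj[OF that] bp_inf bp(1) MD that by (metis subsetD)
    fix \<tau> :: "'e orth" assume t: "\<tau> \<in> band_projections" "\<forall>\<rho>\<in>M. \<rho> \<le> \<tau>"
    show "\<tau> = 1"
    proof (rule ccontr)
      assume "\<tau> \<noteq> 1"
      hence c: "1 - \<tau> \<in> band_projections" "1 - \<tau> \<noteq> 0" "1 - \<tau> \<le> 1" using t(1) bp_le_one[OF bp_compl[OF t(1)]] by auto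
      obtain \<delta> where d: "\<delta> \<in> D" "\<delta> \<le> 1 - \<tau>" "\<delta> \<in> band_projections" "\<delta> \<noteq> 0" using densely_ex[OF dense c(1,3,2)] by blast
      have dt: "\<delta> * \<tau> = 0" using bp_le_iff[OF d(3) c(1)] d(2) by (simp add: algebra_simps)
      have z: "\<delta> * \<rho> = 0 \<and> \<rho> * \<delta> = 0" if r: "\<rho> \<in> M" for \<rho>
      proof -
        have rb: "\<rho> \<in> band_projections" using bp MD r by blast
        have "\<rho> * \<tau> = \<rho>" using t r bp_le_iff[OF rb t(1)] by blast
        hence "\<delta> * \<rho> = \<delta> * \<tau> * \<rho>" using band_projection_commute[OF rb, of \<tau>] by (simp add: mult.assoc)
        thus ?thesis using dt band_projection_commute[OF rb, of \<delta>] by simp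
      qed
      have "\<rho> * \<kappa> = 0" if "\<rho> \<in> insert \<delta> M" "\<kappa> \<in> insert \<delta> M" "\<rho> \<noteq> \<kappa>" for \<rho> \<kappa>
        using that disj[of \<rho> \<kappa>] z[of \<rho>] z[of \<kappa>] by auto
      hence "insert \<delta> M \<in> ?X" using d(1) MD by simp
      from M0(2)[rule_format, OF this subset_insertI] have "insert \<delta> M = M" .
      hence "\<delta> \<in> M" by blast
      hence "\<delta> * \<delta> = 0" using z by blast
      thus False using d(4) bp_idem[OF d(3)] by simp
    qed
  qed
  thus ?thesis using MD by blast
qed

text \<open>The members of a partition that carry the same label are merged into their supremum.\<close>

lemma partition_group:
  fixes I :: "'e::dedekind_vector_lattice orth set" and g :: "'e orth \<Rightarrow> 's"
  assumes part: "partition_of_unity I (\<lambda>\<rho>. \<rho>)"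
  shows "\<exists>\<pi>. partition_of_unity (UNIV :: 's set) \<pi> \<and> (\<forall>\<rho>\<in>I. \<rho> \<le> \<pi> (g \<rho>))"
proof -
  have bp: "\<rho> \<in> band_projections" if "\<rho> \<in> I" for \<rho> using part that by (auto simp: partition_of_unity_def)
  have "\<exists>\<pi>. \<forall>s. \<pi> s \<in> band_projections \<and> (\<forall>\<rho>\<in>{\<rho>\<in>I. g \<rho> = s}. \<rho> \<le> \<pi> s) \<and>
      (\<forall>\<kappa>\<in>band_projections. (\<forall>\<rho>\<in>{\<rho>\<in>I. g \<rho> = s}. \<rho> \<le> \<kappa>) \<longrightarrow> \<pi> s \<le> \<kappa>)"
  proof (rule choice, rule allI)
    fix s
    have "{\<rho>\<in>I. g \<rho> = s} \<subseteq> band_projections" using bp by blast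
    from bp_Sup_ex[OF this] show "\<exists>p. p \<in> band_projections \<and> (\<forall>\<rho>\<in>{\<rho>\<in>I. g \<rho> = s}. \<rho> \<le> p) \<and>
      (\<forall>\<kappa>\<in>band_projections. (\<forall>\<rho>\<in>{\<rho>\<in>I. g \<rho> = s}. \<rho> \<le> \<kappa>) \<longrightarrow> p \<le> \<kappa>)" by blast
  qed
  then obtain \<pi> where pi0: "\<forall>s. \<pi> s \<in> band_projections \<and> (\<forall>\<rho>\<in>{\<rho>\<in>I. g \<rho> = s}. \<rho> \<le> \<pi> s) \<and>
      (\<forall>\<kappa>\<in>band_projections. (\<forall>\<rho>\<in>{\<rho>\<in>I. g \<rho> = s}. \<rho> \<le> \<kappa>) \<longrightarrow> \<pi> s \<le> \<kappa>)" by (elim exE)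
  have pi: "\<pi> s \<in> band_projections" "\<rho> \<in> I \<Longrightarrow> \<rho> \<le> \<pi> (g \<rho>)"
    "\<kappa> \<in> band_projections \<Longrightarrow> (\<And>\<rho>. \<rho> \<in> I \<Longrightarrow> g \<rho> = s \<Longrightarrow> \<rho> \<le> \<kappa>) \<Longrightarrow> \<pi> s \<le> \<kappa>" for s \<rho> \<kappa>
    using pi0 by simp_all
  have le_compl: "p \<le> 1 - q \<longleftrightarrow> p * q = 0" if "p \<in> band_projections" "q \<in> band_projections" for p q :: "'e orth"
    using bp_le_iff[OF that(1) bp_compl[OF that(2)]] by (auto simp: algebra_simps)
  have dis: "\<pi> s * \<pi> t = 0" if st: "s \<noteq> t" for s t
  proof -
    \<comment> \<open>Disjointness passes to the suprema in two rounds, first for the label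
      \<open>s\<close> and then for \<open>t\<close>.\<close>
    have 1: "\<pi> s \<le> 1 - \<rho>" if r: "\<rho> \<in> I" "g \<rho> = t" for \<rho>
    proof (rule pi(3)[OF bp_compl[OF bp[OF r(1)]]])
      fix \<kappa> assume k: "\<kappa> \<in> I" "g \<kappa> = s"
      have "inf \<kappa> \<rho> = 0" using part k r st unfolding partition_of_unity_def by metis
      hence "\<kappa> * \<rho> = 0" using bp_inf[OF bp[OF k(1)] bp[OF r(1)]] by simp
      thus "\<kappa> \<le> 1 - \<rho>" using le_compl[OF bp[OF k(1)] bp[OF r(1)]] by simp
    qed
    have "\<pi> t \<le> 1 - \<pi> s"
    proof (rule pi(3)[OF bp_compl[OF pi(1)]])
      fix \<rho> assume r: "\<rho> \<in> I" "g \<rho> = t"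
      have "\<pi> s * \<rho> = 0" using 1[OF r] le_compl[OF pi(1) bp[OF r(1)]] by simp
      hence "\<rho> * \<pi> s = 0" using band_projection_commute[OF pi(1), of s \<rho>] by simp
      thus "\<rho> \<le> 1 - \<pi> s" using le_compl[OF bp[OF r(1)] pi(1)] by simp
    qed
    hence "\<pi> t * \<pi> s = 0" using le_compl[OF pi(1) pi(1)] by simp
    thus ?thesis using band_projection_commute[OF pi(1), of s "\<pi> t"] by simp
  qed
  have "partition_of_unity UNIV \<pi>"
    unfolding partition_of_unity_def
  proof (intro conjI ballI impI pi(1))
    show "inf (\<pi> s) (\<pi> t) = 0" if "s \<noteq> t" for s t using dis[OF that] bp_inf[OF pi(1) pi(1)] by simp
    fix \<kappa> :: "'e orth" assume k: "\<kappa> \<in> band_projections" "\<forall>s\<in>UNIV. \<pi> s \<le> \<kappa>"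
    have "\<rho> \<le> \<kappa>" if "\<rho> \<in> I" for \<rho> using order_trans[OF pi(2)[OF that]] k(2) by blast
    thus "\<kappa> = 1" using part k(1) unfolding partition_of_unity_def by blast
  qed
  thus ?thesis using pi(2) by blast
qed

section \<open>Values at the states of ultrafilters\<close>

text \<open>On small parts one point \<open>s\<close> is good for all of \<open>\<Phi>\<close>,
  because the finitely many witnessing sets meet. Exhaustion makes a partition of such parts; it is
  then grouped by the chosen points because pure states are indexed by points.\<close>

lemma pure_state_approx:
  fixes G :: "('e::dedekind_vector_lattice orth \<times> 's::uniform_space set) set"
  assumes comp: "compact (UNIV :: 's set)" and G: "bultra G"
    and Phi: "finite \<Phi>" "\<Phi> \<subseteq> cuo_orth" and eps: "0 < \<epsilon>"
  shows "\<exists>\<pi>. partition_of_unity UNIV \<pi> \<and> (\<forall>\<phi>\<in>\<Phi>. \<bar>state_of G \<phi> - pure_state \<pi> \<phi>\<bar> \<le> \<epsilon> *\<^sub>R 1)"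
proof -
  note F = bultra_bfilter[OF G]
  have "densely 1 (\<lambda>\<rho>. \<forall>\<phi>\<in>\<Phi>. L.close_on G \<phi> (state_of G \<phi>) (\<epsilon> *\<^sub>R 1) \<rho>)"
  proof (rule densely_ball[OF Phi(1)])
    show "densely 1 (L.close_on G \<phi> (state_of G \<phi>) (\<epsilon> *\<^sub>R 1))" if "\<phi> \<in> \<Phi>" for \<phi>
      using that Phi(2) by (intro L.blim_regulator[OF F blim_state_of[OF comp G] orth_zero_le_one full_one bp_one eps]) auto
  qed (erule (3) L.close_on_down[OF F])
  hence "densely 1 (\<lambda>\<rho>. \<exists>s. \<forall>\<phi>\<in>\<Phi>. L.le_on \<rho> \<bar>\<phi> s - state_of G \<phi>\<bar> (\<epsilon> *\<^sub>R 1))"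
  proof (rule densely_mono)
    fix \<rho> :: "'e orth" assume r: "\<rho> \<in> band_projections" "\<rho> \<noteq> 0" and "\<forall>\<phi>\<in>\<Phi>. L.close_on G \<phi> (state_of G \<phi>) (\<epsilon> *\<^sub>R 1) \<rho>"
    hence "\<forall>\<phi>\<in>\<Phi>. \<exists>A. (\<rho>, A) \<in> G \<and> (\<forall>s\<in>A. L.le_on \<rho> \<bar>\<phi> s - state_of G \<phi>\<bar> (\<epsilon> *\<^sub>R 1))" by (simp add: L.close_on_def)
    then obtain A where A: "\<And>\<phi>. \<phi> \<in> \<Phi> \<Longrightarrow> (\<rho>, A \<phi>) \<in> G"
      "\<And>\<phi> s. \<phi> \<in> \<Phi> \<Longrightarrow> s \<in> A \<phi> \<Longrightarrow> L.le_on \<rho> \<bar>\<phi> s - state_of G \<phi>\<bar> (\<epsilon> *\<^sub>R 1)" by metis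
    have "(\<rho>, \<Inter>\<phi>\<in>\<Phi>. A \<phi>) \<in> G"
      using Phi(1) A(1)
    proof (induction \<Phi> rule: finite_induct)
      case empty
      then show ?case using bfilter_UNIV[OF F r(1)] by simp
    next
      case (insert \<phi> \<Phi>)
      then show ?case using bfilter_int[OF F] by simp
    qed
    then obtain s where "s \<in> (\<Inter>\<phi>\<in>\<Phi>. A \<phi>)" using bfilter_nonempty[OF F _ r(2)] by metis
    thus "\<exists>s. \<forall>\<phi>\<in>\<Phi>. L.le_on \<rho> \<bar>\<phi> s - state_of G \<phi>\<bar> (\<epsilon> *\<^sub>R 1)" using A(2) by blast
  qed
  hence "densely 1 (\<lambda>\<rho>. \<rho> \<in> {\<rho> \<in> band_projections - {0}. \<exists>s. \<forall>\<phi>\<in>\<Phi>. L.le_on \<rho> \<bar>\<phi> s - state_of G \<phi>\<bar> (\<epsilon> *\<^sub>R 1)})"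
    (is "densely 1 (\<lambda>\<rho>. \<rho> \<in> ?D)") by (rule densely_mono) simp
  then obtain I where I: "I \<subseteq> ?D" "partition_of_unity I (\<lambda>\<rho>. \<rho>)"
    using partition_exhaustion[of ?D] by auto
  hence "\<forall>\<rho>\<in>I. \<exists>s. \<forall>\<phi>\<in>\<Phi>. L.le_on \<rho> \<bar>\<phi> s - state_of G \<phi>\<bar> (\<epsilon> *\<^sub>R 1)" by blast
  then obtain g where g: "\<And>\<rho> \<phi>. \<rho> \<in> I \<Longrightarrow> \<phi> \<in> \<Phi> \<Longrightarrow> L.le_on \<rho> \<bar>\<phi> (g \<rho>) - state_of G \<phi>\<bar> (\<epsilon> *\<^sub>R 1)" by metis
  obtain \<pi> where p: "partition_of_unity UNIV \<pi>" "\<And>\<rho>. \<rho> \<in> I \<Longrightarrow> \<rho> \<le> \<pi> (g \<rho>)" using partition_group[OF I(2), of g] by blast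
  have "\<bar>state_of G \<phi> - pure_state \<pi> \<phi>\<bar> \<le> \<epsilon> *\<^sub>R 1" if phi: "\<phi> \<in> \<Phi>" for \<phi>
  proof (rule L.partition_le[OF I(2)])
    fix \<rho> assume r: "\<rho> \<in> I"
    have rb: "\<rho> \<in> band_projections" using I r by auto
    have pb: "\<pi> (g \<rho>) \<in> band_projections" using p(1) by (simp add: partition_of_unity_def)
    have "\<pi> (g \<rho>) * pure_state \<pi> \<phi> = \<pi> (g \<rho>) * \<phi> (g \<rho>)" using phi Phi(2) by (intro pure_state_mult[OF p(1)]) auto
    hence e: "\<rho> * pure_state \<pi> \<phi> = \<rho> * \<phi> (g \<rho>)" using L.P_down(1)[OF rb pb p(2)[OF r]] by metis
    have "L.le_on \<rho> (\<phi> (g \<rho>) - state_of G \<phi>) (\<epsilon> *\<^sub>R 1)" "L.le_on \<rho> (- (\<phi> (g \<rho>) - state_of G \<phi>)) (\<epsilon> *\<^sub>R 1)"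
      using g[OF r phi] rb by (simp_all only: L.le_on_abs_iff)
    thus "L.le_on \<rho> \<bar>state_of G \<phi> - pure_state \<pi> \<phi>\<bar> (\<epsilon> *\<^sub>R 1)"
      unfolding L.le_on_abs_iff[OF rb] by (simp add: L.le_on_def L.P_diff L.P_minus e)
  qed
  thus ?thesis using p(1) by blast
qed

text \<open>The net runs over finite sets of functions and tolerances. Its existence keeps the
  definition of \<open>state_value\<close> at this state from being vacuous: without any net every
  \<open>y\<close> would qualify.\<close>

lemma pure_net_ex:
  fixes G :: "('e::dedekind_vector_lattice orth \<times> 's::uniform_space set) set"
  assumes comp: "compact (UNIV :: 's set)" and G: "bultra G"
  shows "\<exists>F. pure_net_tendsto F (state_of G)"
proof -
  define B where "B p = {\<pi>. partition_of_unity UNIV \<pi> \<and> (\<forall>\<phi>\<in>fst p. \<bar>state_of G \<phi> - pure_state \<pi> \<phi>\<bar> \<le> snd p *\<^sub>R 1)}"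
    for p :: "('s \<Rightarrow> 'e orth) set \<times> real"
  let ?I = "{p. finite (fst p) \<and> fst p \<subseteq> cuo_orth \<and> 0 < snd p} :: (('s \<Rightarrow> 'e orth) set \<times> real) set"
  define F where "F = (INF p\<in>?I. principal (B p))"
  have ne: "B p \<noteq> {}" if "p \<in> ?I" for p
    using pure_state_approx[OF comp G, of "fst p" "snd p"] that by (auto simp: B_def)
  have ev: "eventually Q F \<longleftrightarrow> (\<exists>p\<in>?I. \<forall>\<pi>\<in>B p. Q \<pi>)" for Q
    unfolding F_def
  proof (subst eventually_INF_base)
    have "({}, 1) \<in> ?I" by simp
    thus "?I \<noteq> {}" by blast
    fix p q assume pq: "p \<in> ?I" "q \<in> ?I"
    let ?m = "(fst p \<union> fst q, min (snd p) (snd q))"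
    have "snd ?m *\<^sub>R 1 \<le> snd p *\<^sub>R (1 :: 'e orth)" "snd ?m *\<^sub>R 1 \<le> snd q *\<^sub>R (1 :: 'e orth)"
      by (intro scaleR_right_mono orth_zero_le_one; simp)+
    hence "B ?m \<subseteq> B p \<inter> B q" unfolding B_def by (auto intro: order_trans)
    thus "\<exists>x\<in>?I. principal (B x) \<le> inf (principal (B p)) (principal (B q))"
      using pq by (intro bexI[of _ ?m]) auto
  qed (simp add: eventually_principal)
  have "pure_net_tendsto F (state_of G)"
    unfolding pure_net_tendsto_def
  proof (intro conjI ballI)
    show "F \<noteq> bot" unfolding trivial_limit_def ev using ne by blast
    show "eventually (partition_of_unity UNIV) F"
      unfolding ev by (intro bexI[of _ "({}, 1)"]) (auto simp: B_def)
    fix \<phi> :: "'s \<Rightarrow> 'e orth" assume "\<phi> \<in> cuo_orth"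
    hence "norm_r_tendsto abs 1 (\<lambda>\<pi>. pure_state \<pi> \<phi>) (state_of G \<phi>) F"
      unfolding norm_r_tendsto_def ev
      by (intro allI impI bexI[of _ "({\<phi>}, _)"]) (auto simp: B_def)
    thus "\<exists>e\<ge>0. norm_r_tendsto abs e (\<lambda>\<pi>. pure_state \<pi> \<phi>) (state_of G \<phi>) F"
      using orth_zero_le_one by blast
  qed
  thus ?thesis by blast
qed

context bk_action
begin

lemma pure_value:
  assumes part: "partition_of_unity UNIV \<pi>" and f: "f \<in> cuo nrm"
  shows "act (\<pi> s) (pure_value act f \<pi>) = act (\<pi> s) (f s)"
proof -
  obtain e where e: "0 \<le> e" "\<And>s. nrm (f s) \<le> e" using X.cuo_bounded[OF f] by blast
  have p: "\<pi> s \<in> band_projections" for s using part by (auto simp: partition_of_unity_def)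
  have "\<exists>y. \<forall>s\<in>UNIV. act (\<pi> s) y = act (\<pi> s) (f s)"
    using e p by (intro mixing_ex[OF part _ e(1)] E.le_onI)
  then obtain y where y: "\<forall>s. act (\<pi> s) y = act (\<pi> s) (f s)" by blast
  have "\<forall>s. act (\<pi> s) (pure_value act f \<pi>) = act (\<pi> s) (f s)"
    unfolding pure_value_def
  proof (rule theI[where P = "\<lambda>y. \<forall>s. act (\<pi> s) y = act (\<pi> s) (f s)", OF y])
    show "x = y" if "\<forall>s. act (\<pi> s) x = act (\<pi> s) (f s)" for x
      using mixing_unique[OF part] that y by simp
  qed
  thus ?thesis by blast
qed

text \<open>The distance \<open>\<psi> s = nrm (f s - y)\<close> is written as
  \<open>\<phi> s\<close> applied to a fixed \<open>e\<close>, with \<open>\<phi>\<close> in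
  \<open>cuo_orth\<close>. The state maps \<open>\<phi>\<close> to 0, so the pure states of the net
  send \<open>\<phi>\<close> to 0 relatively uniformly; and the distance of a pure value from
  \<open>y\<close> is at most the pure state at \<open>\<phi>\<close>, applied to
  \<open>e\<close>.\<close>

lemma pure_value_tendsto:
  fixes G :: "('e orth \<times> 's::uniform_space set) set"
  assumes comp: "compact (UNIV :: 's set)" and G: "bultra G"
    and f: "f \<in> cuo nrm" and y: "X.blim G f y" and net: "pure_net_tendsto F (state_of G)"
  shows "norm_o_tendsto nrm (pure_value act f) y F"
proof -
  note BF = bultra_bfilter[OF G]
  define \<psi> where "\<psi> s = nrm (f s - y)" for s
  obtain b where b: "0 \<le> b" "\<And>s. nrm (f s) \<le> b" using X.cuo_bounded[OF f] by blast
  define e where "e = b + nrm y"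
  have e: "0 \<le> e" using b nrm_nonneg by (simp add: e_def add_nonneg_nonneg)
  have pe: "0 \<le> \<psi> s" "\<psi> s \<le> e" for s
    unfolding \<psi>_def e_def using order_trans[OF X.nrm_diff_le add_right_mono[OF b(2)]] nrm_nonneg by auto
  have psi: "\<psi> \<in> cuo abs"
  proof (rule cuo_lipschitz[OF X.band_normed_axioms band_normed_E f])
    show "\<bar>\<psi> s\<bar> \<le> e" for s using pe[of s] by simp
    show "\<bar>\<psi> s - \<psi> t\<bar> \<le> nrm (f s - f t)" for s t
      using X.nrm_reverse[of "f s - y" "f t - y"] by (simp add: \<psi>_def)
  qed
  obtain \<tau> where t: "\<tau> \<in> band_projections" "orth_apply \<tau> e = e" "E.full \<tau> e" using E.support_ex[OF e] by blast
  obtain \<phi> where phi: "\<phi> \<in> cuo_orth" "\<And>s. 0 \<le> \<phi> s" "\<And>s. orth_apply (\<phi> s) e = \<psi> s" "\<And>s. (1 - \<tau>) * \<phi> s = 0"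
    using cuo_divide[OF psi pe t] by blast
  have "L.blim G \<phi> 0"
    unfolding L.blim_def
  proof (intro exI[of _ 1] conjI allI impI orth_zero_le_one)
    fix \<epsilon> :: real assume eps: "0 < \<epsilon>"
    show "densely 1 (L.close_on G \<phi> 0 (\<epsilon> *\<^sub>R 1))"
      unfolding densely_def
    proof (intro ballI impI)
      fix \<kappa> :: "'e orth" assume k: "\<kappa> \<in> band_projections" "\<kappa> \<le> 1" "\<kappa> \<noteq> 0"
      show "\<exists>\<rho>\<in>band_projections. \<rho> \<noteq> 0 \<and> \<rho> \<le> \<kappa> \<and> L.close_on G \<phi> 0 (\<epsilon> *\<^sub>R 1) \<rho>"
      proof (rule bp_split[OF k(1,3) t(1)])
        assume a: "\<kappa> * \<tau> \<in> band_projections" "\<kappa> * \<tau> \<noteq> 0" "\<kappa> * \<tau> \<le> \<kappa>" "\<kappa> * \<tau> \<le> \<tau>"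
        obtain \<rho> where r: "\<rho> \<in> band_projections" "\<rho> \<noteq> 0" "\<rho> \<le> \<kappa> * \<tau>" "X.close_on G f y (\<epsilon> *\<^sub>R e) \<rho>"
          using densely_ex[OF X.blim_regulator[OF BF y e t(3,1) eps] a(1,4,2)] by blast
        obtain A where A: "(\<rho>, A) \<in> G" "\<And>s. s \<in> A \<Longrightarrow> E.le_on \<rho> (nrm (f s - y)) (\<epsilon> *\<^sub>R e)"
          using r(4) by (auto simp: X.close_on_def)
        have rt: "\<rho> \<le> \<tau>" "\<rho> \<le> \<kappa>" using r(3) a(3,4) by (meson order_trans)+
        have "L.le_on \<rho> \<bar>\<phi> s - 0\<bar> (\<epsilon> *\<^sub>R 1)" if "s \<in> A" for s
        proof -
          have "E.le_on \<rho> (orth_apply (\<phi> s) e) (\<epsilon> *\<^sub>R e)" using A(2)[OF that] by (simp add: phi(3) \<psi>_def)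
          hence "L.le_on \<rho> (\<phi> s) (\<epsilon> *\<^sub>R 1)" by (rule le_on_cancel[OF e E.full_down[OF t(3) rt(1)] r(1)])
          thus ?thesis using phi(2)[of s] by simp
        qed
        hence "L.close_on G \<phi> 0 (\<epsilon> *\<^sub>R 1) \<rho>" using A(1) unfolding L.close_on_def by blast
        thus ?thesis using r rt by blast
      next
        assume a: "\<kappa> * (1 - \<tau>) \<in> band_projections" "\<kappa> * (1 - \<tau>) \<noteq> 0" "\<kappa> * (1 - \<tau>) \<le> \<kappa>"
        have z: "\<kappa> * (1 - \<tau>) * \<phi> s = 0" for s by (simp only: mult.assoc phi(4) mult_zero_right)
        have "0 \<le> \<kappa> * (1 - \<tau>) * (\<epsilon> *\<^sub>R 1)" unfolding orth_scaleR_mult mult_1_right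
          using eps by (intro scaleR_nonneg_nonneg bp_nonneg a(1)) simp
        hence "L.le_on (\<kappa> * (1 - \<tau>)) \<bar>\<phi> s - 0\<bar> (\<epsilon> *\<^sub>R 1)" for s
          using phi(2)[of s] unfolding L.le_on_def diff_zero by (simp only: abs_of_nonneg z)
        hence "L.close_on G \<phi> 0 (\<epsilon> *\<^sub>R 1) (\<kappa> * (1 - \<tau>))"
          using bfilter_UNIV[OF BF a(1)] unfolding L.close_on_def by blast
        thus ?thesis using a by blast
      qed
    qed
  qed
  hence s0: "state_of G \<phi> = 0" by (rule state_of_eq[OF comp G phi(1)])
  obtain e' where e': "0 \<le> e'" "norm_r_tendsto abs e' (\<lambda>\<pi>. pure_state \<pi> \<phi>) 0 F"
    using net phi(1) s0 unfolding pure_net_tendsto_def by metis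
  have ep: "eventually (partition_of_unity UNIV) F" using net by (simp add: pure_net_tendsto_def)
  let ?d = "orth_apply e' e"
  have d0: "0 \<le> ?d" by (rule orth_apply_nonneg[OF e'(1) e])
  show ?thesis
    unfolding norm_o_tendsto_def o_tendsto_def
  \<comment> \<open>The dominating set consists of the multiples of one regulator, so the
    convergence is even relatively uniform.\<close>
  proof (intro exI[of _ "(\<lambda>\<epsilon>. \<epsilon> *\<^sub>R ?d) ` {0<..}"] conjI ballI)
    show "(\<lambda>\<epsilon>. \<epsilon> *\<^sub>R ?d) ` {0<..} \<noteq> {}" by auto
    show "0 \<le> x" if "x \<in> (\<lambda>\<epsilon>. \<epsilon> *\<^sub>R ?d) ` {0<..}" for x using that d0 by (auto intro: scaleR_nonneg_nonneg)
    show "\<exists>x''\<in>(\<lambda>\<epsilon>. \<epsilon> *\<^sub>R ?d) ` {0<..}. x'' \<le> x \<and> x'' \<le> x'"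
      if xx: "x \<in> (\<lambda>\<epsilon>. \<epsilon> *\<^sub>R ?d) ` {0<..}" "x' \<in> (\<lambda>\<epsilon>. \<epsilon> *\<^sub>R ?d) ` {0<..}" for x x'
    proof -
      obtain r r' where r: "0 < r" "x = r *\<^sub>R ?d" "0 < r'" "x' = r' *\<^sub>R ?d" using xx by auto
      thus ?thesis using d0 by (intro bexI[of _ "min r r' *\<^sub>R ?d"]) (auto intro!: scaleR_right_mono)
    qed
    show "Inf ((\<lambda>\<epsilon>. \<epsilon> *\<^sub>R ?d) ` {0<..}) = 0"
    proof (rule Inf_eq_0I)
      fix h assume "\<And>x. x \<in> (\<lambda>\<epsilon>. \<epsilon> *\<^sub>R ?d) ` {0<..} \<Longrightarrow> h \<le> x"
      thus "h \<le> 0" by (intro archimedean_le_0[of h ?d]) auto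
    qed (use d0 in \<open>auto intro: scaleR_nonneg_nonneg\<close>)
    show "eventually (\<lambda>a. \<bar>nrm (y - pure_value act f a) - 0\<bar> \<le> x) F" if xx: "x \<in> (\<lambda>\<epsilon>. \<epsilon> *\<^sub>R ?d) ` {0<..}" for x
    proof -
      obtain \<epsilon> where eps: "0 < \<epsilon>" "x = \<epsilon> *\<^sub>R ?d" using xx by auto
      have "eventually (\<lambda>a. \<bar>0 - pure_state a \<phi>\<bar> \<le> \<epsilon> *\<^sub>R e') F"
        using e'(2) eps(1) by (simp add: norm_r_tendsto_def)
      with ep show ?thesis
      proof eventually_elim
        fix \<pi> :: "'s \<Rightarrow> 'e orth" assume p: "partition_of_unity UNIV \<pi>" and c: "\<bar>0 - pure_state \<pi> \<phi>\<bar> \<le> \<epsilon> *\<^sub>R e'"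
        have pb: "\<pi> s \<in> band_projections" for s using p by (auto simp: partition_of_unity_def)
        have "nrm (pure_value act f \<pi> - y) \<le> orth_apply (pure_state \<pi> \<phi>) e"
        proof (rule E.partition_le[OF p])
          fix s
          have "orth_apply (\<pi> s) (nrm (pure_value act f \<pi> - y)) = orth_apply (\<pi> s) (nrm (f s - y))"
            by (rule orth_apply_nrm_cong[OF pb pure_value[OF p f]])
          also have "\<dots> = orth_apply (\<pi> s * \<phi> s) e" by (simp add: times_orth.rep_eq phi(3) \<psi>_def)
          also have "\<dots> = orth_apply (\<pi> s) (orth_apply (pure_state \<pi> \<phi>) e)"
            unfolding pure_state_mult[OF p phi(1), symmetric] by (simp add: times_orth.rep_eq)
          finally show "E.le_on (\<pi> s) (nrm (pure_value act f \<pi> - y)) (orth_apply (pure_state \<pi> \<phi>) e)"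
            by (simp add: E.le_on_def)
        qed
        also have "\<dots> \<le> orth_apply (\<epsilon> *\<^sub>R e') e"
        proof -
          have "pure_state \<pi> \<phi> \<le> \<epsilon> *\<^sub>R e'" using c order_trans[OF abs_ge_self] by simp
          thus ?thesis using e by (simp only: orth_le_iff)
        qed
        also have "\<dots> = x" by (simp add: eps scaleR_orth.rep_eq)
        finally show "\<bar>nrm (y - pure_value act f \<pi>) - 0\<bar> \<le> x"
          using nrm_nonneg by (simp add: X.nrm_minus_commute)
      qed
    qed
  qed
qed

lemma norm_o_tendsto_unique:
  assumes "F \<noteq> bot" "norm_o_tendsto nrm g y F" "norm_o_tendsto nrm g z F"
  shows "y = z"
proof -
  obtain D where D: "D \<noteq> {}" "Inf D = 0" "\<And>d. d \<in> D \<Longrightarrow> eventually (\<lambda>a. \<bar>nrm (y - g a) - 0\<bar> \<le> d) F"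
    using assms(2) unfolding norm_o_tendsto_def o_tendsto_def by blast
  obtain D' where D': "D' \<noteq> {}" "Inf D' = 0" "\<And>d. d \<in> D' \<Longrightarrow> eventually (\<lambda>a. \<bar>nrm (z - g a) - 0\<bar> \<le> d) F"
    using assms(3) unfolding norm_o_tendsto_def o_tendsto_def by blast
  have le: "nrm (y - z) \<le> d + d'" if "d \<in> D" "d' \<in> D'" for d d'
  proof -
    have "eventually (\<lambda>a. \<bar>nrm (y - g a) - 0\<bar> \<le> d \<and> \<bar>nrm (z - g a) - 0\<bar> \<le> d') F"
      by (intro eventually_conj D D' that)
    then obtain a where a: "nrm (y - g a) \<le> d" "nrm (z - g a) \<le> d'"
      using eventually_happens'[OF assms(1)] nrm_nonneg by auto
    have "nrm (y - z) \<le> nrm (y - g a) + nrm (g a - z)" by (rule X.nrm_triangle3)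
    also have "\<dots> \<le> d + d'" using a by (intro add_mono) (simp_all add: X.nrm_minus_commute)
    finally show ?thesis .
  qed
  hence "nrm (y - z) - d \<le> d'" if "d \<in> D" "d' \<in> D'" for d d' using le[OF that] by (simp add: diff_le_eq add.commute)
  hence "nrm (y - z) - d \<le> Inf D'" if "d \<in> D" for d using that by (intro cInf_greatest D')
  hence "nrm (y - z) \<le> d" if "d \<in> D" for d using that D' by simp
  hence "nrm (y - z) \<le> Inf D" by (intro cInf_greatest D)
  hence "nrm (y - z) = 0" using D nrm_nonneg by (simp add: order_antisym)
  thus ?thesis using nrm_eq_0 by fastforce
qed

text \<open>Every net of pure states has the limit \<open>y\<close>, and a single one already
  determines it.\<close>

lemma state_value_eq:
  fixes G :: "('e orth \<times> 's::uniform_space set) set"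
  assumes comp: "compact (UNIV :: 's set)" and G: "bultra G"
    and f: "f \<in> cuo nrm" and y: "X.blim G f y"
  shows "state_value nrm act f (state_of G) = y"
proof -
  obtain F where F: "pure_net_tendsto F (state_of G)" using pure_net_ex[OF comp G] by blast
  hence nb: "F \<noteq> bot" by (simp add: pure_net_tendsto_def)
  show ?thesis
    unfolding state_value_def
  proof (rule the_equality)
    show "\<forall>F. pure_net_tendsto F (state_of G) \<longrightarrow> norm_o_tendsto nrm (pure_value act f) y F"
      using pure_value_tendsto[OF comp G f y] by blast
    show "z = y" if "\<forall>F. pure_net_tendsto F (state_of G) \<longrightarrow> norm_o_tendsto nrm (pure_value act f) z F" for z
      using norm_o_tendsto_unique[OF nb _ pure_value_tendsto[OF comp G f y F]] that F by blast
  qed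
qed

end

section \<open>Polynomials of orthomorphisms\<close>

lemma near_weaken: "near \<rho> \<alpha> t \<epsilon> \<Longrightarrow> \<epsilon> \<le> \<delta> \<Longrightarrow> \<rho> \<in> band_projections \<Longrightarrow> near \<rho> \<alpha> t \<delta>"
  unfolding near_def
  by (erule L.le_on_trans) (intro L.le_onI scaleR_right_mono orth_zero_le_one)

lemma near_le:
  assumes "near \<rho> \<alpha> t \<epsilon>" "\<rho> \<in> band_projections"
  shows "L.le_on \<rho> \<alpha> ((t + \<epsilon>) *\<^sub>R 1)" "L.le_on \<rho> ((t - \<epsilon>) *\<^sub>R 1) \<alpha>"
proof -
  have a: "L.le_on \<rho> (\<alpha> - t *\<^sub>R 1) (\<epsilon> *\<^sub>R 1)" "L.le_on \<rho> (- (\<alpha> - t *\<^sub>R 1)) (\<epsilon> *\<^sub>R 1)"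
    using assms(1) unfolding near_def L.le_on_abs_iff[OF assms(2)] by simp_all
  show "L.le_on \<rho> \<alpha> ((t + \<epsilon>) *\<^sub>R 1)" using a(1) by (simp add: L.le_on_diff_le scaleR_add_left add.commute)
  have "- (\<alpha> - t *\<^sub>R 1) = t *\<^sub>R 1 - \<alpha>" by simp
  hence "L.le_on \<rho> (t *\<^sub>R 1) (\<epsilon> *\<^sub>R 1 + \<alpha>)" using a(2) by (simp only: L.le_on_diff_le)
  hence "L.le_on \<rho> (t *\<^sub>R 1 - \<epsilon> *\<^sub>R 1) \<alpha>" by (simp only: L.le_on_diff_le add.commute)
  thus "L.le_on \<rho> ((t - \<epsilon>) *\<^sub>R 1) \<alpha>" by (simp add: scaleR_diff_left)
qed

lemma le_on_one_real:
  assumes "L.le_on \<rho> (a *\<^sub>R 1) (c *\<^sub>R 1)" "\<rho> \<in> band_projections" "\<rho> \<noteq> 0"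
  shows "a \<le> c"
  using L.le_on_real[OF orth_zero_le_one full_one assms(2,3,1)] .

lemma near_const: "near \<rho> (c *\<^sub>R 1) c 0"
  by (simp add: near_def L.le_on_refl)

text \<open>\<open>q\<close> plays the role of \<open>p\<close> on orthomorphisms. It is
  characterised by what the induction over \<open>p\<close> can carry: closure of \<open>A\<close>,
  and a local comparison with \<open>p\<close> at the approximate value, uniform for bounded
  arguments. Boundedness of \<open>p\<close> is included for the error term of products.\<close>

lemma polynomial_calculus:
  fixes p :: "real \<Rightarrow> real" and A :: "('s \<Rightarrow> 'e::dedekind_vector_lattice orth) set"
  assumes p: "real_polynomial_function p"
    and const: "\<And>c. (\<lambda>s. c *\<^sub>R 1) \<in> A"
    and add: "\<And>\<phi> \<psi>. \<phi> \<in> A \<Longrightarrow> \<psi> \<in> A \<Longrightarrow> (\<lambda>s. \<phi> s + \<psi> s) \<in> A"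
    and mult: "\<And>\<phi> \<psi>. \<phi> \<in> A \<Longrightarrow> \<psi> \<in> A \<Longrightarrow> (\<lambda>s. \<phi> s * \<psi> s) \<in> A"
  shows "\<exists>q. (\<forall>\<phi>\<in>A. (\<lambda>s. q (\<phi> s)) \<in> A) \<and>
    (\<forall>N \<epsilon>. 0 < \<epsilon> \<longrightarrow> (\<exists>\<delta>>0. \<forall>\<rho>\<in>band_projections. \<forall>\<alpha> t. \<bar>t\<bar> \<le> N \<longrightarrow> near \<rho> \<alpha> t \<delta> \<longrightarrow> near \<rho> (q \<alpha>) (p t) \<epsilon>)) \<and>
    (\<forall>N. \<exists>B\<ge>0. \<forall>t. \<bar>t\<bar> \<le> N \<longrightarrow> \<bar>p t\<bar> \<le> B)"
  using p
proof (induction p rule: real_polynomial_function.induct)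
  case (linear f)
  then obtain c where c: "f = (\<lambda>x. x * c)" using real_bounded_linear by blast
  show ?case
  proof (intro exI[of _ "\<lambda>\<alpha>. c *\<^sub>R \<alpha>"] conjI allI impI ballI)
    show "(\<lambda>s. c *\<^sub>R \<phi> s) \<in> A" if "\<phi> \<in> A" for \<phi>
      using mult[OF const[of c] that] by (simp add: orth_scaleR_mult)
    show "\<exists>B\<ge>0. \<forall>t. \<bar>t\<bar> \<le> N \<longrightarrow> \<bar>f t\<bar> \<le> B" for N
      by (rule exI[of _ "\<bar>N\<bar> * \<bar>c\<bar>"]) (auto simp: c abs_mult intro!: mult_right_mono)
    fix N \<epsilon> :: real assume eps: "0 < \<epsilon>"
    define \<delta> where "\<delta> = \<epsilon> / (\<bar>c\<bar> + 1)"
    have d: "0 < \<delta>" "\<bar>c\<bar> * \<delta> \<le> \<epsilon>" using eps by (auto simp: \<delta>_def field_simps intro: add_pos_nonneg)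
    have "near \<rho> (c *\<^sub>R \<alpha>) (f t) \<epsilon>" if "\<rho> \<in> band_projections" "near \<rho> \<alpha> t \<delta>" for \<rho> t and \<alpha> :: "'e orth"
      using near_weaken[OF near_scaleR[OF that(2), of c] d(2) that(1)] by (simp add: c mult.commute)
    thus "\<exists>\<delta>>0. \<forall>\<rho>\<in>band_projections. \<forall>\<alpha> :: 'e orth. \<forall>t. \<bar>t\<bar> \<le> N \<longrightarrow> near \<rho> \<alpha> t \<delta> \<longrightarrow> near \<rho> (c *\<^sub>R \<alpha>) (f t) \<epsilon>"
      using d(1) by blast
  qed
next
  case (const c)
  show ?case
  proof (intro exI[of _ "\<lambda>\<alpha>. c *\<^sub>R 1"] conjI allI impI ballI)
    show "(\<lambda>s. c *\<^sub>R 1) \<in> A" by (rule assms(2))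
    show "\<exists>B\<ge>0. \<forall>t. \<bar>t\<bar> \<le> N \<longrightarrow> \<bar>c\<bar> \<le> B" for N :: real by (rule exI[of _ "\<bar>c\<bar>"]) simp
    fix N \<epsilon> :: real assume eps: "0 < \<epsilon>"
    have "near \<rho> (c *\<^sub>R 1 :: 'e orth) c \<epsilon>" if "\<rho> \<in> band_projections" for \<rho>
      using near_weaken[OF near_const _ that] eps by simp
    thus "\<exists>\<delta>>0. \<forall>\<rho>\<in>band_projections. \<forall>\<alpha> :: 'e orth. \<forall>t. \<bar>t\<bar> \<le> N \<longrightarrow> near \<rho> \<alpha> t \<delta> \<longrightarrow> near \<rho> (c *\<^sub>R 1 :: 'e orth) c \<epsilon>"
      by (intro exI[of _ 1]) simp
  qed
next
  case (add f g)
  obtain q where q: "\<forall>\<phi>\<in>A. (\<lambda>s. q (\<phi> s)) \<in> A"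
    "\<forall>N \<epsilon>. 0 < \<epsilon> \<longrightarrow> (\<exists>\<delta>>0. \<forall>\<rho>\<in>band_projections. \<forall>\<alpha> t. \<bar>t\<bar> \<le> N \<longrightarrow> near \<rho> \<alpha> t \<delta> \<longrightarrow> near \<rho> (q \<alpha>) (f t) \<epsilon>)"
    "\<forall>N. \<exists>B\<ge>0. \<forall>t. \<bar>t\<bar> \<le> N \<longrightarrow> \<bar>f t\<bar> \<le> B" using add.IH(1) by (elim exE conjE)
  obtain q' where q': "\<forall>\<phi>\<in>A. (\<lambda>s. q' (\<phi> s)) \<in> A"
    "\<forall>N \<epsilon>. 0 < \<epsilon> \<longrightarrow> (\<exists>\<delta>>0. \<forall>\<rho>\<in>band_projections. \<forall>\<alpha> t. \<bar>t\<bar> \<le> N \<longrightarrow> near \<rho> \<alpha> t \<delta> \<longrightarrow> near \<rho> (q' \<alpha>) (g t) \<epsilon>)"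
    "\<forall>N. \<exists>B\<ge>0. \<forall>t. \<bar>t\<bar> \<le> N \<longrightarrow> \<bar>g t\<bar> \<le> B" using add.IH(2) by (elim exE conjE)
  show ?case
  proof (intro exI[of _ "\<lambda>\<alpha>. q \<alpha> + q' \<alpha>"] conjI allI impI ballI)
    show "(\<lambda>s. q (\<phi> s) + q' (\<phi> s)) \<in> A" if "\<phi> \<in> A" for \<phi> using assms(3) q(1) q'(1) that by simp
    fix N :: real
    obtain B B' where "0 \<le> B" "\<forall>t. \<bar>t\<bar> \<le> N \<longrightarrow> \<bar>f t\<bar> \<le> B" "0 \<le> B'" "\<forall>t. \<bar>t\<bar> \<le> N \<longrightarrow> \<bar>g t\<bar> \<le> B'" using q(3) q'(3) by metis
    thus "\<exists>B\<ge>0. \<forall>t. \<bar>t\<bar> \<le> N \<longrightarrow> \<bar>f t + g t\<bar> \<le> B"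
      by (intro exI[of _ "B + B'"]) (auto intro: order_trans[OF abs_triangle_ineq] add_mono)
    fix \<epsilon> :: real assume eps: "0 < \<epsilon>"
    obtain \<delta> where d: "0 < \<delta>" "\<forall>\<rho>\<in>band_projections. \<forall>\<alpha> t. \<bar>t\<bar> \<le> N \<longrightarrow> near \<rho> \<alpha> t \<delta> \<longrightarrow> near \<rho> (q \<alpha>) (f t) (\<epsilon> / 2)"
      using q(2)[rule_format, of "\<epsilon> / 2" N] eps by auto
    obtain \<delta>' where d': "0 < \<delta>'" "\<forall>\<rho>\<in>band_projections. \<forall>\<alpha> t. \<bar>t\<bar> \<le> N \<longrightarrow> near \<rho> \<alpha> t \<delta>' \<longrightarrow> near \<rho> (q' \<alpha>) (g t) (\<epsilon> / 2)"
      using q'(2)[rule_format, of "\<epsilon> / 2" N] eps by auto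
    have "near \<rho> (q \<alpha> + q' \<alpha>) (f t + g t) \<epsilon>" if r: "\<rho> \<in> band_projections" "\<bar>t\<bar> \<le> N" "near \<rho> \<alpha> t (min \<delta> \<delta>')" for \<rho> \<alpha> t
    proof -
      have "near \<rho> (q \<alpha>) (f t) (\<epsilon> / 2)" using d(2) r near_weaken[OF r(3) _ r(1), of \<delta>] by simp
      moreover have "near \<rho> (q' \<alpha>) (g t) (\<epsilon> / 2)" using d'(2) r near_weaken[OF r(3) _ r(1), of \<delta>'] by simp
      ultimately show ?thesis using near_add[of \<rho> "q \<alpha>" "f t" "\<epsilon> / 2" "q' \<alpha>" "g t" "\<epsilon> / 2"] r(1) by simp
    qed
    thus "\<exists>\<delta>>0. \<forall>\<rho>\<in>band_projections. \<forall>\<alpha> t. \<bar>t\<bar> \<le> N \<longrightarrow> near \<rho> \<alpha> t \<delta> \<longrightarrow> near \<rho> (q \<alpha> + q' \<alpha>) (f t + g t) \<epsilon>"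
      using d(1) d'(1) by (intro exI[of _ "min \<delta> \<delta>'"]) simp
  qed
next
  case (mult f g)
  obtain q where q: "\<forall>\<phi>\<in>A. (\<lambda>s. q (\<phi> s)) \<in> A"
    "\<forall>N \<epsilon>. 0 < \<epsilon> \<longrightarrow> (\<exists>\<delta>>0. \<forall>\<rho>\<in>band_projections. \<forall>\<alpha> t. \<bar>t\<bar> \<le> N \<longrightarrow> near \<rho> \<alpha> t \<delta> \<longrightarrow> near \<rho> (q \<alpha>) (f t) \<epsilon>)"
    "\<forall>N. \<exists>B\<ge>0. \<forall>t. \<bar>t\<bar> \<le> N \<longrightarrow> \<bar>f t\<bar> \<le> B" using mult.IH(1) by (elim exE conjE)
  obtain q' where q': "\<forall>\<phi>\<in>A. (\<lambda>s. q' (\<phi> s)) \<in> A"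
    "\<forall>N \<epsilon>. 0 < \<epsilon> \<longrightarrow> (\<exists>\<delta>>0. \<forall>\<rho>\<in>band_projections. \<forall>\<alpha> t. \<bar>t\<bar> \<le> N \<longrightarrow> near \<rho> \<alpha> t \<delta> \<longrightarrow> near \<rho> (q' \<alpha>) (g t) \<epsilon>)"
    "\<forall>N. \<exists>B\<ge>0. \<forall>t. \<bar>t\<bar> \<le> N \<longrightarrow> \<bar>g t\<bar> \<le> B" using mult.IH(2) by (elim exE conjE)
  show ?case
  proof (intro exI[of _ "\<lambda>\<alpha>. q \<alpha> * q' \<alpha>"] conjI allI impI ballI)
    show "(\<lambda>s. q (\<phi> s) * q' (\<phi> s)) \<in> A" if "\<phi> \<in> A" for \<phi> using assms(4) q(1) q'(1) that by simp
    fix N :: real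
    obtain B B' where B: "0 \<le> B" "\<forall>t. \<bar>t\<bar> \<le> N \<longrightarrow> \<bar>f t\<bar> \<le> B" "0 \<le> B'" "\<forall>t. \<bar>t\<bar> \<le> N \<longrightarrow> \<bar>g t\<bar> \<le> B'" using q(3) q'(3) by metis
    thus "\<exists>B\<ge>0. \<forall>t. \<bar>t\<bar> \<le> N \<longrightarrow> \<bar>f t * g t\<bar> \<le> B"
      by (intro exI[of _ "B * B'"]) (auto simp: abs_mult intro!: mult_mono)
    fix \<epsilon> :: real assume eps: "0 < \<epsilon>"
    \<comment> \<open>Chosen so that the error of \<open>near_mult\<close>, at most
      \<open>\<epsilon>1 (B' + 1) + (B + 1) \<epsilon>2\<close>, does not exceed
      \<open>\<epsilon>\<close>; the cap 1 on \<open>\<epsilon>2\<close> accounts for the 1 added to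
      \<open>B'\<close>.\<close>
    define \<epsilon>1 where "\<epsilon>1 = \<epsilon> / (2 * (B' + 1))"
    define \<epsilon>2 where "\<epsilon>2 = min 1 (\<epsilon> / (2 * (B + 1)))"
    have e1: "0 < \<epsilon>1" "\<epsilon>1 * (B' + 1) = \<epsilon> / 2" using eps B(3) by (auto simp: \<epsilon>1_def field_simps add_pos_nonneg)
    have e2: "0 < \<epsilon>2" "\<epsilon>2 \<le> 1" using eps B(1) by (auto simp: \<epsilon>2_def)
    have "(B + 1) * \<epsilon>2 \<le> (B + 1) * (\<epsilon> / (2 * (B + 1)))" using B(1) by (intro mult_left_mono) (auto simp: \<epsilon>2_def)
    also have "\<dots> = \<epsilon> / 2" using B(1) by (simp add: field_simps)
    finally have e3: "(B + 1) * \<epsilon>2 \<le> \<epsilon> / 2" .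
    obtain \<delta> where d: "0 < \<delta>" "\<forall>\<rho>\<in>band_projections. \<forall>\<alpha> t. \<bar>t\<bar> \<le> N \<longrightarrow> near \<rho> \<alpha> t \<delta> \<longrightarrow> near \<rho> (q \<alpha>) (f t) \<epsilon>1"
      using q(2)[rule_format, of "\<epsilon>1" N] e1 by auto
    obtain \<delta>' where d': "0 < \<delta>'" "\<forall>\<rho>\<in>band_projections. \<forall>\<alpha> t. \<bar>t\<bar> \<le> N \<longrightarrow> near \<rho> \<alpha> t \<delta>' \<longrightarrow> near \<rho> (q' \<alpha>) (g t) \<epsilon>2"
      using q'(2)[rule_format, of "\<epsilon>2" N] e2 by auto
    have "near \<rho> (q \<alpha> * q' \<alpha>) (f t * g t) \<epsilon>" if r: "\<rho> \<in> band_projections" "\<bar>t\<bar> \<le> N" "near \<rho> \<alpha> t (min \<delta> \<delta>')" for \<rho> \<alpha> t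
    proof -
      have 1: "near \<rho> (q \<alpha>) (f t) \<epsilon>1" using d(2) r near_weaken[OF r(3) _ r(1), of \<delta>] by simp
      have 2: "near \<rho> (q' \<alpha>) (g t) \<epsilon>2" using d'(2) r near_weaken[OF r(3) _ r(1), of \<delta>'] by simp
      have "\<epsilon>1 * (\<bar>g t\<bar> + \<epsilon>2) + \<bar>f t\<bar> * \<epsilon>2 \<le> \<epsilon>1 * (B' + 1) + (B + 1) * \<epsilon>2"
      proof (rule add_mono)
        show "\<epsilon>1 * (\<bar>g t\<bar> + \<epsilon>2) \<le> \<epsilon>1 * (B' + 1)" using B(4) r(2) e1 e2 by (intro mult_left_mono add_mono) auto
        have "\<bar>f t\<bar> \<le> B + 1" using B(2) r(2) by (meson add_increasing2 zero_le_one)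
        thus "\<bar>f t\<bar> * \<epsilon>2 \<le> (B + 1) * \<epsilon>2" using e2 by (intro mult_right_mono) auto
      qed
      also have "\<dots> \<le> \<epsilon>" using e1(2) e3 by linarith
      finally show ?thesis
        using near_weaken[OF near_mult[OF 1 2 r(1)] _ r(1)] e1(1) e2(1) by simp
    qed
    thus "\<exists>\<delta>>0. \<forall>\<rho>\<in>band_projections. \<forall>\<alpha> t. \<bar>t\<bar> \<le> N \<longrightarrow> near \<rho> \<alpha> t \<delta> \<longrightarrow> near \<rho> (q \<alpha> * q' \<alpha>) (f t * g t) \<epsilon>"
      using d(1) d'(1) by (intro exI[of _ "min \<delta> \<delta>'"]) simp
  qed
qed

text \<open>One real number per set of a finite cover suffices. No continuity of \<open>r\<close> is
  claimed; it serves to define level sets of \<open>\<phi>\<close> on a part by real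
  inequalities.\<close>

lemma step_approx:
  fixes \<phi> :: "'s::uniform_space \<Rightarrow> 'e::dedekind_vector_lattice orth"
  assumes comp: "compact (UNIV :: 's set)" and phi: "\<phi> \<in> cuo_orth" and p: "\<pi> \<in> band_projections" and eps: "0 < \<epsilon>"
  shows "densely \<pi> (\<lambda>\<rho>. \<exists>r. \<forall>s. near \<rho> (\<phi> s) (r s) \<epsilon>)"
proof -
  have e2: "0 < \<epsilon> / 2" using eps by simp
  show ?thesis
  proof (rule densely_densely[OF L.cuo_cover[OF comp phi orth_zero_le_one full_one p e2]])
    fix \<rho> :: "'e orth" assume r: "\<rho> \<in> band_projections"
      and "\<exists>C. finite C \<and> \<Union>C = UNIV \<and> (\<forall>A\<in>C. L.small_on \<rho> \<phi> ((\<epsilon> / 2) *\<^sub>R 1) (A \<times> A))"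
    then obtain C where C: "finite C" "\<Union>C = (UNIV :: 's set)" "\<And>A. A \<in> C \<Longrightarrow> L.small_on \<rho> \<phi> ((\<epsilon> / 2) *\<^sub>R 1) (A \<times> A)" by blast
    \<comment> \<open>For the empty set this is an arbitrary point; only members of the cover that
      contain some \<open>s\<close> matter below.\<close>
    define c where "c A = (SOME s. s \<in> A)" for A :: "'s set"
    have "densely 1 (\<lambda>\<rho>. \<forall>A\<in>C. \<exists>t. near \<rho> (\<phi> (c A)) t (\<epsilon> / 2))"
      using C(1) e2 by (intro densely_ball near_densely) (auto intro: near_down)
    hence "densely \<rho> (\<lambda>\<rho>. \<forall>A\<in>C. \<exists>t. near \<rho> (\<phi> (c A)) t (\<epsilon> / 2))" using bp_le_one[OF r] by (rule densely_subset)
    thus "densely \<rho> (\<lambda>\<rho>. \<exists>r. \<forall>s. near \<rho> (\<phi> s) (r s) \<epsilon>)"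
    proof (rule densely_mono)
      fix \<kappa> :: "'e orth" assume k: "\<kappa> \<in> band_projections" "\<kappa> \<le> \<rho>" and ex: "\<forall>A\<in>C. \<exists>t. near \<kappa> (\<phi> (c A)) t (\<epsilon> / 2)"
      from bchoice[OF ex] obtain t where "\<forall>A\<in>C. near \<kappa> (\<phi> (c A)) (t A) (\<epsilon> / 2)" by (elim exE)
      hence t: "near \<kappa> (\<phi> (c A)) (t A) (\<epsilon> / 2)" if "A \<in> C" for A using that by blast
      have "\<exists>A. A \<in> C \<and> s \<in> A" for s
      proof -
        have "s \<in> \<Union>C" using C(2) by simp
        thus ?thesis by (elim UnionE) (intro exI conjI)
      qed
      hence "\<forall>s. \<exists>A. A \<in> C \<and> s \<in> A" by (intro allI)
      from choice[OF this] obtain a where "\<forall>s. a s \<in> C \<and> s \<in> a s" by (elim exE)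
      hence a: "a s \<in> C" "s \<in> a s" for s by simp_all
      have "near \<kappa> (\<phi> s) (t (a s)) \<epsilon>" for s
      proof -
        have "c (a s) \<in> a s" unfolding c_def using a(2) by (rule someI)
        hence "L.le_on \<rho> \<bar>\<phi> s - \<phi> (c (a s))\<bar> ((\<epsilon> / 2) *\<^sub>R 1)"
          using C(3)[OF a(1)[of s]] a(2)[of s] by (auto simp: L.small_on_def)
        hence 1: "L.le_on \<kappa> \<bar>\<phi> s - \<phi> (c (a s))\<bar> ((\<epsilon> / 2) *\<^sub>R 1)" by (rule L.le_on_down[OF _ k(1) r k(2)])
        have "L.le_on \<kappa> \<bar>\<phi> s - t (a s) *\<^sub>R 1\<bar> (\<bar>\<phi> s - \<phi> (c (a s))\<bar> + \<bar>\<phi> (c (a s)) - t (a s) *\<^sub>R 1\<bar>)"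
          by (rule L.le_onI[OF L.nrm_triangle3 k(1)])
        hence "L.le_on \<kappa> \<bar>\<phi> s - t (a s) *\<^sub>R 1\<bar> ((\<epsilon> / 2) *\<^sub>R 1 + (\<epsilon> / 2) *\<^sub>R 1)"
          by (rule L.le_on_trans) (rule L.le_on_add[OF 1 t[OF a(1), unfolded near_def]])
        thus ?thesis by (simp add: near_def scaleR_add_left[symmetric])
      qed
      thus "\<exists>r. \<forall>s. near \<kappa> (\<phi> s) (r s) \<epsilon>" by (intro exI[of _ "\<lambda>s. t (a s)"]) blast
    qed
  qed
qed

section \<open>The distance to the module\<close>

text \<open>For \<open>a < b\<close> it is 1 up to \<open>a\<close>, 0 from \<open>b\<close> on and
  linear between: the weight with which two approximations are blended, before its replacement by a
  polynomial.\<close>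

definition ramp :: "real \<Rightarrow> real \<Rightarrow> real \<Rightarrow> real"
  where "ramp a b t = max 0 (min 1 ((b - t) / (b - a)))"

lemma ramp: "0 \<le> ramp a b t" "ramp a b t \<le> 1" "a < b \<Longrightarrow> t \<le> a \<Longrightarrow> ramp a b t = 1" "a < b \<Longrightarrow> b \<le> t \<Longrightarrow> ramp a b t = 0"
  by (auto simp: ramp_def field_simps min_def max_def)

lemma ramp_continuous: "a < b \<Longrightarrow> continuous_on S (ramp a b)"
  unfolding ramp_def by (intro continuous_intros) simp

text \<open>Only the pairs that the conditions force. It is the starting point for the maximal
  distant filter.\<close>

lemma bfilter_least:
  "bfilter {(\<pi>, B :: 's set). \<pi> \<in> (band_projections :: 'e::dedekind_vector_lattice orth set) \<and> (\<pi> = 0 \<or> B = UNIV)}"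
  (is "bfilter ?R")
  unfolding bfilter_def
proof (intro conjI allI impI)
  show "(0, B) \<in> ?R" "(1, UNIV) \<in> ?R" for B by simp_all
  show "\<pi> \<in> band_projections" if "(\<pi>, B) \<in> ?R" for \<pi> B using that by simp
  show "(\<pi>, B \<inter> C) \<in> ?R" if "(\<pi>, B) \<in> ?R" "(\<pi>, C) \<in> ?R" for \<pi> B C using that by auto
  show "\<pi> = 0" if "(\<pi>, {}) \<in> ?R" for \<pi> using that by simp
  fix \<pi> \<rho> :: "'e orth" and B C :: "'s set"
  assume a: "(\<pi>, B) \<in> ?R" "\<rho> \<in> band_projections" "\<rho> \<le> \<pi>" "B \<subseteq> C"
  show "(\<rho>, C) \<in> ?R"
  proof (cases "\<pi> = 0")
    case True
    hence "\<rho> = 0" using a(3) bp_nonneg[OF a(2)] by (simp add: order_antisym)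
    thus ?thesis by simp
  next
    case False
    hence "C = UNIV" using a(1,4) by (simp add: top.extremum_unique)
    thus ?thesis using a(2) by simp
  qed
qed

locale approximation = bk_action scale nrm act
  for scale :: "'k::real_normed_field \<Rightarrow> 'x::ab_group_add \<Rightarrow> 'x"
    and nrm :: "'x \<Rightarrow> 'e::dedekind_vector_lattice"
    and act :: "'e orth \<Rightarrow> 'x \<Rightarrow> 'x" +
  fixes W :: "('s::uniform_space \<Rightarrow> 'x) set" and A :: "('s \<Rightarrow> 'e orth) set"
  assumes comp: "compact (UNIV :: 's set)"
    and W_sub: "W \<subseteq> cuo nrm"
    and W_0: "(\<lambda>s. 0) \<in> W"
    and W_add: "g \<in> W \<Longrightarrow> h \<in> W \<Longrightarrow> (\<lambda>s. g s + h s) \<in> W"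
    and W_scale: "g \<in> W \<Longrightarrow> (\<lambda>s. scale c (g s)) \<in> W"
    and A_def: "A = {\<phi> \<in> cuo_orth. \<forall>g\<in>W. (\<lambda>s. act (\<phi> s) (g s)) \<in> W}"
    and separates: "separates_states A"
    and approx: "\<sigma> \<in> extreme_states \<Longrightarrow> approximates nrm {state_value nrm act g \<sigma> | g. g \<in> W} x"
begin

lemma A_cuo: "\<phi> \<in> A \<Longrightarrow> \<phi> \<in> cuo_orth"
  by (simp add: A_def)

lemma A_act: "\<phi> \<in> A \<Longrightarrow> g \<in> W \<Longrightarrow> (\<lambda>s. act (\<phi> s) (g s)) \<in> W"
  by (simp add: A_def)

lemma A_const: "(\<lambda>s. c *\<^sub>R 1) \<in> A"
  unfolding A_def using L.cuo_const W_scale by (simp add: act_scaleR act_one)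

lemma A_add:
  assumes "\<phi> \<in> A" "\<psi> \<in> A" shows "(\<lambda>s. \<phi> s + \<psi> s) \<in> A"
proof -
  have "(\<lambda>s. \<phi> s + \<psi> s) \<in> cuo_orth" by (intro L.cuo_add A_cuo assms)
  moreover have "(\<lambda>s. act (\<phi> s + \<psi> s) (g s)) \<in> W" if "g \<in> W" for g
    unfolding act_plus by (intro W_add A_act assms that)
  ultimately show ?thesis by (simp add: A_def)
qed

lemma A_mult:
  assumes "\<phi> \<in> A" "\<psi> \<in> A" shows "(\<lambda>s. \<phi> s * \<psi> s) \<in> A"
proof -
  have "(\<lambda>s. \<phi> s * \<psi> s) \<in> cuo_orth" by (intro cuo_orth_mult A_cuo assms)
  moreover have "(\<lambda>s. act (\<phi> s * \<psi> s) (g s)) \<in> W" if "g \<in> W" for g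
    unfolding act_mult by (rule A_act[OF assms(1) A_act[OF assms(2) that]])
  ultimately show ?thesis by (simp add: A_def)
qed

text \<open>The weight \<open>1 - \<phi>\<close> is again in \<open>A\<close>, because
  \<open>A\<close> contains the constants and is closed under sums and products. This is how two
  approximations from \<open>W\<close> are blended.\<close>

lemma W_mix:
  assumes "\<phi> \<in> A" "g \<in> W" "h \<in> W"
  shows "(\<lambda>s. act (\<phi> s) (g s) + act (1 - \<phi> s) (h s)) \<in> W"
proof -
  have "(\<lambda>s. (- 1) *\<^sub>R \<phi> s) \<in> A" using A_mult[OF A_const[of "- 1"] assms(1)] by (simp add: orth_scaleR_mult)
  from A_add[OF A_const[of 1] this] have "(\<lambda>s. 1 - \<phi> s) \<in> A" by simp
  from W_add[OF A_act[OF assms(1,2)] A_act[OF this assms(3)]] show ?thesis .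
qed

text \<open>
  The filter \<open>R\<close> keeps the distance \<open>l\<close> between \<open>f\<close> and \<open>W\<close>: on no part that meets \<open>l\<close> does it
  contain a set on which some member of \<open>W\<close> comes uniformly closer to \<open>f\<close> than \<open>l\<close>.
\<close>

definition distant :: "('s \<Rightarrow> 'x) \<Rightarrow> 'e \<Rightarrow> ('e orth \<times> 's set) set \<Rightarrow> bool"
  where "distant f l R \<longleftrightarrow> bfilter R \<and> (\<forall>\<rho> B. \<forall>g\<in>W. \<forall>r<1. (\<rho>, B) \<in> R \<longrightarrow>
    (\<forall>s\<in>B. E.le_on \<rho> (nrm (f s - g s)) (r *\<^sub>R l)) \<longrightarrow> orth_apply \<rho> l = 0)"

lemma distantD:
  "distant f l R \<Longrightarrow> g \<in> W \<Longrightarrow> r < 1 \<Longrightarrow> (\<rho>, B) \<in> R \<Longrightarrow>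
    (\<And>s. s \<in> B \<Longrightarrow> E.le_on \<rho> (nrm (f s - g s)) (r *\<^sub>R l)) \<Longrightarrow> orth_apply \<rho> l = 0"
  unfolding distant_def by simp

text \<open>For the least filter, a violation would be an estimate on all of \<open>S\<close>,
  forcing \<open>l \<le> r l\<close> on a part with \<open>r < 1\<close>. The union of a chain stays
  distant because each violation involves one pair only.\<close>

lemma maximal_distant:
  assumes f: "f \<in> cuo nrm" and l: "0 \<le> l" "\<And>g. g \<in> W \<Longrightarrow> l \<le> cuo_norm nrm (\<lambda>s. f s - g s)"
  shows "\<exists>R. distant f l R \<and> (\<forall>R'. distant f l R' \<longrightarrow> R \<subseteq> R' \<longrightarrow> R' = R)"
proof -
  let ?X = "{R. distant f l R}"
  have "\<exists>M\<in>?X. \<forall>X\<in>?X. M \<subseteq> X \<longrightarrow> X = M"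
  proof (rule subset_Zorn_nonempty)
    define R where "R = {(\<pi>, B :: 's set). \<pi> \<in> (band_projections :: 'e orth set) \<and> (\<pi> = 0 \<or> B = UNIV)}"
    have "bfilter R" unfolding R_def by (rule bfilter_least)
    moreover have "orth_apply \<rho> l = 0"
      if a: "(\<rho>, B) \<in> R" "g \<in> W" "r < 1" "\<forall>s\<in>B. E.le_on \<rho> (nrm (f s - g s)) (r *\<^sub>R l)" for \<rho> B g r
    proof (cases "\<rho> = 0")
      case True
      then show ?thesis by (simp add: E.P_zero)
    next
      case False
      hence p: "\<rho> \<in> band_projections" "B = UNIV" using a(1) by (auto simp: R_def)
      have fg: "(\<lambda>s. f s - g s) \<in> cuo nrm" using a(2) W_sub by (intro X.cuo_diff f) auto
      then obtain e where e: "\<And>s. nrm (f s - g s) \<le> e" using X.cuo_bounded by blast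
      have "E.le_on \<rho> l (cuo_norm nrm (\<lambda>s. f s - g s))" by (rule E.le_onI[OF l(2)[OF a(2)] p(1)])
      moreover have "E.le_on \<rho> (cuo_norm nrm (\<lambda>s. f s - g s)) (r *\<^sub>R l)"
        unfolding cuo_norm_def
      proof (rule E.le_on_Sup[OF p(1)])
        show "bdd_above (range (\<lambda>s. nrm (f s - g s)))" using e by (intro bdd_aboveI[of _ e]) auto
      qed (use a(4) p(2) in auto)
      ultimately have "E.le_on \<rho> l (r *\<^sub>R l)" by (rule E.le_on_trans)
      hence "(1 - r) *\<^sub>R orth_apply \<rho> l \<le> 0" by (simp add: E.le_on_def orth_simps algebra_simps)
      hence "(1 / (1 - r)) *\<^sub>R ((1 - r) *\<^sub>R orth_apply \<rho> l) \<le> (1 / (1 - r)) *\<^sub>R 0"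
        using a(3) by (intro scaleR_left_mono) auto
      hence "orth_apply \<rho> l \<le> 0" using a(3) by simp
      thus ?thesis using orth_apply_nonneg[OF bp_nonneg[OF p(1)] l(1)] by (rule order_antisym)
    qed
    ultimately have "distant f l R" unfolding distant_def by blast
    thus "?X \<noteq> {}" by blast
  next
    fix C assume C: "C \<noteq> {}" "subset.chain ?X C"
    hence "subset.chain {R. bfilter R} C" by (auto simp: subset.chain_def distant_def)
    hence "bfilter (\<Union>C)" using C(1) by (intro bfilter_chain)
    moreover have sub: "C \<subseteq> ?X" using C(2) by (simp add: subset.chain_def)
    hence "orth_apply \<rho> l = 0"
      if a: "(\<rho>, B) \<in> \<Union>C" "g \<in> W" "r < 1" "\<forall>s\<in>B. E.le_on \<rho> (nrm (f s - g s)) (r *\<^sub>R l)" for \<rho> B g r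
    proof -
      obtain R where R: "R \<in> C" "(\<rho>, B) \<in> R" using a(1) by (elim UnionE)
      have "distant f l R" using sub R(1) by auto
      thus ?thesis using distantD a R(2) by blast
    qed
    ultimately show "\<Union>C \<in> ?X" unfolding distant_def by blast
  qed
  then obtain M where M: "M \<in> ?X" "\<forall>X\<in>?X. M \<subseteq> X \<longrightarrow> X = M" by (elim bexE)
  have "\<forall>R'. distant f l R' \<longrightarrow> M \<subseteq> R' \<longrightarrow> R' = M" using M(2) by simp
  moreover have "distant f l M" using M(1) by simp
  ultimately show ?thesis by blast
qed

section \<open>A maximal filter that keeps the distance\<close>

context
  fixes f :: "'s \<Rightarrow> 'x" and l :: 'e and b :: "'e orth" and F :: "('e orth \<times> 's set) set"
  assumes f: "f \<in> cuo nrm" and l: "0 \<le> l"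
    and b: "b \<in> band_projections" "orth_apply b l = l" "E.full b l"
    and dist: "distant f l F" and max: "\<And>R. distant f l R \<Longrightarrow> F \<subseteq> R \<Longrightarrow> R = F"
begin

lemma F_bfilter: "bfilter F" using dist by (simp add: distant_def)

text \<open>By maximality the enlarged filter is no longer distant. The violation leaves no trace of
  \<open>l\<close> outside \<open>\<rho>0\<close>, where the pair belongs to \<open>F\<close>
  itself, so it has a nonzero trace on \<open>\<rho>0\<close>. In terms of \<open>F\<close> the
  result is an implication: on \<open>\<rho>\<close>, a point of \<open>B\<close> lies in
  \<open>C\<close>, where \<open>g\<close> is closer to \<open>f\<close> than
  \<open>l\<close>.\<close>

lemma extend:
  assumes r0: "\<rho>0 \<in> band_projections" "\<rho>0 \<le> b"
    and con: "\<And>\<kappa>. \<kappa> \<in> band_projections \<Longrightarrow> \<kappa> \<le> \<rho>0 \<Longrightarrow> (\<kappa>, - B) \<in> F \<Longrightarrow> \<kappa> = 0"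
    and new: "(\<rho>0, B) \<notin> F"
  obtains \<rho> g r C where "\<rho> \<in> band_projections" "\<rho> \<noteq> 0" "\<rho> \<le> \<rho>0" "g \<in> W" "r < 1" "(\<rho>, C \<union> - B) \<in> F"
    "\<And>s. s \<in> C \<Longrightarrow> E.le_on \<rho> (nrm (f s - g s)) (r *\<^sub>R l)"
proof -
  note ad = adjoin[OF F_bfilter r0(1) con]
  have "\<not> distant f l (adjoin F \<rho>0 B)"
    using max[of "adjoin F \<rho>0 B"] ad(2,3) new by auto
  then obtain \<rho> C g r where a: "g \<in> W" "r < 1" "(\<rho>, C) \<in> adjoin F \<rho>0 B"
    "\<forall>s\<in>C. E.le_on \<rho> (nrm (f s - g s)) (r *\<^sub>R l)" "orth_apply \<rho> l \<noteq> 0"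
    unfolding distant_def using ad(1) by blast
  have p: "\<rho> \<in> band_projections" "1 - \<rho>0 \<in> band_projections" and
    i: "(\<rho> * (1 - \<rho>0), C) \<in> F" "(\<rho> * \<rho>0, C \<union> - B) \<in> F"
    using a(3) r0(1) by (auto simp: adjoin_def)
  have "orth_apply (\<rho> * (1 - \<rho>0)) l = 0"
    using a(4) p by (intro distantD[OF dist a(1,2) i(1)] E.le_on_mult(1)) auto
  moreover have "orth_apply \<rho> l = orth_apply (\<rho> * \<rho>0) l + orth_apply (\<rho> * (1 - \<rho>0)) l"
    by (simp add: E.P_plus[symmetric] algebra_simps)
  ultimately have "orth_apply (\<rho> * \<rho>0) l \<noteq> 0" using a(5) by simp
  hence nz: "\<rho> * \<rho>0 \<noteq> 0" using E.P_zero by metis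
  show ?thesis
  proof (rule that[of "\<rho> * \<rho>0" g r C])
    show "\<rho> * \<rho>0 \<in> band_projections" "\<rho> * \<rho>0 \<le> \<rho>0" using p r0 bp_mult_le by auto
    show "E.le_on (\<rho> * \<rho>0) (nrm (f s - g s)) (r *\<^sub>R l)" if "s \<in> C" for s
      using a(4) that p r0 by (intro E.le_on_mult(1)) auto
  qed (fact nz a(1) a(2) i(2))+
qed

text \<open>The two level sets \<open>L\<close> and \<open>K\<close> of \<open>\<phi>\<close>
  overlap, so the weight need not jump: where it changes from 1 to 0 both approximations are good,
  and where only one is good almost all of the weight lies on it.\<close>

lemma not_separated:
  assumes G: "bultra G" "F \<subseteq> G" and H: "bultra H" "F \<subseteq> H" and phi: "\<phi> \<in> A"
  shows "L.le_on b (state_of H \<phi>) (state_of G \<phi>)"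
proof (rule ccontr)
  note GF = bultra_bfilter[OF G(1)] and HF = bultra_bfilter[OF H(1)]
  let ?g = "state_of G \<phi>" and ?h = "state_of H \<phi>"
  assume "\<not> L.le_on b ?h ?g"
  then obtain \<pi>0 \<delta> where p0: "\<pi>0 \<in> band_projections" "\<pi>0 \<noteq> 0" "\<pi>0 \<le> b" "0 < \<delta>" "L.le_on \<pi>0 (?g + \<delta> *\<^sub>R 1) ?h"
    using L.not_le_on[OF b(1), of ?h ?g 1] by metis
  \<comment> \<open>The limits \<open>?g\<close> and \<open>?h\<close> differ by at least
    \<open>32 d\<close> on \<open>\<pi>0\<close>. In steps of \<open>d\<close> above
    \<open>\<alpha>\<close>: \<open>?g\<close> is at most 4 and \<open>?h\<close> at least 28, the
    level sets overlap from 12 to 20, and the ramp falls from 14 to 18. These margins absorb the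
    later errors, which are at most 3 steps.\<close>
  define d where "d = \<delta> / 32"
  have d: "0 < d" "\<delta> = 32 * d" using p0(4) by (auto simp: d_def)
  have d4: "0 < 4 * d" "0 < 2 * d" using d by auto
  obtain \<pi>1 \<alpha> where p1: "\<pi>1 \<in> band_projections" "\<pi>1 \<noteq> 0" "\<pi>1 \<le> \<pi>0" "near \<pi>1 ?g \<alpha> (4 * d)"
    using densely_ex[OF near_densely[OF d4(1)] p0(1) bp_le_one[OF p0(1)] p0(2)] by blast
  obtain \<pi>2 r where p2: "\<pi>2 \<in> band_projections" "\<pi>2 \<noteq> 0" "\<pi>2 \<le> \<pi>1" "\<And>s. near \<pi>2 (\<phi> s) (r s) d"
    using densely_ex[OF step_approx[OF comp A_cuo[OF phi] p1(1) d(1)] p1(1) order_refl p1(2)] by blast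
  obtain m where m: "0 \<le> m" "\<And>s. \<bar>\<phi> s\<bar> \<le> m" using L.cuo_bounded[OF A_cuo[OF phi]] by blast
  obtain \<pi> n where p: "\<pi> \<in> band_projections" "\<pi> \<noteq> 0" "\<pi> \<le> \<pi>2" "L.le_on \<pi> \<bar>m\<bar> (real n *\<^sub>R 1)"
    using densely_ex[OF orth_bounded p2(1) bp_le_one[OF p2(1)] p2(2), of m] by blast
  have le: "\<pi> \<le> \<pi>1" "\<pi> \<le> \<pi>0" "\<pi> \<le> b" using p(3) p2(3) p1(3) p0(3) by (meson order_trans)+
  have near_phi: "near \<pi> (\<phi> s) (r s) d" for s by (rule near_down[OF p2(4) p(1) p2(1) p(3)])
  have phi_n: "L.le_on \<pi> \<bar>\<phi> s\<bar> (real n *\<^sub>R 1)" for s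
    using L.le_on_trans[OF L.le_onI[OF m(2) p(1)]] p(4) m(1) by simp
  have g_up: "L.le_on \<pi> ?g ((\<alpha> + 4 * d) *\<^sub>R 1)"
    by (rule near_le(1)[OF near_down[OF p1(4) p(1) p1(1) le(1)] p(1)])
  have h_low: "L.le_on \<pi> ((\<alpha> + 28 * d) *\<^sub>R 1) ?h"
  proof -
    have "L.le_on \<pi> ((\<alpha> - 4 * d) *\<^sub>R 1 + \<delta> *\<^sub>R 1) (?g + \<delta> *\<^sub>R 1)"
      by (intro L.le_on_add L.le_on_refl near_le(2)[OF near_down[OF p1(4) p(1) p1(1) le(1)] p(1)])
    hence "L.le_on \<pi> ((\<alpha> - 4 * d) *\<^sub>R 1 + \<delta> *\<^sub>R 1) ?h"
      by (rule L.le_on_trans[OF _ L.le_on_down[OF p0(5) p(1) p0(1) le(2)]])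
    thus ?thesis by (simp add: scaleR_add_left[symmetric] d(2) add.commute)
  qed
  define L where "L = {s. r s \<le> \<alpha> + 20 * d}"
  define K where "K = {s. \<alpha> + 12 * d \<le> r s}"
  have LK: "- L \<inter> - K = {}" using d(1) by (auto simp: L_def K_def)
  \<comment> \<open>In steps of \<open>d\<close> above \<open>\<alpha>\<close>, the value
    \<open>r s\<close> is at most 7 along \<open>G\<close> and, by the same computation below, at
    least 25 along \<open>H\<close>.\<close>
  have GK: "densely \<pi> (\<lambda>\<rho>. (\<rho>, - K) \<in> G)"
  proof (rule densely_mono[OF L.blim_regulator[OF GF blim_state_of[OF comp G(1) A_cuo[OF phi]] orth_zero_le_one full_one p(1) d4(2)]])
    fix \<rho> assume r: "\<rho> \<in> band_projections" "\<rho> \<noteq> 0" "\<rho> \<le> \<pi>" "L.close_on G \<phi> ?g ((2 * d) *\<^sub>R 1) \<rho>"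
    then obtain B where B: "(\<rho>, B) \<in> G" "\<And>s. s \<in> B \<Longrightarrow> L.le_on \<rho> \<bar>\<phi> s - ?g\<bar> ((2 * d) *\<^sub>R 1)"
      by (auto simp: L.close_on_def)
    have "B \<subseteq> - K"
    proof
      fix s assume s: "s \<in> B"
      have 1: "L.le_on \<rho> ((r s - d) *\<^sub>R 1) (\<phi> s)" by (rule near_le(2)[OF near_down[OF near_phi r(1) p(1) r(3)] r(1)])
      have "L.le_on \<rho> (\<phi> s - ?g) ((2 * d) *\<^sub>R 1)" using B(2)[OF s] r(1) by (simp add: L.le_on_abs_iff)
      hence 2: "L.le_on \<rho> (\<phi> s) ((2 * d) *\<^sub>R 1 + ?g)" by (simp only: L.le_on_diff_le)
      have 3: "L.le_on \<rho> ((2 * d) *\<^sub>R 1 + ?g) ((2 * d + (\<alpha> + 4 * d)) *\<^sub>R 1)"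
        unfolding scaleR_add_left[of "2 * d"] by (intro L.le_on_add L.le_on_refl L.le_on_down[OF g_up r(1) p(1) r(3)])
      have "r s - d \<le> 2 * d + (\<alpha> + 4 * d)"
        by (rule le_on_one_real[OF L.le_on_trans[OF L.le_on_trans[OF 1 2] 3] r(1,2)])
      thus "s \<in> - K" using d(1) by (simp add: K_def)
    qed
    thus "(\<rho>, - K) \<in> G" using bfilter_down[OF GF B(1) r(1) order_refl] by blast
  qed
  have HL: "densely \<pi> (\<lambda>\<rho>. (\<rho>, - L) \<in> H)"
  proof (rule densely_mono[OF L.blim_regulator[OF HF blim_state_of[OF comp H(1) A_cuo[OF phi]] orth_zero_le_one full_one p(1) d4(2)]])
    fix \<rho> assume r: "\<rho> \<in> band_projections" "\<rho> \<noteq> 0" "\<rho> \<le> \<pi>" "L.close_on H \<phi> ?h ((2 * d) *\<^sub>R 1) \<rho>"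
    then obtain B where B: "(\<rho>, B) \<in> H" "\<And>s. s \<in> B \<Longrightarrow> L.le_on \<rho> \<bar>\<phi> s - ?h\<bar> ((2 * d) *\<^sub>R 1)"
      by (auto simp: L.close_on_def)
    have "B \<subseteq> - L"
    proof
      fix s assume s: "s \<in> B"
      have 1: "L.le_on \<rho> (\<phi> s) ((r s + d) *\<^sub>R 1)" by (rule near_le(1)[OF near_down[OF near_phi r(1) p(1) r(3)] r(1)])
      have "L.le_on \<rho> (- (\<phi> s - ?h)) ((2 * d) *\<^sub>R 1)" using B(2)[OF s] unfolding L.le_on_abs_iff[OF r(1)] by simp
      hence "L.le_on \<rho> (?h - \<phi> s) ((2 * d) *\<^sub>R 1)" by (simp only: minus_diff_eq)
      hence 2: "L.le_on \<rho> ?h ((2 * d) *\<^sub>R 1 + \<phi> s)" by (simp only: L.le_on_diff_le)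
      have 3: "L.le_on \<rho> ((2 * d) *\<^sub>R 1 + \<phi> s) ((2 * d + (r s + d)) *\<^sub>R 1)"
        unfolding scaleR_add_left[of "2 * d"] by (intro L.le_on_add L.le_on_refl 1)
      have "\<alpha> + 28 * d \<le> 2 * d + (r s + d)"
        by (rule le_on_one_real[OF L.le_on_trans[OF L.le_on_down[OF h_low r(1) p(1) r(3)] L.le_on_trans[OF 2 3]] r(1,2)])
      thus "s \<in> - L" using d(1) by (simp add: L_def)
    qed
    thus "(\<rho>, - L) \<in> H" using bfilter_down[OF HF B(1) r(1) order_refl] by blast
  qed
  have clash: "\<kappa> = 0" if R: "bfilter R" "densely \<pi> (\<lambda>\<rho>. (\<rho>, B) \<in> R)" "(\<kappa>, C) \<in> R" "B \<inter> C = {}" "\<kappa> \<le> \<pi>" for \<kappa> B C R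
  proof (rule ccontr)
    assume k: "\<kappa> \<noteq> 0"
    have kb: "\<kappa> \<in> band_projections" by (rule bfilter_bp[OF R(1,3)])
    obtain \<rho> where r: "\<rho> \<in> band_projections" "\<rho> \<noteq> 0" "\<rho> \<le> \<kappa>" "(\<rho>, B) \<in> R" using densely_ex[OF R(2) kb R(5) k] by blast
    have "(\<rho>, B \<inter> C) \<in> R" by (rule bfilter_int2[OF R(1) r(4) R(3) r(1) order_refl r(3)])
    thus False using bfilter_empty[OF R(1)] R(4) r(2) by simp
  qed
  \<comment> \<open>\<open>L\<close> can be adjoined because \<open>G\<close> densely contains the
    complement of \<open>K\<close>, hence on no nonzero part that of \<open>L\<close>; it is new
    because \<open>H\<close> densely contains the complement of \<open>L\<close>. For
    \<open>K\<close> the two ultrafilters exchange their roles.\<close>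
  obtain \<rho>1 g1 r1 B1 where e1: "\<rho>1 \<in> band_projections" "\<rho>1 \<noteq> 0" "\<rho>1 \<le> \<pi>" "g1 \<in> W" "r1 < 1" "(\<rho>1, B1 \<union> - L) \<in> F"
    "\<And>s. s \<in> B1 \<Longrightarrow> E.le_on \<rho>1 (nrm (f s - g1 s)) (r1 *\<^sub>R l)"
  proof (rule extend[OF p(1) le(3), of L])
    show "\<kappa> = 0" if "\<kappa> \<le> \<pi>" "(\<kappa>, - L) \<in> F" for \<kappa>
      using clash[OF GF GK _ _ that(1), of "- L"] that(2) G(2) LK by (auto simp: Int_commute)
    show "(\<pi>, L) \<notin> F" using clash[OF HF HL _ _ order_refl, of L] H(2) p(2) by auto
  qed blast
  have rb: "\<rho>1 \<le> b" using e1(3) le(3) by (rule order_trans)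
  obtain \<rho>2 g2 r2 B2 where e2: "\<rho>2 \<in> band_projections" "\<rho>2 \<noteq> 0" "\<rho>2 \<le> \<rho>1" "g2 \<in> W" "r2 < 1" "(\<rho>2, B2 \<union> - K) \<in> F"
    "\<And>s. s \<in> B2 \<Longrightarrow> E.le_on \<rho>2 (nrm (f s - g2 s)) (r2 *\<^sub>R l)"
  proof (rule extend[OF e1(1) rb, of K])
    show "\<kappa> = 0" if "\<kappa> \<le> \<rho>1" "(\<kappa>, - K) \<in> F" for \<kappa>
      using clash[OF HF HL _ LK order_trans[OF that(1) e1(3)]] that(2) H(2) by auto
    show "(\<rho>1, K) \<notin> F" using clash[OF GF GK _ _ e1(3), of K] G(2) e1(2) by auto
  qed blast
  obtain a1 where a1: "\<And>s. nrm (f s - g1 s) \<le> a1" using X.cuo_bounded[OF X.cuo_diff[OF f, of g1]] e1(4) W_sub by blast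
  obtain a2 where a2: "\<And>s. nrm (f s - g2 s) \<le> a2" using X.cuo_bounded[OF X.cuo_diff[OF f, of g2]] e2(4) W_sub by blast
  have r2b: "\<rho>2 \<le> b" using e2(3) rb by (rule order_trans)
  \<comment> \<open>Each approximation is good only at some points; elsewhere a crude bound by a
    multiple of \<open>l\<close> is secured here, to be multiplied with the small error of the
    weight.\<close>
  obtain \<rho> k where rho: "\<rho> \<in> band_projections" "\<rho> \<noteq> 0" "\<rho> \<le> \<rho>2" "E.le_on \<rho> (sup a1 a2) (real k *\<^sub>R l)"
    using densely_ex[OF E.bounded_densely[OF l E.full_down[OF b(3) r2b] e2(1), of "sup a1 a2"] e2(1) order_refl e2(2)] by blast
  have rhole: "\<rho> \<le> \<rho>1" "\<rho> \<le> \<pi>" "\<rho> \<le> b" using rho(3) e2(3) e1(3) le(3) by (meson order_trans)+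
  define M where "M = real k + 1"
  \<comment> \<open>\<open>r1\<close> and \<open>r2\<close> may be negative; including 0 yields a
    nonnegative factor.\<close>
  define c where "c = max 0 (max r1 r2)"
  have c: "0 \<le> c" "c < 1" "r1 \<le> c" "r2 \<le> c" using e1(5) e2(5) by (auto simp: c_def)
  have M: "1 \<le> M" "c \<le> M" using c by (auto simp: M_def)
  have bound: "E.le_on \<rho> (nrm (f s - g1 s)) (M *\<^sub>R l)" "E.le_on \<rho> (nrm (f s - g2 s)) (M *\<^sub>R l)" for s
  proof -
    have "real k *\<^sub>R l \<le> M *\<^sub>R l" using l by (intro scaleR_right_mono) (auto simp: M_def)
    hence *: "E.le_on \<rho> (sup a1 a2) (M *\<^sub>R l)" using E.le_on_trans[OF rho(4) E.le_onI[OF _ rho(1)]] by blast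
    have "nrm (f s - g1 s) \<le> sup a1 a2" "nrm (f s - g2 s) \<le> sup a1 a2" by (intro le_supI1 le_supI2 a1 a2)+
    thus "E.le_on \<rho> (nrm (f s - g1 s)) (M *\<^sub>R l)" "E.le_on \<rho> (nrm (f s - g2 s)) (M *\<^sub>R l)"
      using E.le_on_trans[OF E.le_onI[OF _ rho(1)] *] by blast+
  qed
  have cl: "r' *\<^sub>R l \<le> c *\<^sub>R l" if "r' \<le> c" for r' using that l by (rule scaleR_right_mono)
  have near1: "E.le_on \<rho> (nrm (f s - g1 s)) (c *\<^sub>R l)" if "s \<in> B1" for s
    using E.le_on_trans[OF E.le_on_down[OF e1(7)[OF that] rho(1) e1(1) rhole(1)] E.le_onI[OF cl[OF c(3)] rho(1)]] .
  have near2: "E.le_on \<rho> (nrm (f s - g2 s)) (c *\<^sub>R l)" if "s \<in> B2" for s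
    using E.le_on_trans[OF E.le_on_down[OF e2(7)[OF that] rho(1) e2(1) rho(3)] E.le_onI[OF cl[OF c(4)] rho(1)]] .
  \<comment> \<open>With weights wrong by at most \<open>2 \<eta>\<close> each, the blended distance
    is at most \<open>c + 2 \<eta> (1 + M)\<close> times \<open>l\<close>. The choice of
    \<open>\<eta>\<close> makes this \<open>(1 + c) / 2\<close>, still below 1.\<close>
  define \<eta> where "\<eta> = (1 - c) / (4 * (M + 1))"
  have eta: "0 < \<eta>" "2 * \<eta> * (1 + M) = (1 - c) / 2" using c M by (auto simp: \<eta>_def field_simps)
  let ?a = "\<alpha> + 14 * d" and ?b = "\<alpha> + 18 * d"
  have ab: "?a < ?b" using d(1) by simp
  obtain p where poly: "real_polynomial_function p" "\<And>t. t \<in> {- real n..real n} \<Longrightarrow> \<bar>ramp ?a ?b t - p t\<bar> < \<eta>"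
    using Stone_Weierstrass_real_polynomial_function[OF compact_Icc ramp_continuous[OF ab] eta(1), of "- real n" "real n"] by blast
  have "\<exists>q. (\<forall>\<phi>\<in>A. (\<lambda>s. q (\<phi> s)) \<in> A) \<and>
    (\<forall>N \<epsilon>. 0 < \<epsilon> \<longrightarrow> (\<exists>\<delta>>0. \<forall>\<rho>\<in>band_projections. \<forall>\<alpha> t. \<bar>t\<bar> \<le> N \<longrightarrow> near \<rho> \<alpha> t \<delta> \<longrightarrow> near \<rho> (q \<alpha>) (p t) \<epsilon>)) \<and>
    (\<forall>N. \<exists>B\<ge>0. \<forall>t. \<bar>t\<bar> \<le> N \<longrightarrow> \<bar>p t\<bar> \<le> B)"
  proof (rule polynomial_calculus[OF poly(1)])
    show "(\<lambda>s. c *\<^sub>R 1) \<in> A" for c by (rule A_const)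
    show "(\<lambda>s. \<phi> s + \<psi> s) \<in> A" "(\<lambda>s. \<phi> s * \<psi> s) \<in> A" if "\<phi> \<in> A" "\<psi> \<in> A" for \<phi> \<psi>
      using that by (rule A_add, rule A_mult)
  qed
  then obtain q where q: "\<forall>\<phi>\<in>A. (\<lambda>s. q (\<phi> s)) \<in> A"
    "\<forall>N \<epsilon>. 0 < \<epsilon> \<longrightarrow> (\<exists>\<delta>>0. \<forall>\<rho>\<in>band_projections. \<forall>\<alpha> t. \<bar>t\<bar> \<le> N \<longrightarrow> near \<rho> \<alpha> t \<delta> \<longrightarrow> near \<rho> (q \<alpha>) (p t) \<epsilon>)"
    by (elim exE conjE)
  obtain \<epsilon>0 where \<epsilon>0: "0 < \<epsilon>0" "\<And>\<rho> \<alpha> t. \<rho> \<in> band_projections \<Longrightarrow> \<bar>t\<bar> \<le> real n \<Longrightarrow> near \<rho> \<alpha> t \<epsilon>0 \<Longrightarrow> near \<rho> (q \<alpha>) (p t) \<eta>"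
    using q(2)[rule_format, OF eta(1), of "real n"] by auto
  define g where "g s = act (q (\<phi> s)) (g1 s) + act (1 - q (\<phi> s)) (g2 s)" for s
  have gW: "g \<in> W" unfolding g_def using W_mix[OF q(1)[rule_format, OF phi] e1(4) e2(4)] .
  have "orth_apply \<rho> l = 0"
  \<comment> \<open>Each point of this set lies in \<open>B1\<close> or outside \<open>L\<close>,
    and in \<open>B2\<close> or outside \<open>K\<close>; as \<open>L\<close> and \<open>K\<close>
    cover \<open>S\<close>, at least one approximation is good there.\<close>
  proof (rule distantD[OF dist gW, of "(1 + c) / 2" \<rho> "(B1 \<union> - L) \<inter> (B2 \<union> - K)"])
    show "(1 + c) / 2 < 1" using c by simp
    show "(\<rho>, (B1 \<union> - L) \<inter> (B2 \<union> - K)) \<in> F"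
      by (rule bfilter_int2[OF F_bfilter e1(6) e2(6) rho(1) rhole(1) rho(3)])
    fix s assume s: "s \<in> (B1 \<union> - L) \<inter> (B2 \<union> - K)"
    define \<epsilon> where "\<epsilon> = min \<epsilon>0 d"
    have eps: "0 < \<epsilon>" "\<epsilon> \<le> \<epsilon>0" "\<epsilon> \<le> d" using \<epsilon>0(1) d(1) by (auto simp: \<epsilon>_def)
    show "E.le_on \<rho> (nrm (f s - g s)) (((1 + c) / 2) *\<^sub>R l)"
    proof (rule E.local_le[OF rho(1)])
      have "densely \<pi> (\<lambda>\<rho>. \<exists>t. \<bar>t\<bar> \<le> real n \<and> L.le_on \<rho> \<bar>\<phi> s - t *\<^sub>R 1\<bar> (\<epsilon> *\<^sub>R 1))"
        by (rule orth_approx_on[OF p(1) phi_n _ eps(1)]) simp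
      hence "densely \<rho> (\<lambda>\<rho>. \<exists>t. \<bar>t\<bar> \<le> real n \<and> near \<rho> (\<phi> s) t \<epsilon>)"
        unfolding near_def using rhole(2) by (rule densely_subset)
      thus "densely \<rho> (\<lambda>\<rho>. E.le_on \<rho> (nrm (f s - g s)) (((1 + c) / 2) *\<^sub>R l))"
      proof (rule densely_mono, elim exE conjE)
        fix \<kappa> t assume k: "\<kappa> \<in> band_projections" "\<kappa> \<noteq> 0" "\<kappa> \<le> \<rho>" and t: "\<bar>t\<bar> \<le> real n" "near \<kappa> (\<phi> s) t \<epsilon>"
        let ?q = "q (\<phi> s)" and ?r = "ramp ?a ?b t"
        have "near \<kappa> (\<phi> s) (r s) d" by (rule near_down[OF near_phi k(1) p(1) order_trans[OF k(3) rhole(2)]])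
        from near_unique[OF t(2) this k(1,2)] eps(3) have tr: "\<bar>t - r s\<bar> \<le> 2 * d" by linarith
        have nq: "near \<kappa> ?q (p t) \<eta>" using \<epsilon>0(2)[OF k(1) t(1) near_weaken[OF t(2) eps(2) k(1)]] .
        have pr: "\<bar>?r - p t\<bar> < \<eta>" using poly(2)[of t] t(1) by (simp add: abs_le_iff)
        have "near \<kappa> (1 - ?q) (1 - p t) \<eta>"
        proof -
          have "\<bar>(1 - ?q) - (1 - p t) *\<^sub>R 1\<bar> = \<bar>?q - p t *\<^sub>R 1\<bar>"
            by (subst abs_minus_commute) (simp add: algebra_simps)
          thus ?thesis using nq by (simp add: near_def)
        qed
        hence q2: "L.le_on \<kappa> \<bar>1 - ?q\<bar> ((\<bar>1 - p t\<bar> + \<eta>) *\<^sub>R 1)" using k(1) by (rule near_bound)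
        have q1: "L.le_on \<kappa> \<bar>?q\<bar> ((\<bar>p t\<bar> + \<eta>) *\<^sub>R 1)" using nq k(1) by (rule near_bound)
        have pt: "\<bar>p t\<bar> + \<eta> \<le> ?r + 2 * \<eta>" "\<bar>1 - p t\<bar> + \<eta> \<le> 1 - ?r + 2 * \<eta>"
          using pr ramp(1,2)[of ?a ?b t] by linarith+
        have bd: "E.le_on \<kappa> (nrm (act S z)) ((v * w) *\<^sub>R l)"
          if "L.le_on \<kappa> \<bar>S\<bar> (u *\<^sub>R 1)" "u \<le> v" "0 \<le> v" "E.le_on \<kappa> (nrm z) (w *\<^sub>R l)" for S z u v w
        proof -
          have "E.le_on \<kappa> (nrm (act S z)) (u *\<^sub>R nrm z)"
            using le_on_orth_apply[OF that(1) nrm_nonneg[of z]] by (simp add: nrm_act orth_simps)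
          moreover have "E.le_on \<kappa> (u *\<^sub>R nrm z) (v *\<^sub>R nrm z)"
            using that(2) by (intro E.le_onI k scaleR_right_mono nrm_nonneg)
          moreover have "E.le_on \<kappa> (v *\<^sub>R nrm z) (v *\<^sub>R (w *\<^sub>R l))" by (rule E.le_on_scaleR[OF that(3,4)])
          ultimately show ?thesis using E.le_on_trans by (metis scaleR_scaleR)
        qed
        have fg: "f s - g s = act ?q (f s - g1 s) + act (1 - ?q) (f s - g2 s)"
          by (simp add: g_def act_diff act_sub act_one)
        have total: "E.le_on \<kappa> (nrm (f s - g s)) (((1 + c) / 2) *\<^sub>R l)"
          if u: "E.le_on \<kappa> (nrm (f s - g1 s)) (u1 *\<^sub>R l)" "E.le_on \<kappa> (nrm (f s - g2 s)) (u2 *\<^sub>R l)"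
            and le: "(?r + 2 * \<eta>) * u1 + (1 - ?r + 2 * \<eta>) * u2 \<le> (1 + c) / 2" for u1 u2
        proof -
          have "E.le_on \<kappa> (nrm (f s - g s)) (nrm (act ?q (f s - g1 s)) + nrm (act (1 - ?q) (f s - g2 s)))"
            unfolding fg by (rule E.le_onI[OF nrm_triangle k(1)])
          moreover have "E.le_on \<kappa> (nrm (act ?q (f s - g1 s)) + nrm (act (1 - ?q) (f s - g2 s)))
              (((?r + 2 * \<eta>) * u1) *\<^sub>R l + ((1 - ?r + 2 * \<eta>) * u2) *\<^sub>R l)"
            using ramp(1,2)[of ?a ?b t] eta(1)
            by (intro E.le_on_add bd[OF q1 pt(1) _ u(1)] bd[OF q2 pt(2) _ u(2)]) auto
          moreover have "E.le_on \<kappa> (((?r + 2 * \<eta>) * u1) *\<^sub>R l + ((1 - ?r + 2 * \<eta>) * u2) *\<^sub>R l) (((1 + c) / 2) *\<^sub>R l)"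
            unfolding scaleR_add_left[symmetric] by (intro E.le_onI scaleR_right_mono le l k)
          ultimately show ?thesis by (meson E.le_on_trans)
        qed
        have dn: "E.le_on \<kappa> x y" if "E.le_on \<rho> x y" for x y by (rule E.le_on_down[OF that k(1) rho(1) k(3)])
        \<comment> \<open>Outside \<open>K\<close> the ramp is 1 and favours \<open>g1\<close>,
          outside \<open>L\<close> it is 0 and favours \<open>g2\<close>; in the overlap both are
          good, so the value of the ramp does not matter. The number \<open>t\<close> differs from
          \<open>r s\<close> by at most \<open>2 d\<close>, which is the margin left around the
          ramp.\<close>
        consider "s \<notin> K" | "s \<notin> L" | "s \<in> L" "s \<in> K" by blast
        thus "E.le_on \<kappa> (nrm (f s - g s)) (((1 + c) / 2) *\<^sub>R l)"
        proof cases
          case 1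
          hence "s \<in> L" using d(1) by (auto simp: K_def L_def)
          hence sB: "s \<in> B1" using s by blast
          have "t \<le> ?a" using 1 tr by (auto simp: K_def abs_le_iff)
          hence "?r = 1" using ramp(3)[OF ab] by blast
          hence "(?r + 2 * \<eta>) * c + (1 - ?r + 2 * \<eta>) * M = c + 2 * \<eta> * (c + M)" by (simp add: algebra_simps)
          also have "\<dots> \<le> c + 2 * \<eta> * (1 + M)" using c eta(1) by simp
          finally have fin: "(?r + 2 * \<eta>) * c + (1 - ?r + 2 * \<eta>) * M \<le> (1 + c) / 2" unfolding eta(2) by (simp add: field_simps)
          show ?thesis by (rule total[OF dn[OF near1[OF sB]] dn[OF bound(2)] fin])
        next
          case 2
          hence "s \<in> K" using d(1) by (auto simp: K_def L_def)
          hence sB: "s \<in> B2" using s by blast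
          have "?b \<le> t" using 2 tr by (auto simp: L_def abs_le_iff)
          hence "?r = 0" using ramp(4)[OF ab] by blast
          hence "(?r + 2 * \<eta>) * M + (1 - ?r + 2 * \<eta>) * c = c + 2 * \<eta> * (c + M)" by (simp add: algebra_simps)
          also have "\<dots> \<le> c + 2 * \<eta> * (1 + M)" using c eta(1) by simp
          finally have fin: "(?r + 2 * \<eta>) * M + (1 - ?r + 2 * \<eta>) * c \<le> (1 + c) / 2" unfolding eta(2) by (simp add: field_simps)
          show ?thesis by (rule total[OF dn[OF bound(1)] dn[OF near2[OF sB]] fin])
        next
          case 3
          hence "s \<in> B1" "s \<in> B2" using s by blast+
          moreover have "(?r + 2 * \<eta>) * c + (1 - ?r + 2 * \<eta>) * c = c + 2 * \<eta> * (2 * c)" by (simp add: algebra_simps)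
          moreover have "2 * \<eta> * (2 * c) \<le> 2 * \<eta> * (1 + M)" using c M eta(1) by (intro mult_left_mono) auto
          ultimately show ?thesis using total[OF dn[OF near1] dn[OF near2]] unfolding eta(2) by (simp add: field_simps)
        qed
      qed
    qed
  qed
  thus False using b(3) rho(1,2) rhole(3) by (auto simp: E.full_def)
qed

text \<open>\<open>not_separated\<close> in both directions gives equality on \<open>A\<close>. It
  is available on the carrier \<open>b\<close> of \<open>l\<close> only, which is why separation is
  applied with the projection \<open>b\<close>.\<close>

lemma states_agree:
  assumes G: "bultra G" "F \<subseteq> G" and H: "bultra H" "F \<subseteq> H" and phi: "\<phi> \<in> cuo_orth"
  shows "b * state_of G \<phi> = b * state_of H \<phi>"
proof -
  have "\<forall>\<phi>\<in>A. b * state_of G \<phi> = b * state_of H \<phi>"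
    using not_separated[OF G H] not_separated[OF H G] by (auto simp: L.le_on_def intro: order_antisym)
  thus ?thesis
    using separates state_of_extreme[OF comp G(1)] state_of_extreme[OF comp H(1)] b(1) phi
    unfolding separates_states_def by blast
qed

end

end

text \<open>Links two ways of computing the limit of a quotient times \<open>e\<close>: through the
  limit of the quotients in \<Lambda>, and directly in \<open>E\<close>.\<close>

lemma blim_orth_apply:
  assumes phi: "L.blim G \<phi> \<mu>" and e: "0 \<le> e"
  shows "E.blim G (\<lambda>s. orth_apply (\<phi> s) e) (orth_apply \<mu> e)"
proof -
  obtain c where c: "0 \<le> c" "\<And>\<epsilon>. 0 < \<epsilon> \<Longrightarrow> densely 1 (L.close_on G \<phi> \<mu> (\<epsilon> *\<^sub>R c))" using phi unfolding L.blim_def by blast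
  have "densely 1 (E.close_on G (\<lambda>s. orth_apply (\<phi> s) e) (orth_apply \<mu> e) (\<epsilon> *\<^sub>R orth_apply c e))" if eps: "0 < \<epsilon>" for \<epsilon>
  proof (rule densely_mono[OF c(2)[OF eps]])
    fix \<rho> assume r: "\<rho> \<in> band_projections" "L.close_on G \<phi> \<mu> (\<epsilon> *\<^sub>R c) \<rho>"
    then obtain B where B: "(\<rho>, B) \<in> G" "\<And>s. s \<in> B \<Longrightarrow> L.le_on \<rho> \<bar>\<phi> s - \<mu>\<bar> (\<epsilon> *\<^sub>R c)" by (auto simp: L.close_on_def)
    have "E.le_on \<rho> \<bar>orth_apply (\<phi> s) e - orth_apply \<mu> e\<bar> (\<epsilon> *\<^sub>R orth_apply c e)" if "s \<in> B" for s
    proof -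
      have "\<bar>orth_apply (\<phi> s) e - orth_apply \<mu> e\<bar> \<le> orth_apply \<bar>\<phi> s - \<mu>\<bar> e"
        using orth_abs_le[of "\<phi> s - \<mu>" e] e by (simp add: minus_orth.rep_eq)
      from E.le_on_trans[OF E.le_onI[OF this r(1)] le_on_orth_apply[OF B(2)[OF that] e]]
      show ?thesis by (simp add: scaleR_orth.rep_eq)
    qed
    thus "E.close_on G (\<lambda>s. orth_apply (\<phi> s) e) (orth_apply \<mu> e) (\<epsilon> *\<^sub>R orth_apply c e) \<rho>"
      using B(1) unfolding E.close_on_def by blast
  qed
  moreover have "0 \<le> orth_apply c e" by (rule orth_apply_nonneg[OF c(1) e])
  ultimately show ?thesis unfolding E.blim_def by blast
qed

context bk_action
begin

lemma cuo_norm_upper: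
  assumes "f \<in> cuo nrm"
  shows "nrm (f s) \<le> cuo_norm nrm f"
proof -
  obtain e where "\<And>s. nrm (f s) \<le> e" using X.cuo_bounded[OF assms] by blast
  hence "bdd_above (range (\<lambda>s. nrm (f s)))" by (intro bdd_aboveI[of _ e]) auto
  thus ?thesis unfolding cuo_norm_def by (intro cSUP_upper) simp_all
qed

lemma cuo_norm_least: "(\<And>s. nrm (f s) \<le> e) \<Longrightarrow> cuo_norm nrm f \<le> e"
  unfolding cuo_norm_def by (rule cSUP_least) simp_all

lemma cuo_norm_nonneg: "f \<in> cuo nrm \<Longrightarrow> 0 \<le> cuo_norm nrm f"
  using cuo_norm_upper nrm_nonneg order_trans by blast

text \<open>Functions that coincide on a part oscillate equally there, so \<open>cuo_local\<close>
  applies.\<close>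

lemma cuo_mixing:
  fixes h :: "'s::uniform_space \<Rightarrow> 'x"
  assumes b: "\<And>s. nrm (h s) \<le> e"
    and loc: "densely 1 (\<lambda>\<rho>. \<exists>g\<in>cuo nrm. \<forall>s. act \<rho> (h s) = act \<rho> (g s))"
  shows "h \<in> cuo nrm"
proof (rule X.cuo_local[of h e, OF b densely_mono[OF loc]])
  fix \<rho> assume r: "\<rho> \<in> band_projections" and "\<exists>g\<in>cuo nrm. \<forall>s. act \<rho> (h s) = act \<rho> (g s)"
  then obtain g where g: "g \<in> cuo nrm" "\<And>s. act \<rho> (h s) = act \<rho> (g s)" by blast
  have "E.le_on \<rho> (nrm (h s - h t)) (nrm (g s - g t))" for s t
    using orth_apply_nrm_cong[OF r, of "h s - h t" "g s - g t" 0] g(2) by (simp add: act_diff E.le_on_def)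
  thus "\<exists>g\<in>cuo nrm. \<forall>s t. E.le_on \<rho> (nrm (h s - h t)) (nrm (g s - g t))" using g(1) by blast
qed

end

section \<open>The distance vanishes\<close>

context approximation
begin

lemma dist_zero:
  assumes f: "f \<in> cuo nrm" and h: "\<And>g. g \<in> W \<Longrightarrow> h \<le> cuo_norm nrm (\<lambda>s. f s - g s)"
  shows "h \<le> 0"
proof (rule ccontr)
  assume "\<not> h \<le> 0"
  \<comment> \<open>\<open>h\<close> need not be comparable with 0; its positive part is still a
    lower bound, as the norms are nonnegative.\<close>
  define l where "l = sup h 0"
  have l0: "0 \<le> l" "l \<noteq> 0" using \<open>\<not> h \<le> 0\<close> by (auto simp: l_def) (metis sup_ge1)
  have fgc: "(\<lambda>s. f s - g s) \<in> cuo nrm" if "g \<in> W" for g using f W_sub that by (intro X.cuo_diff) auto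
  have lW: "l \<le> cuo_norm nrm (\<lambda>s. f s - g s)" if "g \<in> W" for g
    unfolding l_def by (intro le_supI h that cuo_norm_nonneg fgc)
  obtain b where b: "b \<in> band_projections" "orth_apply b l = l" "E.full b l" using E.support_ex[OF l0(1)] by blast
  have b0: "b \<noteq> 0" using b(2) l0(2) by (auto simp: E.P_zero)
  obtain F where F: "distant f l F" "\<And>R. distant f l R \<Longrightarrow> F \<subseteq> R \<Longrightarrow> R = F"
    using maximal_distant[OF f l0(1) lW] by blast
  have FF: "bfilter F" using F(1) by (simp add: distant_def)
  obtain G where G: "F \<subseteq> G" "bultra G" using bultra_ex[OF FF] by blast
  note GF = bultra_bfilter[OF G(2)]
  obtain y where y: "X.blim G f y" using blim_value_ex[OF comp f G(2)] by blast
  \<comment> \<open>\<open>y\<close> is the value of \<open>f\<close> at the state of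
    \<open>G\<close>. The hypothesis on the values of \<open>W\<close> approximates it, and
    \<open>state_value_eq\<close> turns the approximating value back into a limit along
    \<open>G\<close>.\<close>
  define D where "D = (\<lambda>v. nrm (y - v)) ` {state_value nrm act g (state_of G) | g. g \<in> W}"
  have "densely b (\<lambda>\<rho>. \<exists>d\<in>D. E.le_on \<rho> d ((1 / 4) *\<^sub>R l))"
  proof (rule E.Inf_densely[OF l0(1) b(3,1)])
    show "D \<noteq> {}" unfolding D_def using W_0 by blast
    show "0 \<le> d" if "d \<in> D" for d using that nrm_nonneg by (auto simp: D_def)
    show "Inf D = 0" using approx[OF state_of_extreme[OF comp G(2)], of y] by (simp add: approximates_def D_def)
  qed simp
  from densely_ex[OF this b(1) order_refl b0]
  obtain \<pi>0 g where p0: "\<pi>0 \<in> band_projections" "\<pi>0 \<noteq> 0" "\<pi>0 \<le> b" "g \<in> W"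
    "E.le_on \<pi>0 (nrm (y - state_value nrm act g (state_of G))) ((1 / 4) *\<^sub>R l)" unfolding D_def by blast
  have gc: "g \<in> cuo nrm" using p0(4) W_sub by blast
  obtain z where z: "X.blim G g z" using blim_value_ex[OF comp gc G(2)] by blast
  have yz: "E.le_on \<pi>0 (nrm (y - z)) ((1 / 4) *\<^sub>R l)" using p0(5) state_value_eq[OF comp G(2) gc z] by simp
  have "X.blim G (\<lambda>s. - g s) (- z)"
    by (rule blim_lipschitz[OF X.band_normed_axioms X.band_normed_axioms z]) (simp add: X.nrm_minus_commute)
  from X.blim_add[OF GF y this] have lim: "X.blim G (\<lambda>s. f s - g s) (y - z)" by simp
  obtain e where e: "\<And>s. nrm (f s - g s) \<le> e" using X.cuo_bounded[OF fgc[OF p0(4)]] by blast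
  obtain \<pi> n where p: "\<pi> \<in> band_projections" "\<pi> \<noteq> 0" "\<pi> \<le> \<pi>0" "E.le_on \<pi> e (real n *\<^sub>R l)"
    using densely_ex[OF E.bounded_densely[OF l0(1) E.full_down[OF b(3) p0(3)] p0(1), of e] p0(1) order_refl p0(2)] by blast
  have pb: "\<pi> \<le> b" using p(3) p0(3) by (rule order_trans)
  define M where "M = real n + 1"
  \<comment> \<open>The values of \<open>\<phi>\<close> will be distances relative to
    \<open>e' = M l\<close>, so that \<open>c m\<close> stands for \<open>c / 16\<close> of
    \<open>l\<close>. In units of \<open>m\<close>: the limit of \<open>\<phi>\<close> along
    \<open>G\<close> is at most 4, because \<open>g\<close> comes within \<open>l / 4\<close> there;
    the set \<open>B\<close> ends at 8, and an error of one unit leaves the distance on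
    \<open>B\<close> at most \<open>9 / 16\<close> of \<open>l\<close>.\<close>
  define m where "m = 1 / (16 * M)"
  have M: "0 < M" "0 < m" "m * M = 1 / 16" by (auto simp: M_def m_def field_simps)
  define e' where "e' = M *\<^sub>R l"
  have e': "0 \<le> e'" using M l0 by (simp add: e'_def scaleR_nonneg_nonneg)
  have me: "(c * m) *\<^sub>R e' = (c / 16) *\<^sub>R l" for c using M(3) by (simp add: e'_def mult.assoc)
  have be: "orth_apply b e' = e'" "E.full b e'"
    using b M(1) by (auto simp: e'_def orth_simps E.full_def)
  \<comment> \<open>Cutting down to \<open>\<pi>\<close> makes the bound \<open>e'\<close> valid
    globally, as \<open>cuo_divide\<close> demands.\<close>
  define \<psi> where "\<psi> s = orth_apply \<pi> (nrm (f s - g s))" for s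
  have contr: "orth_apply \<pi> x \<le> x" if "0 \<le> x" for x
    using bp_le_one[OF p(1)] that by (simp add: orth_le_iff one_orth.rep_eq)
  have lip: "\<bar>orth_apply \<pi> (nrm u) - orth_apply \<pi> (nrm v)\<bar> \<le> nrm (u - v)" for u v
  proof -
    have "\<bar>orth_apply \<pi> (nrm u) - orth_apply \<pi> (nrm v)\<bar> \<le> orth_apply \<pi> \<bar>nrm u - nrm v\<bar>"
      using orth_apply_abs_le[OF bp_nonneg[OF p(1)], of "nrm u - nrm v"] by (simp add: orth_simps)
    also have "\<dots> \<le> \<bar>nrm u - nrm v\<bar>" by (rule contr) simp
    also have "\<dots> \<le> nrm (u - v)" by (rule X.nrm_reverse)
    finally show ?thesis .
  qed
  have psi_le: "\<psi> s \<le> e'" for s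
  proof -
    have "\<psi> s \<le> orth_apply \<pi> e" unfolding \<psi>_def by (intro orth_apply_mono bp_nonneg p e)
    also have "\<dots> \<le> orth_apply \<pi> (real n *\<^sub>R l)" using p(4) by (simp add: E.le_on_def)
    also have "\<dots> \<le> real n *\<^sub>R l" using l0 by (intro contr scaleR_nonneg_nonneg) auto
    also have "\<dots> \<le> e'" unfolding e'_def using l0 by (intro scaleR_right_mono) (auto simp: M_def)
    finally show ?thesis .
  qed
  have psi0: "0 \<le> \<psi> s" for s unfolding \<psi>_def by (intro orth_apply_nonneg bp_nonneg p nrm_nonneg)
  have psi: "\<psi> \<in> cuo abs"
  proof (rule cuo_lipschitz[OF X.band_normed_axioms band_normed_E fgc[OF p0(4)]])
    show "\<bar>\<psi> s\<bar> \<le> e'" for s using psi_le[of s] psi0[of s] by simp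
    show "\<bar>\<psi> s - \<psi> t\<bar> \<le> nrm ((f s - g s) - (f t - g t))" for s t unfolding \<psi>_def by (rule lip)
  qed
  obtain \<phi> where phi: "\<phi> \<in> cuo_orth" "\<And>s. 0 \<le> \<phi> s" "\<And>s. orth_apply (\<phi> s) e' = \<psi> s"
    using cuo_divide[OF psi psi0 psi_le b(1) be] by blast
  have val: "orth_apply (state_of G \<phi>) e' = orth_apply \<pi> (nrm (y - z))"
  proof -
    have 1: "E.blim G \<psi> (orth_apply (state_of G \<phi>) e')"
      using blim_orth_apply[OF blim_state_of[OF comp G(2) phi(1)] e'] by (simp add: phi(3))
    have 2: "E.blim G \<psi> (orth_apply \<pi> (nrm (y - z)))"
      unfolding \<psi>_def by (rule blim_lipschitz[OF X.band_normed_axioms band_normed_E lim]) (rule lip)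
    show ?thesis using E.blim_unique[OF GF 1 2] by simp
  qed
  have "E.le_on \<pi> (orth_apply (state_of G \<phi>) e') ((4 * m) *\<^sub>R e')"
    using E.le_on_down[OF yz p(1) p0(1) p(3)] p(1) unfolding val me by (simp add: E.le_on_def E.P_comp)
  hence sG: "L.le_on \<pi> (state_of G \<phi>) ((4 * m) *\<^sub>R 1)"
    by (rule le_on_cancel[OF e' E.full_down[OF be(2) pb] p(1)])
  obtain \<kappa> r where k: "\<kappa> \<in> band_projections" "\<kappa> \<noteq> 0" "\<kappa> \<le> \<pi>" "\<And>s. near \<kappa> (\<phi> s) (r s) m"
    using densely_ex[OF step_approx[OF comp phi(1) p(1) M(2)] p(1) order_refl p(2)] by blast
  have kb: "\<kappa> \<le> b" using k(3) pb by (rule order_trans)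
  define B where "B = {s. r s \<le> 8 * m}"
  \<comment> \<open>If \<open>F\<close> contained \<open>B\<close> on a nonzero part,
    \<open>g\<close> would be closer to \<open>f\<close> there than \<open>l\<close>, against
    \<open>distant\<close>. Hence the complement of \<open>B\<close> can be adjoined, and an
    ultrafilter \<open>H\<close> above the result sees values of \<open>\<phi>\<close> that are too
    large for the common state.\<close>
  have con: "\<rho> = 0" if r: "\<rho> \<in> band_projections" "\<rho> \<le> \<kappa>" "(\<rho>, - (- B)) \<in> F" for \<rho>
  proof -
    have rp: "\<rho> \<le> \<pi>" "\<rho> \<le> b" using r(2) k(3) kb by (meson order_trans)+
    have "orth_apply \<rho> l = 0"
    proof (rule distantD[OF F(1) p0(4), of "9 / 16" \<rho> B])
      show "(\<rho>, B) \<in> F" using r(3) by simp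
      fix s assume s: "s \<in> B"
      have 1: "L.le_on \<rho> (\<phi> s) ((r s + m) *\<^sub>R 1)" by (rule near_le(1)[OF near_down[OF k(4) r(1) k(1) r(2)] r(1)])
      have "(r s + m) *\<^sub>R 1 \<le> (9 * m) *\<^sub>R (1 :: 'e orth)" using s by (intro scaleR_right_mono orth_zero_le_one) (auto simp: B_def)
      from le_on_orth_apply[OF L.le_on_trans[OF 1 L.le_onI[OF this r(1)]] e']
      have "E.le_on \<rho> (\<psi> s) ((9 * m) *\<^sub>R e')" by (simp add: phi(3) orth_simps)
      hence "E.le_on \<rho> (\<psi> s) ((9 / 16) *\<^sub>R l)" unfolding me .
      thus "E.le_on \<rho> (nrm (f s - g s)) ((9 / 16) *\<^sub>R l)"
        unfolding \<psi>_def E.le_on_def E.P_down(1)[OF r(1) p(1) rp(1)] .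
    qed simp
    thus ?thesis using b(3) r(1) rp(2) by (simp add: E.full_def)
  qed
  note ad = adjoin[OF FF k(1) con]
  obtain H where H: "adjoin F \<kappa> (- B) \<subseteq> H" "bultra H" using bultra_ex[OF ad(1)] by blast
  note HF = bultra_bfilter[OF H(2)]
  have FH: "F \<subseteq> H" using ad(2) H(1) by (rule order_trans)
  have kB: "(\<kappa>, - B) \<in> H" using ad(3) H(1) by blast
  have "b * state_of G \<phi> = b * state_of H \<phi>"
    by (rule states_agree[OF f l0(1) b F(1) F(2) G(2,1) H(2) FH phi(1)])
  hence "\<pi> * state_of G \<phi> = \<pi> * state_of H \<phi>" using L.P_down(1)[OF p(1) b(1) pb] by metis
  hence sH: "L.le_on \<pi> (state_of H \<phi>) ((4 * m) *\<^sub>R 1)" using sG by (simp add: L.le_on_def)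
  obtain \<rho> where r: "\<rho> \<in> band_projections" "\<rho> \<noteq> 0" "\<rho> \<le> \<kappa>" "L.close_on H \<phi> (state_of H \<phi>) (m *\<^sub>R 1) \<rho>"
    using densely_ex[OF L.blim_regulator[OF HF blim_state_of[OF comp H(2) phi(1)] orth_zero_le_one full_one k(1) M(2)] k(1) order_refl k(2)] by blast
  then obtain C where C: "(\<rho>, C) \<in> H" "\<And>s. s \<in> C \<Longrightarrow> L.le_on \<rho> \<bar>\<phi> s - state_of H \<phi>\<bar> (m *\<^sub>R 1)" by (auto simp: L.close_on_def)
  \<comment> \<open>At this point \<open>r s\<close> exceeds \<open>8 m\<close> by the choice of
    \<open>H\<close>, while the common value of the states bounds it by \<open>6 m\<close>.\<close>
  obtain s where s: "s \<in> C \<inter> - B" using bfilter_nonempty[OF HF bfilter_int2[OF HF C(1) kB r(1) order_refl r(3)] r(2)] by blast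
  have rp: "\<rho> \<le> \<pi>" using r(3) k(3) by (rule order_trans)
  have 1: "L.le_on \<rho> ((r s - m) *\<^sub>R 1) (\<phi> s)" by (rule near_le(2)[OF near_down[OF k(4) r(1) k(1) r(3)] r(1)])
  have "L.le_on \<rho> (\<phi> s - state_of H \<phi>) (m *\<^sub>R 1)" using C(2)[of s] s r(1) by (simp add: L.le_on_abs_iff)
  hence 2: "L.le_on \<rho> (\<phi> s) (m *\<^sub>R 1 + state_of H \<phi>)" by (simp only: L.le_on_diff_le)
  have 3: "L.le_on \<rho> (m *\<^sub>R 1 + state_of H \<phi>) ((m + 4 * m) *\<^sub>R 1)"
    unfolding scaleR_add_left[of m] by (intro L.le_on_add L.le_on_refl L.le_on_down[OF sH r(1) p(1) rp])
  have "r s - m \<le> m + 4 * m" by (rule le_on_one_real[OF L.le_on_trans[OF L.le_on_trans[OF 1 2] 3] r(1,2)])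
  thus False using s M(2) by (simp add: B_def)
qed

section \<open>Density of the mixings\<close>

abbreviation "acts \<equiv> \<lambda>\<pi> h s. act \<pi> (h s)"

text \<open>Indices that carry the same projection may share one choice of \<open>u\<close>, so a
  partition can be indexed by its own members.\<close>

lemma mix_fin_iff:
  "h \<in> mix_fin acts (cuo nrm) W \<longleftrightarrow> h \<in> cuo nrm \<and> (\<exists>I. finite I \<and> partition_of_unity I (\<lambda>\<rho>. \<rho>) \<and>
    (\<forall>i\<in>I. \<exists>u\<in>W. acts i h = acts i u))"
proof
  assume "h \<in> mix_fin acts (cuo nrm) W"
  then obtain I \<pi> u where I: "h \<in> cuo nrm" "finite (I :: 'e orth set)" "partition_of_unity I \<pi>"
    "\<forall>i\<in>I. u i \<in> W \<and> acts (\<pi> i) h = acts (\<pi> i) (u i)" unfolding mix_fin_def by blast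
  have "partition_of_unity (\<pi> ` I) (\<lambda>\<rho>. \<rho>)"
    using I(3) unfolding partition_of_unity_def by auto
  moreover have "\<forall>i\<in>\<pi> ` I. \<exists>u\<in>W. acts i h = acts i u" using I(4) by blast
  ultimately show "h \<in> cuo nrm \<and> (\<exists>I. finite I \<and> partition_of_unity I (\<lambda>\<rho>. \<rho>) \<and> (\<forall>i\<in>I. \<exists>u\<in>W. acts i h = acts i u))"
    using I(1,2) by blast
next
  assume "h \<in> cuo nrm \<and> (\<exists>I. finite I \<and> partition_of_unity I (\<lambda>\<rho>. \<rho>) \<and> (\<forall>i\<in>I. \<exists>u\<in>W. acts i h = acts i u))"
  then obtain I where I: "h \<in> cuo nrm" "finite I" "partition_of_unity I (\<lambda>\<rho>. \<rho>)" "\<forall>i\<in>I. \<exists>u\<in>W. acts i h = acts i u" by blast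
  have "\<forall>i\<in>I. \<exists>u. u \<in> W \<and> acts i h = acts i u" using I(4) by blast
  from bchoice[OF this] obtain u where "\<forall>i\<in>I. u i \<in> W \<and> acts i h = acts i (u i)" by blast
  thus "h \<in> mix_fin acts (cuo nrm) W" unfolding mix_fin_def using I(1-3) by blast
qed

lemma W_mix_fin: "W \<subseteq> mix_fin acts (cuo nrm) W"
proof
  fix g assume g: "g \<in> W"
  have "partition_of_unity {1 :: 'e orth} (\<lambda>\<rho>. \<rho>)"
    unfolding partition_of_unity_def using bp_le_one by (auto intro: order_antisym)
  thus "g \<in> mix_fin acts (cuo nrm) W" unfolding mix_fin_iff using g W_sub by (intro conjI exI[of _ "{1}"]) auto
qed

text \<open>The new partition consists of the members of the first one cut by \<open>\<tau>\<close>
  and those of the second one cut by \<open>1 - \<tau>\<close>. This closure property makes the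
  distances to finite mixings directed downwards.\<close>

lemma mix_fin_combine:
  assumes h: "h1 \<in> mix_fin acts (cuo nrm) W" "h2 \<in> mix_fin acts (cuo nrm) W" and t: "\<tau> \<in> band_projections"
  shows "(\<lambda>s. act \<tau> (h1 s) + act (1 - \<tau>) (h2 s)) \<in> mix_fin acts (cuo nrm) W" (is "?h \<in> _")
proof -
  obtain I where I: "h1 \<in> cuo nrm" "finite I" "partition_of_unity I (\<lambda>\<rho>. \<rho>)" "\<forall>i\<in>I. \<exists>u\<in>W. acts i h1 = acts i u"
    using h(1) unfolding mix_fin_iff by blast
  obtain J where J: "h2 \<in> cuo nrm" "finite J" "partition_of_unity J (\<lambda>\<rho>. \<rho>)" "\<forall>i\<in>J. \<exists>u\<in>W. acts i h2 = acts i u"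
    using h(2) unfolding mix_fin_iff by blast
  have t': "1 - \<tau> \<in> band_projections" using t by simp
  have a1: "act \<tau> (?h s) = act \<tau> (h1 s)" for s
    using t by (simp add: act_add act_mult[symmetric] bp_idem bp_compl_mult act_zero)
  have a2: "act (1 - \<tau>) (?h s) = act (1 - \<tau>) (h2 s)" for s
    using bp_compl_mult(2)[OF t] bp_idem[OF t'] by (simp add: act_add act_mult[symmetric] act_zero)
  obtain e1 where e1: "\<And>s. nrm (h1 s) \<le> e1" using X.cuo_bounded[OF I(1)] by blast
  obtain e2 where e2: "\<And>s. nrm (h2 s) \<le> e2" using X.cuo_bounded[OF J(1)] by blast
  have contr: "nrm (act \<pi> x) \<le> nrm x" if "\<pi> \<in> band_projections" for \<pi> x
    using bp_le_one[OF that] nrm_nonneg[of x] by (simp add: nrm_act_bp[OF that] orth_le_iff one_orth.rep_eq)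
  have "?h \<in> cuo nrm"
  proof (rule cuo_mixing)
    show "nrm (?h s) \<le> e1 + e2" for s
      using order_trans[OF nrm_triangle add_mono[OF order_trans[OF contr[OF t] e1] order_trans[OF contr[OF t'] e2]]] .
    show "densely 1 (\<lambda>\<rho>. \<exists>g\<in>cuo nrm. \<forall>s. act \<rho> (?h s) = act \<rho> (g s))"
      unfolding densely_def
    proof (intro ballI impI)
      fix \<kappa> :: "'e orth" assume k: "\<kappa> \<in> band_projections" "\<kappa> \<le> 1" "\<kappa> \<noteq> 0"
      show "\<exists>\<rho>\<in>band_projections. \<rho> \<noteq> 0 \<and> \<rho> \<le> \<kappa> \<and> (\<exists>g\<in>cuo nrm. \<forall>s. act \<rho> (?h s) = act \<rho> (g s))"
      proof (rule bp_split[OF k(1,3) t])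
        assume a: "\<kappa> * \<tau> \<in> band_projections" "\<kappa> * \<tau> \<noteq> 0" "\<kappa> * \<tau> \<le> \<kappa>" "\<kappa> * \<tau> \<le> \<tau>"
        have "act (\<kappa> * \<tau>) (?h s) = act (\<kappa> * \<tau>) (h1 s)" for s by (rule act_eq_down[OF a1 t a(1,4)])
        thus ?thesis using a I(1) by blast
      next
        assume a: "\<kappa> * (1 - \<tau>) \<in> band_projections" "\<kappa> * (1 - \<tau>) \<noteq> 0" "\<kappa> * (1 - \<tau>) \<le> \<kappa>" "\<kappa> * (1 - \<tau>) \<le> 1 - \<tau>"
        have "act (\<kappa> * (1 - \<tau>)) (?h s) = act (\<kappa> * (1 - \<tau>)) (h2 s)" for s by (rule act_eq_down[OF a2 t' a(1,4)])
        thus ?thesis using a J(1) by blast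
      qed
    qed
  qed
  moreover have "finite ((*) \<tau> ` I \<union> (*) (1 - \<tau>) ` J)" using I J by simp
  moreover have "partition_of_unity ((*) \<tau> ` I \<union> (*) (1 - \<tau>) ` J) (\<lambda>\<rho>. \<rho>)"
  proof -
    have Ib: "i \<in> band_projections" if "i \<in> I" for i using I(3) that by (auto simp: partition_of_unity_def)
    have Jb: "i \<in> band_projections" if "i \<in> J" for i using J(3) that by (auto simp: partition_of_unity_def)
    have Id: "i * i' = 0" if "i \<in> I" "i' \<in> I" "i \<noteq> i'" for i i'
      using I(3) that bp_inf[OF Ib Ib] unfolding partition_of_unity_def by metis
    have Jd: "i * i' = 0" if "i \<in> J" "i' \<in> J" "i \<noteq> i'" for i i'
      using J(3) that bp_inf[OF Jb Jb] unfolding partition_of_unity_def by metis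
    have sw: "(p * i) * (q * j) = (p * q) * (i * j)" if "i \<in> band_projections" for p q i j :: "'e orth"
      using band_projection_commute[OF that, of q] by (simp add: mult.assoc) (simp add: mult.assoc[symmetric])
    show ?thesis
      unfolding partition_of_unity_def
    proof (intro conjI ballI impI)
      let ?K = "(*) \<tau> ` I \<union> (*) (1 - \<tau>) ` J"
      show bpK: "i \<in> band_projections" if "i \<in> ?K" for i using that Ib Jb t t' by auto
      show "inf i j = 0" if ij: "i \<in> ?K" "j \<in> ?K" "i \<noteq> j" for i j
      proof -
        have "i * j = 0"
        proof -
          have II: "i * j = 0" if "i = \<tau> * i'" "j = \<tau> * j'" "i' \<in> I" "j' \<in> I" for i' j'
          proof -
            have "i' \<noteq> j'" using that ij(3) by blast
            thus ?thesis unfolding that(1,2) sw[OF Ib[OF that(3)]] by (simp add: Id[OF that(3,4)])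
          qed
          have JJ: "i * j = 0" if "i = (1 - \<tau>) * i'" "j = (1 - \<tau>) * j'" "i' \<in> J" "j' \<in> J" for i' j'
          proof -
            have "i' \<noteq> j'" using that ij(3) by blast
            thus ?thesis unfolding that(1,2) sw[OF Jb[OF that(3)]] by (simp add: Jd[OF that(3,4)])
          qed
          have IJ: "i * j = 0" if "i = \<tau> * i'" "j = (1 - \<tau>) * j'" "i' \<in> I" for i' j'
            unfolding that(1,2) sw[OF Ib[OF that(3)]] bp_compl_mult[OF t] by simp
          have JI: "i * j = 0" if "i = (1 - \<tau>) * i'" "j = \<tau> * j'" "i' \<in> J" for i' j'
            unfolding that(1,2) sw[OF Jb[OF that(3)]] bp_compl_mult[OF t] by simp
          show ?thesis using ij(1)
          proof (elim UnE imageE)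
            fix i' assume i: "i = \<tau> * i'" "i' \<in> I"
            show ?thesis using ij(2)
              by (elim UnE imageE) (erule II[OF i(1) _ i(2)], assumption, erule IJ[OF i(1) _ i(2)])
          next
            fix i' assume i: "i = (1 - \<tau>) * i'" "i' \<in> J"
            show ?thesis using ij(2)
              by (elim UnE imageE) (erule JI[OF i(1) _ i(2)], erule JJ[OF i(1) _ i(2)], assumption)
          qed
        qed
        thus ?thesis using bp_inf[OF bpK[OF ij(1)] bpK[OF ij(2)]] by simp
      qed
      fix \<rho> :: "'e orth" assume r: "\<rho> \<in> band_projections" "\<forall>i\<in>?K. i \<le> \<rho>"
      \<comment> \<open>What an upper bound \<open>\<rho>\<close> leaves over on
        \<open>\<sigma>\<close> is disjoint from every member of the old partition, hence 0.\<close>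
      have half: "\<sigma> * (1 - \<rho>) = 0" if s: "\<sigma> \<in> band_projections" "partition_of_unity N (\<lambda>\<rho>. \<rho>)" "\<And>i. i \<in> N \<Longrightarrow> \<sigma> * i \<le> \<rho>" for \<sigma> N
      proof -
        have sr: "\<sigma> * (1 - \<rho>) \<in> band_projections" using s(1) r(1) by simp
        have "i \<le> 1 - \<sigma> * (1 - \<rho>)" if i: "i \<in> N" for i
        proof -
          have ib: "i \<in> band_projections" using s(2) i by (auto simp: partition_of_unity_def)
          have "\<sigma> * i * \<rho> = \<sigma> * i" using s(3)[OF i] bp_le_iff[OF bp_mult[OF s(1) ib] r(1)] by simp
          hence "\<sigma> * i * (1 - \<rho>) = 0" by (simp add: algebra_simps)
          moreover have "i * (\<sigma> * (1 - \<rho>)) = \<sigma> * i * (1 - \<rho>)"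
            using band_projection_commute[OF ib, of \<sigma>] by (simp add: mult.assoc[symmetric])
          ultimately have "i * (\<sigma> * (1 - \<rho>)) = 0" by simp
          thus ?thesis using bp_le_iff[OF ib bp_compl[OF sr]] by (simp only: right_diff_distrib[of i 1] mult_1_right diff_zero simp_thms)
        qed
        hence "1 - \<sigma> * (1 - \<rho>) = 1" using s(2) bp_compl[OF sr] unfolding partition_of_unity_def by blast
        thus ?thesis by simp
      qed
      have "\<tau> * (1 - \<rho>) = 0" using r(2) by (intro half[OF t I(3)]) auto
      moreover have "(1 - \<tau>) * (1 - \<rho>) = 0" using r(2) by (intro half[OF t' J(3)]) auto
      moreover have "1 - \<rho> = \<tau> * (1 - \<rho>) + (1 - \<tau>) * (1 - \<rho>)" by (simp add: algebra_simps)
      ultimately have "1 - \<rho> = 0" by simp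
      thus "\<rho> = 1" by simp
    qed
  qed
  moreover have "\<exists>u\<in>W. acts k ?h = acts k u" if k: "k \<in> (*) \<tau> ` I \<union> (*) (1 - \<tau>) ` J" for k
  proof -
    have comb: "\<exists>u\<in>W. acts (\<sigma> * i) ?h = acts (\<sigma> * i) u"
      if s: "\<And>s. act \<sigma> (?h s) = act \<sigma> (h s)" "i \<in> band_projections" "\<exists>u\<in>W. acts i h = acts i u" for \<sigma> i h
    proof -
      obtain u where u: "u \<in> W" "acts i h = acts i u" using s(3) by blast
      have ui: "act i (h s) = act i (u s)" for s using fun_cong[OF u(2)] .
      have "act (\<sigma> * i) (?h s) = act (\<sigma> * i) (u s)" for s
      proof -
        have "act (\<sigma> * i) (?h s) = act i (act \<sigma> (?h s))"
          using band_projection_commute[OF s(2), of \<sigma>] by (metis act_mult)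
        also have "\<dots> = act \<sigma> (act i (h s))"
          unfolding s(1) using band_projection_commute[OF s(2), of \<sigma>] by (metis act_mult)
        finally show ?thesis unfolding ui by (simp add: act_mult)
      qed
      thus ?thesis using u(1) by blast
    qed
    show ?thesis using k
    proof
      assume "k \<in> (*) \<tau> ` I"
      then obtain i where i: "k = \<tau> * i" "i \<in> I" by blast
      have "i \<in> band_projections" using I(3) i(2) by (auto simp: partition_of_unity_def)
      thus ?thesis unfolding i(1) using I(4) i(2) by (intro comb[OF a1]) auto
    next
      assume "k \<in> (*) (1 - \<tau>) ` J"
      then obtain i where i: "k = (1 - \<tau>) * i" "i \<in> J" by blast
      have "i \<in> band_projections" using J(3) i(2) by (auto simp: partition_of_unity_def)
      thus ?thesis unfolding i(1) using J(4) i(2) by (intro comb[OF a2]) auto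
    qed
  qed
  ultimately show ?thesis unfolding mix_fin_iff by blast
qed

text \<open>The set \<open>D\<close> of attained distances is itself the dominating set for order
  convergence, and the net consists of the mixings sorted by distance. That the infimum is 0 is due
  to \<open>W\<close> alone; the finite mixings are what makes \<open>D\<close> directed.\<close>

lemma mix_fin_dense: "norm_o_dense_in (cuo_norm nrm) (mix_fin acts (cuo nrm) W) (cuo nrm)"
  unfolding norm_o_dense_in_def
proof (intro conjI ballI)
  let ?M = "mix_fin acts (cuo nrm) W"
  show MC: "?M \<subseteq> cuo nrm" by (auto simp: mix_fin_def)
  fix f :: "'s \<Rightarrow> 'x" assume f: "f \<in> cuo nrm"
  have fh: "(\<lambda>s. f s - h s) \<in> cuo nrm" if "h \<in> ?M" for h using f MC that by (intro X.cuo_diff) auto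
  have fd: "f - h = (\<lambda>s. f s - h s)" for h by (simp add: fun_eq_iff)
  define D where "D = (\<lambda>h. cuo_norm nrm (f - h)) ` ?M"
  define B where "B d = {h \<in> ?M. cuo_norm nrm (f - h) \<le> d}" for d
  define F where "F = (INF d\<in>D. principal (B d))"
  have W: "W \<subseteq> ?M" by (rule W_mix_fin)
  have Dne: "D \<noteq> {}" using W W_0 by (auto simp: D_def)
  have D0: "0 \<le> d" if "d \<in> D" for d using that cuo_norm_nonneg[OF fh] by (auto simp: D_def fd)
  have dir: "\<exists>d''\<in>D. d'' \<le> d \<and> d'' \<le> d'" if dd: "d \<in> D" "d' \<in> D" for d d'
  proof -
    obtain h h' where h: "h \<in> ?M" "d = cuo_norm nrm (f - h)" "h' \<in> ?M" "d' = cuo_norm nrm (f - h')" using dd by (auto simp: D_def)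
    \<comment> \<open>On each side of the cut the better of the two mixings is used, which brings
      the distance below \<open>inf d d'\<close>.\<close>
    obtain \<tau> where t: "\<tau> \<in> band_projections" "E.le_on \<tau> d d'" "E.le_on (1 - \<tau>) d' d" using E.cut[of d d'] by blast
    have t': "1 - \<tau> \<in> band_projections" using t(1) by simp
    let ?h = "\<lambda>s. act \<tau> (h s) + act (1 - \<tau>) (h' s)"
    have hM: "?h \<in> ?M" by (rule mix_fin_combine[OF h(1,3) t(1)])
    have "nrm (f s - ?h s) \<le> inf d d'" for s
    proof -
      have e: "f s - ?h s = act \<tau> (f s - h s) + act (1 - \<tau>) (f s - h' s)"
        by (simp add: act_diff act_sub act_one)
      have "nrm (f s - ?h s) \<le> orth_apply \<tau> (nrm (f s - h s)) + orth_apply (1 - \<tau>) (nrm (f s - h' s))"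
        unfolding e using nrm_triangle[of "act \<tau> (f s - h s)" "act (1 - \<tau>) (f s - h' s)"]
        by (simp only: nrm_act_bp[OF t(1)] nrm_act_bp[OF t'])
      also have "\<dots> \<le> orth_apply \<tau> d + orth_apply (1 - \<tau>) d'"
        using cuo_norm_upper[OF fh[OF h(1)], of s] cuo_norm_upper[OF fh[OF h(3)], of s]
        by (intro add_mono orth_apply_mono bp_nonneg t(1) t') (simp_all add: h fd)
      also have "\<dots> \<le> orth_apply \<tau> (inf d d') + orth_apply (1 - \<tau>) (inf d d')"
      proof (rule add_mono)
        have "E.le_on \<tau> d (inf d d')" by (intro E.le_on_inf t(1) E.le_on_refl t(2))
        thus "orth_apply \<tau> d \<le> orth_apply \<tau> (inf d d')" by (simp only: E.le_on_def)
        have "E.le_on (1 - \<tau>) d' (inf d d')" by (intro E.le_on_inf t' E.le_on_refl t(3))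
        thus "orth_apply (1 - \<tau>) d' \<le> orth_apply (1 - \<tau>) (inf d d')" by (simp only: E.le_on_def)
      qed
      also have "\<dots> = inf d d'" by (rule E.P_split[symmetric])
      finally show ?thesis .
    qed
    hence "cuo_norm nrm (f - ?h) \<le> inf d d'" unfolding fd by (rule cuo_norm_least)
    moreover have "cuo_norm nrm (f - ?h) \<in> D" unfolding D_def using hM by (rule imageI)
    ultimately show ?thesis by (intro bexI[of _ "cuo_norm nrm (f - ?h)"]) auto
  qed
  have ev: "eventually Q F \<longleftrightarrow> (\<exists>d\<in>D. \<forall>h\<in>B d. Q h)" for Q
    unfolding F_def
  proof (subst eventually_INF_base[OF Dne])
    fix d d' assume "d \<in> D" "d' \<in> D"
    then obtain d'' where d: "d'' \<in> D" "d'' \<le> d" "d'' \<le> d'" using dir by blast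
    hence "B d'' \<subseteq> B d" "B d'' \<subseteq> B d'" by (auto simp: B_def intro: order_trans)
    thus "\<exists>x\<in>D. principal (B x) \<le> inf (principal (B d)) (principal (B d'))" using d(1) by (intro bexI[of _ d'']) auto
  qed (simp add: eventually_principal)
  have Bne: "B d \<noteq> {}" if "d \<in> D" for d using that by (auto simp: D_def B_def)
  show "\<exists>F. F \<noteq> bot \<and> eventually (\<lambda>y. y \<in> ?M) F \<and> norm_o_tendsto (cuo_norm nrm) (\<lambda>y. y) f F"
  proof (intro exI[of _ F] conjI)
    show "F \<noteq> bot" unfolding trivial_limit_def ev using Bne by blast
    show "eventually (\<lambda>y. y \<in> ?M) F" unfolding ev using Dne by (auto simp: B_def)
    show "norm_o_tendsto (cuo_norm nrm) (\<lambda>y. y) f F"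
      unfolding norm_o_tendsto_def o_tendsto_def
    proof (intro exI[of _ D] conjI ballI)
      show "Inf D = 0"
      proof (rule Inf_eq_0I[OF Dne D0])
        fix x assume x: "\<And>d. d \<in> D \<Longrightarrow> x \<le> d"
        show "x \<le> 0"
        proof (rule dist_zero[OF f])
          show "x \<le> cuo_norm nrm (\<lambda>s. f s - g s)" if "g \<in> W" for g
            using x[of "cuo_norm nrm (f - g)"] that W by (auto simp: D_def fd)
        qed
      qed
      fix d assume d: "d \<in> D"
      have "\<bar>cuo_norm nrm (f - h) - 0\<bar> \<le> d" if "h \<in> B d" for h
        using that cuo_norm_nonneg[OF fh] by (auto simp: B_def fd)
      thus "eventually (\<lambda>a. \<bar>cuo_norm nrm (f - a) - 0\<bar> \<le> d) F" unfolding ev using d by blast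
    qed (use Dne D0 dir in auto)
  qed
qed

text \<open>An order unit is a regulator that is full everywhere and the same on all parts. So
  members of \<open>W\<close> that are within \<open>\<epsilon> u\<close> of \<open>f\<close> on
  small parts can be pasted, by a possibly infinite mixing, into one function within
  \<open>\<epsilon> u\<close> of \<open>f\<close>.\<close>

lemma mix_dense:
  assumes u: "order_unit u"
  shows "norm_r_dense_in (cuo_norm nrm) u (mix acts (cuo nrm) W) (cuo nrm)"
  unfolding norm_r_dense_in_def
proof (intro conjI ballI)
  let ?M = "mix acts (cuo nrm) W"
  show MC: "?M \<subseteq> cuo nrm" by (auto simp: mix_def)
  have u0: "0 \<le> u" using u by (simp add: order_unit_def)
  have fu: "E.full 1 u"
    unfolding E.full_def
  proof (intro ballI impI)
    fix \<rho> :: "'e orth" assume r: "\<rho> \<in> band_projections" "orth_apply \<rho> u = 0"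
    show "\<rho> = 0"
    proof (rule orth_eqI)
      fix x :: 'e assume x: "0 \<le> x"
      obtain c where "\<bar>x\<bar> \<le> c *\<^sub>R u" using u unfolding order_unit_def by blast
      hence "orth_apply \<rho> x \<le> orth_apply \<rho> (c *\<^sub>R u)" using x by (intro orth_apply_mono bp_nonneg r(1)) simp
      hence "orth_apply \<rho> x \<le> 0" using r(2) by (simp add: orth_simps)
      thus "orth_apply \<rho> x = orth_apply 0 x" using orth_apply_nonneg[OF bp_nonneg[OF r(1)] x]
        by (simp add: E.P_zero order_antisym)
    qed
  qed
  fix f :: "'s \<Rightarrow> 'x" assume f: "f \<in> cuo nrm"
  have fg: "(\<lambda>s. f s - g s) \<in> cuo nrm" if "g \<in> W" for g using f W_sub that by (intro X.cuo_diff) auto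
  obtain e where e: "0 \<le> e" "\<And>s. nrm (f s) \<le> e" using X.cuo_bounded[OF f] by blast
  have fd: "f - h = (\<lambda>s. f s - h s)" for h by (simp add: fun_eq_iff)
  have ex: "\<exists>h\<in>?M. cuo_norm nrm (f - h) \<le> \<epsilon> *\<^sub>R u" if eps: "0 < \<epsilon>" for \<epsilon>
  proof -
    have eu: "0 \<le> \<epsilon> *\<^sub>R u" using eps u0 by (simp add: scaleR_nonneg_nonneg)
    let ?D = "{\<rho> \<in> band_projections - {0}. \<exists>g\<in>W. E.le_on \<rho> (cuo_norm nrm (\<lambda>s. f s - g s)) (\<epsilon> *\<^sub>R u)}"
    have "densely 1 (\<lambda>\<rho>. \<exists>d\<in>(\<lambda>g. cuo_norm nrm (\<lambda>s. f s - g s)) ` W. E.le_on \<rho> d (\<epsilon> *\<^sub>R u))"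
    proof (rule E.Inf_densely[OF u0 fu bp_one eps])
      show ne: "(\<lambda>g. cuo_norm nrm (\<lambda>s. f s - g s)) ` W \<noteq> {}" using W_0 by blast
      show nn: "0 \<le> d" if "d \<in> (\<lambda>g. cuo_norm nrm (\<lambda>s. f s - g s)) ` W" for d using that cuo_norm_nonneg[OF fg] by auto
      show "Inf ((\<lambda>g. cuo_norm nrm (\<lambda>s. f s - g s)) ` W) = 0"
      proof (rule Inf_eq_0I[OF ne nn])
        fix x assume "\<And>d. d \<in> (\<lambda>g. cuo_norm nrm (\<lambda>s. f s - g s)) ` W \<Longrightarrow> x \<le> d"
        thus "x \<le> 0" by (intro dist_zero[OF f, of x]) blast
      qed
    qed
    hence "densely 1 (\<lambda>\<rho>. \<rho> \<in> ?D)" by (rule densely_mono) auto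
    then obtain I where I: "I \<subseteq> ?D" "partition_of_unity I (\<lambda>\<rho>. \<rho>)" using partition_exhaustion[of ?D] by auto
    have Ib: "\<rho> \<in> band_projections" if "\<rho> \<in> I" for \<rho> using I(1) that by auto
    have "\<forall>\<rho>\<in>I. \<exists>g. g \<in> W \<and> E.le_on \<rho> (cuo_norm nrm (\<lambda>s. f s - g s)) (\<epsilon> *\<^sub>R u)" using I(1) by blast
    from bchoice[OF this] obtain g where "\<forall>\<rho>\<in>I. g \<rho> \<in> W \<and> E.le_on \<rho> (cuo_norm nrm (\<lambda>s. f s - g \<rho> s)) (\<epsilon> *\<^sub>R u)" by (elim exE)
    hence g: "g \<rho> \<in> W" "E.le_on \<rho> (cuo_norm nrm (\<lambda>s. f s - g \<rho> s)) (\<epsilon> *\<^sub>R u)" if "\<rho> \<in> I" for \<rho> using that by simp_all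
    have close: "E.le_on \<rho> (nrm (g \<rho> s - f s)) (\<epsilon> *\<^sub>R u)" if r: "\<rho> \<in> I" for \<rho> s
    proof -
      have "nrm (g \<rho> s - f s) \<le> cuo_norm nrm (\<lambda>s. f s - g \<rho> s)"
        using cuo_norm_upper[OF fg[OF g(1)[OF r]], of s] by (simp add: X.nrm_minus_commute)
      from E.le_on_trans[OF E.le_onI[OF this Ib[OF r]] g(2)[OF r]] show ?thesis .
    qed
    \<comment> \<open>The members \<open>g \<rho>\<close> need not have a common norm bound, yet
      each is bounded by \<open>\<epsilon> u + e\<close> on its own part, and that is what the
      existence of the mixing requires.\<close>
    have bound: "E.le_on \<rho> (nrm (g \<rho> s)) (\<epsilon> *\<^sub>R u + e)" if r: "\<rho> \<in> I" for \<rho> s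
    proof -
      have "nrm (g \<rho> s) \<le> nrm (g \<rho> s - f s) + nrm (f s)" using nrm_triangle[of "g \<rho> s - f s" "f s"] by simp
      from E.le_on_trans[OF E.le_onI[OF this Ib[OF r]] E.le_on_add[OF close[OF r] E.le_onI[OF e(2) Ib[OF r]]]]
      show ?thesis .
    qed
    have "\<forall>s. \<exists>y. \<forall>\<rho>\<in>I. act \<rho> y = act \<rho> (g \<rho> s)"
      using eu e(1) by (intro allI mixing_ex[OF I(2) bound]) (auto intro: add_nonneg_nonneg)
    from choice[OF this] obtain h where "\<forall>s. \<forall>\<rho>\<in>I. act \<rho> (h s) = act \<rho> (g \<rho> s)" by (elim exE)
    hence h: "act \<rho> (h s) = act \<rho> (g \<rho> s)" if "\<rho> \<in> I" for \<rho> s using that by blast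
    have hf: "nrm (h s - f s) \<le> \<epsilon> *\<^sub>R u" for s
      by (rule mixing_norm_le[OF I(2), of "\<lambda>\<rho>. g \<rho> s"]) (auto intro: close h)
    have hc: "h \<in> cuo nrm"
    proof (rule cuo_mixing)
      show "nrm (h s) \<le> \<epsilon> *\<^sub>R u + e" for s
        using order_trans[OF nrm_triangle[of "h s - f s" "f s"] add_mono[OF hf e(2)]] by simp
      show "densely 1 (\<lambda>\<rho>. \<exists>g\<in>cuo nrm. \<forall>s. act \<rho> (h s) = act \<rho> (g s))"
      proof (rule densely_mono[OF partition_densely[OF I(2)]])
        fix \<rho> assume r: "\<rho> \<in> band_projections" "\<exists>i\<in>I. \<rho> \<le> i"
        then obtain i where i: "i \<in> I" "\<rho> \<le> i" by blast
        have "act \<rho> (h s) = act \<rho> (g i s)" for s by (rule act_eq_down[OF h[OF i(1)] Ib[OF i(1)] r(1) i(2)])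
        thus "\<exists>g\<in>cuo nrm. \<forall>s. act \<rho> (h s) = act \<rho> (g s)" using g(1)[OF i(1)] W_sub by blast
      qed
    qed
    have "h \<in> ?M" unfolding mix_def
      using hc I(2) g(1) h by (intro CollectI conjI exI[of _ I] exI[of _ "\<lambda>\<rho>. \<rho>"] exI[of _ g]) auto
    moreover have "cuo_norm nrm (f - h) \<le> \<epsilon> *\<^sub>R u"
      unfolding fd using hf by (intro cuo_norm_least) (simp add: X.nrm_minus_commute)
    ultimately show ?thesis by blast
  qed
  define B where "B \<epsilon> = {h \<in> ?M. cuo_norm nrm (f - h) \<le> \<epsilon> *\<^sub>R u}" for \<epsilon> :: real
  define F where "F = (INF \<epsilon>\<in>{0<..}. principal (B \<epsilon>))"
  have Bmono: "B r \<subseteq> B r'" if "r \<le> r'" for r r'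
    unfolding B_def using scaleR_right_mono[OF that u0] by (auto intro: order_trans)
  have ev: "eventually Q F \<longleftrightarrow> (\<exists>\<epsilon>\<in>{0<..}. \<forall>h\<in>B \<epsilon>. Q h)" for Q
    unfolding F_def
  proof (subst eventually_INF_base)
    show "{0 :: real<..} \<noteq> {}" by simp
    fix r r' :: real assume "r \<in> {0<..}" "r' \<in> {0<..}"
    thus "\<exists>x\<in>{0<..}. principal (B x) \<le> inf (principal (B r)) (principal (B r'))"
      using Bmono[of "min r r'" r] Bmono[of "min r r'" r'] by (intro bexI[of _ "min r r'"]) auto
  qed (simp add: eventually_principal)
  show "\<exists>F. F \<noteq> bot \<and> eventually (\<lambda>y. y \<in> ?M) F \<and> norm_r_tendsto (cuo_norm nrm) u (\<lambda>y. y) f F"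
  proof (intro exI[of _ F] conjI)
    have "B \<epsilon> \<noteq> {}" if "0 < \<epsilon>" for \<epsilon> using ex[OF that] by (auto simp: B_def)
    thus "F \<noteq> bot" unfolding trivial_limit_def ev by auto
    show "eventually (\<lambda>y. y \<in> ?M) F" unfolding ev by (intro bexI[of _ 1]) (auto simp: B_def)
    show "norm_r_tendsto (cuo_norm nrm) u (\<lambda>y. y) f F"
      unfolding norm_r_tendsto_def ev
    proof (intro allI impI)
      fix \<epsilon> :: real assume "0 < \<epsilon>"
      thus "\<exists>r\<in>{0<..}. \<forall>h\<in>B r. cuo_norm nrm (f - h) \<le> \<epsilon> *\<^sub>R u"
        by (intro bexI[of _ \<epsilon>]) (auto simp: B_def)
    qed
  qed
qed

end

theorem theorem3p13:
  fixes scale :: "'k::real_normed_field \<Rightarrow> 'x::ab_group_add \<Rightarrow> 'x"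
    and nrm :: "'x \<Rightarrow> 'e::dedekind_vector_lattice"
    and W :: "('s::{uniform_space,t2_space} \<Rightarrow> 'x) set"
    and act :: "'e orth \<Rightarrow> 'x \<Rightarrow> 'x"
    and A :: "('s \<Rightarrow> 'e orth) set"
  assumes compact_S: "compact (UNIV :: 's set)"
    and X: "banach_kantorovich scale nrm"
    and act_def: "act = orth_action scale nrm"
    and W_sub: "W \<subseteq> cuo nrm"
    and W_subspace: "module.subspace (\<lambda>c g s. scale c (g s)) W"
    and A_def: "A = {\<phi> \<in> cuo_orth. \<forall>g\<in>W. (\<lambda>s. act (\<phi> s) (g s)) \<in> W}"
    and separates: "separates_states A"
    and approx: "\<And>\<sigma> x. \<sigma> \<in> extreme_states \<Longrightarrow>
      approximates nrm {state_value nrm act g \<sigma> | g. g \<in> W} x"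
  shows "norm_o_dense_in (cuo_norm nrm) (mix_fin (\<lambda>\<pi> f s. act \<pi> (f s)) (cuo nrm) W) (cuo nrm)
    \<and> (\<forall>u::'e. order_unit u \<longrightarrow>
        norm_r_dense_in (cuo_norm nrm) u (mix (\<lambda>\<pi> f s. act \<pi> (f s)) (cuo nrm) W) (cuo nrm))"
proof -
  interpret BK: banach_kantorovich scale nrm by (rule X)
  \<comment> \<open>\<open>module.subspace\<close> refers to pointwise scaling; its rules become
    available once this scaling is known to form a module.\<close>
  interpret M: module "\<lambda>c (g :: 's \<Rightarrow> 'x) s. scale c (g s)"
    by standard (simp_all add: fun_eq_iff BK.scale_right_distrib BK.scale_left_distrib)
  interpret approximation scale nrm act W A
  proof
    show "is_orth_action scale nrm act" unfolding act_def by (rule BK.is_orth_action_orth_action)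
    show "compact (UNIV :: 's set)" by (rule compact_S)
    show "W \<subseteq> cuo nrm" by (rule W_sub)
    show "(\<lambda>s. 0) \<in> W" using M.subspace_0[OF W_subspace] by (simp add: zero_fun_def)
    show "(\<lambda>s. g s + h s) \<in> W" if "g \<in> W" "h \<in> W" for g h
      using M.subspace_add[OF W_subspace that] by (simp add: plus_fun_def)
    show "(\<lambda>s. scale c (g s)) \<in> W" if "g \<in> W" for c g
      by (rule M.subspace_scale[OF W_subspace that])
    show "A = {\<phi> \<in> cuo_orth. \<forall>g\<in>W. (\<lambda>s. act (\<phi> s) (g s)) \<in> W}" by (rule A_def)
    show "separates_states A" by (rule separates)
    show "approximates nrm {state_value nrm act g \<sigma> | g. g \<in> W} x" if "\<sigma> \<in> extreme_states" for \<sigma> x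
      by (rule approx[OF that])
  qed
  show ?thesis using mix_fin_dense mix_dense by blast
qed

end
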